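(* Let $\nu_1>0$, $\nu_j\ge 0$ $(2\le j\le Q)$ and $0<\alpha_{j+1}\le\alpha_j\le1$ $(1\le j<Q)$. Let $Y(t)$ be the solution to $$\sum_{j=1}^Q\nu_j\,{}_{C}D_{0,t}^{\alpha_j}Y(t)=f(t,Y),\quad t\in(0,T],\qquad Y(0)=Y_0,$$ satisfying $Y(t)-Y(0)=c_1t^{\sigma_1}+c_2t^{\sigma_2}+\cdots$, where $\{c_k\}$ are constants and $0<\sigma_k<\sigma_{k+1}$ for $k>0$. Let $y^n$ be the solution to the scheme $$\sum_{j=1}^Q \nu_j\,\mathcal{A}_{0,-1}^{\alpha_j,n,m_j}\hat y=f(t_n,y^n),\qquad y^0=Y_0,\qquad \hat y=y-y^0.$$ Suppose that $f(t,Y)$ satisfies the Lipschitz condition in its second argument, and that $m_j$ $(j=1,2,\dots,Q)$ are positive integers satisfying $\sigma_{m_j}\le 2$. Then there exists a positive constant $C$ independent of $n$ and $\tau$ such that $$|Y(t_n)-y^n|\le C\left(\sum_{k=0}^{\max_{1\le j\le Q}\{m_j\}}|Y(t_k)-y^k|+\tau^{\min\left\{2,\ \min_{1\le j\le Q}\{\sigma_{m_j+1}+\alpha_1-\alpha_j\}\right\}}\right).$$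
   Context: ${}_CD^{\alpha}_{0,t}$ is the Caputo derivative of order $\alpha$ with base point $0$. $T>0$, $n_T$ is a positive integer, $\tau=T/n_T$, $t_n=n\tau$ $(0\le n\le n_T)$, and $y^n$ approximates $Y(t_n)$. Set $\omega^{(\alpha)}_k=(-1)^k\binom{\alpha}{k}$, $g^{(\alpha)}_{0}=\frac{2+\alpha}{2}\omega^{(\alpha)}_{0}$, $g^{(\alpha)}_{k}=\frac{2+\alpha}{2}\omega^{(\alpha)}_{k}-\frac{\alpha}{2}\omega^{(\alpha)}_{k-1}$ for $k\ge1$. For a grid function $U$ with $U^k=U(t_k)$, $$\mathcal{A}_{0,-1}^{\alpha,n,m}U=\frac{1}{\tau^{\alpha}}\sum_{k=0}^{n}g^{(\alpha)}_{n-k}U^k+\frac{1}{\tau^{\alpha}}\sum_{k=1}^m w_{n,k}^{(\alpha)}U^k,$$ where, with the exponents $\sigma_1,\sigma_2,\dots$ from the expansion of $Y$, the starting weights $w^{(\alpha)}_{n,k}$ solve $$\sum_{k=1}^m w_{n,k}^{(\alpha)}k^{\sigma_r}=\frac{\Gamma(\sigma_r+1)}{\Gamma(\sigma_r+1-\alpha)}n^{\sigma_r-\alpha}-\sum_{k=0}^{n}g^{(\alpha)}_{n-k}k^{\sigma_r},\qquad 1\le r\le m.$$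
   Formalization: The solution Y is additionally assumed three times continuously differentiable on (0,T], which restricts it only at t=T; without this the bound can fail, e.g. Y(t)=(1-t)^{3/2}, T=1, Q=1, α_1=1, ν_1=1, m_1=1, σ_k=k, f=Y'(t), where the error at T is of order τ^{3/2}. *)

theory Defs
  imports "HOL-Analysis.Analysis"
begin

text \<open>
  Caputo derivative of order \<open>0 < \<alpha> \<le> 1\<close> with base point \<open>0\<close>. It only depends on \<open>Y\<close> on
  \<open>[0,t]\<close>, so the classical derivative is taken within that interval (two-sided in the
  interior, one-sided at \<open>t\<close>). The values of the integrand at the end points are irrelevant.
\<close>

definition caputo :: "real \<Rightarrow> (real \<Rightarrow> real) \<Rightarrow> real \<Rightarrow> real" where
  "caputo \<alpha> Y t =
     (if \<alpha> = 1 then vector_derivative Y (at t within {0..t})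
      else (1 / Gamma (1 - \<alpha>)) *
        integral {0..t} (\<lambda>s. (t - s) powr (- \<alpha>) * vector_derivative Y (at s within {0..t})))"

definition Ck_on :: "nat \<Rightarrow> real set \<Rightarrow> (real \<Rightarrow> real) \<Rightarrow> bool" where
  "Ck_on k S Y \<longleftrightarrow>
     (\<exists>D :: nat \<Rightarrow> real \<Rightarrow> real.
        (\<forall>t\<in>S. D 0 t = Y t) \<and>
        (\<forall>i<k. \<forall>t\<in>S. (D i has_real_derivative D (Suc i) t) (at t within S)) \<and>
        (\<forall>i\<le>k. continuous_on S (D i)))"

definition omega_coeff :: "real \<Rightarrow> nat \<Rightarrow> real" where
  "omega_coeff \<alpha> k = (- 1) ^ k * (\<alpha> gchoose k)"

definition g_coeff :: "real \<Rightarrow> nat \<Rightarrow> real" where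
  "g_coeff \<alpha> k =
     (if k = 0 then (2 + \<alpha>) / 2 * omega_coeff \<alpha> 0
      else (2 + \<alpha>) / 2 * omega_coeff \<alpha> k - \<alpha> / 2 * omega_coeff \<alpha> (k - 1))"

text \<open>
  The exponents \<open>\<sigma> 1, \<sigma> 2, \<dots>\<close> are indexed from \<open>1\<close>; \<open>\<sigma> 0\<close> is never used. They are positive, so
  \<open>0 powr \<sigma> r = 0\<close> is the correct value. The weights do not depend on the step size.
\<close>

definition starting_weights ::
  "real \<Rightarrow> (nat \<Rightarrow> real) \<Rightarrow> nat \<Rightarrow> (nat \<Rightarrow> nat \<Rightarrow> real) \<Rightarrow> bool" where
  "starting_weights \<alpha> \<sigma> m w \<longleftrightarrow>
     (\<forall>n\<ge>1. \<forall>r\<in>{1..m}.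
        (\<Sum>k=1..m. w n k * real k powr \<sigma> r) =
          Gamma (\<sigma> r + 1) / Gamma (\<sigma> r + 1 - \<alpha>) * real n powr (\<sigma> r - \<alpha>)
          - (\<Sum>k=0..n. g_coeff \<alpha> (n - k) * real k powr \<sigma> r))"

definition A_op ::
  "real \<Rightarrow> real \<Rightarrow> (nat \<Rightarrow> nat \<Rightarrow> real) \<Rightarrow> nat \<Rightarrow> nat \<Rightarrow> (nat \<Rightarrow> real) \<Rightarrow> real" where
  "A_op \<tau> \<alpha> w n m U =
     1 / \<tau> powr \<alpha> * (\<Sum>k=0..n. g_coeff \<alpha> (n - k) * U k)
     + 1 / \<tau> powr \<alpha> * (\<Sum>k=1..m. w n k * U k)"

text \<open>
  \<open>y 0, \<dots>, y N\<close> solve the scheme on the grid \<open>t\<^sub>n = n T / N\<close>. The correction terms refer to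
  \<open>y k\<close> for \<open>k \<le> m j\<close>, so this is only meaningful if \<open>m j \<le> N\<close> for all \<open>j\<close>.
\<close>

definition scheme_solution ::
  "nat \<Rightarrow> (nat \<Rightarrow> real) \<Rightarrow> (nat \<Rightarrow> real) \<Rightarrow> (nat \<Rightarrow> nat) \<Rightarrow> (nat \<Rightarrow> nat \<Rightarrow> nat \<Rightarrow> real) \<Rightarrow>
   (real \<Rightarrow> real \<Rightarrow> real) \<Rightarrow> real \<Rightarrow> real \<Rightarrow> nat \<Rightarrow> (nat \<Rightarrow> real) \<Rightarrow> bool" where
  "scheme_solution Q \<nu> \<alpha> m w f Y0 T N y \<longleftrightarrow>
     y 0 = Y0 \<and>
     (\<forall>n\<in>{1..N}.
        (\<Sum>j=1..Q. \<nu> j * A_op (T / real N) (\<alpha> j) (w j) n (m j) (\<lambda>k. y k - y 0))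
          = f (real n * (T / real N)) (y n))"

end

theory Submission
  imports Defs
begin

text \<open>
  The weights \<open>g_coeff \<alpha>\<close> have the generating function
  \<open>(1 - z)\<^sup>\<alpha> (1 + (\<alpha>/2) (1 - z))\<close>, so applied to a grid function they form a second order
  approximation of the Caputo derivative. The error \<open>e\<^sub>n = Y(t\<^sub>n) - y\<^sup>n\<close> satisfies the scheme with
  right-hand side bounded by \<open>L |e\<^sub>n|\<close>, the consistency errors of the \<open>Q\<close> operators, and the
  contribution of the starting values through the correction weights. Three ingredients
  turn this into the claim.

  \<^item> \<^bold>\<open>Consistency.\<close> The correction makes each operator exact on \<open>t powr \<sigma> r\<close> for \<open>r \<le> m j\<close>. What
  remains of \<open>Y - Y 0\<close> is a function that behaves like \<open>t powr s\<close>, \<open>s = \<sigma> (m j + 1)\<close>, together with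
  three derivatives (\<open>expansion_remainder_power_like\<close>). The exponents may accumulate, so this
  remainder is not treated term by term: a Peano kernel argument (\<open>truncation_error_bound\<close>) gives
  a truncation error \<open>O(\<tau> powr (s - \<alpha>) (n powr (- 1 - \<alpha>/2) + n powr (s - \<alpha> - 2)))\<close>. The same
  bound for the exact powers, and the invertibility of generalized Vandermonde matrices,
  bound the correction weights (\<open>starting_weights_bound\<close>).

  \<^item> \<^bold>\<open>Inversion.\<close> Let \<open>a = \<alpha> 1\<close> be the largest order. Multiplying the error equation by the inverse of
  \<open>(1 - z)\<^sup>a (1 + (a/2) (1 - z))\<close> turns the terms of order \<open>a\<close> into a multiple of \<open>e\<close>, the remaining
  terms into discrete fractional integrals of \<open>e\<close> of orders \<open>a - \<alpha> j > 0\<close>, and the right-hand side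
  into its discrete fractional integral of order \<open>a\<close> (\<open>multi_term_inversion\<close>). A weakly singular
  discrete Gronwall inequality then bounds \<open>e\<close> by the integrated consistency and starting errors
  (\<open>multi_term_stability\<close>).

  \<^item> \<^bold>\<open>Integration of the consistency errors.\<close> The integral of order \<open>a\<close> sums the truncation errors to
  \<open>\<tau> powr min 2 (s + a - \<alpha>)\<close> (\<open>corrected_consistency\<close>). The exponent \<open>s = 1 + \<alpha>\<close> is critical,
  because a truncation error of size \<open>1 / n\<close> would cost a logarithm when \<open>a = 1\<close>. For the power
  \<open>t powr (1 + \<alpha>)\<close> itself the coefficient of \<open>1 / n\<close> contains \<open>1 / \<Gamma>(0) = 0\<close>, so that its truncation
  error is summable (\<open>resonant_power_truncation\<close>); it is split off before the general bound is
  applied to the rest.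

  Stability needs a small step size. Only finitely many grids are too coarse for it, and on each
  of them the right-hand side of the claim is positive.
\<close>

section \<open>Coefficients of powers of 1 - z\<close>

lemma bounded_seq_from_limit:
  fixes x :: "nat \<Rightarrow> real"
  assumes "x \<longlonglongrightarrow> l"
  obtains C where "C > 0" "\<And>n. \<bar>x n\<bar> \<le> C"
proof -
  have "Bseq x" using assms by (auto simp: convergent_def intro!: convergent_imp_Bseq)
  then show ?thesis using that unfolding Bseq_def by auto
qed

text \<open>
  The power series \<open>(1 - z) powr \<beta>\<close>. Sums and convolutions of coefficients become identities
  between exponents.
\<close>

definition omega_fps :: "real \<Rightarrow> real fps" where
  "omega_fps \<beta> = Abs_fps (omega_coeff \<beta>)"

lemma omega_fps_nth [simp]: "fps_nth (omega_fps \<beta>) n = omega_coeff \<beta> n"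
  by (simp add: omega_fps_def)

lemma omega_fps_mult: "omega_fps a * omega_fps b = omega_fps (a + b)"
proof (rule fps_ext)
  fix n
  have "fps_nth (omega_fps a * omega_fps b) n
      = (\<Sum>k=0..n. (-1)^n * ((a gchoose k) * (b gchoose (n - k))))"
    unfolding fps_mult_nth omega_fps_nth omega_coeff_def
    by (intro sum.cong) (auto simp: mult_ac power_add[symmetric])
  also have "\<dots> = omega_coeff (a + b) n"
    by (simp add: sum_distrib_left[symmetric] gbinomial_Vandermonde omega_coeff_def)
  finally show "fps_nth (omega_fps a * omega_fps b) n = fps_nth (omega_fps (a + b)) n"
    by simp
qed

lemma omega_coeff_0 [simp]: "omega_coeff \<beta> 0 = 1"
  by (simp add: omega_coeff_def)

lemma omega_coeff_Suc: "omega_coeff \<beta> (Suc k) = omega_coeff \<beta> k * (real k - \<beta>) / (real k + 1)"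
  unfolding omega_coeff_def gbinomial_prod_rev
  by (simp add: field_simps)

lemma omega_fps_0: "omega_fps 0 = 1"
proof (rule fps_ext)
  fix n show "fps_nth (omega_fps 0) n = fps_nth 1 n"
    by (induction n) (auto simp: omega_coeff_Suc)
qed

lemma omega_fps_1: "omega_fps 1 = 1 - fps_X"
proof (rule fps_ext)
  fix n show "fps_nth (omega_fps 1) n = fps_nth (1 - fps_X) n"
  proof (cases n)
    case (Suc k)
    have "omega_coeff 1 (Suc (Suc k)) = 0" for k
      by (induction k) (auto simp: omega_coeff_Suc)
    then show ?thesis using Suc by (cases k) (auto simp: omega_coeff_Suc)
  qed auto
qed

lemma omega_coeff_plus1: "omega_coeff (\<beta> + 1) (Suc n) = omega_coeff \<beta> (Suc n) - omega_coeff \<beta> n"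
proof -
  have "fps_nth (omega_fps (\<beta> + 1)) (Suc n) = fps_nth (omega_fps \<beta> * (1 - fps_X)) (Suc n)"
    by (simp add: omega_fps_mult[symmetric] omega_fps_1)
  then show ?thesis by (simp add: algebra_simps)
qed

lemma powr_taylor3:
  fixes \<beta> :: real
  obtains C where "C > 0" "\<And>x. 0 \<le> x \<Longrightarrow> x \<le> 1 \<Longrightarrow>
     \<bar>(1 + x) powr \<beta> - (1 + \<beta> * x + \<beta> * (\<beta> - 1) / 2 * x^2 + \<beta> * (\<beta> - 1) * (\<beta> - 2) / 6 * x^3)\<bar> \<le> C * x^4"
proof -
  define d where "d m x = (\<Prod>i<m. \<beta> - real i) * (1 + x) powr (\<beta> - real m)" for m and x :: real
  define K where "K = \<bar>\<Prod>i<4. \<beta> - real i\<bar> * max 1 (2 powr (\<beta> - 4)) / 24 + 1"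
  have K: "K > 0" unfolding K_def by (intro add_nonneg_pos) auto
  show ?thesis
  proof (rule that[OF K])
    fix x :: real assume x: "0 \<le> x" "x \<le> 1"
    show "\<bar>(1 + x) powr \<beta> - (1 + \<beta> * x + \<beta> * (\<beta> - 1) / 2 * x^2 + \<beta> * (\<beta> - 1) * (\<beta> - 2) / 6 * x^3)\<bar> \<le> K * x^4"
    proof (cases "x = 0")
      case False
      with x have x0: "x > 0" by simp
      have der: "\<forall>m t. m < 4 \<and> 0 \<le> t \<and> t \<le> x \<longrightarrow> DERIV (d m) t :> d (Suc m) t"
      proof (intro allI impI)
        fix m t assume "m < (4::nat) \<and> 0 \<le> t \<and> t \<le> x"
        then have t: "1 + t > 0" by simp
        show "DERIV (d m) t :> d (Suc m) t"
          unfolding d_def using t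
          by (auto intro!: derivative_eq_intros simp: diff_diff_eq mult_ac add_ac)
      qed
      have "\<exists>t>0. t \<le> x \<and> (1 + x) powr \<beta> = (\<Sum>m<4. d m 0 / fact m * x ^ m) + d 4 t / fact 4 * x ^ 4"
        by (rule Maclaurin2[OF x0 _ der]) (simp add: d_def fun_eq_iff)
      then obtain t where t: "t > 0" "t \<le> x"
        and eq: "(1 + x) powr \<beta> = (\<Sum>m<4. d m 0 / fact m * x ^ m) + d 4 t / fact 4 * x ^ 4" by blast
      have s: "(\<Sum>m<4. d m 0 / fact m * x ^ m) = 1 + \<beta> * x + \<beta> * (\<beta> - 1) / 2 * x^2 + \<beta> * (\<beta> - 1) * (\<beta> - 2) / 6 * x^3"
        by (simp add: eval_nat_numeral d_def lessThan_Suc algebra_simps)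
      have "(1 + t) powr (\<beta> - 4) \<le> max 1 (2 powr (\<beta> - 4))"
      proof (cases "\<beta> \<ge> 4")
        case True
        then have "(1 + t) powr (\<beta> - 4) \<le> 2 powr (\<beta> - 4)" using t x by (intro powr_mono2) auto
        then show ?thesis by simp
      next
        case False
        then have "(1 + t) powr (\<beta> - 4) \<le> 1 powr (\<beta> - 4)" using t x by (intro powr_mono2') auto
        then show ?thesis by simp
      qed
      then have "\<bar>d 4 t\<bar> \<le> \<bar>\<Prod>i<4. \<beta> - real i\<bar> * max 1 (2 powr (\<beta> - 4))"
        unfolding d_def by (simp add: abs_mult mult_left_mono)
      then have "\<bar>d 4 t / fact 4\<bar> \<le> K" by (simp add: K_def fact_numeral)
      then have "\<bar>d 4 t / fact 4 * x ^ 4\<bar> \<le> K * x^4"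
        unfolding abs_mult using x K by (intro mult_mono) auto
      then show ?thesis unfolding eq s by simp
    qed auto
  qed
qed

text \<open>
  Summing the increments gives the rate. Instead of a series, the proof uses that
  \<open>d n + 8 C / n\<^sup>3\<close> decreases and \<open>d n - 8 C / n\<^sup>3\<close> increases towards the limit.
\<close>

lemma limit_rate_from_increments:
  fixes d :: "nat \<Rightarrow> real"
  assumes "d \<longlonglongrightarrow> l" and C: "C \<ge> 0"
    and inc: "\<And>n. n \<ge> 1 \<Longrightarrow> \<bar>d (Suc n) - d n\<bar> \<le> C / real n ^ 4"
    and n: "n \<ge> 1"
  shows "\<bar>d n - l\<bar> \<le> 8 * C / real n ^ 3"
proof -
  have dec: "C / real n ^ 4 \<le> 8 * C / real n ^ 3 - 8 * C / real (Suc n) ^ 3" if "n \<ge> 1" for n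
  proof -
    define x where "x = real n"
    have x: "x \<ge> 1" using that by (simp add: x_def)
    have "8 * x * (x+1)^3 - 8 * x^4 - (x+1)^3 \<ge> 0"
    proof -
      have "8 * x * (x+1)^3 - 8 * x^4 - (x+1)^3 = 23*x^3 + 21*x^2 + 5*x - 1"
        by (simp add: algebra_simps power2_eq_square power3_eq_cube power4_eq_xxxx)
      moreover have "x^3 \<ge> 0" "x^2 \<ge> 0" using x by auto
      ultimately show ?thesis using x by linarith
    qed
    then have "(x+1)^3 \<le> (8 * (x+1)^3 - 8 * x^3) * x"
      by (simp add: algebra_simps power3_eq_cube power4_eq_xxxx)
    then have "1 / x^4 \<le> 8 / x^3 - 8 / (x+1)^3"
      using x by (simp add: divide_simps power4_eq_xxxx power3_eq_cube)
    then have "C * (1 / x^4) \<le> C * (8 / x^3 - 8 / (x+1)^3)" using C by (rule mult_left_mono)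
    then show ?thesis by (simp add: x_def algebra_simps)
  qed
  have lim0: "(\<lambda>n. 8 * C / real n ^ 3) \<longlonglongrightarrow> 0"
    by (intro tendsto_divide_0[OF tendsto_const] filterlim_at_top_imp_at_infinity filterlim_pow_at_top filterlim_real_sequentially) simp_all?
  have up: "l \<le> d n + 8 * C / real n ^ 3"
  proof -
    have mono: "d k + 8 * C / real k ^ 3 \<le> d n + 8 * C / real n ^ 3" if "k \<ge> n" for k
      using that
    proof (induction k rule: dec_induct)
      case (step k)
      have "d (Suc k) - d k \<le> C / real k ^ 4" using inc[of k] step n by auto
      then show ?case using dec[of k] step n by auto
    qed auto
    have "(\<lambda>k. d k + 8 * C / real k ^ 3) \<longlonglongrightarrow> l + 0" by (intro tendsto_add assms lim0)
    then have "l + 0 \<le> d n + 8 * C / real n ^ 3"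
      by (rule LIMSEQ_le_const2) (use mono in auto)
    then show ?thesis by simp
  qed
  have lo: "l \<ge> d n - 8 * C / real n ^ 3"
  proof -
    have mono: "d k - 8 * C / real k ^ 3 \<ge> d n - 8 * C / real n ^ 3" if "k \<ge> n" for k
      using that
    proof (induction k rule: dec_induct)
      case (step k)
      have "d (Suc k) - d k \<ge> - (C / real k ^ 4)" using inc[of k] step n by auto
      then show ?case using dec[of k] step n by auto
    qed auto
    have "(\<lambda>k. d k - 8 * C / real k ^ 3) \<longlonglongrightarrow> l - 0" by (intro tendsto_diff assms lim0)
    then have "l - 0 \<ge> d n - 8 * C / real n ^ 3"
      by (rule LIMSEQ_le_const) (use mono in auto)
    then show ?thesis by simp
  qed
  show ?thesis using up lo by linarith
qed

lemma omega_coeff_limit: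
  "(\<lambda>n. omega_coeff \<beta> n * real n powr (\<beta> + 1)) \<longlonglongrightarrow> rGamma (- \<beta>)"
proof -
  have "(\<lambda>n. (\<beta> gchoose n) / ((-1)^n / exp ((\<beta>+1) * of_real (ln (real n))))) \<longlonglongrightarrow> rGamma (- \<beta>)"
    using gbinomial_asymptotic[of \<beta>] by (simp add: rGamma_inverse_Gamma)
  moreover have "eventually (\<lambda>n. (\<beta> gchoose n) / ((-1)^n / exp ((\<beta>+1) * of_real (ln (real n)))) = omega_coeff \<beta> n * real n powr (\<beta> + 1)) sequentially"
    using eventually_gt_at_top[of 0]
  proof eventually_elim
    case (elim n)
    have "((-1::real)^n) = 1 \<or> ((-1::real)^n) = -1" by (cases "even n") auto
    then show ?case using elim by (auto simp: omega_coeff_def powr_def)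
  qed
  ultimately show ?thesis by (simp add: tendsto_cong)
qed

lemma omega_coeff_bound:
  obtains C where "C > 0" "\<And>n. \<bar>omega_coeff \<beta> n\<bar> \<le> C * (real n + 1) powr (- \<beta> - 1)"
proof -
  obtain C where C: "C > 0" "\<And>n. \<bar>omega_coeff \<beta> n * real n powr (\<beta> + 1)\<bar> \<le> C"
    using bounded_seq_from_limit[OF omega_coeff_limit] by blast
  define D where "D = max 1 (C * 2 powr \<bar>\<beta> + 1\<bar>)"
  show ?thesis
  proof (rule that[of D])
    show "D > 0" by (simp add: D_def)
    fix n show "\<bar>omega_coeff \<beta> n\<bar> \<le> D * (real n + 1) powr (- \<beta> - 1)"
    proof (cases "n = 0")
      case False
      then have n: "real n > 0" by simp
      have "\<bar>omega_coeff \<beta> n\<bar> = \<bar>omega_coeff \<beta> n * real n powr (\<beta> + 1)\<bar> * real n powr (- \<beta> - 1)"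
        using n by (simp add: abs_mult powr_add[symmetric])
      also have "\<dots> \<le> C * real n powr (- \<beta> - 1)"
        using C by (intro mult_right_mono) auto
      also have "real n powr (- \<beta> - 1) = (real n + 1) powr (- \<beta> - 1) * ((real n + 1) / real n) powr (\<beta> + 1)"
      proof -
        have "(real n + 1) powr (- \<beta> - 1) * (real n + 1) powr (\<beta> + 1) = 1"
          by (simp add: powr_add[symmetric] add_nonneg_eq_0_iff)
        moreover have "real n powr (- \<beta> - 1) = 1 / real n powr (\<beta> + 1)"
          by (simp add: powr_minus_divide[symmetric])
        ultimately show ?thesis using n by (simp add: powr_divide)
      qed
      also have "((real n + 1) / real n) powr (\<beta> + 1) \<le> ((real n + 1) / real n) powr \<bar>\<beta> + 1\<bar>"
        using n by (intro powr_mono) auto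
      also have "\<dots> \<le> 2 powr \<bar>\<beta> + 1\<bar>"
        using n False by (intro powr_mono2) (auto simp: field_simps)
      finally have "\<bar>omega_coeff \<beta> n\<bar> \<le> C * 2 powr \<bar>\<beta> + 1\<bar> * (real n + 1) powr (- \<beta> - 1)"
        using C by (simp add: mult_ac mult_left_mono)
      also have "\<dots> \<le> D * (real n + 1) powr (- \<beta> - 1)"
        by (intro mult_right_mono) (auto simp: D_def)
      finally show ?thesis .
    qed (simp add: D_def)
  qed
qed

text \<open>
  With \<open>h = 1 / n\<close>, the recursion for the normalized coefficient
  \<open>x n = omega_coeff \<beta> n * n powr (\<beta> + 1)\<close> is multiplication by \<open>(1 + h) powr \<beta> * (1 - \<beta> h)\<close>.
  The numbers \<open>A\<close> and \<open>B\<close> are the ones for which the factor \<open>1 + A h + B h\<^sup>2\<close> removes the terms of order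
  two and three from the increments.
\<close>

lemma omega_step_expansion:
  fixes \<beta> :: real
  defines "A \<equiv> - \<beta> * (\<beta> + 1) / 2"
  defines "B \<equiv> (A^2 + A - \<beta> * (\<beta> - 1) * (\<beta> + 1) / 3) / 2"
  obtains C where "C > 0" "\<And>h. 0 \<le> h \<Longrightarrow> h \<le> 1 \<Longrightarrow>
    \<bar>(1 + h) powr \<beta> * (1 - \<beta> * h) * (1 + A * (h / (1 + h)) + B * (h / (1 + h))^2) - (1 + A * h + B * h^2)\<bar> \<le> C * h^4"
proof -
  obtain K where K: "K > 0" "\<And>x. 0 \<le> x \<Longrightarrow> x \<le> 1 \<Longrightarrow>
     \<bar>(1 + x) powr \<beta> - (1 + \<beta> * x + \<beta> * (\<beta> - 1) / 2 * x^2 + \<beta> * (\<beta> - 1) * (\<beta> - 2) / 6 * x^3)\<bar> \<le> K * x^4"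
    using powr_taylor3[of \<beta>] by blast
  define e3 where "e3 = - \<beta> * (\<beta> - 1) * (\<beta> + 1) / 3"
  define e4 where "e4 = - \<beta> * \<beta> * (\<beta> - 1) * (\<beta> - 2) / 6"
  have B2: "2 * B = A^2 + A + e3" by (simp add: B_def e3_def)
  define q0 where "q0 = A * (1 + A + B) + e3 * (2 + A) + e4 - B"
  define q1 where "q1 = e3 * (1 + A + B) + e4 * (2 + A)"
  define q2 where "q2 = e4 * (1 + A + B)"
  define M where "M = (1 + \<bar>\<beta>\<bar>) * (1 + \<bar>A\<bar> + \<bar>B\<bar>)"
  define D where "D = \<bar>q0\<bar> + \<bar>q1\<bar> + \<bar>q2\<bar> + K * M"
  have M: "M > 0" unfolding M_def by (intro mult_pos_pos) auto
  show ?thesis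
  proof (rule that[of D])
    show "D > 0" unfolding D_def using K M by (intro add_nonneg_pos) auto
    fix h :: real assume h: "0 \<le> h" "h \<le> 1"
    define P where "P = 1 + \<beta> * h + \<beta> * (\<beta> - 1) / 2 * h^2 + \<beta> * (\<beta> - 1) * (\<beta> - 2) / 6 * h^3"
    define W where "W = 1 + A * (h / (1 + h)) + B * (h / (1 + h))^2"
    have Pb: "P * (1 - \<beta> * h) = 1 + A * h^2 + e3 * h^3 + e4 * h^4"
      by (simp add: P_def A_def e3_def e4_def field_simps power2_eq_square power3_eq_cube power4_eq_xxxx)
    have "W * (1 + h)^2 = 1 + (2 + A) * h + (1 + A + B) * h^2"
      using h by (simp add: W_def divide_simps) (simp add: algebra_simps power2_eq_square)
    then have "(P * (1 - \<beta> * h) * W - (1 + A * h + B * h^2)) * (1 + h)^2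
       = (1 + A * h^2 + e3 * h^3 + e4 * h^4) * (1 + (2 + A) * h + (1 + A + B) * h^2) - (1 + A * h + B * h^2) * (1 + h)^2"
      unfolding Pb left_diff_distrib mult.assoc by simp
    also have "\<dots> = h^4 * (q0 + q1 * h + q2 * h^2)"
      unfolding q0_def q1_def q2_def using B2 by algebra
    finally have eq: "(P * (1 - \<beta> * h) * W - (1 + A * h + B * h^2)) * (1 + h)^2 = h^4 * (q0 + q1 * h + q2 * h^2)" .
    have h1: "(1 + h)^2 \<ge> 1" using h by simp
    have hp: "h^2 \<le> 1" using h by (simp add: power_le_one)
    have "\<bar>P * (1 - \<beta> * h) * W - (1 + A * h + B * h^2)\<bar> \<le> \<bar>P * (1 - \<beta> * h) * W - (1 + A * h + B * h^2)\<bar> * (1 + h)^2"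
      using mult_left_mono[OF h1] by force
    also have "\<dots> = h^4 * \<bar>q0 + q1 * h + q2 * h^2\<bar>"
      using eq by (metis abs_mult abs_of_nonneg zero_le_even_power even_numeral zero_le_power2)
    also have "\<dots> \<le> h^4 * (\<bar>q0\<bar> + \<bar>q1\<bar> + \<bar>q2\<bar>)"
    proof (rule mult_left_mono)
      have "\<bar>q1 * h\<bar> \<le> \<bar>q1\<bar>" "\<bar>q2 * h^2\<bar> \<le> \<bar>q2\<bar>"
        using h hp by (auto simp: abs_mult intro!: mult_left_le)
      then show "\<bar>q0 + q1 * h + q2 * h^2\<bar> \<le> \<bar>q0\<bar> + \<bar>q1\<bar> + \<bar>q2\<bar>" by linarith
    qed (use h in simp)
    finally have 1: "\<bar>P * (1 - \<beta> * h) * W - (1 + A * h + B * h^2)\<bar> \<le> (\<bar>q0\<bar> + \<bar>q1\<bar> + \<bar>q2\<bar>) * h^4"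
      by (simp add: mult_ac)
    have hh: "0 \<le> h / (1 + h)" "h / (1 + h) \<le> 1" using h by auto
    have "\<bar>1 - \<beta> * h\<bar> \<le> 1 + \<bar>\<beta>\<bar>"
    proof -
      have "\<bar>\<beta> * h\<bar> \<le> \<bar>\<beta>\<bar>" using h by (auto simp: abs_mult intro!: mult_left_le)
      then show ?thesis by linarith
    qed
    moreover have "\<bar>W\<bar> \<le> 1 + \<bar>A\<bar> + \<bar>B\<bar>"
    proof -
      have "(h / (1 + h))^2 \<le> 1" using hh by (simp only: power_le_one)
      then have "\<bar>A * (h / (1 + h))\<bar> \<le> \<bar>A\<bar>" "\<bar>B * (h / (1 + h))^2\<bar> \<le> \<bar>B\<bar>"
        using hh mult_left_le[of "h / (1 + h)" "\<bar>A\<bar>"] mult_left_le[of "(h / (1 + h))^2" "\<bar>B\<bar>"]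
        unfolding abs_mult by (simp_all only: abs_of_nonneg abs_ge_zero zero_le_power2)
      then show ?thesis unfolding W_def by linarith
    qed
    ultimately have MW: "\<bar>(1 - \<beta> * h) * W\<bar> \<le> M" unfolding M_def abs_mult by (intro mult_mono) auto
    have "\<bar>((1 + h) powr \<beta> - P) * ((1 - \<beta> * h) * W)\<bar> \<le> K * h^4 * M"
      unfolding abs_mult[of "(1 + h) powr \<beta> - P"] using K(2)[of h] h MW K(1) by (intro mult_mono) (auto simp: P_def)
    moreover have "(1 + h) powr \<beta> * (1 - \<beta> * h) * W - (1 + A * h + B * h^2)
        = (P * (1 - \<beta> * h) * W - (1 + A * h + B * h^2)) + ((1 + h) powr \<beta> - P) * ((1 - \<beta> * h) * W)"
      by (simp add: algebra_simps)
    ultimately have "\<bar>(1 + h) powr \<beta> * (1 - \<beta> * h) * W - (1 + A * h + B * h^2)\<bar> \<le> D * h^4"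
      using 1 unfolding D_def by (simp add: algebra_simps)
    then show "\<bar>(1 + h) powr \<beta> * (1 - \<beta> * h) * (1 + A * (h / (1 + h)) + B * (h / (1 + h))^2) - (1 + A * h + B * h^2)\<bar> \<le> D * h^4"
      by (simp add: W_def)
  qed
qed

text \<open>
  The corrected sequence \<open>x n (1 + A / n + B / n\<^sup>2)\<close> has increments of order \<open>n powr (-4)\<close>, hence
  converges with rate \<open>n powr (-3)\<close>; its limit is Gauss' formula for the reciprocal Gamma function.
  Dividing by the correction gives three terms of the expansion. Two of them yield the second order
  of the scheme, the third is used for the critical power \<open>t powr (1 + \<alpha>)\<close> only, and its
  coefficient \<open>a\<close> need not be known.
\<close>

lemma omega_coeff_expansion:
  fixes \<beta> :: real
  obtains a C where "C > 0" "\<And>n. n \<ge> 1 \<Longrightarrow>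
    \<bar>omega_coeff \<beta> n - rGamma (- \<beta>) * (real n powr (- \<beta> - 1) + \<beta> * (\<beta> + 1) / 2 * real n powr (- \<beta> - 2) + a * real n powr (- \<beta> - 3))\<bar>
       \<le> C * real n powr (- \<beta> - 4)"
proof -
  define A where "A = - \<beta> * (\<beta> + 1) / 2"
  define B where "B = (A^2 + A - \<beta> * (\<beta> - 1) * (\<beta> + 1) / 3) / 2"
  define r where "r = rGamma (- \<beta>)"
  define x where "x n = omega_coeff \<beta> n * real n powr (\<beta> + 1)" for n
  define d where "d n = x n * (1 + A * (1 / real n) + B * (1 / real n)^2)" for n
  obtain C1 where C1: "C1 > 0" "\<And>h. 0 \<le> h \<Longrightarrow> h \<le> 1 \<Longrightarrow>
    \<bar>(1 + h) powr \<beta> * (1 - \<beta> * h) * (1 + A * (h / (1 + h)) + B * (h / (1 + h))^2) - (1 + A * h + B * h^2)\<bar> \<le> C1 * h^4"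
    using omega_step_expansion[of \<beta>] unfolding A_def B_def by blast
  have xlim: "x \<longlonglongrightarrow> r" using omega_coeff_limit[of \<beta>] unfolding x_def r_def .
  obtain X where X: "X > 0" "\<And>n. \<bar>x n\<bar> \<le> X" using bounded_seq_from_limit[OF xlim] by blast
  have "(\<lambda>n. 1 / real n) \<longlonglongrightarrow> 0" by (rule lim_1_over_n)
  then have dlim: "d \<longlonglongrightarrow> r * (1 + A * 0 + B * 0^2)"
    unfolding d_def by (intro tendsto_intros xlim)
  have inc: "\<bar>d (Suc n) - d n\<bar> \<le> X * C1 / real n ^ 4" if n: "n \<ge> 1" for n
  proof -
    define h where "h = 1 / real n"
    have h: "0 < h" "h \<le> 1" using n by (auto simp: h_def)
    have hs: "1 / real (Suc n) = h / (1 + h)" using n by (simp add: h_def field_simps)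
    have sn: "real (Suc n) = real n * (1 + h)" using n by (simp add: h_def field_simps)
    have "x (Suc n) = omega_coeff \<beta> n * ((real n - \<beta>) / (real n + 1)) * (real n powr (\<beta> + 1) * ((1 + h) powr \<beta> * (1 + h)))"
      unfolding x_def omega_coeff_Suc sn using h n by (simp add: powr_mult powr_add)
    also have "(real n - \<beta>) / (real n + 1) = (1 - \<beta> * h) / (1 + h)"
      using n by (simp add: h_def divide_simps) (simp add: algebra_simps)?
    finally have xs: "x (Suc n) = x n * ((1 + h) powr \<beta> * (1 - \<beta> * h))"
      using h by (simp add: x_def)
    have "d (Suc n) - d n = x n * ((1 + h) powr \<beta> * (1 - \<beta> * h) * (1 + A * (h / (1 + h)) + B * (h / (1 + h))^2) - (1 + A * h + B * h^2))"
      unfolding d_def xs hs h_def[symmetric] right_diff_distrib[of "x n"] by (simp only: mult.assoc)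
    then have "\<bar>d (Suc n) - d n\<bar> \<le> X * (C1 * h^4)"
      by (simp only: abs_mult[of "x n"]) (intro mult_mono X C1(2), use h X C1 in auto)
    then show ?thesis by (simp add: h_def power_divide)
  qed
  have db: "\<bar>d n - r\<bar> \<le> 8 * (X * C1) / real n ^ 3" if "n \<ge> 1" for n
    using limit_rate_from_increments[OF dlim _ inc that] X C1 by simp
  \<comment> \<open>\<open>1 - A h + a h\<^sup>2\<close> inverts \<open>1 + A h + B h\<^sup>2\<close> up to the third order.\<close>
  define a where "a = A^2 - B"
  define K where "K = (1 + \<bar>A\<bar> + \<bar>a\<bar>) * (8 * (X * C1)) + X * (\<bar>A * a - A * B\<bar> + \<bar>B * a\<bar>)"
  have main: "\<bar>x n - r * (1 - A * (1 / real n) + a * (1 / real n)^2)\<bar> \<le> K * (1 / real n)^3" if n: "n \<ge> 1" for n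
  proof -
    define h where "h = 1 / real n"
    have h: "0 < h" "h \<le> 1" using n by (auto simp: h_def)
    have hp: "h^2 \<le> 1" using h by (simp add: power_le_one)
    have "x n - r * (1 - A * h + a * h^2) = (d n - r) * (1 - A * h + a * h^2) - x n * (h^3 * ((A * a - A * B) + B * a * h))"
      unfolding d_def h_def[symmetric] a_def by algebra
    moreover have "\<bar>(d n - r) * (1 - A * h + a * h^2)\<bar> \<le> (8 * (X * C1) * h^3) * (1 + \<bar>A\<bar> + \<bar>a\<bar>)"
    proof -
      have "\<bar>A * h\<bar> \<le> \<bar>A\<bar>" "\<bar>a * h^2\<bar> \<le> \<bar>a\<bar>"
        using h hp by (auto simp: abs_mult intro!: mult_left_le)
      then have "\<bar>1 - A * h + a * h^2\<bar> \<le> 1 + \<bar>A\<bar> + \<bar>a\<bar>" by linarith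
      then show ?thesis unfolding abs_mult using db[OF n] X C1 h
        by (intro mult_mono) (auto simp: h_def power_divide)
    qed
    moreover have "\<bar>x n * (h^3 * ((A * a - A * B) + B * a * h))\<bar> \<le> X * (h^3 * (\<bar>A * a - A * B\<bar> + \<bar>B * a\<bar>))"
    proof -
      have "\<bar>B * a * h\<bar> \<le> \<bar>B * a\<bar>" using h by (auto simp: abs_mult intro!: mult_left_le)
      then have "\<bar>(A * a - A * B) + B * a * h\<bar> \<le> \<bar>A * a - A * B\<bar> + \<bar>B * a\<bar>" by linarith
      then show ?thesis unfolding abs_mult[of "x n"] abs_mult[of "h^3"] using X h
        by (intro mult_mono) auto
    qed
    ultimately have "\<bar>x n - r * (1 - A * h + a * h^2)\<bar> \<le> (8 * (X * C1) * h^3) * (1 + \<bar>A\<bar> + \<bar>a\<bar>) + X * (h^3 * (\<bar>A * a - A * B\<bar> + \<bar>B * a\<bar>))"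
      by linarith
    then show ?thesis unfolding K_def h_def[symmetric] by (simp add: algebra_simps)
  qed
  show ?thesis
  proof (rule that[of "\<bar>K\<bar> + 1" a])
    fix n :: nat assume n: "n \<ge> 1"
    have n0: "real n > 0" using n by simp
    define p where "p = real n powr (- \<beta> - 1)"
    have p1: "real n powr (- \<beta> - 2) = p * (1 / real n)" "real n powr (- \<beta> - 3) = p * (1 / real n)^2"
         "real n powr (- \<beta> - 4) = p * (1 / real n)^3"
      using n0 powr_add[of "real n" "- \<beta> - 1" "-1"] powr_add[of "real n" "- \<beta> - 1" "-2"] powr_add[of "real n" "- \<beta> - 1" "-3"]
      by (auto simp: p_def powr_minus field_simps powr_numeral)
    have om: "omega_coeff \<beta> n = x n * p" using n0 by (simp add: x_def p_def powr_add[symmetric])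
    have "omega_coeff \<beta> n - r * (p + \<beta> * (\<beta> + 1) / 2 * (p * (1 / real n)) + a * (p * (1 / real n)^2))
        = (x n - r * (1 - A * (1 / real n) + a * (1 / real n)^2)) * p"
    proof -
      have bA: "\<beta> * (\<beta> + 1) / 2 = - A" by (simp add: A_def)
      show ?thesis unfolding om bA by (simp add: algebra_simps)
    qed
    also have "\<bar>\<dots>\<bar> \<le> (\<bar>K\<bar> + 1) * (1 / real n)^3 * p"
    proof -
      have "K * (1 / real n)^3 \<le> (\<bar>K\<bar> + 1) * (1 / real n)^3" by (intro mult_right_mono) auto
      then show ?thesis unfolding abs_mult using main[OF n]
        by (intro mult_mono) (auto simp: p_def)
    qed
    finally show "\<bar>omega_coeff \<beta> n - rGamma (- \<beta>) * (real n powr (- \<beta> - 1) + \<beta> * (\<beta> + 1) / 2 * real n powr (- \<beta> - 2) + a * real n powr (- \<beta> - 3))\<bar>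
       \<le> (\<bar>K\<bar> + 1) * real n powr (- \<beta> - 4)"
      unfolding p1 p_def[symmetric] r_def by (simp only: mult_ac)
  qed auto
qed

section \<open>The weights applied to polynomials of low degree\<close>

lemma abs_add_mono: "\<bar>a\<bar> \<le> A \<Longrightarrow> \<bar>b\<bar> \<le> B \<Longrightarrow> \<bar>a + b\<bar> \<le> A + B" for a b A B :: real
  by linarith

lemma abs_diff_mono: "\<bar>a\<bar> \<le> A \<Longrightarrow> \<bar>b\<bar> \<le> B \<Longrightarrow> \<bar>a - b\<bar> \<le> A + B" for a b A B :: real
  by linarith

lemma abs_mult_mono: "\<bar>a\<bar> \<le> A \<Longrightarrow> \<bar>c * a\<bar> \<le> \<bar>c\<bar> * A" for a A c :: real
  unfolding abs_mult by (intro mult_left_mono) auto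

text \<open>
  The mechanism behind second order: the second term in the expansion of \<open>w2\<close> is cancelled by the
  first term in the expansion of \<open>w1\<close>.
\<close>

lemma cancel_leading_term:
  fixes w1 :: real
  assumes "w2 = e1 + r * (q1 + b * q0)" "w1 = e2 + c * r * q0" "b = - (k * c)"
  shows "w2 + k * w1 - r * q1 = e1 + k * e2"
  unfolding assms by (simp add: algebra_simps)

text \<open>
  The expansion after one and after two terms. The exponents are restated as parameters in
  \<open>omega_asymp1\<close> and \<open>omega_asymp2\<close>, so that they can be given in simplified form.
\<close>

lemma omega_coeff_expansion_coarse:
  fixes \<beta> :: real
  obtains C where "C > 0" "\<And>n. n \<ge> 1 \<Longrightarrow>
    \<bar>omega_coeff \<beta> n - rGamma (- \<beta>) * real n powr (- \<beta> - 1)\<bar> \<le> C * real n powr (- \<beta> - 2)"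
    "\<And>n. n \<ge> 1 \<Longrightarrow>
    \<bar>omega_coeff \<beta> n - rGamma (- \<beta>) * (real n powr (- \<beta> - 1) + \<beta> * (\<beta> + 1) / 2 * real n powr (- \<beta> - 2))\<bar>
       \<le> C * real n powr (- \<beta> - 3)"
proof -
  obtain a C where C: "C > 0" "\<And>n. n \<ge> 1 \<Longrightarrow>
    \<bar>omega_coeff \<beta> n - rGamma (- \<beta>) * (real n powr (- \<beta> - 1) + \<beta> * (\<beta> + 1) / 2 * real n powr (- \<beta> - 2) + a * real n powr (- \<beta> - 3))\<bar>
       \<le> C * real n powr (- \<beta> - 4)"
    using omega_coeff_expansion[of \<beta>] by blast
  define r where "r = rGamma (- \<beta>)"
  define b where "b = \<beta> * (\<beta> + 1) / 2"
  have mono: "real n powr p \<le> real n powr q" if "n \<ge> 1" "p \<le> q" for n p q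
    using that by (intro powr_mono) auto
  have le: "\<bar>z * real n powr p\<bar> \<le> \<bar>z\<bar> * real n powr q" if "n \<ge> 1" "p \<le> q" for z n p q
    using mono[OF that] by (simp add: abs_mult mult_left_mono)
  show ?thesis
  proof (rule that[of "C + \<bar>r * a\<bar> + \<bar>r * b\<bar>"])
    show "C + \<bar>r * a\<bar> + \<bar>r * b\<bar> > 0" using C by (simp add: add_pos_nonneg)
    fix n :: nat assume n: "n \<ge> 1"
    have tail: "C * real n powr (- \<beta> - 4) \<le> C * real n powr (- \<beta> - 3)"
      "C * real n powr (- \<beta> - 3) \<le> C * real n powr (- \<beta> - 2)"
      "\<bar>r * a * real n powr (- \<beta> - 3)\<bar> \<le> \<bar>r * a\<bar> * real n powr (- \<beta> - 2)"
      "\<bar>r * a * real n powr (- \<beta> - 3)\<bar> \<le> \<bar>r * a\<bar> * real n powr (- \<beta> - 3)"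
      "\<bar>r * b * real n powr (- \<beta> - 2)\<bar> \<le> \<bar>r * b\<bar> * real n powr (- \<beta> - 2)"
      "0 \<le> \<bar>r * b\<bar> * real n powr (- \<beta> - 3)"
    subgoal by (rule mult_left_mono[OF mono[OF n]]) (use C(1) in auto)
    subgoal by (rule mult_left_mono[OF mono[OF n]]) (use C(1) in auto)
    subgoal by (rule le[OF n]) auto
    subgoal by (rule le[OF n]) auto
    subgoal by (rule le[OF n]) auto
    subgoal by simp
    done
    define X where "X = omega_coeff \<beta> n"
    define q1 where "q1 = real n powr (- \<beta> - 1)"
    define q2 where "q2 = real n powr (- \<beta> - 2)"
    define q3 where "q3 = real n powr (- \<beta> - 3)"
    define q4 where "q4 = real n powr (- \<beta> - 4)"
    have main: "\<bar>X - r * (q1 + b * q2 + a * q3)\<bar> \<le> C * q4"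
      using C(2)[OF n] by (simp add: r_def b_def X_def q1_def q2_def q3_def q4_def)
    have "\<bar>X - r * q1\<bar> = \<bar>(X - r * (q1 + b * q2 + a * q3)) + (r * a * q3 + r * b * q2)\<bar>"
      by (simp add: algebra_simps)
    also have "\<dots> \<le> \<bar>X - r * (q1 + b * q2 + a * q3)\<bar> + (\<bar>r * a * q3\<bar> + \<bar>r * b * q2\<bar>)"
      by (rule order_trans[OF abs_triangle_ineq add_left_mono[OF abs_triangle_ineq]])
    also have "\<dots> \<le> C * q2 + (\<bar>r * a\<bar> * q2 + \<bar>r * b\<bar> * q2)"
      using tail main by (intro add_mono) (auto simp: q1_def q2_def q3_def q4_def)
    finally show "\<bar>omega_coeff \<beta> n - rGamma (- \<beta>) * real n powr (- \<beta> - 1)\<bar> \<le> (C + \<bar>r * a\<bar> + \<bar>r * b\<bar>) * real n powr (- \<beta> - 2)"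
      by (simp add: X_def q1_def q2_def r_def distrib_right)
    have "\<bar>X - r * (q1 + b * q2)\<bar> = \<bar>(X - r * (q1 + b * q2 + a * q3)) + r * a * q3\<bar>"
      by (simp add: algebra_simps)
    also have "\<dots> \<le> \<bar>X - r * (q1 + b * q2 + a * q3)\<bar> + \<bar>r * a * q3\<bar>"
      by (rule abs_triangle_ineq)
    also have "\<dots> \<le> C * q3 + \<bar>r * a\<bar> * q3"
      using tail main by (intro add_mono) (auto simp: q1_def q2_def q3_def q4_def)
    also have "\<dots> \<le> (C + \<bar>r * a\<bar> + \<bar>r * b\<bar>) * q3"
      using tail by (simp add: distrib_right q3_def)
    finally show "\<bar>omega_coeff \<beta> n - rGamma (- \<beta>) * (real n powr (- \<beta> - 1) + \<beta> * (\<beta> + 1) / 2 * real n powr (- \<beta> - 2))\<bar>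
       \<le> (C + \<bar>r * a\<bar> + \<bar>r * b\<bar>) * real n powr (- \<beta> - 3)"
      by (simp add: X_def q1_def q2_def q3_def r_def b_def)
  qed
qed

lemma omega_asymp1:
  assumes "p = - \<beta> - 1" "p' = - \<beta> - 2" "r = rGamma (- \<beta>)"
  shows "\<exists>C>0. \<forall>n\<ge>1. \<bar>omega_coeff \<beta> n - r * real n powr p\<bar> \<le> C * real n powr p'"
  using omega_coeff_expansion_coarse[of \<beta>] assms by metis

lemma omega_asymp2:
  assumes "p = - \<beta> - 1" "p' = - \<beta> - 2" "p'' = - \<beta> - 3" "r = rGamma (- \<beta>)" "b = \<beta> * (\<beta> + 1) / 2"
  shows "\<exists>C>0. \<forall>n\<ge>1. \<bar>omega_coeff \<beta> n - r * (real n powr p + b * real n powr p')\<bar> \<le> C * real n powr p''"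
  using omega_coeff_expansion_coarse[of \<beta>] assms by metis

lemma omega_asymp0:
  assumes "p = - \<beta> - 1"
  shows "\<exists>C>0. \<forall>n\<ge>1. \<bar>omega_coeff \<beta> n\<bar> \<le> C * real n powr p"
proof -
  obtain C where C: "C > 0" "\<And>n. n \<ge> 1 \<Longrightarrow>
    \<bar>omega_coeff \<beta> n - rGamma (- \<beta>) * real n powr (- \<beta> - 1)\<bar> \<le> C * real n powr (- \<beta> - 2)"
    using omega_coeff_expansion_coarse[of \<beta>] by metis
  have "\<bar>omega_coeff \<beta> n\<bar> \<le> (C + \<bar>rGamma (- \<beta>)\<bar>) * real n powr p" if "n \<ge> 1" for n
  proof -
    have "C * real n powr (- \<beta> - 2) \<le> C * real n powr p"
      using that C assms by (intro mult_left_mono powr_mono) auto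
    moreover have "\<bar>rGamma (- \<beta>) * real n powr (- \<beta> - 1)\<bar> = \<bar>rGamma (- \<beta>)\<bar> * real n powr p"
      using assms by (simp add: abs_mult)
    ultimately show ?thesis using C(2)[OF that] unfolding distrib_right by linarith
  qed
  then show ?thesis using C(1) by (intro exI[of _ "C + \<bar>rGamma (- \<beta>)\<bar>"]) (auto simp: add_pos_nonneg)
qed

lemma rGamma_step: "rGamma (1 - a) = (1 - a) * rGamma (2 - a)" for a :: real
  using rGamma_plus1[of "1 - a"] by (simp add: algebra_simps)

definition g_fps :: "real \<Rightarrow> real fps" where
  "g_fps \<alpha> = Abs_fps (g_coeff \<alpha>)"

text \<open>
  Since \<open>omega_coeff \<alpha> k - omega_coeff \<alpha> (k - 1)\<close> is \<open>omega_coeff (\<alpha> + 1) k\<close>, the weights are the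
  coefficients of \<open>(1 - z)\<^sup>\<alpha> (1 + (\<alpha>/2) (1 - z))\<close>.
\<close>

lemma g_fps_eq: "g_fps \<alpha> = omega_fps \<alpha> + fps_const (\<alpha> / 2) * omega_fps (\<alpha> + 1)"
proof (rule fps_ext)
  fix n show "fps_nth (g_fps \<alpha>) n = fps_nth (omega_fps \<alpha> + fps_const (\<alpha> / 2) * omega_fps (\<alpha> + 1)) n"
  proof (cases n)
    case (Suc k)
    then show ?thesis
      by (simp add: g_fps_def g_coeff_def omega_coeff_plus1) (simp add: field_simps)
  qed (simp add: g_fps_def g_coeff_def field_simps)
qed

lemma g_coeff_eq: "g_coeff \<alpha> n = omega_coeff \<alpha> n + \<alpha> / 2 * omega_coeff (\<alpha> + 1) n"
proof -
  have "fps_nth (g_fps \<alpha>) n = fps_nth (omega_fps \<alpha> + fps_const (\<alpha> / 2) * omega_fps (\<alpha> + 1)) n"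
    by (simp only: g_fps_eq)
  then show ?thesis by (simp add: g_fps_def)
qed

lemma g_fps_nth [simp]: "fps_nth (g_fps \<alpha>) n = g_coeff \<alpha> n"
  by (simp add: g_fps_def)

lemma omega_coeff_m1: "omega_coeff (-1) n = 1"
  by (induction n) (auto simp: omega_coeff_Suc field_simps)

lemma omega_coeff_m2: "omega_coeff (-2) n = real n + 1"
  by (induction n) (auto simp: omega_coeff_Suc field_simps)

lemma omega_coeff_m3: "omega_coeff (-3) n = (real n + 1) * (real n + 2) / 2"
  by (induction n) (auto simp: omega_coeff_Suc field_simps)

lemma g_partial_sum: "(\<Sum>i\<le>n. g_coeff \<alpha> i) = omega_coeff (\<alpha> - 1) n + \<alpha> / 2 * omega_coeff \<alpha> n"
proof -
  have "fps_nth (g_fps \<alpha> * omega_fps (-1)) n = (\<Sum>i=0..n. g_coeff \<alpha> i)"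
    by (simp add: fps_mult_nth omega_coeff_m1)
  also have "g_fps \<alpha> * omega_fps (-1) = omega_fps (\<alpha> - 1) + fps_const (\<alpha> / 2) * omega_fps \<alpha>"
    by (simp add: g_fps_eq distrib_right omega_fps_mult mult.assoc)
  finally show ?thesis by (simp add: atLeast0AtMost)
qed

text \<open>
  This is the discrete operator applied to \<open>t\<close> on the unit grid: the sequence \<open>n\<close> has the generating function
  \<open>(1 - z)\<^sup>-\<^sup>2 - (1 - z)\<^sup>-\<^sup>1\<close>. Likewise \<open>n\<^sup>2 / 2\<close>, in \<open>g_square_sum\<close>, is a combination of the powers
  \<open>-3\<close>, \<open>-2\<close> and \<open>-1\<close>.
\<close>

lemma g_ramp_sum:
  "(\<Sum>i\<le>n. g_coeff \<alpha> i * (real n - real i))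
     = omega_coeff (\<alpha> - 2) n + (\<alpha> / 2 - 1) * omega_coeff (\<alpha> - 1) n - \<alpha> / 2 * omega_coeff \<alpha> n"
proof -
  have "fps_nth (g_fps \<alpha> * (omega_fps (-2) - omega_fps (-1))) n = (\<Sum>i=0..n. g_coeff \<alpha> i * (real n - real i))"
    unfolding fps_mult_nth by (intro sum.cong) (auto simp: omega_coeff_m1 omega_coeff_m2 of_nat_diff)
  also have "g_fps \<alpha> * (omega_fps (-2) - omega_fps (-1))
     = omega_fps (\<alpha> - 2) - omega_fps (\<alpha> - 1) + fps_const (\<alpha> / 2) * (omega_fps (\<alpha> - 1) - omega_fps \<alpha>)"
    by (simp add: g_fps_eq distrib_right right_diff_distrib omega_fps_mult mult.assoc)
  finally show ?thesis by (simp add: atLeast0AtMost algebra_simps)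
qed

lemma g_fps_mult_omega: "g_fps \<alpha> * omega_fps b = omega_fps (\<alpha> + b) + fps_const (\<alpha> / 2) * omega_fps (\<alpha> + 1 + b)"
  by (simp add: g_fps_eq distrib_right omega_fps_mult mult.assoc)

lemma g_square_sum:
  "(\<Sum>i\<le>n. g_coeff \<alpha> i * ((real n - real i)^2 / 2))
     = omega_coeff (\<alpha> - 3) n + (\<alpha> - 3) / 2 * omega_coeff (\<alpha> - 2) n + (1/2 - 3 * \<alpha> / 4) * omega_coeff (\<alpha> - 1) n + \<alpha> / 4 * omega_coeff \<alpha> n"
proof -
  let ?q = "omega_fps (-3) - fps_const (3/2) * omega_fps (-2) + fps_const (1/2) * omega_fps (-1)"
  have "(\<Sum>i=0..n. g_coeff \<alpha> i * ((real n - real i)^2 / 2)) = fps_nth (g_fps \<alpha> * ?q) n"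
    unfolding fps_mult_nth
    by (intro sum.cong) (auto simp: omega_coeff_m1 omega_coeff_m2 omega_coeff_m3 of_nat_diff field_simps power2_eq_square)
  also have "g_fps \<alpha> * ?q = g_fps \<alpha> * omega_fps (-3) - fps_const (3/2) * (g_fps \<alpha> * omega_fps (-2)) + fps_const (1/2) * (g_fps \<alpha> * omega_fps (-1))"
    by (simp add: algebra_simps)
  finally show ?thesis by (simp add: g_fps_mult_omega atLeast0AtMost field_simps)
qed

lemma powr_diff_le:
  fixes a b q :: real
  assumes "0 < a" "a \<le> b" "q \<le> 1"
  shows "\<bar>b powr q - a powr q\<bar> \<le> \<bar>q\<bar> * (b - a) * a powr (q - 1)"
proof (cases "a = b")
  case False
  with assms have ab: "a < b" by simp
  obtain z where z: "z > a" "z < b" "b powr q - a powr q = (b - a) * (q * z powr (q - 1))"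
    using MVT2[OF ab, of "\<lambda>x. x powr q" "\<lambda>z. q * z powr (q - 1)"] assms
    by (force intro!: derivative_eq_intros simp: mult.commute)
  have "z powr (q - 1) \<le> a powr (q - 1)" using z assms by (intro powr_mono2') auto
  then show ?thesis unfolding z(3) abs_mult using ab
    by (simp add: mult_ac mult_left_mono)
qed auto

lemma rGamma_step': "rGamma (2 - a) = (2 - a) * rGamma (3 - a)" for a :: real
  using rGamma_plus1[of "2 - a"] by (simp add: algebra_simps)

text \<open>
  The Caputo derivative of \<open>t\<close> is \<open>t powr (1 - \<alpha>) / \<Gamma>(2 - \<alpha>)\<close>, and the discrete operator matches it
  up to a relative error of order \<open>n powr (-2)\<close>. Writing \<open>rGamma\<close> includes \<open>\<alpha> = 1\<close> without a case
  distinction.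
\<close>

lemma g_ramp_sum_asymp:
  "\<exists>C>0. \<forall>n\<ge>1. \<bar>(\<Sum>i\<le>n. g_coeff \<alpha> i * (real n - real i)) - rGamma (2 - \<alpha>) * real n powr (1 - \<alpha>)\<bar>
     \<le> C * real n powr (- 1 - \<alpha>)"
proof -
  define r where "r = rGamma (2 - \<alpha>)"
  have "\<exists>C>0. \<forall>n\<ge>1. \<bar>omega_coeff (\<alpha> - 2) n - r * (real n powr (1 - \<alpha>) + (\<alpha> - 2) * (\<alpha> - 1) / 2 * real n powr (- \<alpha>))\<bar>
       \<le> C * real n powr (- 1 - \<alpha>)"
    by (rule omega_asymp2) (simp_all add: r_def)
  then obtain C1 where C1: "C1 > 0" "\<forall>n\<ge>1. \<bar>omega_coeff (\<alpha> - 2) n - r * (real n powr (1 - \<alpha>) + (\<alpha> - 2) * (\<alpha> - 1) / 2 * real n powr (- \<alpha>))\<bar>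
       \<le> C1 * real n powr (- 1 - \<alpha>)" by blast
  have "\<exists>C>0. \<forall>n\<ge>1. \<bar>omega_coeff (\<alpha> - 1) n - (1 - \<alpha>) * r * real n powr (- \<alpha>)\<bar> \<le> C * real n powr (- 1 - \<alpha>)"
    by (rule omega_asymp1) (simp_all add: r_def rGamma_step)
  then obtain C2 where C2: "C2 > 0" "\<forall>n\<ge>1. \<bar>omega_coeff (\<alpha> - 1) n - (1 - \<alpha>) * r * real n powr (- \<alpha>)\<bar> \<le> C2 * real n powr (- 1 - \<alpha>)" by blast
  have "\<exists>C>0. \<forall>n\<ge>1. \<bar>omega_coeff \<alpha> n\<bar> \<le> C * real n powr (- 1 - \<alpha>)"
    by (rule omega_asymp0) simp
  then obtain C3 where C3: "C3 > 0" "\<forall>n\<ge>1. \<bar>omega_coeff \<alpha> n\<bar> \<le> C3 * real n powr (- 1 - \<alpha>)" by blast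
  define D where "D = C1 + \<bar>\<alpha> / 2 - 1\<bar> * C2 + \<bar>\<alpha> / 2\<bar> * C3"
  have "\<bar>(\<Sum>i\<le>n. g_coeff \<alpha> i * (real n - real i)) - r * real n powr (1 - \<alpha>)\<bar> \<le> D * real n powr (- 1 - \<alpha>)" if n: "n \<ge> 1" for n
  proof -
    define p where "p = real n powr (- 1 - \<alpha>)"
    define e1 where "e1 = omega_coeff (\<alpha> - 2) n - r * (real n powr (1 - \<alpha>) + (\<alpha> - 2) * (\<alpha> - 1) / 2 * real n powr (- \<alpha>))"
    define e2 where "e2 = omega_coeff (\<alpha> - 1) n - (1 - \<alpha>) * r * real n powr (- \<alpha>)"
    have e: "\<bar>e1\<bar> \<le> C1 * p" "\<bar>e2\<bar> \<le> C2 * p" "\<bar>omega_coeff \<alpha> n\<bar> \<le> C3 * p"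
      using C1 C2 C3 n by (auto simp: e1_def e2_def p_def)
    have "omega_coeff (\<alpha> - 2) n = e1 + r * (real n powr (1 - \<alpha>) + (\<alpha> - 2) * (\<alpha> - 1) / 2 * real n powr (- \<alpha>))"
      "omega_coeff (\<alpha> - 1) n = e2 + (1 - \<alpha>) * r * real n powr (- \<alpha>)"
      by (simp_all add: e1_def e2_def)
    note eqs = this
    have "(\<Sum>i\<le>n. g_coeff \<alpha> i * (real n - real i)) - r * real n powr (1 - \<alpha>)
       = e1 + (\<alpha> / 2 - 1) * e2 - \<alpha> / 2 * omega_coeff \<alpha> n"
      using cancel_leading_term[OF eqs, of "\<alpha> / 2 - 1"] unfolding g_ramp_sum by (simp add: field_simps)
    then have "\<bar>(\<Sum>i\<le>n. g_coeff \<alpha> i * (real n - real i)) - r * real n powr (1 - \<alpha>)\<bar>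
      \<le> C1 * p + \<bar>\<alpha> / 2 - 1\<bar> * (C2 * p) + \<bar>\<alpha> / 2\<bar> * (C3 * p)"
      using e by (simp only:) (intro abs_add_mono abs_diff_mono abs_mult_mono)
    then show ?thesis by (simp add: D_def p_def algebra_simps)
  qed
  moreover have "D > 0" unfolding D_def using C1 C2 C3 by (intro add_pos_nonneg) auto
  ultimately show ?thesis unfolding r_def by blast
qed

lemma g_square_sum_asymp:
  "\<exists>C>0. \<forall>n\<ge>1. \<bar>(\<Sum>i\<le>n. g_coeff \<alpha> i * ((real n - real i)^2 / 2)) - rGamma (3 - \<alpha>) * real n powr (2 - \<alpha>)\<bar>
     \<le> C * real n powr (- \<alpha>)"
proof -
  define r where "r = rGamma (3 - \<alpha>)"
  have "\<exists>C>0. \<forall>n\<ge>1. \<bar>omega_coeff (\<alpha> - 3) n - r * (real n powr (2 - \<alpha>) + (\<alpha> - 3) * (\<alpha> - 2) / 2 * real n powr (1 - \<alpha>))\<bar>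
       \<le> C * real n powr (- \<alpha>)"
    by (rule omega_asymp2) (simp_all add: r_def)
  then obtain C1 where C1: "C1 > 0" "\<forall>n\<ge>1. \<bar>omega_coeff (\<alpha> - 3) n - r * (real n powr (2 - \<alpha>) + (\<alpha> - 3) * (\<alpha> - 2) / 2 * real n powr (1 - \<alpha>))\<bar>
       \<le> C1 * real n powr (- \<alpha>)" by blast
  have "\<exists>C>0. \<forall>n\<ge>1. \<bar>omega_coeff (\<alpha> - 2) n - (2 - \<alpha>) * r * real n powr (1 - \<alpha>)\<bar> \<le> C * real n powr (- \<alpha>)"
    by (rule omega_asymp1) (simp_all add: r_def rGamma_step')
  then obtain C2 where C2: "C2 > 0" "\<forall>n\<ge>1. \<bar>omega_coeff (\<alpha> - 2) n - (2 - \<alpha>) * r * real n powr (1 - \<alpha>)\<bar> \<le> C2 * real n powr (- \<alpha>)" by blast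
  have "\<exists>C>0. \<forall>n\<ge>1. \<bar>omega_coeff (\<alpha> - 1) n\<bar> \<le> C * real n powr (- \<alpha>)"
    by (rule omega_asymp0) simp
  then obtain C3 where C3: "C3 > 0" "\<forall>n\<ge>1. \<bar>omega_coeff (\<alpha> - 1) n\<bar> \<le> C3 * real n powr (- \<alpha>)" by blast
  have "\<exists>C>0. \<forall>n\<ge>1. \<bar>omega_coeff \<alpha> n\<bar> \<le> C * real n powr (- \<alpha> - 1)"
    by (rule omega_asymp0) simp
  then obtain C4 where C4: "C4 > 0" "\<forall>n\<ge>1. \<bar>omega_coeff \<alpha> n\<bar> \<le> C4 * real n powr (- \<alpha> - 1)" by blast
  define D where "D = C1 + \<bar>(\<alpha> - 3) / 2\<bar> * C2 + \<bar>1/2 - 3 * \<alpha> / 4\<bar> * C3 + \<bar>\<alpha> / 4\<bar> * C4"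
  have "\<bar>(\<Sum>i\<le>n. g_coeff \<alpha> i * ((real n - real i)^2 / 2)) - r * real n powr (2 - \<alpha>)\<bar> \<le> D * real n powr (- \<alpha>)" if n: "n \<ge> 1" for n
  proof -
    define p where "p = real n powr (- \<alpha>)"
    define e1 where "e1 = omega_coeff (\<alpha> - 3) n - r * (real n powr (2 - \<alpha>) + (\<alpha> - 3) * (\<alpha> - 2) / 2 * real n powr (1 - \<alpha>))"
    define e2 where "e2 = omega_coeff (\<alpha> - 2) n - (2 - \<alpha>) * r * real n powr (1 - \<alpha>)"
    have "C4 * real n powr (- \<alpha> - 1) \<le> C4 * p"
      unfolding p_def using n C4(1) by (intro mult_left_mono powr_mono) auto
    then have e: "\<bar>e1\<bar> \<le> C1 * p" "\<bar>e2\<bar> \<le> C2 * p" "\<bar>omega_coeff (\<alpha> - 1) n\<bar> \<le> C3 * p" "\<bar>omega_coeff \<alpha> n\<bar> \<le> C4 * p"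
      using C1 C2 C3 C4 n by (auto simp: e1_def e2_def p_def intro: order_trans)
    have "omega_coeff (\<alpha> - 3) n = e1 + r * (real n powr (2 - \<alpha>) + (\<alpha> - 3) * (\<alpha> - 2) / 2 * real n powr (1 - \<alpha>))"
      "omega_coeff (\<alpha> - 2) n = e2 + (2 - \<alpha>) * r * real n powr (1 - \<alpha>)"
      by (simp_all add: e1_def e2_def)
    note eqs = this
    have "(\<Sum>i\<le>n. g_coeff \<alpha> i * ((real n - real i)^2 / 2)) - r * real n powr (2 - \<alpha>)
       = e1 + (\<alpha> - 3) / 2 * e2 + (1/2 - 3 * \<alpha> / 4) * omega_coeff (\<alpha> - 1) n + \<alpha> / 4 * omega_coeff \<alpha> n"
      using cancel_leading_term[OF eqs, of "(\<alpha> - 3) / 2"] unfolding g_square_sum by (simp add: field_simps)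
    then have "\<bar>(\<Sum>i\<le>n. g_coeff \<alpha> i * ((real n - real i)^2 / 2)) - r * real n powr (2 - \<alpha>)\<bar>
      \<le> C1 * p + \<bar>(\<alpha> - 3) / 2\<bar> * (C2 * p) + \<bar>1/2 - 3 * \<alpha> / 4\<bar> * (C3 * p) + \<bar>\<alpha> / 4\<bar> * (C4 * p)"
      using e by (simp only:) (intro abs_add_mono abs_diff_mono abs_mult_mono)
    then show ?thesis by (simp only: D_def p_def distrib_right mult.assoc)
  qed
  moreover have "D > 0" unfolding D_def using C1 C2 C3 C4 by (intro add_pos_nonneg) auto
  ultimately show ?thesis unfolding r_def by blast
qed

text \<open>
  The partial sums are the discrete operator applied to a unit step. They are compared at
  \<open>n - 1/2\<close> because the error analysis below splits the interval at \<open>1/2\<close>, which lies strictly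
  between \<open>0\<close> and every other grid point.
\<close>

lemma g_partial_sum_asymp:
  assumes "\<alpha> > 0"
  shows "\<exists>C>0. \<forall>n\<ge>1. \<bar>(\<Sum>i\<le>n - 1. g_coeff \<alpha> i) - rGamma (1 - \<alpha>) * (real n - 1/2) powr (- \<alpha>)\<bar>
     \<le> C * real n powr (- 1 - \<alpha>)"
proof -
  define r where "r = rGamma (1 - \<alpha>)"
  have "\<exists>C>0. \<forall>n\<ge>1. \<bar>omega_coeff (\<alpha> - 1) n - r * real n powr (- \<alpha>)\<bar> \<le> C * real n powr (- 1 - \<alpha>)"
    by (rule omega_asymp1) (simp_all add: r_def)
  then obtain C2 where C2: "C2 > 0" "\<forall>n\<ge>1. \<bar>omega_coeff (\<alpha> - 1) n - r * real n powr (- \<alpha>)\<bar> \<le> C2 * real n powr (- 1 - \<alpha>)" by blast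
  have "\<exists>C>0. \<forall>n\<ge>1. \<bar>omega_coeff \<alpha> n\<bar> \<le> C * real n powr (- 1 - \<alpha>)"
    by (rule omega_asymp0) simp
  then obtain C3 where C3: "C3 > 0" "\<forall>n\<ge>1. \<bar>omega_coeff \<alpha> n\<bar> \<le> C3 * real n powr (- 1 - \<alpha>)" by blast
  define D where "D = (C2 + \<alpha> / 2 * C3 + \<bar>r\<bar> * \<alpha>) * 2 powr (1 + \<alpha>) + \<bar>g_coeff \<alpha> 0 - r * (1/2) powr (- \<alpha>)\<bar>"
  have "\<bar>(\<Sum>i\<le>n - 1. g_coeff \<alpha> i) - r * (real n - 1/2) powr (- \<alpha>)\<bar> \<le> D * real n powr (- 1 - \<alpha>)" if n: "n \<ge> 1" for n
  proof (cases "n = 1")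
    case True
    have "(C2 + \<alpha> / 2 * C3 + \<bar>r\<bar> * \<alpha>) * 2 powr (1 + \<alpha>) \<ge> 0" using C2 C3 assms by auto
    then show ?thesis using True by (simp add: D_def)
  next
    case False
    define m where "m = n - 1"
    have m: "m \<ge> 1" "real n = real m + 1" using n False by (auto simp: m_def)
    define p where "p = real m powr (- 1 - \<alpha>)"
    define e2 where "e2 = omega_coeff (\<alpha> - 1) m - r * real m powr (- \<alpha>)"
    define d where "d = (real m + 1/2) powr (- \<alpha>) - real m powr (- \<alpha>)"
    have e: "\<bar>e2\<bar> \<le> C2 * p" "\<bar>omega_coeff \<alpha> m\<bar> \<le> C3 * p" using C2 C3 m by (auto simp: e2_def p_def)
    have "\<bar>d\<bar> \<le> \<bar>- \<alpha>\<bar> * (real m + 1/2 - real m) * real m powr (- \<alpha> - 1)"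
      unfolding d_def by (rule powr_diff_le) (use m assms in auto)
    also have "\<dots> \<le> \<alpha> * p" using assms by (simp add: p_def minus_diff_commute)
    finally have d: "\<bar>d\<bar> \<le> \<alpha> * p" .
    have "(\<Sum>i\<le>n - 1. g_coeff \<alpha> i) - r * (real n - 1/2) powr (- \<alpha>) = e2 + \<alpha> / 2 * omega_coeff \<alpha> m - r * d"
      unfolding g_partial_sum m_def[symmetric] m(2) by (simp add: e2_def d_def algebra_simps)
    then have "\<bar>(\<Sum>i\<le>n - 1. g_coeff \<alpha> i) - r * (real n - 1/2) powr (- \<alpha>)\<bar> \<le> C2 * p + \<bar>\<alpha> / 2\<bar> * (C3 * p) + \<bar>r\<bar> * (\<alpha> * p)"
      using e d by (simp only:) (intro abs_add_mono abs_diff_mono abs_mult_mono)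
    also have "\<dots> = (C2 + \<alpha> / 2 * C3 + \<bar>r\<bar> * \<alpha>) * p" using assms by (simp add: algebra_simps)
    also have "p \<le> 2 powr (1 + \<alpha>) * real n powr (- 1 - \<alpha>)"
    proof -
      have "p = (real n / real m) powr (1 + \<alpha>) * real n powr (- 1 - \<alpha>)"
      proof -
        have "real n powr (1 + \<alpha>) * real n powr (- 1 - \<alpha>) = 1" using n by (simp add: powr_add[symmetric])
        moreover have "p = 1 / real m powr (1 + \<alpha>)" unfolding p_def
          using powr_minus_divide[of "real m" "1 + \<alpha>"] by simp
        ultimately show ?thesis using m by (simp add: powr_divide)
      qed
      moreover have "(real n / real m) powr (1 + \<alpha>) \<le> 2 powr (1 + \<alpha>)"
        using m assms by (intro powr_mono2) (auto simp: field_simps)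
      ultimately show ?thesis by (simp add: mult_right_mono)
    qed
    then have "(C2 + \<alpha> / 2 * C3 + \<bar>r\<bar> * \<alpha>) * p \<le> (C2 + \<alpha> / 2 * C3 + \<bar>r\<bar> * \<alpha>) * (2 powr (1 + \<alpha>) * real n powr (- 1 - \<alpha>))"
      using C2 C3 assms by (intro mult_left_mono) auto
    also have "\<dots> \<le> D * real n powr (- 1 - \<alpha>)" by (simp add: D_def algebra_simps)
    finally show ?thesis .
  qed
  moreover have "D > 0" unfolding D_def using C2 C3 assms by (intro add_pos_nonneg mult_pos_pos) auto
  ultimately show ?thesis unfolding r_def by blast
qed

text \<open>
  The discrete operator at the grid point \<open>n\<close>, applied to the truncated powers \<open>t \<mapsto> (t - s)\<^sub>+\<close> and
  \<open>t \<mapsto> (t - s)\<^sub>+\<^sup>2 / 2\<close>, as functions of the distance \<open>x = n - s\<close>.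
\<close>

section \<open>Peano kernels of the truncation error\<close>

definition ramp_sum :: "real \<Rightarrow> nat \<Rightarrow> real \<Rightarrow> real" where
  "ramp_sum \<alpha> n x = (\<Sum>i\<le>n. g_coeff \<alpha> i * max 0 (x - real i))"

definition square_sum :: "real \<Rightarrow> nat \<Rightarrow> real \<Rightarrow> real" where
  "square_sum \<alpha> n x = (\<Sum>i\<le>n. g_coeff \<alpha> i * ((max 0 (x - real i))^2 / 2))"

text \<open>
  Peano kernels of the truncation error at the grid point \<open>n\<close>: the error for truncated powers of
  degree one and two. Both decay in the distance \<open>x\<close> from that point, with bounds uniform in \<open>n\<close>.
\<close>

definition kernel2 :: "real \<Rightarrow> nat \<Rightarrow> real \<Rightarrow> real" where
  "kernel2 \<alpha> n x = ramp_sum \<alpha> n x - rGamma (2 - \<alpha>) * x powr (1 - \<alpha>)"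

definition kernel3 :: "real \<Rightarrow> nat \<Rightarrow> real \<Rightarrow> real" where
  "kernel3 \<alpha> n x = square_sum \<alpha> n x - rGamma (3 - \<alpha>) * x powr (2 - \<alpha>)"

lemma sum_truncate:
  fixes x :: real
  assumes "real j \<le> x" "x \<le> real j + 1" "j \<le> n" "h 0 = 0"
  shows "(\<Sum>i\<le>n. g i * h (max 0 (x - real i))) = (\<Sum>i\<le>j. g i * h (x - real i) :: real)"
proof -
  have "(\<Sum>i\<le>n. g i * h (max 0 (x - real i))) = (\<Sum>i\<le>j. g i * h (max 0 (x - real i)))"
  proof (rule sum.mono_neutral_right)
    show "\<forall>i\<in>{..n} - {..j}. g i * h (max 0 (x - real i)) = 0"
    proof
      fix i assume "i \<in> {..n} - {..j}"
      then have "j + 1 \<le> i" by auto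
      then have "real j + 1 \<le> real i" by linarith
      then have "max 0 (x - real i) = 0" using assms by simp
      then show "g i * h (max 0 (x - real i)) = 0" using assms by simp
    qed
  qed (use assms in auto)
  also have "\<dots> = (\<Sum>i\<le>j. g i * h (x - real i))"
  proof (rule sum.cong)
    fix i assume "i \<in> {..j}"
    then have "real i \<le> x" using assms by auto
    then show "g i * h (max 0 (x - real i)) = g i * h (x - real i)" by simp
  qed auto
  finally show ?thesis .
qed

lemma ramp_sum_interpolates:
  fixes x :: real
  assumes "real j \<le> x" "x \<le> real j + 1" "j \<le> n"
  shows "ramp_sum \<alpha> n x
    = (real j + 1 - x) * (\<Sum>i\<le>j. g_coeff \<alpha> i * (real j - real i))
      + (x - real j) * (\<Sum>i\<le>Suc j. g_coeff \<alpha> i * (real (Suc j) - real i))"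
proof -
  have "ramp_sum \<alpha> n x = (\<Sum>i\<le>j. g_coeff \<alpha> i * (x - real i))"
    unfolding ramp_sum_def using sum_truncate[OF assms, of "\<lambda>x. x"] by simp
  also have "\<dots> = (\<Sum>i\<le>j. (real j + 1 - x) * (g_coeff \<alpha> i * (real j - real i)) + (x - real j) * (g_coeff \<alpha> i * (real (Suc j) - real i)))"
    by (intro sum.cong) (auto simp: algebra_simps)
  also have "\<dots> = (real j + 1 - x) * (\<Sum>i\<le>j. g_coeff \<alpha> i * (real j - real i))
      + (x - real j) * (\<Sum>i\<le>Suc j. g_coeff \<alpha> i * (real (Suc j) - real i))"
    by (simp add: sum.distrib sum_distrib_left)
  finally show ?thesis .
qed

text \<open>
  Linear interpolation on a unit cell: two applications of the mean value theorem replace the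
  difference by a difference of first derivatives.
\<close>

lemma powr_interpolation_error:
  fixes a p \<theta> :: real
  assumes "a > 0" "0 \<le> \<theta>" "\<theta> \<le> 1" "0 \<le> p" "p \<le> 1"
  shows "\<bar>(1 - \<theta>) * a powr p + \<theta> * (a + 1) powr p - (a + \<theta>) powr p\<bar> \<le> a powr (p - 2)"
proof (cases "\<theta> = 0 \<or> \<theta> = 1")
  case False
  with assms have t: "0 < \<theta>" "\<theta> < 1" by auto
  have D: "((\<lambda>x. x powr p) has_real_derivative p * z powr (p - 1)) (at z)" if "z > 0" for z
    using that by (auto intro!: derivative_eq_intros simp: mult.commute)
  obtain z1 where z1: "a < z1" "z1 < a + \<theta>" "(a + \<theta>) powr p - a powr p = \<theta> * (p * z1 powr (p - 1))"
    using MVT2[of a "a + \<theta>" "\<lambda>x. x powr p" "\<lambda>z. p * z powr (p - 1)"] t assms D by auto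
  obtain z2 where z2: "a + \<theta> < z2" "z2 < a + 1" "(a + 1) powr p - (a + \<theta>) powr p = (1 - \<theta>) * (p * z2 powr (p - 1))"
    using MVT2[of "a + \<theta>" "a + 1" "\<lambda>x. x powr p" "\<lambda>z. p * z powr (p - 1)"] t assms D by auto
  have "(1 - \<theta>) * a powr p + \<theta> * (a + 1) powr p - (a + \<theta>) powr p
      = \<theta> * ((a + 1) powr p - (a + \<theta>) powr p) - (1 - \<theta>) * ((a + \<theta>) powr p - a powr p)"
    by (simp add: algebra_simps)
  also have "\<dots> = (\<theta> * (1 - \<theta>) * p) * (z2 powr (p - 1) - z1 powr (p - 1))"
    unfolding z1 z2 by (simp add: algebra_simps)
  also have "\<bar>\<dots>\<bar> \<le> 1 * a powr (p - 2)"
    unfolding abs_mult[of "\<theta> * (1 - \<theta>) * p"]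
  proof (rule mult_mono)
    have "\<theta> * (1 - \<theta>) * p \<le> 1 * 1" using t assms by (intro mult_mono) (auto intro: mult_le_one)
    moreover have "0 \<le> \<theta> * (1 - \<theta>) * p" using t assms by auto
    ultimately show "\<bar>\<theta> * (1 - \<theta>) * p\<bar> \<le> 1" by simp
    have "\<bar>z2 powr (p - 1) - z1 powr (p - 1)\<bar> \<le> \<bar>p - 1\<bar> * (z2 - z1) * z1 powr (p - 1 - 1)"
      by (rule powr_diff_le) (use z1 z2 assms in auto)
    also have "\<dots> \<le> 1 * a powr (p - 2)"
    proof (rule mult_mono)
      show "\<bar>p - 1\<bar> * (z2 - z1) \<le> 1" using z1 z2 assms by (intro mult_le_one) auto
      show "z1 powr (p - 1 - 1) \<le> a powr (p - 2)"
        using z1 assms by (simp add: powr_mono2')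
    qed auto
    finally show "\<bar>z2 powr (p - 1) - z1 powr (p - 1)\<bar> \<le> a powr (p - 2)" by simp
  qed auto
  finally show ?thesis by simp
qed auto

lemma floor_cell:
  fixes x :: real
  assumes "0 \<le> x" "x \<le> real n"
  obtains j where "real j \<le> x" "x < real j + 1" "j \<le> n"
proof (rule that[of "nat \<lfloor>x\<rfloor>"])
  show "real (nat \<lfloor>x\<rfloor>) \<le> x" "x < real (nat \<lfloor>x\<rfloor>) + 1" "nat \<lfloor>x\<rfloor> \<le> n"
    using assms by (simp_all, linarith+)
qed

lemma powr_cell:
  fixes x q :: real
  assumes "j \<ge> 1" "x \<ge> 0" "x \<le> real j + 1" "q \<ge> 0"
  shows "real j powr (- q) \<le> 3 powr q * (1 + x) powr (- q)"
proof -
  have "(3 * real j) powr (- q) \<le> (1 + x) powr (- q)"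
    using assms by (intro powr_mono2') auto
  then have "3 powr (- q) * real j powr (- q) \<le> (1 + x) powr (- q)"
    by (simp add: powr_mult)
  then have "3 powr q * (3 powr (- q) * real j powr (- q)) \<le> 3 powr q * (1 + x) powr (- q)"
    by (intro mult_left_mono) auto
  then show ?thesis by (simp add: powr_minus mult.assoc[symmetric])
qed

text \<open>
  At integers this is \<open>g_ramp_sum_asymp\<close>. In between, \<open>ramp_sum\<close> is linear, so the only additional
  error is the one of interpolating \<open>x powr (1 - \<alpha>)\<close>, which has the same size.
\<close>

lemma kernel2_bound:
  assumes \<alpha>: "0 < \<alpha>" "\<alpha> \<le> 1"
  shows "\<exists>C>0. \<forall>n x. 0 < x \<longrightarrow> x \<le> real n \<longrightarrow> \<bar>kernel2 \<alpha> n x\<bar> \<le> C * (1 + x) powr (- 1 - \<alpha>)"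
proof -
  define r where "r = rGamma (2 - \<alpha>)"
  define S where "S j = (\<Sum>i\<le>j. g_coeff \<alpha> i * (real j - real i))" for j
  obtain C where C: "C > 0" "\<And>j. j \<ge> 1 \<Longrightarrow> \<bar>S j - r * real j powr (1 - \<alpha>)\<bar> \<le> C * real j powr (- 1 - \<alpha>)"
    using g_ramp_sum_asymp[of \<alpha>] unfolding S_def r_def by blast
  define D where "D = (C + \<bar>r\<bar>) * 3 powr (1 + \<alpha>) + (\<bar>g_coeff \<alpha> 0\<bar> + \<bar>r\<bar>) * 2 powr (1 + \<alpha>)"
  have "\<bar>kernel2 \<alpha> n x\<bar> \<le> D * (1 + x) powr (- 1 - \<alpha>)" if x: "0 < x" "x \<le> real n" for n x
  proof -
    obtain j where j: "real j \<le> x" "x < real j + 1" "j \<le> n" using floor_cell[of x n] x by auto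
    have rs: "ramp_sum \<alpha> n x = (real j + 1 - x) * S j + (x - real j) * S (Suc j)"
      unfolding S_def using j by (intro ramp_sum_interpolates) auto
    show ?thesis
    proof (cases "j = 0")
      case True
      then have x1: "x < 1" using j by simp
      have "\<bar>kernel2 \<alpha> n x\<bar> \<le> \<bar>g_coeff \<alpha> 0\<bar> + \<bar>r\<bar>"
        unfolding kernel2_def r_def[symmetric]
      proof (rule abs_diff_mono)
        have "ramp_sum \<alpha> n x = x * g_coeff \<alpha> 0" unfolding rs True by (simp add: S_def)
        then show "\<bar>ramp_sum \<alpha> n x\<bar> \<le> \<bar>g_coeff \<alpha> 0\<bar>" using x x1 by (simp add: abs_mult mult_left_le_one_le)
        have "x powr (1 - \<alpha>) \<le> 1" using x x1 \<alpha> by (intro powr_le1) auto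
        then show "\<bar>r * x powr (1 - \<alpha>)\<bar> \<le> \<bar>r\<bar>" by (simp add: abs_mult mult_left_le)
      qed
      also have "\<dots> = (\<bar>g_coeff \<alpha> 0\<bar> + \<bar>r\<bar>) * (2 powr (1 + \<alpha>) * 2 powr (- 1 - \<alpha>))"
        by (simp add: powr_add[symmetric])
      also have "\<dots> \<le> (\<bar>g_coeff \<alpha> 0\<bar> + \<bar>r\<bar>) * (2 powr (1 + \<alpha>) * (1 + x) powr (- 1 - \<alpha>))"
        using x x1 \<alpha> by (intro mult_left_mono powr_mono2') auto
      also have "\<dots> \<le> D * (1 + x) powr (- 1 - \<alpha>)"
        unfolding D_def distrib_right using C by (simp add: mult.assoc)
      finally show ?thesis .
    next
      case False
      then have j1: "j \<ge> 1" by simp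
      define \<theta> where "\<theta> = x - real j"
      have t: "0 \<le> \<theta>" "\<theta> \<le> 1" "x = real j + \<theta>" using j by (auto simp: \<theta>_def)
      define q where "q = real j powr (- 1 - \<alpha>)"
      define I where "I = (1 - \<theta>) * real j powr (1 - \<alpha>) + \<theta> * (real j + 1) powr (1 - \<alpha>) - (real j + \<theta>) powr (1 - \<alpha>)"
      have k: "kernel2 \<alpha> n x = ((1 - \<theta>) * (S j - r * real j powr (1 - \<alpha>)) + \<theta> * (S (Suc j) - r * real (Suc j) powr (1 - \<alpha>))) + r * I"
        unfolding kernel2_def rs r_def[symmetric] I_def unfolding t(3) by (simp add: algebra_simps)
      have 1: "\<bar>S j - r * real j powr (1 - \<alpha>)\<bar> \<le> C * q" using C(2)[OF j1] by (simp add: q_def)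
      have 2: "\<bar>S (Suc j) - r * real (Suc j) powr (1 - \<alpha>)\<bar> \<le> C * q"
      proof -
        have "real (Suc j) powr (- 1 - \<alpha>) \<le> q" unfolding q_def using j1 \<alpha> by (intro powr_mono2') auto
        then have "C * real (Suc j) powr (- 1 - \<alpha>) \<le> C * q" using C(1) by (intro mult_left_mono) auto
        moreover have "\<bar>S (Suc j) - r * real (Suc j) powr (1 - \<alpha>)\<bar> \<le> C * real (Suc j) powr (- 1 - \<alpha>)"
          using C(2)[of "Suc j"] by simp
        ultimately show ?thesis by linarith
      qed
      have 3: "\<bar>I\<bar> \<le> q" using powr_interpolation_error[of "real j" \<theta> "1 - \<alpha>"] j1 t \<alpha>
        by (simp add: I_def q_def minus_diff_commute)
      have "\<bar>kernel2 \<alpha> n x\<bar> \<le> (\<bar>1 - \<theta>\<bar> * (C * q) + \<bar>\<theta>\<bar> * (C * q)) + \<bar>r\<bar> * q"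
        unfolding k by (intro abs_add_mono abs_mult_mono 1 2 3)
      also have "\<dots> = (C + \<bar>r\<bar>) * q" using t by (simp add: algebra_simps)
      also have "\<dots> \<le> (C + \<bar>r\<bar>) * (3 powr (1 + \<alpha>) * (1 + x) powr (- 1 - \<alpha>))"
        unfolding q_def using powr_cell[of j x "1 + \<alpha>"] j1 x j \<alpha> C by (intro mult_left_mono) auto
      also have "\<dots> \<le> D * (1 + x) powr (- 1 - \<alpha>)"
        unfolding D_def distrib_right by (simp add: mult.assoc)
      finally show ?thesis .
    qed
  qed
  moreover have "D > 0" unfolding D_def using C by (intro add_pos_nonneg mult_pos_pos) auto
  ultimately show ?thesis by blast
qed

text \<open>
  Writing the truncated square with \<open>x * \<bar>x\<bar>\<close> reduces the kink to the derivative of that function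
  at \<open>0\<close>.
\<close>

lemma half_square_derivative:
  "((\<lambda>x. (max 0 (x - c))^2 / 2) has_real_derivative max 0 (x - c)) (at x)" for x c :: real
proof -
  have eq: "(\<lambda>x. (max 0 (x - c))^2 / 2) = (\<lambda>x. ((x - c)^2 + (x - c) * \<bar>x - c\<bar>) / 4)"
    by (rule ext) (auto simp: max_def abs_if power2_eq_square algebra_simps)
  have "((\<lambda>x. (x - c) * \<bar>x - c\<bar>) has_real_derivative 2 * \<bar>x - c\<bar>) (at x)"
  proof (cases "x = c")
    case True
    have "(\<lambda>h. \<bar>h\<bar>) \<midarrow>0\<rightarrow> (0::real)" by (rule tendsto_eq_intros | simp)+
    moreover have "\<forall>\<^sub>F h in at 0. ((c + h - c) * \<bar>c + h - c\<bar> - (c - c) * \<bar>c - c\<bar>) / h = \<bar>h\<bar>"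
      by (auto simp: eventually_at_filter)
    ultimately have "(\<lambda>h. ((c + h - c) * \<bar>c + h - c\<bar> - (c - c) * \<bar>c - c\<bar>) / h) \<midarrow>0\<rightarrow> 0"
      by (simp cong: tendsto_cong)
    then show ?thesis using True unfolding DERIV_def by simp
  next
    case False
    then consider "x > c" | "x < c" by linarith
    then show ?thesis
    proof cases
      case 1
      have "((\<lambda>x. (x - c) * (x - c)) has_real_derivative 2 * (x - c)) (at x)"
        by (auto intro!: derivative_eq_intros)
      then have "((\<lambda>x. (x - c) * \<bar>x - c\<bar>) has_real_derivative 2 * (x - c)) (at x)"
        by (rule has_field_derivative_transform_within_open[of _ _ _ "{c<..}"]) (use 1 in auto)
      then show ?thesis using 1 by simp
    next
      case 2
      have "((\<lambda>x. (x - c) * (c - x)) has_real_derivative 2 * (c - x)) (at x)"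
        by (auto intro!: derivative_eq_intros simp: algebra_simps)
      then have "((\<lambda>x. (x - c) * \<bar>x - c\<bar>) has_real_derivative 2 * (c - x)) (at x)"
        by (rule has_field_derivative_transform_within_open[of _ _ _ "{..<c}"]) (use 2 in auto)
      then show ?thesis using 2 by simp
    qed
  qed
  moreover have "((\<lambda>x. (x - c)^2) has_real_derivative 2 * (x - c)) (at x)"
    by (auto intro!: derivative_eq_intros)
  ultimately have "((\<lambda>x. ((x - c)^2 + (x - c) * \<bar>x - c\<bar>) / 4) has_real_derivative (2 * (x - c) + 2 * \<bar>x - c\<bar>) / 4) (at x)"
    by (intro DERIV_cdivide DERIV_add)
  also have "(2 * (x - c) + 2 * \<bar>x - c\<bar>) / 4 = max 0 (x - c)"
    by (auto simp: max_def abs_if)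
  finally show ?thesis unfolding eq .
qed

lemma kernel3_derivative:
  assumes "x > 0"
  shows "(kernel3 \<alpha> n has_real_derivative kernel2 \<alpha> n x) (at x)"
proof -
  have "(square_sum \<alpha> n has_real_derivative ramp_sum \<alpha> n x) (at x)"
    unfolding square_sum_def[abs_def] ramp_sum_def
    by (intro DERIV_sum DERIV_cmult half_square_derivative)
  moreover have "((\<lambda>x. rGamma (3 - \<alpha>) * x powr (2 - \<alpha>)) has_real_derivative rGamma (2 - \<alpha>) * x powr (1 - \<alpha>)) (at x)"
    using assms by (auto intro!: derivative_eq_intros simp: rGamma_step')
  ultimately show ?thesis unfolding kernel3_def[abs_def] kernel2_def by (rule DERIV_diff)
qed

lemma kernel3_continuous:
  assumes "\<alpha> \<le> 1"
  shows "continuous_on {0..} (kernel3 \<alpha> n)"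
proof -
  have "continuous_on {0..} (\<lambda>x::real. x powr (2 - \<alpha>))"
    by (intro continuous_on_powr') (use assms in \<open>auto intro!: continuous_intros\<close>)
  then show ?thesis unfolding kernel3_def[abs_def] square_sum_def[abs_def]
    by (intro continuous_on_diff continuous_on_mult continuous_on_const continuous_on_sum
        continuous_on_divide continuous_on_power continuous_on_max continuous_on_id) auto
qed

lemma kernel3_0 [simp]: "kernel3 \<alpha> n 0 = 0"
  by (simp add: kernel3_def square_sum_def max_absorb1)

text \<open>
  At integers this is \<open>g_square_sum_asymp\<close>; within a cell \<open>kernel3\<close> varies by at most the maximum of
  its derivative \<open>kernel2\<close>.
\<close>

lemma kernel3_bound_weak:
  assumes \<alpha>: "0 < \<alpha>" "\<alpha> \<le> 1"
  shows "\<exists>C>0. \<forall>n x. 0 < x \<longrightarrow> x \<le> real n \<longrightarrow> \<bar>kernel3 \<alpha> n x\<bar> \<le> C * (1 + x) powr (- \<alpha>)"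
proof -
  define r where "r = rGamma (3 - \<alpha>)"
  define S where "S j = (\<Sum>i\<le>j. g_coeff \<alpha> i * ((real j - real i)^2 / 2))" for j
  obtain C where C: "C > 0" "\<And>j. j \<ge> 1 \<Longrightarrow> \<bar>S j - r * real j powr (2 - \<alpha>)\<bar> \<le> C * real j powr (- \<alpha>)"
    using g_square_sum_asymp[of \<alpha>] unfolding S_def r_def by blast
  obtain K where K: "K > 0" "\<And>n x. 0 < x \<Longrightarrow> x \<le> real n \<Longrightarrow> \<bar>kernel2 \<alpha> n x\<bar> \<le> K * (1 + x) powr (- 1 - \<alpha>)"
    using kernel2_bound[OF \<alpha>] by blast
  define D where "D = (C + K) * 3 powr \<alpha> + (\<bar>g_coeff \<alpha> 0\<bar> + \<bar>r\<bar>) * 2 powr \<alpha>"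
  have "\<bar>kernel3 \<alpha> n x\<bar> \<le> D * (1 + x) powr (- \<alpha>)" if x: "0 < x" "x \<le> real n" for n x
  proof -
    obtain j where j: "real j \<le> x" "x < real j + 1" "j \<le> n" using floor_cell[of x n] x by auto
    show ?thesis
    proof (cases "j = 0")
      case True
      then have x1: "x < 1" using j by simp
      have "\<bar>kernel3 \<alpha> n x\<bar> \<le> \<bar>g_coeff \<alpha> 0\<bar> + \<bar>r\<bar>"
        unfolding kernel3_def r_def[symmetric]
      proof (rule abs_diff_mono)
        have "square_sum \<alpha> n x = g_coeff \<alpha> 0 * (x^2 / 2)"
          unfolding square_sum_def using sum_truncate[of 0 x n "\<lambda>x. x^2 / 2" "g_coeff \<alpha>"] x x1 by simp
        moreover have "x^2 / 2 \<le> 1" using power_le_one[of x 2] x x1 by simp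
        ultimately show "\<bar>square_sum \<alpha> n x\<bar> \<le> \<bar>g_coeff \<alpha> 0\<bar>"
          by (simp only: abs_mult) (rule mult_left_le, auto)
        have "x powr (2 - \<alpha>) \<le> 1" using x x1 \<alpha> by (intro powr_le1) auto
        then show "\<bar>r * x powr (2 - \<alpha>)\<bar> \<le> \<bar>r\<bar>" by (simp add: abs_mult mult_left_le)
      qed
      also have "\<dots> = (\<bar>g_coeff \<alpha> 0\<bar> + \<bar>r\<bar>) * (2 powr \<alpha> * 2 powr (- \<alpha>))"
        by (simp add: powr_add[symmetric])
      also have "\<dots> \<le> (\<bar>g_coeff \<alpha> 0\<bar> + \<bar>r\<bar>) * (2 powr \<alpha> * (1 + x) powr (- \<alpha>))"
        using x x1 \<alpha> by (intro mult_left_mono powr_mono2') auto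
      also have "\<dots> \<le> D * (1 + x) powr (- \<alpha>)"
        unfolding D_def distrib_right using C K by (simp add: mult.assoc)
      finally show ?thesis .
    next
      case False
      then have j1: "j \<ge> 1" by simp
      define q where "q = real j powr (- \<alpha>)"
      have "square_sum \<alpha> n (real j) = S j"
        unfolding square_sum_def S_def using sum_truncate[of j "real j" n "\<lambda>x. x^2 / 2" "g_coeff \<alpha>"] j by simp
      then have 1: "\<bar>kernel3 \<alpha> n (real j)\<bar> \<le> C * q"
        using C(2)[OF j1] by (simp add: kernel3_def q_def r_def)
      have 2: "\<bar>kernel3 \<alpha> n x - kernel3 \<alpha> n (real j)\<bar> \<le> K * q"
      proof (cases "x = real j")
        case True
        then show ?thesis using K by (simp add: q_def)
      next
        case False
        then have "real j < x" using j by simp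
        then obtain z where z: "real j < z" "z < x" "kernel3 \<alpha> n x - kernel3 \<alpha> n (real j) = (x - real j) * kernel2 \<alpha> n z"
          using MVT2[of "real j" x "kernel3 \<alpha> n" "kernel2 \<alpha> n"] kernel3_derivative j1 by fastforce
        have "\<bar>kernel2 \<alpha> n z\<bar> \<le> K * (1 + z) powr (- 1 - \<alpha>)" using z x j1 by (intro K) auto
        also have "(1 + z) powr (- 1 - \<alpha>) \<le> (1 + z) powr (- \<alpha>)" using z j1 by (intro powr_mono) auto
        also have "(1 + z) powr (- \<alpha>) \<le> q" unfolding q_def using z j1 \<alpha> by (intro powr_mono2') auto
        finally have "\<bar>kernel2 \<alpha> n z\<bar> \<le> K * q" using K by simp
        moreover have "0 \<le> K * q" using K by (simp add: q_def)
        ultimately have "\<bar>x - real j\<bar> * \<bar>kernel2 \<alpha> n z\<bar> \<le> 1 * (K * q)" using j by (intro mult_mono) auto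
        then show ?thesis unfolding z(3) abs_mult by simp
      qed
      have "\<bar>kernel3 \<alpha> n x\<bar> \<le> C * q + K * q" using abs_add_mono[OF 1 2] by simp
      also have "\<dots> = (C + K) * q" by (simp add: algebra_simps)
      also have "\<dots> \<le> (C + K) * (3 powr \<alpha> * (1 + x) powr (- \<alpha>))"
        unfolding q_def using powr_cell[of j x \<alpha>] j1 x j \<alpha> C K by (intro mult_left_mono) auto
      also have "\<dots> \<le> D * (1 + x) powr (- \<alpha>)"
        unfolding D_def distrib_right by (simp add: mult.assoc)
      finally show ?thesis .
    qed
  qed
  moreover have "D > 0" unfolding D_def using C K by (intro add_pos_nonneg mult_pos_pos) auto
  ultimately show ?thesis by blast
qed

text \<open>
  For \<open>\<alpha> = 1\<close> the weights are those of the backward differentiation formula BDF2. It uses three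
  grid values and is exact on quadratic polynomials, so its kernels vanish at distance \<open>2\<close> and beyond.
\<close>

lemma kernel2_BDF:
  assumes "2 \<le> x" "x \<le> real n"
  shows "kernel2 1 n x = 0"
proof -
  obtain j where j: "real j \<le> x" "x < real j + 1" "j \<le> n" using floor_cell[of x n] assms by auto
  then have "2 < real j + 1" using assms by linarith
  then have j2: "j \<ge> 2" by linarith
  have 0: "omega_coeff 0 k = 0" if "k \<ge> 1" for k
  proof -
    have "fps_nth (omega_fps 0) k = 0" using that by (simp add: omega_fps_0)
    then show ?thesis by simp
  qed
  have 1: "omega_coeff 1 k = 0" if "k \<ge> 2" for k
  proof -
    have "fps_nth (omega_fps 1) k = 0" using that by (simp add: omega_fps_1)
    then show ?thesis by simp
  qed
  have S: "(\<Sum>i\<le>k. g_coeff 1 i * (real k - real i)) = 1" if "k \<ge> 2" for k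
    unfolding g_ramp_sum using that 0[of k] 1[of k] by (simp add: omega_coeff_m1)
  have "ramp_sum 1 n x = (real j + 1 - x) * 1 + (x - real j) * 1"
    using ramp_sum_interpolates[of j x n 1] j S[of j] S[of "Suc j"] j2 by simp
  then show ?thesis using assms by (simp add: kernel2_def rGamma_inverse_Gamma)
qed

lemma kernel3_BDF:
  assumes "2 \<le> x" "x \<le> real n"
  shows "kernel3 1 n x = 0"
proof -
  have "n \<ge> 2" using assms by linarith
  have g: "g_coeff 1 0 = 3/2" "g_coeff 1 1 = -2"
    by (simp_all add: g_coeff_def omega_coeff_def)
  have "square_sum 1 n (real 2) = (\<Sum>i\<le>2. g_coeff 1 i * ((real 2 - real i)^2 / 2))"
    unfolding square_sum_def using sum_truncate[of 2 "real 2" n "\<lambda>x. x^2 / 2" "g_coeff 1"] \<open>n \<ge> 2\<close> by simp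
  also have "\<dots> = 2" using g by (simp add: numeral_2_eq_2 field_simps)
  moreover have "rGamma (2::real) = 1" using Gamma_numeral[of "num.Bit0 num.One", where ?'a = real] by (simp add: rGamma_inverse_Gamma)
  ultimately have 2: "kernel3 1 n 2 = 0"
    by (simp add: kernel3_def)
  show ?thesis
  proof (cases "x = 2")
    case False
    then have "2 < x" using assms by simp
    then obtain z where z: "2 < z" "z < x" "kernel3 1 n x - kernel3 1 n 2 = (x - 2) * kernel2 1 n z"
      using MVT2[of 2 x "kernel3 1 n" "kernel2 1 n"] kernel3_derivative by fastforce
    then show ?thesis using 2 kernel2_BDF[of z n] assms by simp
  qed (use 2 in simp)
qed

text \<open>
  For \<open>\<alpha> = 1\<close> the decay \<open>x powr (- \<alpha>)\<close> would not be integrable, but the kernel has bounded support;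
  \<open>2\<close> stands for any exponent above \<open>1\<close>.
\<close>

definition kernel3_decay :: "real \<Rightarrow> real" where
  "kernel3_decay \<alpha> = (if \<alpha> = 1 then 2 else \<alpha>)"

lemma kernel3_bound:
  assumes \<alpha>: "0 < \<alpha>" "\<alpha> \<le> 1"
  shows "\<exists>C>0. \<forall>n x. 0 < x \<longrightarrow> x \<le> real n \<longrightarrow> \<bar>kernel3 \<alpha> n x\<bar> \<le> C * (1 + x) powr (- kernel3_decay \<alpha>)"
proof (cases "\<alpha> = 1")
  case False
  then show ?thesis using kernel3_bound_weak[OF assms] by (simp add: kernel3_decay_def)
next
  case True
  obtain C where C: "C > 0" "\<And>n x. 0 < x \<Longrightarrow> x \<le> real n \<Longrightarrow> \<bar>kernel3 \<alpha> n x\<bar> \<le> C * (1 + x) powr (- \<alpha>)"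
    using kernel3_bound_weak[OF assms] by blast
  have "\<bar>kernel3 \<alpha> n x\<bar> \<le> (3 * C) * (1 + x) powr (- 2)" if x: "0 < x" "x \<le> real n" for n x
  proof (cases "x \<ge> 2")
    case True
    then show ?thesis using kernel3_BDF[of x n] x \<open>\<alpha> = 1\<close> C by simp
  next
    case False
    have "(1 + x) powr (- \<alpha>) = (1 + x) * (1 + x) powr (- 2)"
      using x \<open>\<alpha> = 1\<close> powr_add[of "1 + x" 1 "-2"] by simp
    also have "\<dots> \<le> 3 * (1 + x) powr (- 2)" using False by (intro mult_right_mono) auto
    finally have "C * (1 + x) powr (- \<alpha>) \<le> C * (3 * (1 + x) powr (- 2))"
      using C(1) by (intro mult_left_mono) auto
    then show ?thesis using C(2)[OF x] by (simp add: mult_ac)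
  qed
  then show ?thesis using True C(1) by (intro exI[of _ "3 * C"]) (auto simp: kernel3_decay_def)
qed

text \<open>
  Taylor's formula at \<open>d\<close>. The truncated power extends the remainder to an interval that does
  not depend on \<open>k\<close>, so that the formulas for all grid points can be summed under one integral.
\<close>

section \<open>Representation of the truncation error\<close>

lemma taylor_ramp_integral:
  fixes v v1 v2 :: "real \<Rightarrow> real"
  assumes "d \<le> k" "k \<le> t"
    and v: "continuous_on {d..t} v" "continuous_on {d..t} v1" "continuous_on {d..t} v2"
    and dv: "\<And>s. s \<in> {d<..<t} \<Longrightarrow> (v has_real_derivative v1 s) (at s)"
    and dv1: "\<And>s. s \<in> {d<..<t} \<Longrightarrow> (v1 has_real_derivative v2 s) (at s)"
  shows "((\<lambda>s. max 0 (k - s) * v2 s) has_integral (v k - v d - (k - d) * v1 d)) {d..t}"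
proof -
  have sub: "{d..k} \<subseteq> {d..t}" using assms by auto
  have "((\<lambda>s. (k - s) * v2 s) has_integral (v k + (k - k) * v1 k) - (v d + (k - d) * v1 d)) {d..k}"
  proof (rule fundamental_theorem_of_calculus_interior)
    show "continuous_on {d..k} (\<lambda>s. v s + (k - s) * v1 s)"
      using v continuous_on_subset[OF _ sub] by (intro continuous_intros) auto
    fix s assume "s \<in> {d<..<k}"
    then have s: "s \<in> {d<..<t}" using assms by auto
    have "((\<lambda>s. v s + (k - s) * v1 s) has_real_derivative (k - s) * v2 s) (at s)"
      by (rule derivative_eq_intros dv[OF s] dv1[OF s] refl)+ simp
    then show "((\<lambda>s. v s + (k - s) * v1 s) has_vector_derivative (k - s) * v2 s) (at s)"
      by (simp add: has_real_derivative_iff_has_vector_derivative)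
  qed (use assms in auto)
  then have "((\<lambda>s. max 0 (k - s) * v2 s) has_integral (v k + (k - k) * v1 k) - (v d + (k - d) * v1 d)) {d..k}"
    by (rule has_integral_eq[rotated]) auto
  then have 1: "((\<lambda>s. max 0 (k - s) * v2 s) has_integral (v k - v d - (k - d) * v1 d)) {d..k}"
    by (simp add: diff_diff_eq)
  have 2: "((\<lambda>s. max 0 (k - s) * v2 s) has_integral 0) {k..t}"
    by (rule has_integral_eq[OF _ has_integral_0]) auto
  show ?thesis using has_integral_combine[OF assms(1,2) 1 2] by simp
qed

lemma discrete_operator_representation:
  fixes v v1 v2 :: "real \<Rightarrow> real"
  assumes n: "n \<ge> 1" and v0: "v 0 = 0"
    and v: "continuous_on {1/2..real n} v" "continuous_on {1/2..real n} v1" "continuous_on {1/2..real n} v2"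
    and dv: "\<And>s. s \<in> {1/2<..<real n} \<Longrightarrow> (v has_real_derivative v1 s) (at s)"
    and dv1: "\<And>s. s \<in> {1/2<..<real n} \<Longrightarrow> (v1 has_real_derivative v2 s) (at s)"
  shows "((\<lambda>s. ramp_sum \<alpha> n (real n - s) * v2 s) has_integral
     (\<Sum>k=0..n. g_coeff \<alpha> (n - k) * v (real k)) - (\<Sum>i\<le>n - 1. g_coeff \<alpha> i) * v (1/2)
      - ramp_sum \<alpha> n (real n - 1/2) * v1 (1/2)) {1/2..real n}"
proof -
  have ramp: "ramp_sum \<alpha> n (real n - s) = (\<Sum>k=1..n. g_coeff \<alpha> (n - k) * max 0 (real k - s))" if "s \<ge> 0" for s
  proof -
    have "ramp_sum \<alpha> n (real n - s) = (\<Sum>i<n. g_coeff \<alpha> i * max 0 (real n - s - real i))"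
      using that by (simp add: ramp_sum_def lessThan_Suc_atMost[symmetric])
    also have "\<dots> = (\<Sum>k=1..n. g_coeff \<alpha> (n - k) * max 0 (real k - s))"
      by (rule sum.reindex_bij_witness[of _ "\<lambda>k. n - k" "\<lambda>i. n - i"]) (auto simp: of_nat_diff algebra_simps)
    finally show ?thesis .
  qed
  have G: "(\<Sum>i\<le>n - 1. g_coeff \<alpha> i) = (\<Sum>k=1..n. g_coeff \<alpha> (n - k))"
    by (rule sum.reindex_bij_witness[of _ "\<lambda>k. n - k" "\<lambda>i. n - i"]) (use n in auto)
  have "((\<lambda>s. \<Sum>k=1..n. g_coeff \<alpha> (n - k) * (max 0 (real k - s) * v2 s)) has_integral
      (\<Sum>k=1..n. g_coeff \<alpha> (n - k) * (v (real k) - v (1/2) - (real k - 1/2) * v1 (1/2)))) {1/2..real n}"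
    by (intro has_integral_sum has_integral_mult_right taylor_ramp_integral v dv dv1) auto
  also have "(\<Sum>k=1..n. g_coeff \<alpha> (n - k) * (v (real k) - v (1/2) - (real k - 1/2) * v1 (1/2)))
     = (\<Sum>k=1..n. g_coeff \<alpha> (n - k) * v (real k)) - (\<Sum>k=1..n. g_coeff \<alpha> (n - k)) * v (1/2)
       - (\<Sum>k=1..n. g_coeff \<alpha> (n - k) * max 0 (real k - 1/2)) * v1 (1/2)"
  proof -
    have eq: "(\<Sum>k=1..n. g_coeff \<alpha> (n - k) * max 0 (real k - 1/2)) = (\<Sum>k=1..n. g_coeff \<alpha> (n - k) * (real k - 1/2))"
      by (intro sum.cong) auto
    show ?thesis unfolding eq sum_distrib_right sum_subtractf[symmetric]
      by (intro sum.cong) (auto simp: algebra_simps)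
  qed
  also have "(\<Sum>k=1..n. g_coeff \<alpha> (n - k) * v (real k)) = (\<Sum>k=0..n. g_coeff \<alpha> (n - k) * v (real k))"
    using v0 by (simp add: sum.atLeast_Suc_atMost[of 0 n])
  finally have "((\<lambda>s. ramp_sum \<alpha> n (real n - s) * v2 s) has_integral
     (\<Sum>k=0..n. g_coeff \<alpha> (n - k) * v (real k)) - (\<Sum>k=1..n. g_coeff \<alpha> (n - k)) * v (1/2)
       - (\<Sum>k=1..n. g_coeff \<alpha> (n - k) * max 0 (real k - 1/2)) * v1 (1/2)) {1/2..real n}"
    by (rule has_integral_eq[rotated]) (auto simp: ramp sum_distrib_right mult.assoc)
  moreover have "ramp_sum \<alpha> n (real n - 1/2) = (\<Sum>k=1..n. g_coeff \<alpha> (n - k) * max 0 (real k - 1/2))"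
    by (rule ramp) simp
  ultimately show ?thesis unfolding G by metis
qed

text \<open>
  The derivative \<open>v1\<close> may be unbounded at \<open>0\<close> and the kernel is singular at \<open>t\<close>. Integration by parts
  moves the derivative off \<open>v\<close> on \<open>{0..d}\<close> and integrates the kernel on \<open>{d..t}\<close>, so that only
  integrals of continuous functions remain. In particular the integral exists.
\<close>

lemma caputo_integral_by_parts:
  fixes v v1 v2 :: "real \<Rightarrow> real"
  assumes \<alpha>: "0 < \<alpha>" "\<alpha> < 1" and d: "0 < d" "d < t" and v0: "v 0 = 0"
    and v: "continuous_on {0..t} v" "continuous_on {d..t} v1" "continuous_on {d..t} v2"
    and dv: "\<And>s. s \<in> {0<..<t} \<Longrightarrow> (v has_real_derivative v1 s) (at s)"
    and dv1: "\<And>s. s \<in> {0<..<t} \<Longrightarrow> (v1 has_real_derivative v2 s) (at s)"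
  shows "((\<lambda>s. (t - s) powr (- \<alpha>) * v1 s) has_integral
       ((t - d) powr (- \<alpha>) * v d - \<alpha> * integral {0..d} (\<lambda>s. (t - s) powr (- \<alpha> - 1) * v s)
       + ((t - d) powr (1 - \<alpha>) * v1 d + integral {d..t} (\<lambda>s. (t - s) powr (1 - \<alpha>) * v2 s)) / (1 - \<alpha>))) {0..t}"
proof -
  have powr_deriv: "((\<lambda>s. (t - s) powr p) has_real_derivative - p * (t - s) powr (p - 1)) (at s)" if "s < t" for s p
    using that by (auto intro!: derivative_eq_intros)
  have cont_powr: "continuous_on {0..d} (\<lambda>s. (t - s) powr p)" for p
    by (intro continuous_intros) (use d in auto)
  have cont_powr': "continuous_on {d..t} (\<lambda>s. (t - s) powr (1 - \<alpha>))"
    by (intro continuous_on_powr' continuous_intros) (use \<alpha> in auto)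
  have v': "continuous_on {0..d} v" using v(1) by (rule continuous_on_subset) (use d in auto)
  have A: "((\<lambda>s. (t - s) powr (- \<alpha>) * v1 s + \<alpha> * ((t - s) powr (- \<alpha> - 1) * v s)) has_integral
      (t - d) powr (- \<alpha>) * v d - (t - 0) powr (- \<alpha>) * v 0) {0..d}"
  proof (rule fundamental_theorem_of_calculus_interior)
    show "continuous_on {0..d} (\<lambda>s. (t - s) powr (- \<alpha>) * v s)"
      by (intro continuous_on_mult cont_powr v')
    fix s assume "s \<in> {0<..<d}"
    then have s: "s \<in> {0<..<t}" "s < t" using d by auto
    have "((\<lambda>s. (t - s) powr (- \<alpha>) * v s) has_real_derivative
        (- (- \<alpha>) * (t - s) powr (- \<alpha> - 1)) * v s + v1 s * (t - s) powr (- \<alpha>)) (at s)"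
      by (rule DERIV_mult[OF powr_deriv[OF s(2)] dv[OF s(1)]])
    then show "((\<lambda>s. (t - s) powr (- \<alpha>) * v s) has_vector_derivative
        (t - s) powr (- \<alpha>) * v1 s + \<alpha> * ((t - s) powr (- \<alpha> - 1) * v s)) (at s)"
      by (simp add: has_real_derivative_iff_has_vector_derivative[symmetric] mult_ac add_ac)
  qed (use d in auto)
  have A2: "((\<lambda>s. (t - s) powr (- \<alpha> - 1) * v s) has_integral integral {0..d} (\<lambda>s. (t - s) powr (- \<alpha> - 1) * v s)) {0..d}"
    by (intro integrable_integral integrable_continuous_real continuous_on_mult cont_powr v')
  have I1: "((\<lambda>s. (t - s) powr (- \<alpha>) * v1 s) has_integral
      ((t - d) powr (- \<alpha>) * v d - \<alpha> * integral {0..d} (\<lambda>s. (t - s) powr (- \<alpha> - 1) * v s))) {0..d}"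
    using has_integral_diff[OF A has_integral_mult_right[OF A2, of \<alpha>]] v0 by simp
  have B: "((\<lambda>s. (1 - \<alpha>) * ((t - s) powr (- \<alpha>) * v1 s) - (t - s) powr (1 - \<alpha>) * v2 s) has_integral
      - ((t - t) powr (1 - \<alpha>) * v1 t) - - ((t - d) powr (1 - \<alpha>) * v1 d)) {d..t}"
  proof (rule fundamental_theorem_of_calculus_interior)
    show "continuous_on {d..t} (\<lambda>s. - ((t - s) powr (1 - \<alpha>) * v1 s))"
      by (intro continuous_on_minus continuous_on_mult cont_powr' v)
    fix s assume "s \<in> {d<..<t}"
    then have s: "s \<in> {0<..<t}" "s < t" using d by auto
    have "((\<lambda>s. - ((t - s) powr (1 - \<alpha>) * v1 s)) has_real_derivative
        - ((- (1 - \<alpha>) * (t - s) powr (1 - \<alpha> - 1)) * v1 s + v2 s * (t - s) powr (1 - \<alpha>))) (at s)"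
      by (rule DERIV_minus[OF DERIV_mult[OF powr_deriv[OF s(2)] dv1[OF s(1)]]])
    then show "((\<lambda>s. - ((t - s) powr (1 - \<alpha>) * v1 s)) has_vector_derivative
        (1 - \<alpha>) * ((t - s) powr (- \<alpha>) * v1 s) - (t - s) powr (1 - \<alpha>) * v2 s) (at s)"
      by (simp add: has_real_derivative_iff_has_vector_derivative[symmetric] algebra_simps)
  qed (use d in auto)
  have B2: "((\<lambda>s. (t - s) powr (1 - \<alpha>) * v2 s) has_integral integral {d..t} (\<lambda>s. (t - s) powr (1 - \<alpha>) * v2 s)) {d..t}"
    by (intro integrable_integral integrable_continuous_real continuous_on_mult cont_powr' v)
  have "((\<lambda>s. (1 - \<alpha>) * ((t - s) powr (- \<alpha>) * v1 s)) has_integral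
      ((t - d) powr (1 - \<alpha>) * v1 d + integral {d..t} (\<lambda>s. (t - s) powr (1 - \<alpha>) * v2 s))) {d..t}"
    using has_integral_add[OF B B2] by simp
  then have "((\<lambda>s. (1 / (1 - \<alpha>)) * ((1 - \<alpha>) * ((t - s) powr (- \<alpha>) * v1 s))) has_integral
      (1 / (1 - \<alpha>)) * ((t - d) powr (1 - \<alpha>) * v1 d + integral {d..t} (\<lambda>s. (t - s) powr (1 - \<alpha>) * v2 s))) {d..t}"
    by (rule has_integral_mult_right)
  then have I2: "((\<lambda>s. (t - s) powr (- \<alpha>) * v1 s) has_integral
      ((t - d) powr (1 - \<alpha>) * v1 d + integral {d..t} (\<lambda>s. (t - s) powr (1 - \<alpha>) * v2 s)) / (1 - \<alpha>)) {d..t}"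
    using \<alpha> by simp
  show ?thesis by (rule has_integral_combine[OF _ _ I1 I2]) (use d in auto)
qed

text \<open>
  The Caputo derivative in terms of a given derivative function \<open>v1\<close>; unlike \<open>caputo\<close>, it does not
  refer to derivatives within \<open>{0..t}\<close>, and it can be rescaled and split.
\<close>

definition caputo_value :: "real \<Rightarrow> (real \<Rightarrow> real) \<Rightarrow> real \<Rightarrow> real" where
  "caputo_value \<alpha> v1 t = (if \<alpha> = 1 then v1 t else rGamma (1 - \<alpha>) * integral {0..t} (\<lambda>s. (t - s) powr (- \<alpha>) * v1 s))"

text \<open>
  The difference of the representations of the discrete operator and of the Caputo derivative. For
  \<open>\<alpha> = 1\<close> the latter is \<open>v1 (1/2)\<close> plus the integral of \<open>v2\<close>, which is the general formula with
  \<open>rGamma (1 - \<alpha>) = 0\<close> and \<open>(n - s) powr (1 - \<alpha>) = 1\<close>, except at the single point \<open>s = n\<close>.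
\<close>

lemma truncation_error_representation:
  fixes v v1 v2 :: "real \<Rightarrow> real"
  assumes \<alpha>: "0 < \<alpha>" "\<alpha> \<le> 1" and n: "n \<ge> 1" and v0: "v 0 = 0"
    and v: "continuous_on {0..real n} v" "continuous_on {1/2..real n} v1" "continuous_on {1/2..real n} v2"
    and dv: "\<And>s. s \<in> {0<..<real n} \<Longrightarrow> (v has_real_derivative v1 s) (at s)"
    and dv1: "\<And>s. s \<in> {0<..<real n} \<Longrightarrow> (v1 has_real_derivative v2 s) (at s)"
  shows "((\<lambda>s. kernel2 \<alpha> n (real n - s) * v2 s) has_integral
     ((\<Sum>k=0..n. g_coeff \<alpha> (n - k) * v (real k)) - caputo_value \<alpha> v1 (real n)
      - ((\<Sum>i\<le>n - 1. g_coeff \<alpha> i) - rGamma (1 - \<alpha>) * (real n - 1/2) powr (- \<alpha>)) * v (1/2)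
      - \<alpha> * rGamma (1 - \<alpha>) * integral {0..1/2} (\<lambda>s. (real n - s) powr (- \<alpha> - 1) * v s)
      - kernel2 \<alpha> n (real n - 1/2) * v1 (1/2))) {1/2..real n}"
proof -
  define r where "r = rGamma (2 - \<alpha>)"
  have v': "continuous_on {1/2..real n} v" using v(1) by (rule continuous_on_subset) auto
  have D: "((\<lambda>s. ramp_sum \<alpha> n (real n - s) * v2 s) has_integral
     (\<Sum>k=0..n. g_coeff \<alpha> (n - k) * v (real k)) - (\<Sum>i\<le>n - 1. g_coeff \<alpha> i) * v (1/2)
      - ramp_sum \<alpha> n (real n - 1/2) * v1 (1/2)) {1/2..real n}"
    by (rule discrete_operator_representation[OF n v0 v' v(2,3)]) (use dv dv1 in auto)
  have n2: "1/2 < real n" using n by simp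
  show ?thesis
  proof (cases "\<alpha> = 1")
    case False
    with \<alpha> have a1: "\<alpha> < 1" by simp
    define J where "J = integral {1/2..real n} (\<lambda>s. (real n - s) powr (1 - \<alpha>) * v2 s)"
    have "((\<lambda>s. (real n - s) powr (- \<alpha>) * v1 s) has_integral
       ((real n - 1/2) powr (- \<alpha>) * v (1/2) - \<alpha> * integral {0..1/2} (\<lambda>s. (real n - s) powr (- \<alpha> - 1) * v s)
       + ((real n - 1/2) powr (1 - \<alpha>) * v1 (1/2) + J) / (1 - \<alpha>))) {0..real n}"
      unfolding J_def by (rule caputo_integral_by_parts[OF \<alpha>(1) a1 _ n2 v0 v dv dv1]) auto
    then have C: "caputo_value \<alpha> v1 (real n) = rGamma (1 - \<alpha>) * ((real n - 1/2) powr (- \<alpha>) * v (1/2) - \<alpha> * integral {0..1/2} (\<lambda>s. (real n - s) powr (- \<alpha> - 1) * v s)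
       + ((real n - 1/2) powr (1 - \<alpha>) * v1 (1/2) + J) / (1 - \<alpha>))"
      using False by (simp add: caputo_value_def integral_unique)
    have r1: "rGamma (1 - \<alpha>) * (x / (1 - \<alpha>)) = r * x" for x
      using a1 by (simp add: r_def rGamma_step)
    have C': "caputo_value \<alpha> v1 (real n) = rGamma (1 - \<alpha>) * ((real n - 1/2) powr (- \<alpha>) * v (1/2)) - \<alpha> * rGamma (1 - \<alpha>) * integral {0..1/2} (\<lambda>s. (real n - s) powr (- \<alpha> - 1) * v s)
       + r * ((real n - 1/2) powr (1 - \<alpha>) * v1 (1/2) + J)"
      unfolding C distrib_left[of "rGamma (1 - \<alpha>)"] right_diff_distrib r1 by (simp add: mult_ac)
    have "continuous_on {1/2..real n} (\<lambda>s. (real n - s) powr (1 - \<alpha>))"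
      by (intro continuous_on_powr' continuous_intros) (use a1 in auto)
    then have J: "((\<lambda>s. (real n - s) powr (1 - \<alpha>) * v2 s) has_integral J) {1/2..real n}"
      unfolding J_def by (intro integrable_integral integrable_continuous_real continuous_on_mult v)
    have "((\<lambda>s. ramp_sum \<alpha> n (real n - s) * v2 s - r * ((real n - s) powr (1 - \<alpha>) * v2 s)) has_integral
      ((\<Sum>k=0..n. g_coeff \<alpha> (n - k) * v (real k)) - (\<Sum>i\<le>n - 1. g_coeff \<alpha> i) * v (1/2)
      - ramp_sum \<alpha> n (real n - 1/2) * v1 (1/2)) - r * J) {1/2..real n}"
      by (intro has_integral_diff has_integral_mult_right D J)
    then show ?thesis
      unfolding C' kernel2_def r_def[symmetric] by (simp add: algebra_simps)
  next
    case True
    have g: "rGamma (2 - \<alpha>) = 1" "rGamma (1 - \<alpha>) = 0"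
      using True by (simp_all add: rGamma_inverse_Gamma)
    have "(v2 has_integral v1 (real n) - v1 (1/2)) {1/2..real n}"
    proof (rule fundamental_theorem_of_calculus_interior)
      fix s assume "s \<in> {1/2<..<real n}"
      then show "(v1 has_vector_derivative v2 s) (at s)"
        using dv1[of s] by (auto simp: has_real_derivative_iff_has_vector_derivative)
    qed (use n2 v in auto)
    from has_integral_diff[OF D this]
    have "((\<lambda>s. kernel2 \<alpha> n (real n - s) * v2 s) has_integral ((\<Sum>k=0..n. g_coeff \<alpha> (n - k) * v (real k)) - (\<Sum>i\<le>n - 1. g_coeff \<alpha> i) * v (1/2)
      - ramp_sum \<alpha> n (real n - 1/2) * v1 (1/2)) - (v1 (real n) - v1 (1/2))) {1/2..real n}"
      by (rule has_integral_spike_finite[of "{real n}", rotated 2]) (auto simp: kernel2_def g True algebra_simps)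
    then show ?thesis
      using n2 by (simp add: kernel2_def g True caputo_value_def algebra_simps)
  qed
qed

text \<open>
  \<open>D 0\<close> behaves near \<open>0\<close> like \<open>t powr \<sigma>\<close> up to the third derivative; \<open>D i\<close> is the derivative of order
  \<open>i\<close>. The factor \<open>B\<close> is explicit because it carries the step size after rescaling to the unit grid.
\<close>

section \<open>Truncation error for functions with a power singularity\<close>

definition power_like :: "real \<Rightarrow> real \<Rightarrow> real \<Rightarrow> (nat \<Rightarrow> real \<Rightarrow> real) \<Rightarrow> bool" where
  "power_like \<sigma> B t D \<longleftrightarrow>
     D 0 0 = 0 \<and> continuous_on {0..t} (D 0) \<and>
     (\<forall>i\<le>3. continuous_on {0<..t} (D i)) \<and>
     (\<forall>i\<le>3. \<forall>s\<in>{0<..t}. \<bar>D i s\<bar> \<le> B * s powr (\<sigma> - real i)) \<and>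
     (\<forall>i<3. \<forall>s\<in>{0<..<t}. (D i has_real_derivative D (Suc i) s) (at s))"

lemma powr_half_range:
  fixes s x e :: real
  assumes "x > 0" "x / 2 \<le> s" "s \<le> x"
  shows "s powr e \<le> 2 powr \<bar>e\<bar> * x powr e"
proof (cases "e \<ge> 0")
  case True
  then have "s powr e \<le> x powr e" using assms by (intro powr_mono2) auto
  also have "\<dots> \<le> 2 powr \<bar>e\<bar> * x powr e" using ge_one_powr_ge_zero[of 2 "\<bar>e\<bar>"] by (simp add: mult_le_cancel_right1)
  finally show ?thesis .
next
  case False
  then have "s powr e \<le> (x / 2) powr e" using assms by (intro powr_mono2') auto
  also have "\<dots> = 2 powr \<bar>e\<bar> * x powr e" using False assms by (simp add: powr_divide powr_minus_divide)
  finally show ?thesis .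
qed

lemma powr_range:
  fixes s x e :: real
  assumes "x \<ge> 1" "1 / 2 \<le> s" "s \<le> x"
  shows "s powr e \<le> 2 powr \<bar>e\<bar> * (1 + x powr e)"
proof (cases "e \<ge> 0")
  case True
  then have "s powr e \<le> x powr e" using assms by (intro powr_mono2) auto
  also have "\<dots> \<le> 1 * (1 + x powr e)" by simp
  also have "\<dots> \<le> 2 powr \<bar>e\<bar> * (1 + x powr e)" using ge_one_powr_ge_zero[of 2 "\<bar>e\<bar>"] by (intro mult_right_mono) auto
  finally show ?thesis .
next
  case False
  then have "s powr e \<le> (1 / 2) powr e" using assms by (intro powr_mono2') auto
  also have "\<dots> = 2 powr \<bar>e\<bar> * 1" using False by (simp add: powr_divide powr_minus_divide)
  also have "\<dots> \<le> 2 powr \<bar>e\<bar> * (1 + x powr e)" by (intro mult_left_mono) auto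
  finally show ?thesis .
qed

lemma kernel3_decay_integral:
  assumes \<alpha>: "0 < \<alpha>" "\<alpha> \<le> 1"
  shows "\<exists>K>0. \<forall>n::real\<ge>1. \<exists>J. ((\<lambda>s. (1 + n - s) powr (- kernel3_decay \<alpha>)) has_integral J) {n/2..n} \<and> J \<le> K * n powr (1 - \<alpha>)"
proof (cases "\<alpha> = 1")
  case True
  have "\<exists>J. ((\<lambda>s. (1 + n - s) powr (-2)) has_integral J) {n/2..n} \<and> J \<le> 1" if n: "n \<ge> 1" for n :: real
  proof (intro exI conjI)
    show "((\<lambda>s. (1 + n - s) powr (-2)) has_integral (1 + n - n) powr (-1) - (1 + n - n/2) powr (-1)) {n/2..n}"
    proof (rule fundamental_theorem_of_calculus)
      fix s assume "s \<in> {n/2..n}"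
      then have "((\<lambda>s. (1 + n - s) powr p) has_real_derivative - p * (1 + n - s) powr (p - 1)) (at s within {n/2..n})" for p
        by (auto intro!: derivative_eq_intros)
      from this[of "-1"] have "((\<lambda>s. (1 + n - s) powr (-1)) has_real_derivative (1 + n - s) powr (-2)) (at s within {n/2..n})"
        by (simp only: diff_minus_eq_add minus_minus mult_1 minus_add_distrib[symmetric] one_add_one diff_conv_add_uminus)
      then show "((\<lambda>s. (1 + n - s) powr (-1)) has_vector_derivative (1 + n - s) powr (-2)) (at s within {n/2..n})"
        by (simp add: has_real_derivative_iff_has_vector_derivative)
    qed (use n in auto)
  qed simp
  then show ?thesis using True by (intro exI[of _ 1]) (auto simp: kernel3_decay_def)
next
  case False
  with \<alpha> have a: "\<alpha> < 1" by simp
  have "\<exists>J. ((\<lambda>s. (1 + n - s) powr (-\<alpha>)) has_integral J) {n/2..n} \<and> J \<le> 2 powr (1 - \<alpha>) / (1 - \<alpha>) * n powr (1 - \<alpha>)" if n: "n \<ge> 1" for n :: real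
  proof (intro exI conjI)
    show "((\<lambda>s. (1 + n - s) powr (-\<alpha>)) has_integral - ((1 + n - n) powr (1 - \<alpha>) / (1 - \<alpha>)) - - ((1 + n - n/2) powr (1 - \<alpha>) / (1 - \<alpha>))) {n/2..n}"
    proof (rule fundamental_theorem_of_calculus)
      fix s assume s: "s \<in> {n/2..n}"
      have "((\<lambda>s. - ((1 + n - s) powr (1 - \<alpha>) / (1 - \<alpha>))) has_real_derivative (1 + n - s) powr (-\<alpha>)) (at s within {n/2..n})"
        using s a by (auto intro!: derivative_eq_intros)
      then show "((\<lambda>s. - ((1 + n - s) powr (1 - \<alpha>) / (1 - \<alpha>))) has_vector_derivative (1 + n - s) powr (-\<alpha>)) (at s within {n/2..n})"
        by (simp add: has_real_derivative_iff_has_vector_derivative)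
    qed (use n in auto)
    have "(1 + n - n/2) powr (1 - \<alpha>) \<le> (2 * n) powr (1 - \<alpha>)" using n a by (intro powr_mono2) auto
    then have "(1 + n - n/2) powr (1 - \<alpha>) \<le> 2 powr (1 - \<alpha>) * n powr (1 - \<alpha>)" using n by (simp add: powr_mult)
    then have "(1 + n - n/2) powr (1 - \<alpha>) / (1 - \<alpha>) \<le> 2 powr (1 - \<alpha>) * n powr (1 - \<alpha>) / (1 - \<alpha>)"
      using a by (intro divide_right_mono) auto
    moreover have "0 \<le> (1 + n - n) powr (1 - \<alpha>) / (1 - \<alpha>)" using a by simp
    ultimately show "- ((1 + n - n) powr (1 - \<alpha>) / (1 - \<alpha>)) - - ((1 + n - n/2) powr (1 - \<alpha>) / (1 - \<alpha>)) \<le> 2 powr (1 - \<alpha>) / (1 - \<alpha>) * n powr (1 - \<alpha>)"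
      by (simp only: times_divide_eq_left)
  qed
  then show ?thesis using False a by (intro exI[of _ "2 powr (1 - \<alpha>) / (1 - \<alpha>)"]) (auto simp: kernel3_decay_def)
qed

text \<open>
  Let \<open>v = D 0\<close>. The Peano kernel is small away from the evaluation point, the derivatives of \<open>v\<close> are small away from
  \<open>0\<close>. On \<open>{0..1/2}\<close> the integrand involves \<open>v\<close> itself; on \<open>{1/2..n/2}\<close> the kernel has size
  \<open>n powr (- 1 - \<alpha>)\<close> and is paired with the second derivative; on \<open>{n/2..n}\<close> a further integration by
  parts pairs \<open>kernel3\<close> with the third derivative, of size \<open>n powr (\<sigma> - 3)\<close>.
\<close>

lemma truncation_error_bound:
  assumes \<alpha>: "0 < \<alpha>" "\<alpha> \<le> 1" and \<sigma>: "\<sigma> > 0"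
  shows "\<exists>C>0. \<forall>n B D. n \<ge> 1 \<longrightarrow> power_like \<sigma> B (real n) D \<longrightarrow>
      \<bar>(\<Sum>k=0..n. g_coeff \<alpha> (n - k) * D 0 (real k)) - caputo_value \<alpha> (D 1) (real n)\<bar>
        \<le> C * B * (real n powr (- 1 - \<alpha> / 2) + real n powr (\<sigma> - \<alpha> - 2))"
proof -
  obtain C1 where C1: "C1 > 0" "\<And>n. n \<ge> 1 \<Longrightarrow> \<bar>(\<Sum>i\<le>n - 1. g_coeff \<alpha> i) - rGamma (1 - \<alpha>) * (real n - 1/2) powr (- \<alpha>)\<bar>
     \<le> C1 * real n powr (- 1 - \<alpha>)"
    using g_partial_sum_asymp[OF \<alpha>(1)] by blast
  obtain C2 where C2: "C2 > 0" "\<And>n x. 0 < x \<Longrightarrow> x \<le> real n \<Longrightarrow> \<bar>kernel2 \<alpha> n x\<bar> \<le> C2 * (1 + x) powr (- 1 - \<alpha>)"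
    using kernel2_bound[OF \<alpha>] by blast
  obtain C3 where C3: "C3 > 0" "\<And>n x. 0 < x \<Longrightarrow> x \<le> real n \<Longrightarrow> \<bar>kernel3 \<alpha> n x\<bar> \<le> C3 * (1 + x) powr (- kernel3_decay \<alpha>)"
    using kernel3_bound[OF \<alpha>] by blast
  obtain K where K: "K > 0" "\<And>n::real. n \<ge> 1 \<Longrightarrow> \<exists>J. ((\<lambda>s. (1 + n - s) powr (- kernel3_decay \<alpha>)) has_integral J) {n/2..n} \<and> J \<le> K * n powr (1 - \<alpha>)"
    using kernel3_decay_integral[OF \<alpha>] by blast
  define \<rho> where "\<rho> = \<bar>\<alpha> * rGamma (1 - \<alpha>)\<bar>"
  define e where "e = \<sigma> - 1 - \<alpha> / 2"
  define M where "M = C1 + \<rho> * 2 powr (1 + \<alpha>) + C2 * 2 powr \<bar>\<sigma> - 1\<bar>"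
  define K4 where "K4 = C2 * 2 powr (1 + \<alpha>) * 2 powr \<bar>e\<bar> * (2 / \<alpha>)"
  define K5 where "K5 = C3 * 2 powr \<alpha> * 2 powr \<bar>\<sigma> - 2\<bar>"
  define K6 where "K6 = C3 * 2 powr \<bar>\<sigma> - 3\<bar> * K"
  define C where "C = M + K4 + K5 + K6"
  have pos: "M > 0" "K4 > 0" "K5 > 0" "K6 > 0"
    using C1 C2 C3 K \<alpha> by (auto simp: M_def K4_def K5_def K6_def \<rho>_def intro!: add_pos_nonneg)
  have "\<bar>(\<Sum>k=0..n. g_coeff \<alpha> (n - k) * D 0 (real k)) - caputo_value \<alpha> (D 1) (real n)\<bar>
        \<le> C * B * (real n powr (- 1 - \<alpha> / 2) + real n powr (\<sigma> - \<alpha> - 2))"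
    if n: "n \<ge> 1" and D: "power_like \<sigma> B (real n) D" for n B D
  proof -
    define x where "x = real n"
    have x: "x \<ge> 1" using n by (simp add: x_def)
    have v0: "D 0 0 = 0" and cont: "continuous_on {0..x} (D 0)" "\<And>i. i \<le> 3 \<Longrightarrow> continuous_on {0<..x} (D i)"
      and bd: "\<And>i s. i \<le> 3 \<Longrightarrow> 0 < s \<Longrightarrow> s \<le> x \<Longrightarrow> \<bar>D i s\<bar> \<le> B * s powr (\<sigma> - real i)"
      and der: "\<And>i s. i < 3 \<Longrightarrow> s \<in> {0<..<x} \<Longrightarrow> (D i has_real_derivative D (Suc i) s) (at s)"
      using D unfolding power_like_def x_def by auto
    have B0: "B \<ge> 0" using bd[of 0 1] x by simp
    have contsub: "continuous_on {a..x} (D i)" if "i \<le> 3" "a > 0" for i a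
      using cont(2)[OF that(1)] by (rule continuous_on_subset) (use that in auto)
    define E where "E = (\<Sum>k=0..n. g_coeff \<alpha> (n - k) * D 0 (real k)) - caputo_value \<alpha> (D 1) x"
    define G where "G = (\<Sum>i\<le>n - 1. g_coeff \<alpha> i) - rGamma (1 - \<alpha>) * (x - 1/2) powr (- \<alpha>)"
    define I0 where "I0 = integral {0..1/2} (\<lambda>s. (x - s) powr (- \<alpha> - 1) * D 0 s)"
    define f where "f s = kernel2 \<alpha> n (x - s) * D 2 s" for s
    have rep: "(f has_integral (E - G * D 0 (1/2) - \<alpha> * rGamma (1 - \<alpha>) * I0 - kernel2 \<alpha> n (x - 1/2) * D 1 (1/2))) {1/2..x}"
      unfolding f_def E_def G_def I0_def x_def
      by (rule truncation_error_representation[where v = "D 0", OF \<alpha> n v0])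
        (use cont(1) contsub[of 1 "1/2"] contsub[of 2 "1/2"] der[of 0] der[of 1] in \<open>auto simp: x_def numeral_2_eq_2\<close>)
    define q where "q = x powr (- 1 - \<alpha>)"
    \<comment> \<open>\<open>T1\<close>, \<open>T2\<close> and \<open>T3\<close> come from the splitting point \<open>1/2\<close>, \<open>X1\<close> and \<open>X2\<close> from the two halves of the integral.\<close>
    have T1: "\<bar>G * D 0 (1/2)\<bar> \<le> C1 * q * B"
    proof -
      have "\<bar>D 0 (1/2)\<bar> \<le> B * (1/2) powr \<sigma>" using bd[of 0 "1/2"] x by simp
      also have "\<dots> \<le> B * 1" using B0 \<sigma> by (intro mult_left_mono powr_le1) auto
      finally show ?thesis unfolding abs_mult using C1(2)[OF n] C1(1)
        by (intro mult_mono) (auto simp: G_def q_def x_def)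
    qed
    have qhalf: "s powr (- 1 - \<alpha>) \<le> 2 powr (1 + \<alpha>) * q" if "s \<ge> x / 2" for s
    proof -
      have "s powr (- 1 - \<alpha>) \<le> (x / 2) powr (- 1 - \<alpha>)" using that x \<alpha> by (intro powr_mono2') auto
      also have "\<dots> = 2 powr (1 + \<alpha>) * q"
        using x powr_minus_divide[of 2 "1 + \<alpha>"] by (simp add: powr_divide q_def)
      finally show ?thesis .
    qed
    have T2: "\<bar>\<alpha> * rGamma (1 - \<alpha>) * I0\<bar> \<le> \<rho> * (2 powr (1 + \<alpha>) * q * B)"
    proof -
      have c: "continuous_on {0..1/2} (D 0)" using cont(1) by (rule continuous_on_subset) (use x in auto)
      have "((\<lambda>s. (x - s) powr (- \<alpha> - 1) * D 0 s) has_integral I0) {0..1/2}"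
        unfolding I0_def
        by (intro integrable_integral integrable_continuous_real continuous_on_mult c continuous_intros) (use x in auto)
      then have "norm I0 \<le> (2 powr (1 + \<alpha>) * q * B) * measure lborel {0..1/2::real}"
      proof (rule has_integral_bound_real[of _ "{}", rotated 2])
        show "norm ((x - s) powr (- \<alpha> - 1) * D 0 s) \<le> 2 powr (1 + \<alpha>) * q * B" if "s \<in> {0..1/2} - {}" for s
        proof -
          have s: "s \<in> {0..1/2}" using that by simp
          have "(x - s) powr (- \<alpha> - 1) \<le> 2 powr (1 + \<alpha>) * q"
            using qhalf[of "x - s"] s x by (simp add: minus_diff_commute)
          moreover have "\<bar>D 0 s\<bar> \<le> B"
          proof (cases "s = 0")
            case False
            then have "\<bar>D 0 s\<bar> \<le> B * s powr \<sigma>" using bd[of 0 s] s x by simp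
            also have "\<dots> \<le> B * 1" using B0 \<sigma> s by (intro mult_left_mono powr_le1) auto
            finally show ?thesis by simp
          qed (use v0 B0 in simp)
          ultimately show ?thesis unfolding real_norm_def abs_mult by (intro mult_mono) (auto simp: q_def)
        qed
      qed (use B0 in \<open>auto simp: q_def\<close>)
      also have "\<dots> \<le> 2 powr (1 + \<alpha>) * q * B" using B0 by (simp add: q_def)
      finally show ?thesis unfolding \<rho>_def real_norm_def by (rule abs_mult_mono)
    qed
    have T3: "\<bar>kernel2 \<alpha> n (x - 1/2) * D 1 (1/2)\<bar> \<le> C2 * q * (B * 2 powr \<bar>\<sigma> - 1\<bar>)"
    proof -
      have "\<bar>kernel2 \<alpha> n (x - 1/2)\<bar> \<le> C2 * (1 + (x - 1/2)) powr (- 1 - \<alpha>)" using x by (intro C2) (auto simp: x_def)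
      also have "\<dots> \<le> C2 * q" unfolding q_def using x C2 \<alpha> by (intro mult_left_mono powr_mono2') auto
      finally have k: "\<bar>kernel2 \<alpha> n (x - 1/2)\<bar> \<le> C2 * q" .
      have "\<bar>D 1 (1/2)\<bar> \<le> B * (1/2) powr (\<sigma> - 1)" using bd[of 1 "1/2"] x by simp
      also have "\<dots> \<le> B * (2 powr \<bar>\<sigma> - 1\<bar> * 1 powr (\<sigma> - 1))" using B0 by (intro mult_left_mono powr_half_range) auto
      finally show ?thesis unfolding abs_mult using k C2 by (intro mult_mono) (auto simp: q_def)
    qed
    have int1: "f integrable_on {1/2..x/2}" and int2: "f integrable_on {x/2..x}"
      using has_integral_integrable[OF rep] x by (auto elim!: integrable_on_subinterval)
    have split: "integral {1/2..x} f = integral {1/2..x/2} f + integral {x/2..x} f"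
      using has_integral_integrable[OF rep] x by (intro Henstock_Kurzweil_Integration.integral_combine[symmetric]) auto
    define p where "p = real n powr (- 1 - \<alpha> / 2) + real n powr (\<sigma> - \<alpha> - 2)"
    have X1: "\<bar>integral {1/2..x/2} f\<bar> \<le> K4 * B * p"
    proof -
      \<comment> \<open>Extracting \<open>s powr (- 1 + \<alpha> / 2)\<close> from \<open>s powr (\<sigma> - 2)\<close> avoids the logarithm that the integral
          would contain for \<open>\<sigma> = 1\<close>; the price is \<open>n powr (\<alpha> / 2)\<close> in the first term of the bound.\<close>
      define L where "L = C2 * (2 powr (1 + \<alpha>) * q) * (B * (2 powr \<bar>e\<bar> * (1 + x powr e)))"
      have L0: "L \<ge> 0" using C2 B0 by (auto simp: L_def q_def)
      have pw: "((\<lambda>s. L * s powr (- 1 + \<alpha> / 2)) has_integral L * ((x/2) powr (\<alpha> / 2) / (\<alpha> / 2) - (1/2) powr (\<alpha> / 2) / (\<alpha> / 2))) {1/2..x/2}"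
      proof (rule has_integral_mult_right, rule fundamental_theorem_of_calculus)
        fix s assume "s \<in> {1/2..x/2}"
        then have "((\<lambda>s. s powr (\<alpha> / 2) / (\<alpha> / 2)) has_real_derivative s powr (- 1 + \<alpha> / 2)) (at s within {1/2..x/2})"
          using \<alpha> by (auto intro!: derivative_eq_intros simp: algebra_simps)
        then show "((\<lambda>s. s powr (\<alpha> / 2) / (\<alpha> / 2)) has_vector_derivative s powr (- 1 + \<alpha> / 2)) (at s within {1/2..x/2})"
          by (simp add: has_real_derivative_iff_has_vector_derivative)
      qed (use x in auto)
      have "norm (integral {1/2..x/2} f) \<le> integral {1/2..x/2} (\<lambda>s. L * s powr (- 1 + \<alpha> / 2))"
      proof (rule integral_norm_bound_integral[OF int1 has_integral_integrable[OF pw]])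
        fix s assume s: "s \<in> {1/2..x/2}"
        have "\<bar>kernel2 \<alpha> n (x - s)\<bar> \<le> C2 * (1 + (x - s)) powr (- 1 - \<alpha>)" using s x by (intro C2) (auto simp: x_def)
        also have "\<dots> \<le> C2 * (2 powr (1 + \<alpha>) * q)" using s C2 by (intro mult_left_mono qhalf) auto
        finally have k: "\<bar>kernel2 \<alpha> n (x - s)\<bar> \<le> C2 * (2 powr (1 + \<alpha>) * q)" .
        have "\<bar>D 2 s\<bar> \<le> B * s powr (\<sigma> - 2)" using bd[of 2 s] s x by simp
        also have "s powr (\<sigma> - 2) = s powr e * s powr (- 1 + \<alpha> / 2)" using s by (simp add: e_def powr_add[symmetric])
        also have "B * (s powr e * s powr (- 1 + \<alpha> / 2)) \<le> B * ((2 powr \<bar>e\<bar> * (1 + x powr e)) * s powr (- 1 + \<alpha> / 2))"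
          using B0 s x by (intro mult_left_mono mult_right_mono powr_range) auto
        finally have "\<bar>f s\<bar> \<le> (C2 * (2 powr (1 + \<alpha>) * q)) * (B * ((2 powr \<bar>e\<bar> * (1 + x powr e)) * s powr (- 1 + \<alpha> / 2)))"
          unfolding f_def abs_mult using k C2 by (intro mult_mono) (auto simp: q_def)
        then show "norm (f s) \<le> L * s powr (- 1 + \<alpha> / 2)" by (simp add: L_def mult_ac)
      qed
      also have "\<dots> = L * ((x/2) powr (\<alpha> / 2) / (\<alpha> / 2) - (1/2) powr (\<alpha> / 2) / (\<alpha> / 2))" using pw by (rule integral_unique)
      also have "\<dots> \<le> L * (x powr (\<alpha> / 2) * (2 / \<alpha>))"
      proof (rule mult_left_mono[OF _ L0])
        have "(x/2) powr (\<alpha> / 2) / (\<alpha> / 2) \<le> x powr (\<alpha> / 2) / (\<alpha> / 2)"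
          using x \<alpha> by (intro divide_right_mono powr_mono2) auto
        moreover have "0 \<le> (1/2) powr (\<alpha> / 2) / (\<alpha> / 2)" using \<alpha> by simp
        moreover have "x powr (\<alpha> / 2) / (\<alpha> / 2) = x powr (\<alpha> / 2) * (2 / \<alpha>)" by simp
        ultimately show "(x/2) powr (\<alpha> / 2) / (\<alpha> / 2) - (1/2) powr (\<alpha> / 2) / (\<alpha> / 2) \<le> x powr (\<alpha> / 2) * (2 / \<alpha>)" by linarith
      qed
      also have "\<dots> = K4 * B * (q * (1 + x powr e) * x powr (\<alpha> / 2))" by (simp add: L_def K4_def mult_ac)
      also have "q * (1 + x powr e) * x powr (\<alpha> / 2) = p"
      proof -
        have "q * x powr (\<alpha> / 2) = x powr (- 1 - \<alpha> / 2)" using x by (simp add: q_def powr_add[symmetric] minus_diff_commute)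
        moreover have "q * x powr e * x powr (\<alpha> / 2) = x powr (\<sigma> - \<alpha> - 2)"
        proof -
          have ex: "- 1 - \<alpha> + e + \<alpha> / 2 = \<sigma> - \<alpha> - 2" by (simp add: e_def)
          show ?thesis unfolding q_def powr_add[symmetric] ex ..
        qed
        ultimately show ?thesis by (simp add: p_def x_def algebra_simps)
      qed
      finally show ?thesis by simp
    qed
    have X2: "\<bar>integral {x/2..x} f\<bar> \<le> (K5 + K6) * B * x powr (\<sigma> - \<alpha> - 2)"
    proof -
      define h where "h s = kernel3 \<alpha> n (x - s) * D 3 s" for s
      have kc: "continuous_on {x/2..x} (\<lambda>s. kernel3 \<alpha> n (x - s))"
        by (rule continuous_on_compose2[OF kernel3_continuous[OF \<alpha>(2)]]) (auto intro!: continuous_intros)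
      have hint: "(h has_integral integral {x/2..x} h) {x/2..x}"
        unfolding h_def using x by (intro integrable_integral integrable_continuous_real continuous_on_mult kc contsub) auto
      have "((\<lambda>s. f s - h s) has_integral (- (kernel3 \<alpha> n (x - x) * D 2 x)) - (- (kernel3 \<alpha> n (x - x/2) * D 2 (x/2)))) {x/2..x}"
      proof (rule fundamental_theorem_of_calculus_interior)
        show "continuous_on {x/2..x} (\<lambda>s. - (kernel3 \<alpha> n (x - s) * D 2 s))"
          using x by (intro continuous_on_minus continuous_on_mult kc contsub) auto
        fix s assume s: "s \<in> {x/2<..<x}"
        have "((\<lambda>s. kernel3 \<alpha> n (x - s)) has_real_derivative kernel2 \<alpha> n (x - s) * (- 1)) (at s)"
          by (rule DERIV_chain2[OF kernel3_derivative]) (use s in \<open>auto intro!: derivative_eq_intros\<close>)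
        then have "((\<lambda>s. - (kernel3 \<alpha> n (x - s) * D 2 s)) has_real_derivative
           - ((kernel2 \<alpha> n (x - s) * (- 1)) * D 2 s + D (Suc 2) s * kernel3 \<alpha> n (x - s))) (at s)"
          using der[of 2 s] s x by (intro DERIV_minus DERIV_mult) auto
        then show "((\<lambda>s. - (kernel3 \<alpha> n (x - s) * D 2 s)) has_vector_derivative f s - h s) (at s)"
          by (simp add: has_real_derivative_iff_has_vector_derivative[symmetric] f_def h_def mult.commute)
      qed (use x in auto)
      from has_integral_add[OF this hint]
      have "integral {x/2..x} f = kernel3 \<alpha> n (x/2) * D 2 (x/2) + integral {x/2..x} h"
        by (simp add: integral_unique)
      moreover have "\<bar>kernel3 \<alpha> n (x/2) * D 2 (x/2)\<bar> \<le> K5 * B * x powr (\<sigma> - \<alpha> - 2)"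
      proof -
        have "\<bar>kernel3 \<alpha> n (x/2)\<bar> \<le> C3 * (1 + x/2) powr (- kernel3_decay \<alpha>)" using x by (intro C3) (auto simp: x_def)
        also have "\<dots> \<le> C3 * (1 + x/2) powr (- \<alpha>)"
          using C3 x \<alpha> by (intro mult_left_mono powr_mono) (auto simp: kernel3_decay_def)
        also have "\<dots> \<le> C3 * (x/2) powr (- \<alpha>)" using C3 x \<alpha> by (intro mult_left_mono powr_mono2') auto
        also have "(x/2) powr (- \<alpha>) = 2 powr \<alpha> * x powr (- \<alpha>)" using x by (simp add: powr_divide powr_minus_divide)
        finally have k: "\<bar>kernel3 \<alpha> n (x/2)\<bar> \<le> C3 * (2 powr \<alpha> * x powr (- \<alpha>))" .
        have "\<bar>D 2 (x/2)\<bar> \<le> B * (x/2) powr (\<sigma> - 2)" using bd[of 2 "x/2"] x by simp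
        also have "\<dots> \<le> B * (2 powr \<bar>\<sigma> - 2\<bar> * x powr (\<sigma> - 2))" using B0 x by (intro mult_left_mono powr_half_range) auto
        finally have "\<bar>kernel3 \<alpha> n (x/2) * D 2 (x/2)\<bar> \<le> (C3 * (2 powr \<alpha> * x powr (- \<alpha>))) * (B * (2 powr \<bar>\<sigma> - 2\<bar> * x powr (\<sigma> - 2)))"
          unfolding abs_mult using k C3 by (intro mult_mono) auto
        also have "\<dots> = K5 * B * (x powr (- \<alpha>) * x powr (\<sigma> - 2))" by (simp add: K5_def mult_ac)
        also have "x powr (- \<alpha>) * x powr (\<sigma> - 2) = x powr (\<sigma> - \<alpha> - 2)"
        proof -
          have ex: "- \<alpha> + (\<sigma> - 2) = \<sigma> - \<alpha> - 2" by simp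
          show ?thesis unfolding powr_add[symmetric] ex ..
        qed
        finally show ?thesis .
      qed
      moreover have "\<bar>integral {x/2..x} h\<bar> \<le> K6 * B * x powr (\<sigma> - \<alpha> - 2)"
      proof -
        obtain J where J: "((\<lambda>s. (1 + x - s) powr (- kernel3_decay \<alpha>)) has_integral J) {x/2..x}" "J \<le> K * x powr (1 - \<alpha>)"
          using K(2)[OF x] by blast
        define L where "L = C3 * (B * (2 powr \<bar>\<sigma> - 3\<bar> * x powr (\<sigma> - 3)))"
        have L0: "L \<ge> 0" using C3 B0 by (auto simp: L_def)
        have LJ: "((\<lambda>s. L * (1 + x - s) powr (- kernel3_decay \<alpha>)) has_integral L * J) {x/2..x}"
          by (intro has_integral_mult_right J)
        have "norm (integral {x/2..x} h) \<le> integral {x/2..x} (\<lambda>s. L * (1 + x - s) powr (- kernel3_decay \<alpha>))"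
        proof (rule integral_norm_bound_integral[OF has_integral_integrable[OF hint] has_integral_integrable[OF LJ]])
          fix s assume s: "s \<in> {x/2..x}"
          have "\<bar>kernel3 \<alpha> n (x - s)\<bar> \<le> C3 * (1 + x - s) powr (- kernel3_decay \<alpha>)"
          proof (cases "s = x")
            case False
            then show ?thesis using C3(2)[of "x - s" n] s x by (auto simp: x_def add_diff_eq)
          qed (use C3 in simp)
          moreover have "\<bar>D 3 s\<bar> \<le> B * (2 powr \<bar>\<sigma> - 3\<bar> * x powr (\<sigma> - 3))"
          proof -
            have "\<bar>D 3 s\<bar> \<le> B * s powr (\<sigma> - 3)" using bd[of 3 s] s x by simp
            also have "\<dots> \<le> B * (2 powr \<bar>\<sigma> - 3\<bar> * x powr (\<sigma> - 3))"
              using B0 s x by (intro mult_left_mono powr_half_range) auto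
            finally show ?thesis .
          qed
          ultimately have "\<bar>h s\<bar> \<le> (C3 * (1 + x - s) powr (- kernel3_decay \<alpha>)) * (B * (2 powr \<bar>\<sigma> - 3\<bar> * x powr (\<sigma> - 3)))"
            unfolding h_def abs_mult using C3 by (intro mult_mono) auto
          then show "norm (h s) \<le> L * (1 + x - s) powr (- kernel3_decay \<alpha>)" by (simp add: L_def mult_ac)
        qed
        also have "\<dots> = L * J" using LJ by (rule integral_unique)
        also have "\<dots> \<le> L * (K * x powr (1 - \<alpha>))" using L0 J by (intro mult_left_mono)
        also have "\<dots> = K6 * B * (x powr (\<sigma> - 3) * x powr (1 - \<alpha>))" by (simp add: L_def K6_def mult_ac)
        also have "x powr (\<sigma> - 3) * x powr (1 - \<alpha>) = x powr (\<sigma> - \<alpha> - 2)" using x by (simp add: powr_add[symmetric] algebra_simps)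
        finally show ?thesis by simp
      qed
      ultimately have "\<bar>integral {x/2..x} f\<bar> \<le> K5 * B * x powr (\<sigma> - \<alpha> - 2) + K6 * B * x powr (\<sigma> - \<alpha> - 2)"
        by (simp only: abs_add_mono)
      then show ?thesis by (simp add: algebra_simps)
    qed
    have qp: "q \<le> p"
    proof -
      have "q \<le> x powr (- 1 - \<alpha> / 2)" unfolding q_def using x \<alpha> by (intro powr_mono) auto
      then show ?thesis unfolding p_def x_def[symmetric] by (simp add: add_increasing2)
    qed
    have p2: "x powr (\<sigma> - \<alpha> - 2) \<le> p" by (simp add: p_def x_def)
    have "E = integral {1/2..x} f + (G * D 0 (1/2) + \<alpha> * rGamma (1 - \<alpha>) * I0 + kernel2 \<alpha> n (x - 1/2) * D 1 (1/2))"
      using integral_unique[OF rep] by simp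
    also have "\<bar>\<dots>\<bar> \<le> (K4 * B * p + (K5 + K6) * B * x powr (\<sigma> - \<alpha> - 2)) +
        (C1 * q * B + \<rho> * (2 powr (1 + \<alpha>) * q * B) + C2 * q * (B * 2 powr \<bar>\<sigma> - 1\<bar>))"
      unfolding split by (intro abs_add_mono X1 X2 T1 T2 T3)
    also have "\<dots> = K4 * B * p + (K5 + K6) * B * x powr (\<sigma> - \<alpha> - 2) + M * B * q"
      by (simp add: M_def algebra_simps)
    also have "\<dots> \<le> K4 * B * p + (K5 + K6) * B * p + M * B * p"
      using pos B0 qp p2 by (intro add_mono mult_left_mono) auto
    also have "\<dots> = C * B * p" by (simp add: C_def algebra_simps)
    finally show ?thesis by (simp add: E_def x_def p_def)
  qed
  moreover have "C > 0" unfolding C_def using pos by simp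
  ultimately show ?thesis by blast
qed

section \<open>Convolution of powers and the critical power\<close>

lemma sum_powr_le_integral:
  fixes q :: real
  assumes "-1 < q" "q \<le> 0"
  shows "(\<Sum>k=1..n. real k powr q) \<le> real n powr (q + 1) / (q + 1)"
proof (induction n)
  case (Suc n)
  have "real (Suc n) powr q \<le> (real (Suc n) powr (q + 1) - real n powr (q + 1)) / (q + 1)"
  proof (cases "n = 0")
    case True
    then show ?thesis using assms by simp
  next
    case False
    obtain z where z: "real n < z" "z < real (Suc n)"
      "real (Suc n) powr (q + 1) - real n powr (q + 1) = (real (Suc n) - real n) * ((q + 1) * z powr (q + 1 - 1))"
      using MVT2[of "real n" "real (Suc n)" "\<lambda>x. x powr (q + 1)" "\<lambda>z. (q + 1) * z powr (q + 1 - 1)"] False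
      by (force intro!: derivative_eq_intros simp: mult.commute)
    have "real (Suc n) powr q \<le> z powr q" using z assms by (intro powr_mono2') auto
    then show ?thesis unfolding z(3) using assms by simp
  qed
  then show ?case using Suc by (simp add: diff_divide_distrib)
qed simp

lemma power_sum_bound:
  fixes q :: real
  assumes "q \<noteq> -1"
  shows "\<exists>C>0. \<forall>n\<ge>1. (\<Sum>k=1..n. real k powr q) \<le> C * max 1 (real n powr (q + 1))"
proof -
  consider "q < -1" | "q \<ge> 0" | "-1 < q" "q < 0" using assms by linarith
  then show ?thesis
  proof cases
    case 1
    then have s: "summable (\<lambda>k. real k powr q)" by (simp add: summable_real_powr_iff)
    define C where "C = (\<Sum>k. real k powr q) + 1"
    have C0: "(\<Sum>k. real k powr q) \<ge> 0" by (intro suminf_nonneg s) auto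
    have "(\<Sum>k=1..n. real k powr q) \<le> C * max 1 (real n powr (q + 1))" for n
    proof -
      have "(\<Sum>k=1..n. real k powr q) \<le> (\<Sum>k. real k powr q)" by (intro sum_le_suminf s) auto
      also have "\<dots> \<le> C * 1" by (simp add: C_def)
      also have "\<dots> \<le> C * max 1 (real n powr (q + 1))" using C0 by (intro mult_left_mono) (auto simp: C_def)
      finally show ?thesis .
    qed
    then show ?thesis using C0 by (intro exI[of _ C]) (auto simp: C_def)
  next
    case 2
    have "(\<Sum>k=1..n. real k powr q) \<le> 1 * max 1 (real n powr (q + 1))" if "n \<ge> 1" for n
    proof -
      have "(\<Sum>k=1..n. real k powr q) \<le> (\<Sum>k=1..n. real n powr q)" using 2 by (intro sum_mono powr_mono2) auto
      also have "\<dots> = real n powr (q + 1)" using that by (simp add: powr_add)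
      finally show ?thesis by simp
    qed
    then show ?thesis by (intro exI[of _ 1]) auto
  next
    case 3
    then have "(\<Sum>k=1..n. real k powr q) \<le> real n powr (q + 1) / (q + 1)" for n
      by (intro sum_powr_le_integral) auto
    moreover have "real n powr (q + 1) / (q + 1) \<le> 1 / (q + 1) * max 1 (real n powr (q + 1))" for n
      using 3 by (simp add: divide_right_mono)
    ultimately have "(\<Sum>k=1..n. real k powr q) \<le> 1 / (q + 1) * max 1 (real n powr (q + 1))" for n
      by (rule order_trans)
    then show ?thesis using 3 by (intro exI[of _ "1 / (q + 1)"]) auto
  qed
qed

text \<open>
  In each term one of the two bases is at least \<open>n / 2\<close>, so its power is comparable to the power of
  \<open>n\<close> and the other one is summed.
\<close>

lemma convolution_power_bound:
  fixes p q :: real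
  assumes "p \<noteq> -1" "q \<noteq> -1"
  shows "\<exists>C>0. \<forall>n\<ge>1. (\<Sum>k=1..n. (real n + 1 - real k) powr p * real k powr q)
     \<le> C * (real n powr p * max 1 (real n powr (q + 1)) + real n powr q * max 1 (real n powr (p + 1)))"
proof -
  obtain C1 where C1: "C1 > 0" "\<And>n. n \<ge> 1 \<Longrightarrow> (\<Sum>k=1..n. real k powr q) \<le> C1 * max 1 (real n powr (q + 1))"
    using power_sum_bound[OF assms(2)] by blast
  obtain C2 where C2: "C2 > 0" "\<And>n. n \<ge> 1 \<Longrightarrow> (\<Sum>k=1..n. real k powr p) \<le> C2 * max 1 (real n powr (p + 1))"
    using power_sum_bound[OF assms(1)] by blast
  define A where "A = 2 powr \<bar>p\<bar> * C1"
  define B where "B = 2 powr \<bar>q\<bar> * C2"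
  have AB: "A > 0" "B > 0" using C1 C2 by (auto simp: A_def B_def)
  have "(\<Sum>k=1..n. (real n + 1 - real k) powr p * real k powr q)
     \<le> (A + B) * (real n powr p * max 1 (real n powr (q + 1)) + real n powr q * max 1 (real n powr (p + 1)))" if n: "n \<ge> 1" for n
  proof -
    have "(\<Sum>k=1..n. (real n + 1 - real k) powr p * real k powr q)
       \<le> (\<Sum>k=1..n. 2 powr \<bar>p\<bar> * real n powr p * real k powr q + 2 powr \<bar>q\<bar> * real n powr q * (real n + 1 - real k) powr p)"
    proof (rule sum_mono)
      fix k assume k: "k \<in> {1..n}"
      show "(real n + 1 - real k) powr p * real k powr q
        \<le> 2 powr \<bar>p\<bar> * real n powr p * real k powr q + 2 powr \<bar>q\<bar> * real n powr q * (real n + 1 - real k) powr p"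
      proof (cases "2 * real k \<le> real n + 1")
        case True
        then have "(real n + 1 - real k) powr p \<le> 2 powr \<bar>p\<bar> * real n powr p"
          using k by (intro powr_half_range) auto
        then have "(real n + 1 - real k) powr p * real k powr q \<le> 2 powr \<bar>p\<bar> * real n powr p * real k powr q"
          by (intro mult_right_mono) auto
        then show ?thesis by (simp add: add_increasing2)
      next
        case False
        then have "real k powr q \<le> 2 powr \<bar>q\<bar> * real n powr q"
          using k by (intro powr_half_range) auto
        then have "(real n + 1 - real k) powr p * real k powr q \<le> (real n + 1 - real k) powr p * (2 powr \<bar>q\<bar> * real n powr q)"
          by (intro mult_left_mono) auto
        then show ?thesis by (simp add: add_increasing mult_ac)
      qed
    qed
    also have "\<dots> = 2 powr \<bar>p\<bar> * real n powr p * (\<Sum>k=1..n. real k powr q) + 2 powr \<bar>q\<bar> * real n powr q * (\<Sum>k=1..n. (real n + 1 - real k) powr p)"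
      by (simp add: sum.distrib sum_distrib_left)
    also have "(\<Sum>k=1..n. (real n + 1 - real k) powr p) = (\<Sum>k=1..n. real k powr p)"
      by (rule sum.reindex_bij_witness[of _ "\<lambda>k. n + 1 - k" "\<lambda>k. n + 1 - k"]) (auto simp: of_nat_diff add.commute)
    also have "2 powr \<bar>p\<bar> * real n powr p * (\<Sum>k=1..n. real k powr q) + 2 powr \<bar>q\<bar> * real n powr q * (\<Sum>k=1..n. real k powr p)
      \<le> 2 powr \<bar>p\<bar> * real n powr p * (C1 * max 1 (real n powr (q + 1))) + 2 powr \<bar>q\<bar> * real n powr q * (C2 * max 1 (real n powr (p + 1)))"
      by (intro add_mono mult_left_mono C1 C2 n) auto
    also have "\<dots> = A * (real n powr p * max 1 (real n powr (q + 1))) + B * (real n powr q * max 1 (real n powr (p + 1)))"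
      by (simp add: A_def B_def mult_ac)
    also have "\<dots> \<le> (A + B) * (real n powr p * max 1 (real n powr (q + 1))) + (A + B) * (real n powr q * max 1 (real n powr (p + 1)))"
      using AB by (intro add_mono mult_right_mono) auto
    finally show ?thesis by (simp add: distrib_left)
  qed
  then show ?thesis using AB by (intro exI[of _ "A + B"]) auto
qed

lemma g_coeff_bound:
  "\<exists>C>0. \<forall>n. \<bar>g_coeff \<alpha> n\<bar> \<le> C * (real n + 1) powr (- 1 - \<alpha>)"
proof -
  obtain C1 where C1: "C1 > 0" "\<And>n. \<bar>omega_coeff \<alpha> n\<bar> \<le> C1 * (real n + 1) powr (- \<alpha> - 1)"
    using omega_coeff_bound[of \<alpha>] by blast
  obtain C2 where C2: "C2 > 0" "\<And>n. \<bar>omega_coeff (\<alpha> + 1) n\<bar> \<le> C2 * (real n + 1) powr (- (\<alpha> + 1) - 1)"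
    using omega_coeff_bound[of "\<alpha> + 1"] by blast
  have "\<bar>g_coeff \<alpha> n\<bar> \<le> (C1 + \<bar>\<alpha> / 2\<bar> * C2) * (real n + 1) powr (- 1 - \<alpha>)" for n
  proof -
    have "(real n + 1) powr (- (\<alpha> + 1) - 1) \<le> (real n + 1) powr (- 1 - \<alpha>)" by (intro powr_mono) auto
    then have "C2 * (real n + 1) powr (- (\<alpha> + 1) - 1) \<le> C2 * (real n + 1) powr (- 1 - \<alpha>)"
      using C2(1) by (intro mult_left_mono) auto
    then have "\<bar>omega_coeff (\<alpha> + 1) n\<bar> \<le> C2 * (real n + 1) powr (- 1 - \<alpha>)" using C2(2)[of n] by linarith
    moreover have "\<bar>omega_coeff \<alpha> n\<bar> \<le> C1 * (real n + 1) powr (- 1 - \<alpha>)"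
      using C1(2)[of n] by (simp add: minus_diff_commute)
    ultimately have "\<bar>g_coeff \<alpha> n\<bar> \<le> C1 * (real n + 1) powr (- 1 - \<alpha>) + \<bar>\<alpha> / 2\<bar> * (C2 * (real n + 1) powr (- 1 - \<alpha>))"
      unfolding g_coeff_eq by (intro abs_add_mono abs_mult_mono)
    then show ?thesis by (simp only: distrib_right mult.assoc)
  qed
  then show ?thesis using C1 C2 by (intro exI[of _ "C1 + \<bar>\<alpha> / 2\<bar> * C2"]) (auto intro!: add_pos_nonneg)
qed

text \<open>
  The discrete operator takes simple values on \<open>omega_coeff (-2 - \<alpha>)\<close>, \<open>omega_coeff (-1 - \<alpha>)\<close> and
  \<open>omega_coeff (- \<alpha>)\<close>. A combination of these three sequences agrees with the power up to three orders, which
  leaves a summable remainder if \<open>\<alpha> < 1\<close>.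
\<close>

lemma resonant_power_remainder:
  assumes "\<alpha> > 0"
  shows "\<exists>B C. C > 0 \<and> (\<forall>k\<ge>1. \<bar>real k powr (1 + \<alpha>) - Gamma (2 + \<alpha>) *
      (omega_coeff (-2 - \<alpha>) k - (2 + \<alpha>) / 2 * omega_coeff (-1 - \<alpha>) k + B * omega_coeff (- \<alpha>) k)\<bar>
     \<le> C * real k powr (\<alpha> - 2))"
proof -
  define G where "G = Gamma (2 + \<alpha>)"
  define r where "r = rGamma (2 + \<alpha>)"
  have G0: "G > 0" unfolding G_def using assms by (intro Gamma_real_pos) simp
  then have Gr: "G * r = 1" by (simp add: G_def r_def rGamma_inverse_Gamma)
  have r1: "rGamma (1 + \<alpha>) = (1 + \<alpha>) * r"
    using rGamma_plus1[of "1 + \<alpha>"] by (simp add: r_def algebra_simps)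
  have r2: "rGamma \<alpha> = \<alpha> * ((1 + \<alpha>) * r)"
    using rGamma_plus1[of \<alpha>] r1 by (simp add: add.commute)
  obtain a C1 where C1: "C1 > 0" "\<And>n. n \<ge> 1 \<Longrightarrow>
    \<bar>omega_coeff (-2 - \<alpha>) n - rGamma (- (-2 - \<alpha>)) * (real n powr (- (-2 - \<alpha>) - 1) + (-2 - \<alpha>) * ((-2 - \<alpha>) + 1) / 2 * real n powr (- (-2 - \<alpha>) - 2) + a * real n powr (- (-2 - \<alpha>) - 3))\<bar>
       \<le> C1 * real n powr (- (-2 - \<alpha>) - 4)"
    using omega_coeff_expansion[of "-2 - \<alpha>"] by blast
  have ex: "- (-2 - \<alpha>) = 2 + \<alpha>" "2 + \<alpha> - 1 = 1 + \<alpha>" "2 + \<alpha> - 2 = \<alpha>" "2 + \<alpha> - 3 = \<alpha> - 1" "2 + \<alpha> - 4 = \<alpha> - 2"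
     "(-2 - \<alpha>) * ((-2 - \<alpha>) + 1) / 2 = (2 + \<alpha>) * (1 + \<alpha>) / 2" by (simp_all add: algebra_simps)
  note C1' = C1(2)[unfolded ex, folded r_def]
  have "\<exists>C>0. \<forall>n\<ge>1. \<bar>omega_coeff (-1 - \<alpha>) n - ((1 + \<alpha>) * r) * (real n powr \<alpha> + (1 + \<alpha>) * \<alpha> / 2 * real n powr (\<alpha> - 1))\<bar> \<le> C * real n powr (\<alpha> - 2)"
    by (rule omega_asymp2) (simp_all add: r1 algebra_simps)
  then obtain C2 where C2: "C2 > 0" "\<And>n. n \<ge> 1 \<Longrightarrow> \<bar>omega_coeff (-1 - \<alpha>) n - ((1 + \<alpha>) * r) * (real n powr \<alpha> + (1 + \<alpha>) * \<alpha> / 2 * real n powr (\<alpha> - 1))\<bar> \<le> C2 * real n powr (\<alpha> - 2)"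
    by blast
  have "\<exists>C>0. \<forall>n\<ge>1. \<bar>omega_coeff (-\<alpha>) n - (\<alpha> * ((1 + \<alpha>) * r)) * real n powr (\<alpha> - 1)\<bar> \<le> C * real n powr (\<alpha> - 2)"
    by (rule omega_asymp1) (simp_all add: r2[symmetric])
  then obtain C3 where C3: "C3 > 0" "\<And>n. n \<ge> 1 \<Longrightarrow> \<bar>omega_coeff (-\<alpha>) n - (\<alpha> * ((1 + \<alpha>) * r)) * real n powr (\<alpha> - 1)\<bar> \<le> C3 * real n powr (\<alpha> - 2)"
    by blast
  define A where "A = (2 + \<alpha>) / 2"
  define b2 where "b2 = (1 + \<alpha>) * \<alpha> / 2"
  \<comment> \<open>\<open>A\<close> removes the terms with \<open>k powr \<alpha>\<close>, and \<open>B\<close> those with \<open>k powr (\<alpha> - 1)\<close>.\<close>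
  define B where "B = (A * b2 * (1 + \<alpha>) - a) / (\<alpha> * (1 + \<alpha>))"
  have Beq: "a - A * b2 * (1 + \<alpha>) + B * (\<alpha> * (1 + \<alpha>)) = 0" using assms by (simp add: B_def)
  define K where "K = G * (C1 + \<bar>A\<bar> * C2 + \<bar>B\<bar> * C3)"
  have "\<bar>real k powr (1 + \<alpha>) - G * (omega_coeff (-2 - \<alpha>) k - A * omega_coeff (-1 - \<alpha>) k + B * omega_coeff (- \<alpha>) k)\<bar>
     \<le> K * real k powr (\<alpha> - 2)" if k: "k \<ge> 1" for k
  proof -
    define p where "p = real k powr (\<alpha> - 2)"
    define x1 where "x1 = real k powr (1 + \<alpha>)"
    define x2 where "x2 = real k powr \<alpha>"
    define x3 where "x3 = real k powr (\<alpha> - 1)"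
    define e1 where "e1 = omega_coeff (-2 - \<alpha>) k - r * (x1 + (2 + \<alpha>) * (1 + \<alpha>) / 2 * x2 + a * x3)"
    define e2 where "e2 = omega_coeff (-1 - \<alpha>) k - ((1 + \<alpha>) * r) * (x2 + b2 * x3)"
    define e3 where "e3 = omega_coeff (-\<alpha>) k - (\<alpha> * ((1 + \<alpha>) * r)) * x3"
    have e: "\<bar>e1\<bar> \<le> C1 * p" "\<bar>e2\<bar> \<le> C2 * p" "\<bar>e3\<bar> \<le> C3 * p"
      using C1'[OF k] C2(2)[OF k] C3(2)[OF k]
      by (simp_all add: e1_def e2_def e3_def x1_def x2_def x3_def b2_def p_def)
    have AA: "(2 + \<alpha>) * (1 + \<alpha>) / 2 = A * (1 + \<alpha>)" by (simp add: A_def)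
    have w: "omega_coeff (-2 - \<alpha>) k = e1 + r * (x1 + A * (1 + \<alpha>) * x2 + a * x3)"
      "omega_coeff (-1 - \<alpha>) k = e2 + ((1 + \<alpha>) * r) * (x2 + b2 * x3)"
      "omega_coeff (-\<alpha>) k = e3 + (\<alpha> * ((1 + \<alpha>) * r)) * x3"
      by (simp_all add: e1_def e2_def e3_def AA)
    have "omega_coeff (-2 - \<alpha>) k - A * omega_coeff (-1 - \<alpha>) k + B * omega_coeff (- \<alpha>) k
       = r * x1 + r * x3 * (a - A * b2 * (1 + \<alpha>) + B * (\<alpha> * (1 + \<alpha>))) + (e1 - A * e2 + B * e3)"
      unfolding w by (simp add: algebra_simps)
    also have "\<dots> = r * x1 + (e1 - A * e2 + B * e3)" by (simp add: Beq)
    finally have U: "omega_coeff (-2 - \<alpha>) k - A * omega_coeff (-1 - \<alpha>) k + B * omega_coeff (- \<alpha>) k = r * x1 + (e1 - A * e2 + B * e3)" .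
    have "x1 - G * (omega_coeff (-2 - \<alpha>) k - A * omega_coeff (-1 - \<alpha>) k + B * omega_coeff (- \<alpha>) k)
       = (1 - G * r) * x1 - G * (e1 - A * e2 + B * e3)" unfolding U by (simp add: algebra_simps)
    also have "\<dots> = - (G * (e1 - A * e2 + B * e3))" by (simp add: Gr)
    also have "\<bar>\<dots>\<bar> \<le> \<bar>G\<bar> * ((C1 * p + \<bar>A\<bar> * (C2 * p)) + \<bar>B\<bar> * (C3 * p))"
      unfolding abs_minus_cancel by (intro abs_mult_mono abs_add_mono abs_diff_mono e)
    also have "\<dots> = K * p" using G0 by (simp add: K_def algebra_simps)
    finally show ?thesis by (simp add: x1_def p_def)
  qed
  moreover have "K > 0" unfolding K_def using G0 C1 C2 C3 by (intro mult_pos_pos add_pos_nonneg) auto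
  ultimately show ?thesis unfolding G_def A_def by blast
qed

text \<open>
  The product with the series of the weights consists of \<open>(1 - z)\<^sup>-\<^sup>2\<close>, whose coefficients are
  \<open>n + 1\<close>, of a multiple of \<open>(1 - z)\<^sup>-\<^sup>1\<close> that compensates the \<open>1\<close>, and of a linear polynomial, which
  is invisible from \<open>n = 2\<close> on.
\<close>

lemma resonant_power_convolution:
  assumes "n \<ge> 2"
  shows "(\<Sum>k=0..n. g_coeff \<alpha> (n - k) * (omega_coeff (-2 - \<alpha>) k - (2 + \<alpha>) / 2 * omega_coeff (-1 - \<alpha>) k + B * omega_coeff (- \<alpha>) k)) = real n"
proof -
  let ?q = "omega_fps (-2 - \<alpha>) - fps_const ((2 + \<alpha>) / 2) * omega_fps (-1 - \<alpha>) + fps_const B * omega_fps (- \<alpha>)"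
  have "(\<Sum>k=0..n. g_coeff \<alpha> (n - k) * (omega_coeff (-2 - \<alpha>) k - (2 + \<alpha>) / 2 * omega_coeff (-1 - \<alpha>) k + B * omega_coeff (- \<alpha>) k))
     = fps_nth (?q * g_fps \<alpha>) n"
    unfolding fps_mult_nth by (intro sum.cong) (auto simp: mult.commute)
  also have "?q * g_fps \<alpha> = g_fps \<alpha> * omega_fps (-2 - \<alpha>) - fps_const ((2 + \<alpha>) / 2) * (g_fps \<alpha> * omega_fps (-1 - \<alpha>)) + fps_const B * (g_fps \<alpha> * omega_fps (- \<alpha>))"
    by (simp add: algebra_simps)
  also have "g_fps \<alpha> * omega_fps (-2 - \<alpha>) = omega_fps (-2) + fps_const (\<alpha> / 2) * omega_fps (-1)"
    by (simp add: g_fps_mult_omega)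
  also have "g_fps \<alpha> * omega_fps (-1 - \<alpha>) = omega_fps (-1) + fps_const (\<alpha> / 2)"
    by (simp add: g_fps_mult_omega omega_fps_0)
  also have "g_fps \<alpha> * omega_fps (- \<alpha>) = 1 + fps_const (\<alpha> / 2) * (1 - fps_X)"
    by (simp add: g_fps_mult_omega omega_fps_0 omega_fps_1)
  finally show ?thesis using assms
    by (simp add: omega_coeff_m1 omega_coeff_m2 right_diff_distrib add_divide_distrib)
qed

text \<open>
  A truncation error proportional to \<open>n powr (-1)\<close> would be expected here, but its coefficient is
  \<open>0\<close>. Matching \<open>k powr (1 + \<alpha>)\<close> up to a remainder \<open>\<rho> k = O(k powr (\<alpha> - 2))\<close> leaves the convolution of
  \<open>\<rho>\<close> with the weights, of size \<open>O(n powr (- 1 - \<alpha>) + n powr (\<alpha> - 2))\<close>. For \<open>\<alpha> = 1\<close> this would not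
  suffice, but then BDF2 is exact on \<open>t\<^sup>2\<close>.
\<close>

lemma resonant_power_truncation:
  assumes \<alpha>: "0 < \<alpha>" "\<alpha> \<le> 1"
  shows "\<exists>\<delta>>0. \<exists>C>0. \<forall>n\<ge>1. \<bar>(\<Sum>k=0..n. g_coeff \<alpha> (n - k) * real k powr (1 + \<alpha>)) - Gamma (2 + \<alpha>) * real n\<bar>
     \<le> C * real n powr (- 1 - \<delta>)"
proof -
  define E where "E n = (\<Sum>k=0..n. g_coeff \<alpha> (n - k) * real k powr (1 + \<alpha>)) - Gamma (2 + \<alpha>) * real n" for n
  have reduce: "\<exists>\<delta>>0. \<exists>C>0. \<forall>n\<ge>1. \<bar>E n\<bar> \<le> C * real n powr (- 1 - \<delta>)"
    if "\<delta> > 0" "C > 0" "\<And>n. n \<ge> 2 \<Longrightarrow> \<bar>E n\<bar> \<le> C * real n powr (- 1 - \<delta>)" for \<delta> C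
  proof -
    have "\<bar>E n\<bar> \<le> (C + \<bar>E 1\<bar>) * real n powr (- 1 - \<delta>)" if "n \<ge> 1" for n
    proof (cases "n = 1")
      case False
      then have "\<bar>E n\<bar> \<le> C * real n powr (- 1 - \<delta>)" using \<open>\<And>n. n \<ge> 2 \<Longrightarrow> _ n\<close> that by auto
      also have "\<dots> \<le> (C + \<bar>E 1\<bar>) * real n powr (- 1 - \<delta>)" by (intro mult_right_mono) auto
      finally show ?thesis .
    qed (use \<open>C > 0\<close> in simp)
    then show ?thesis using that(1,2) by (intro exI[of _ \<delta>] conjI exI[of _ "C + \<bar>E 1\<bar>"]) auto
  qed
  show ?thesis
  proof (cases "\<alpha> = 1")
    case True
    have om: "omega_coeff 0 n = 0" "omega_coeff 1 n = 0" if "n \<ge> 2" for n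
    proof -
      have "fps_nth (omega_fps 0) n = 0" "fps_nth (omega_fps 1) n = 0" using that by (simp_all add: omega_fps_0 omega_fps_1)
      then show "omega_coeff 0 n = 0" "omega_coeff 1 n = 0" by simp_all
    qed
    have G3: "Gamma (3::real) = 2" using Gamma_numeral[of "num.Bit1 num.One", where ?'a = real] by (simp add: fact_numeral)
    have "E n = 0" if n: "n \<ge> 2" for n
    proof -
      have "(\<Sum>k=0..n. g_coeff 1 (n - k) * real k powr (1 + 1)) = (\<Sum>i\<le>n. 2 * (g_coeff 1 i * ((real n - real i)^2 / 2)))"
        by (rule sum.reindex_bij_witness[of _ "\<lambda>k. n - k" "\<lambda>i. n - i"]) (auto simp: of_nat_diff)
      also have "\<dots> = 2 * real n"
        unfolding sum_distrib_left[symmetric] g_square_sum using om[OF n] by (simp add: omega_coeff_m1 omega_coeff_m2)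
      finally show ?thesis by (simp add: E_def True G3)
    qed
    then show ?thesis using reduce[of 1 1] by (simp add: E_def)
  next
    case False
    with \<alpha> have a1: "\<alpha> < 1" by simp
    define \<delta> where "\<delta> = min \<alpha> (1 - \<alpha>)"
    have d: "\<delta> > 0" "\<delta> \<le> \<alpha>" "\<delta> \<le> 1 - \<alpha>" using \<alpha> a1 by (auto simp: \<delta>_def)
    obtain B C1 where C1: "C1 > 0" "\<And>k. k \<ge> 1 \<Longrightarrow> \<bar>real k powr (1 + \<alpha>) - Gamma (2 + \<alpha>) *
      (omega_coeff (-2 - \<alpha>) k - (2 + \<alpha>) / 2 * omega_coeff (-1 - \<alpha>) k + B * omega_coeff (- \<alpha>) k)\<bar>
     \<le> C1 * real k powr (\<alpha> - 2)"
      using resonant_power_remainder[OF \<alpha>(1)] by blast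
    define u where "u k = omega_coeff (-2 - \<alpha>) k - (2 + \<alpha>) / 2 * omega_coeff (-1 - \<alpha>) k + B * omega_coeff (- \<alpha>) k" for k
    define \<rho> where "\<rho> k = real k powr (1 + \<alpha>) - Gamma (2 + \<alpha>) * u k" for k
    obtain C2 where C2: "C2 > 0" "\<And>n. \<bar>g_coeff \<alpha> n\<bar> \<le> C2 * (real n + 1) powr (- 1 - \<alpha>)"
      using g_coeff_bound by blast
    obtain C3 where C3: "C3 > 0" "\<And>n. n \<ge> 1 \<Longrightarrow> (\<Sum>k=1..n. (real n + 1 - real k) powr (-1 - \<alpha>) * real k powr (\<alpha> - 2))
     \<le> C3 * (real n powr (-1 - \<alpha>) * max 1 (real n powr (\<alpha> - 2 + 1)) + real n powr (\<alpha> - 2) * max 1 (real n powr (-1 - \<alpha> + 1)))"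
      using convolution_power_bound[of "-1 - \<alpha>" "\<alpha> - 2"] \<alpha> a1 by auto
    define C where "C = 2 * C2 * C1 * C3 + C2 * \<bar>\<rho> 0\<bar>"
    have "\<bar>E n\<bar> \<le> C * real n powr (- 1 - \<delta>)" if n: "n \<ge> 2" for n
    proof -
      have "(\<Sum>k=0..n. g_coeff \<alpha> (n - k) * real k powr (1 + \<alpha>)) = (\<Sum>k=0..n. g_coeff \<alpha> (n - k) * \<rho> k + Gamma (2 + \<alpha>) * (g_coeff \<alpha> (n - k) * u k))"
        by (intro sum.cong) (auto simp: \<rho>_def algebra_simps)
      also have "\<dots> = (\<Sum>k=0..n. g_coeff \<alpha> (n - k) * \<rho> k) + Gamma (2 + \<alpha>) * (\<Sum>k=0..n. g_coeff \<alpha> (n - k) * u k)"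
        by (simp only: sum.distrib sum_distrib_left)
      also have "(\<Sum>k=0..n. g_coeff \<alpha> (n - k) * u k) = real n"
        unfolding u_def by (rule resonant_power_convolution[OF n])
      finally have "E n = (\<Sum>k=0..n. g_coeff \<alpha> (n - k) * \<rho> k)" by (simp add: E_def)
      also have "\<dots> = g_coeff \<alpha> n * \<rho> 0 + (\<Sum>k=1..n. g_coeff \<alpha> (n - k) * \<rho> k)"
        by (simp add: sum.atLeast_Suc_atMost[of 0 n])
      finally have E: "E n = g_coeff \<alpha> n * \<rho> 0 + (\<Sum>k=1..n. g_coeff \<alpha> (n - k) * \<rho> k)" .
      define p where "p = real n powr (- 1 - \<delta>)"
      have m: "real n powr x \<le> p" if "x \<le> -1 - \<delta>" for x using n that by (auto simp: p_def intro!: powr_mono)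
      have "\<bar>g_coeff \<alpha> n * \<rho> 0\<bar> \<le> C2 * p * \<bar>\<rho> 0\<bar>"
      proof -
        have "(real n + 1) powr (- 1 - \<alpha>) \<le> real n powr (- 1 - \<alpha>)" using n \<alpha> by (intro powr_mono2') auto
        also have "\<dots> \<le> p" using d by (intro m) auto
        finally have "C2 * (real n + 1) powr (- 1 - \<alpha>) \<le> C2 * p" using C2(1) by (intro mult_left_mono) auto
        then have "\<bar>g_coeff \<alpha> n\<bar> \<le> C2 * p" using C2(2)[of n] by linarith
        then show ?thesis unfolding abs_mult by (intro mult_right_mono) auto
      qed
      moreover have "\<bar>\<Sum>k=1..n. g_coeff \<alpha> (n - k) * \<rho> k\<bar> \<le> C2 * C1 * (C3 * (2 * p))"
      proof -
        have "\<bar>\<Sum>k=1..n. g_coeff \<alpha> (n - k) * \<rho> k\<bar> \<le> (\<Sum>k=1..n. \<bar>g_coeff \<alpha> (n - k) * \<rho> k\<bar>)" by (rule sum_abs)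
        also have "\<dots> \<le> (\<Sum>k=1..n. C2 * C1 * ((real n + 1 - real k) powr (-1 - \<alpha>) * real k powr (\<alpha> - 2)))"
        proof (rule sum_mono)
          fix k assume k: "k \<in> {1..n}"
          then have "\<bar>g_coeff \<alpha> (n - k)\<bar> \<le> C2 * (real n + 1 - real k) powr (-1 - \<alpha>)"
            using C2(2)[of "n - k"] by (simp add: of_nat_diff algebra_simps)
          moreover have "\<bar>\<rho> k\<bar> \<le> C1 * real k powr (\<alpha> - 2)" using C1(2)[of k] k by (simp add: \<rho>_def u_def)
          ultimately have "\<bar>g_coeff \<alpha> (n - k) * \<rho> k\<bar> \<le> (C2 * (real n + 1 - real k) powr (-1 - \<alpha>)) * (C1 * real k powr (\<alpha> - 2))"
            unfolding abs_mult using C2(1) by (intro mult_mono) auto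
          then show "\<bar>g_coeff \<alpha> (n - k) * \<rho> k\<bar> \<le> C2 * C1 * ((real n + 1 - real k) powr (-1 - \<alpha>) * real k powr (\<alpha> - 2))"
            by (simp add: mult_ac)
        qed
        also have "\<dots> = C2 * C1 * (\<Sum>k=1..n. (real n + 1 - real k) powr (-1 - \<alpha>) * real k powr (\<alpha> - 2))"
          by (simp add: sum_distrib_left)
        also have "\<dots> \<le> C2 * C1 * (C3 * (2 * p))"
        proof (rule mult_left_mono)
          have l: "real n powr x \<le> 1" if "x \<le> 0" for x
            using n that powr_mono[of x 0 "real n"] by simp
          have "(\<Sum>k=1..n. (real n + 1 - real k) powr (-1 - \<alpha>) * real k powr (\<alpha> - 2))
            \<le> C3 * (real n powr (-1 - \<alpha>) * max 1 (real n powr (\<alpha> - 2 + 1)) + real n powr (\<alpha> - 2) * max 1 (real n powr (-1 - \<alpha> + 1)))"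
            using C3(2)[of n] n by simp
          also have "\<dots> = C3 * (real n powr (-1 - \<alpha>) + real n powr (\<alpha> - 2))"
            using l[of "\<alpha> - 2 + 1"] l[of "-1 - \<alpha> + 1"] \<alpha> by simp
          also have "\<dots> \<le> C3 * (p + p)" using C3(1) d by (intro mult_left_mono add_mono m) auto
          finally show "(\<Sum>k=1..n. (real n + 1 - real k) powr (-1 - \<alpha>) * real k powr (\<alpha> - 2)) \<le> C3 * (2 * p)" by simp
        qed (use C1 C2 in auto)
        finally show ?thesis .
      qed
      ultimately have "\<bar>E n\<bar> \<le> C2 * p * \<bar>\<rho> 0\<bar> + C2 * C1 * (C3 * (2 * p))"
        unfolding E by (rule abs_add_mono)
      then show ?thesis by (simp add: C_def p_def algebra_simps)
    qed
    moreover have "C > 0" unfolding C_def using C1 C2 C3 by (intro add_pos_nonneg) auto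
    ultimately show ?thesis using reduce[of \<delta> C] d by (simp add: E_def)
  qed
qed

section \<open>Exact powers and rescaling\<close>

definition power_deriv :: "real \<Rightarrow> nat \<Rightarrow> real \<Rightarrow> real" where
  "power_deriv \<sigma> i s = (\<Prod>l<i. \<sigma> - real l) * s powr (\<sigma> - real i)"

lemma power_deriv_0: "power_deriv \<sigma> 0 s = s powr \<sigma>"
  by (simp add: power_deriv_def)

lemma power_deriv_1: "power_deriv \<sigma> 1 s = \<sigma> * s powr (\<sigma> - 1)"
  by (simp add: power_deriv_def)

lemma power_deriv_derivative:
  assumes "s > 0"
  shows "(power_deriv \<sigma> i has_real_derivative power_deriv \<sigma> (Suc i) s) (at s)"
  unfolding power_deriv_def[abs_def] using assms
  by (auto intro!: derivative_eq_intros simp: diff_diff_eq add_ac)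

lemma power_deriv_bound:
  assumes "i \<le> 3"
  shows "\<bar>power_deriv \<sigma> i s\<bar> \<le> (\<Sum>j\<le>3. \<bar>\<Prod>l<j. \<sigma> - real l\<bar>) * s powr (\<sigma> - real i)"
proof -
  have "\<bar>\<Prod>l<i. \<sigma> - real l\<bar> \<le> (\<Sum>j\<le>3. \<bar>\<Prod>l<j. \<sigma> - real l\<bar>)"
    by (rule member_le_sum) (use assms in auto)
  then show ?thesis unfolding power_deriv_def abs_mult by (intro mult_mono) auto
qed

lemma power_like_powr:
  assumes "\<sigma> > 0"
  shows "power_like \<sigma> (\<Sum>j\<le>3. \<bar>\<Prod>l<j. \<sigma> - real l\<bar>) t (power_deriv \<sigma>)"
  unfolding power_like_def
proof (intro conjI allI impI ballI)
  show "power_deriv \<sigma> 0 0 = 0" by (simp add: power_deriv_0)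
  show "continuous_on {0..t} (power_deriv \<sigma> 0)"
    unfolding power_deriv_0[abs_def] by (intro continuous_on_powr' continuous_intros) (use assms in auto)
  fix i :: nat
  show "continuous_on {0<..t} (power_deriv \<sigma> i)"
    by (intro continuous_at_imp_continuous_on ballI DERIV_isCont[OF power_deriv_derivative]) auto
  show "\<bar>power_deriv \<sigma> i s\<bar> \<le> (\<Sum>j\<le>3. \<bar>\<Prod>l<j. \<sigma> - real l\<bar>) * s powr (\<sigma> - real i)" if "i \<le> 3" for s
    by (rule power_deriv_bound[OF that])
  show "(power_deriv \<sigma> i has_real_derivative power_deriv \<sigma> (Suc i) s) (at s)" if "s \<in> {0<..<t}" for s
    by (rule power_deriv_derivative) (use that in auto)
qed

text \<open>
  For \<open>\<alpha> < 1\<close> the integral is Euler's Beta integral on \<open>{0..1}\<close>, stretched to \<open>{0..t}\<close>.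
\<close>

lemma caputo_value_power:
  assumes \<alpha>: "0 < \<alpha>" "\<alpha> \<le> 1" and "\<sigma> > 0" "t > 0"
  shows "caputo_value \<alpha> (power_deriv \<sigma> 1) t = Gamma (\<sigma> + 1) / Gamma (\<sigma> + 1 - \<alpha>) * t powr (\<sigma> - \<alpha>)"
proof (cases "\<alpha> = 1")
  case True
  have "Gamma \<sigma> > 0" using assms by (intro Gamma_real_pos)
  moreover have "Gamma (\<sigma> + 1) = \<sigma> * Gamma \<sigma>" using assms by (intro Gamma_plus1) auto
  ultimately show ?thesis using True by (simp add: caputo_value_def power_deriv_1 del: One_nat_def)
next
  case False
  with \<alpha> have a1: "\<alpha> < 1" by simp
  have pos: "Gamma \<sigma> > 0" "Gamma (1 - \<alpha>) > 0" "Gamma (\<sigma> + 1 - \<alpha>) > 0"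
    using assms a1 by (auto intro!: Gamma_real_pos)
  have Gs: "Gamma (\<sigma> + 1) = \<sigma> * Gamma \<sigma>" using assms by (intro Gamma_plus1) auto
  have "((\<lambda>s. s powr (\<sigma> - 1) * (1 - s) powr ((1 - \<alpha>) - 1)) has_integral Beta \<sigma> (1 - \<alpha>)) {0..1}"
    by (rule has_integral_Beta_real) (use assms a1 in auto)
  then have "((\<lambda>s. ((1/t) * s) powr (\<sigma> - 1) * (1 - (1/t) * s) powr ((1 - \<alpha>) - 1)) has_integral (1 / \<bar>1/t\<bar>) *\<^sub>R Beta \<sigma> (1 - \<alpha>)) ((\<lambda>x. x / (1/t)) ` {0..1})"
    by (rule has_integral_stretch_real) (use assms in auto)
  moreover have "(\<lambda>x. x / (1/t)) ` {0..1} = {0..t}"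
  proof -
    have "(\<lambda>x. x / (1/t)) ` {0..1} = (\<lambda>x. t * x) ` {0..1}" by (intro image_cong) auto
    then show ?thesis using assms image_mult_atLeastAtMost[of t 0 1] by simp
  qed
  ultimately have "((\<lambda>s. ((1/t) * s) powr (\<sigma> - 1) * (1 - (1/t) * s) powr ((1 - \<alpha>) - 1)) has_integral t * Beta \<sigma> (1 - \<alpha>)) {0..t}"
    using assms by simp
  then have "((\<lambda>s. (\<sigma> * t powr (\<sigma> - 1 - \<alpha>)) * (((1/t) * s) powr (\<sigma> - 1) * (1 - (1/t) * s) powr ((1 - \<alpha>) - 1))) has_integral (\<sigma> * t powr (\<sigma> - 1 - \<alpha>)) * (t * Beta \<sigma> (1 - \<alpha>))) {0..t}"
    by (rule has_integral_mult_right)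
  then have "((\<lambda>s. (t - s) powr (- \<alpha>) * power_deriv \<sigma> 1 s) has_integral (\<sigma> * t powr (\<sigma> - 1 - \<alpha>)) * (t * Beta \<sigma> (1 - \<alpha>))) {0..t}"
  proof (rule has_integral_eq[rotated])
    fix s assume s: "s \<in> {0..t}"
    have "1 - (1/t) * s = (t - s) / t" using assms by (simp add: field_simps)
    note e1 = this
    have e2: "t powr (\<sigma> - 1 - \<alpha>) = t powr (\<sigma> - 1) * t powr (- \<alpha>)" by (simp add: powr_add[symmetric])
    show "(\<sigma> * t powr (\<sigma> - 1 - \<alpha>)) * (((1/t) * s) powr (\<sigma> - 1) * (1 - (1/t) * s) powr ((1 - \<alpha>) - 1)) = (t - s) powr (- \<alpha>) * power_deriv \<sigma> 1 s"
      unfolding e1 e2 using s assms by (simp add: powr_divide power_deriv_1 del: One_nat_def)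
  qed
  then have "caputo_value \<alpha> (power_deriv \<sigma> 1) t = rGamma (1 - \<alpha>) * ((\<sigma> * t powr (\<sigma> - 1 - \<alpha>)) * (t * Beta \<sigma> (1 - \<alpha>)))"
    using False by (simp add: caputo_value_def integral_unique)
  also have "\<dots> = (\<sigma> * Gamma \<sigma>) / Gamma (\<sigma> + 1 - \<alpha>) * (t powr (\<sigma> - 1 - \<alpha>) * t)"
    using pos by (simp add: Beta_altdef rGamma_inverse_Gamma divide_inverse add_diff_eq)
  also have "t powr (\<sigma> - 1 - \<alpha>) * t = t powr (\<sigma> - \<alpha>)"
    using assms powr_add[of t "\<sigma> - 1 - \<alpha>" 1] by simp
  finally show ?thesis by (simp add: Gs)
qed

text \<open>
  The general bound, except for the critical exponent, where the second term can be dropped. The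
  exponent \<open>\<delta>\<close> does not depend on \<open>\<sigma>\<close>.
\<close>

lemma power_truncation:
  assumes \<alpha>: "0 < \<alpha>" "\<alpha> \<le> 1"
  shows "\<exists>\<delta>>0. \<forall>\<sigma>>0. \<exists>C>0. \<forall>n\<ge>1.
     \<bar>(\<Sum>k=0..n. g_coeff \<alpha> (n - k) * real k powr \<sigma>) - Gamma (\<sigma> + 1) / Gamma (\<sigma> + 1 - \<alpha>) * real n powr (\<sigma> - \<alpha>)\<bar>
      \<le> C * (real n powr (- 1 - \<delta>) + (if \<sigma> = 1 + \<alpha> then 0 else real n powr (\<sigma> - \<alpha> - 2)))"
proof -
  obtain \<delta>1 C1 where d1: "\<delta>1 > 0" and C1: "C1 > 0" "\<And>n. n \<ge> 1 \<Longrightarrow> \<bar>(\<Sum>k=0..n. g_coeff \<alpha> (n - k) * real k powr (1 + \<alpha>)) - Gamma (2 + \<alpha>) * real n\<bar>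
     \<le> C1 * real n powr (- 1 - \<delta>1)"
    using resonant_power_truncation[OF \<alpha>] by blast
  define \<delta> where "\<delta> = min \<delta>1 (\<alpha> / 2)"
  have d: "\<delta> > 0" "\<delta> \<le> \<delta>1" "\<delta> \<le> \<alpha> / 2" using d1 \<alpha> by (auto simp: \<delta>_def)
  show ?thesis
  proof (rule exI[of _ \<delta>], intro conjI allI impI d(1))
    fix \<sigma> :: real assume \<sigma>: "\<sigma> > 0"
    show "\<exists>C>0. \<forall>n\<ge>1. \<bar>(\<Sum>k=0..n. g_coeff \<alpha> (n - k) * real k powr \<sigma>) - Gamma (\<sigma> + 1) / Gamma (\<sigma> + 1 - \<alpha>) * real n powr (\<sigma> - \<alpha>)\<bar>
      \<le> C * (real n powr (- 1 - \<delta>) + (if \<sigma> = 1 + \<alpha> then 0 else real n powr (\<sigma> - \<alpha> - 2)))"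
    proof (cases "\<sigma> = 1 + \<alpha>")
      case True
      have G: "Gamma (\<sigma> + 1) / Gamma (\<sigma> + 1 - \<alpha>) * real n powr (\<sigma> - \<alpha>) = Gamma (2 + \<alpha>) * real n" for n
        using True Gamma_numeral[of "num.Bit0 num.One", where ?'a = real] by (simp add: add_ac)
      have "\<bar>(\<Sum>k=0..n. g_coeff \<alpha> (n - k) * real k powr \<sigma>) - Gamma (\<sigma> + 1) / Gamma (\<sigma> + 1 - \<alpha>) * real n powr (\<sigma> - \<alpha>)\<bar> \<le> C1 * real n powr (- 1 - \<delta>)"
        if n: "n \<ge> 1" for n
      proof -
        have "C1 * real n powr (- 1 - \<delta>1) \<le> C1 * real n powr (- 1 - \<delta>)"
          using d n C1(1) by (intro mult_left_mono powr_mono) auto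
        then show ?thesis unfolding G using C1(2)[OF n] True by simp
      qed
      then show ?thesis using True C1(1) by (intro exI[of _ C1]) auto
    next
      case False
      obtain C where C: "C > 0" "\<And>n B D. n \<ge> 1 \<Longrightarrow> power_like \<sigma> B (real n) D \<Longrightarrow>
        \<bar>(\<Sum>k=0..n. g_coeff \<alpha> (n - k) * D 0 (real k)) - caputo_value \<alpha> (D 1) (real n)\<bar>
        \<le> C * B * (real n powr (- 1 - \<alpha> / 2) + real n powr (\<sigma> - \<alpha> - 2))"
        using truncation_error_bound[OF \<alpha> \<sigma>] by blast
      define B where "B = (\<Sum>j\<le>3. \<bar>\<Prod>l<j. \<sigma> - real l\<bar>)"
      have "B > 0"
      proof -
        have "\<bar>\<Prod>l<0. \<sigma> - real l\<bar> \<le> B" unfolding B_def by (rule member_le_sum) auto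
        then show ?thesis by simp
      qed
      have "\<bar>(\<Sum>k=0..n. g_coeff \<alpha> (n - k) * real k powr \<sigma>) - Gamma (\<sigma> + 1) / Gamma (\<sigma> + 1 - \<alpha>) * real n powr (\<sigma> - \<alpha>)\<bar> \<le> C * B * (real n powr (- 1 - \<delta>) + real n powr (\<sigma> - \<alpha> - 2))"
        if n: "n \<ge> 1" for n
      proof -
        have "\<bar>(\<Sum>k=0..n. g_coeff \<alpha> (n - k) * real k powr \<sigma>) - Gamma (\<sigma> + 1) / Gamma (\<sigma> + 1 - \<alpha>) * real n powr (\<sigma> - \<alpha>)\<bar>
          \<le> C * B * (real n powr (- 1 - \<alpha> / 2) + real n powr (\<sigma> - \<alpha> - 2))"
          using C(2)[OF n power_like_powr[OF \<sigma>]] caputo_value_power[OF \<alpha> \<sigma>, of "real n"] n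
          by (simp add: power_deriv_0 B_def)
        also have "\<dots> \<le> C * B * (real n powr (- 1 - \<delta>) + real n powr (\<sigma> - \<alpha> - 2))"
          using C(1) \<open>B > 0\<close> n d by (intro mult_left_mono add_mono powr_mono) auto
        finally show ?thesis .
      qed
      then show ?thesis using False C(1) \<open>B > 0\<close> by (intro exI[of _ "C * B"]) auto
    qed
  qed
qed

lemma caputo_integrable:
  assumes "0 < \<alpha>" "\<alpha> < 1" "t > 0" and D: "power_like \<sigma> B t D"
  shows "(\<lambda>s. (t - s) powr (- \<alpha>) * D 1 s) integrable_on {0..t}"
proof (rule has_integral_integrable, rule caputo_integral_by_parts[where v = "D 0" and d = "t/2" and ?v2.0 = "D 2"])
  have "continuous_on {0<..t} (D 1)" "continuous_on {0<..t} (D 2)"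
    using D unfolding power_like_def by auto
  note c = this
  show "continuous_on {t/2..t} (D 1)" "continuous_on {t/2..t} (D 2)"
    by (rule continuous_on_subset[OF c(1)], use assms(3) in force, rule continuous_on_subset[OF c(2)], use assms(3) in force)
  fix s assume "s \<in> {0<..<t}"
  then show "(D 0 has_real_derivative D 1 s) (at s)" "(D 1 has_real_derivative D 2 s) (at s)"
    using D unfolding power_like_def by (auto simp: numeral_2_eq_2)
qed (use assms in \<open>auto simp: power_like_def\<close>)

lemma power_like_scale:
  assumes "\<tau> > 0" "power_like \<sigma> B (\<tau> * t) D"
  shows "power_like \<sigma> (B * \<tau> powr \<sigma>) t (\<lambda>i s. \<tau> ^ i * D i (\<tau> * s))"
  unfolding power_like_def
proof (intro conjI allI impI ballI)
  note D = assms(2)[unfolded power_like_def]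
  show "\<tau> ^ 0 * D 0 (\<tau> * 0) = 0" using D by simp
  have "continuous_on {0..t} (\<lambda>s. D 0 (\<tau> * s))"
    by (rule continuous_on_compose2[of "{0..\<tau> * t}" "D 0"])
      (use D assms in \<open>auto intro!: continuous_intros mult_left_mono\<close>)
  then show "continuous_on {0..t} (\<lambda>s. \<tau> ^ 0 * D 0 (\<tau> * s))" by simp
  fix i :: nat
  show "continuous_on {0<..t} (\<lambda>s. \<tau> ^ i * D i (\<tau> * s))" if "i \<le> 3"
  proof (intro continuous_on_mult continuous_on_const)
    show "continuous_on {0<..t} (\<lambda>s. D i (\<tau> * s))"
      by (rule continuous_on_compose2[of "{0<..\<tau> * t}" "D i"])
        (use D assms that in \<open>auto intro!: continuous_intros mult_left_mono\<close>)
  qed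
  show "\<bar>\<tau> ^ i * D i (\<tau> * s)\<bar> \<le> B * \<tau> powr \<sigma> * s powr (\<sigma> - real i)" if "i \<le> 3" "s \<in> {0<..t}" for s
  proof -
    have "\<tau> * s \<in> {0<..\<tau> * t}" using that assms by auto
    then have "\<bar>D i (\<tau> * s)\<bar> \<le> B * (\<tau> * s) powr (\<sigma> - real i)" using D that by blast
    then have "\<tau> ^ i * \<bar>D i (\<tau> * s)\<bar> \<le> \<tau> ^ i * (B * (\<tau> * s) powr (\<sigma> - real i))"
      using assms by (intro mult_left_mono) auto
    also have "\<dots> = B * (\<tau> powr real i * \<tau> powr (\<sigma> - real i)) * s powr (\<sigma> - real i)"
      using assms that by (simp add: powr_mult powr_realpow)
    also have "\<tau> powr real i * \<tau> powr (\<sigma> - real i) = \<tau> powr \<sigma>" by (simp add: powr_add[symmetric])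
    finally show ?thesis using assms by (simp add: abs_mult)
  qed
  show "((\<lambda>s. \<tau> ^ i * D i (\<tau> * s)) has_real_derivative \<tau> ^ Suc i * D (Suc i) (\<tau> * s)) (at s)" if "i < 3" "s \<in> {0<..<t}" for s
  proof -
    have "\<tau> * s \<in> {0<..<\<tau> * t}" using that assms by auto
    then have "(D i has_real_derivative D (Suc i) (\<tau> * s)) (at (\<tau> * s))" using D that by blast
    then have "((\<lambda>s. D i (\<tau> * s)) has_real_derivative D (Suc i) (\<tau> * s) * \<tau>) (at s)"
      by (rule DERIV_chain2) (auto intro!: derivative_eq_intros)
    from DERIV_cmult[OF this, of "\<tau> ^ i"] show ?thesis by (simp add: mult_ac)
  qed
qed

lemma caputo_value_scale:
  assumes \<alpha>: "0 < \<alpha>" "\<alpha> \<le> 1" and "\<tau> > 0" "t > 0" "power_like \<sigma> B (\<tau> * t) D"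
  shows "caputo_value \<alpha> (\<lambda>s. \<tau> * D 1 (\<tau> * s)) t = \<tau> powr \<alpha> * caputo_value \<alpha> (D 1) (\<tau> * t)"
proof (cases "\<alpha> = 1")
  case True
  then show ?thesis using assms by (simp add: caputo_value_def)
next
  case False
  define I where "I = integral {0..\<tau> * t} (\<lambda>s. (\<tau> * t - s) powr (- \<alpha>) * D 1 s)"
  have "((\<lambda>s. (\<tau> * t - s) powr (- \<alpha>) * D 1 s) has_integral I) {0..\<tau> * t}"
    unfolding I_def by (intro integrable_integral caputo_integrable[where \<sigma> = \<sigma> and B = B]) (use assms False in auto)
  then have "((\<lambda>s. (\<tau> * t - \<tau> * s) powr (- \<alpha>) * D 1 (\<tau> * s)) has_integral (1 / \<bar>\<tau>\<bar>) *\<^sub>R I) ((\<lambda>x. x / \<tau>) ` {0..\<tau> * t})"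
    by (rule has_integral_stretch_real) (use assms in auto)
  moreover have "(\<lambda>x. x / \<tau>) ` {0..\<tau> * t} = {0..t}"
  proof -
    have "(\<lambda>x. x / \<tau>) ` {0..\<tau> * t} = (\<lambda>x. (1/\<tau>) * x) ` {0..\<tau> * t}" by (intro image_cong) auto
    then show ?thesis using assms image_mult_atLeastAtMost[of "1/\<tau>" 0 "\<tau> * t"] by simp
  qed
  ultimately have "((\<lambda>s. (\<tau> * t - \<tau> * s) powr (- \<alpha>) * D 1 (\<tau> * s)) has_integral I / \<tau>) {0..t}"
    using assms by simp
  then have "((\<lambda>s. \<tau> powr (1 + \<alpha>) * ((\<tau> * t - \<tau> * s) powr (- \<alpha>) * D 1 (\<tau> * s))) has_integral \<tau> powr (1 + \<alpha>) * (I / \<tau>)) {0..t}"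
    by (rule has_integral_mult_right)
  then have "((\<lambda>s. (t - s) powr (- \<alpha>) * (\<tau> * D 1 (\<tau> * s))) has_integral \<tau> powr (1 + \<alpha>) * (I / \<tau>)) {0..t}"
  proof (rule has_integral_eq[rotated])
    fix s assume s: "s \<in> {0..t}"
    have "(\<tau> * t - \<tau> * s) powr (- \<alpha>) = \<tau> powr (- \<alpha>) * (t - s) powr (- \<alpha>)"
      using s assms powr_mult[of \<tau> "t - s" "- \<alpha>"] by (simp add: right_diff_distrib)
    moreover have "\<tau> powr (1 + \<alpha>) * \<tau> powr (- \<alpha>) = \<tau>"
      using assms by (simp add: powr_add[symmetric])
    ultimately show "\<tau> powr (1 + \<alpha>) * ((\<tau> * t - \<tau> * s) powr (- \<alpha>) * D 1 (\<tau> * s)) = (t - s) powr (- \<alpha>) * (\<tau> * D 1 (\<tau> * s))"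
      by (metis mult.assoc mult.left_commute)
  qed
  then have "integral {0..t} (\<lambda>s. (t - s) powr (- \<alpha>) * (\<tau> * D 1 (\<tau> * s))) = \<tau> powr \<alpha> * I"
    using assms by (simp add: integral_unique powr_add)
  then show ?thesis using False by (simp add: caputo_value_def I_def)
qed

text \<open>
  The step size \<open>\<tau>\<close> is removed by substituting \<open>\<tau> * s\<close> for \<open>s\<close>, which multiplies the constant \<open>B\<close> by
  \<open>\<tau> powr \<sigma>\<close> and the Caputo derivative by \<open>\<tau> powr \<alpha>\<close>.
\<close>

lemma truncation_error_scaled:
  assumes \<alpha>: "0 < \<alpha>" "\<alpha> \<le> 1" and \<sigma>: "\<sigma> > 0"
  shows "\<exists>C>0. \<forall>n \<tau> B D. n \<ge> 1 \<longrightarrow> \<tau> > 0 \<longrightarrow> power_like \<sigma> B (\<tau> * real n) D \<longrightarrow>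
      \<bar>1 / \<tau> powr \<alpha> * (\<Sum>k=0..n. g_coeff \<alpha> (n - k) * D 0 (\<tau> * real k)) - caputo_value \<alpha> (D 1) (\<tau> * real n)\<bar>
        \<le> C * B * \<tau> powr (\<sigma> - \<alpha>) * (real n powr (- 1 - \<alpha> / 2) + real n powr (\<sigma> - \<alpha> - 2))"
proof -
  obtain C where C: "C > 0" "\<And>n B D. n \<ge> 1 \<Longrightarrow> power_like \<sigma> B (real n) D \<Longrightarrow>
        \<bar>(\<Sum>k=0..n. g_coeff \<alpha> (n - k) * D 0 (real k)) - caputo_value \<alpha> (D 1) (real n)\<bar>
        \<le> C * B * (real n powr (- 1 - \<alpha> / 2) + real n powr (\<sigma> - \<alpha> - 2))"
    using truncation_error_bound[OF \<alpha> \<sigma>] by blast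
  have "\<bar>1 / \<tau> powr \<alpha> * (\<Sum>k=0..n. g_coeff \<alpha> (n - k) * D 0 (\<tau> * real k)) - caputo_value \<alpha> (D 1) (\<tau> * real n)\<bar>
        \<le> C * B * \<tau> powr (\<sigma> - \<alpha>) * (real n powr (- 1 - \<alpha> / 2) + real n powr (\<sigma> - \<alpha> - 2))"
    if n: "n \<ge> 1" and t: "\<tau> > 0" and D: "power_like \<sigma> B (\<tau> * real n) D" for n \<tau> B D
  proof -
    define S where "S = (\<Sum>k=0..n. g_coeff \<alpha> (n - k) * D 0 (\<tau> * real k))"
    define V where "V = caputo_value \<alpha> (D 1) (\<tau> * real n)"
    define p where "p = real n powr (- 1 - \<alpha> / 2) + real n powr (\<sigma> - \<alpha> - 2)"
    have "\<bar>S - \<tau> powr \<alpha> * V\<bar> \<le> C * (B * \<tau> powr \<sigma>) * p"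
      using C(2)[OF n power_like_scale[OF t D]] caputo_value_scale[OF \<alpha> t _ D] n
      by (simp add: S_def V_def p_def)
    then have "\<bar>S - \<tau> powr \<alpha> * V\<bar> / \<tau> powr \<alpha> \<le> (C * (B * \<tau> powr \<sigma>) * p) / \<tau> powr \<alpha>"
      by (intro divide_right_mono) auto
    also have "\<bar>S - \<tau> powr \<alpha> * V\<bar> / \<tau> powr \<alpha> = \<bar>(S - \<tau> powr \<alpha> * V) / \<tau> powr \<alpha>\<bar>" by simp
    also have "(S - \<tau> powr \<alpha> * V) / \<tau> powr \<alpha> = 1 / \<tau> powr \<alpha> * S - V" using t by (simp add: diff_divide_distrib)
    also have "(C * (B * \<tau> powr \<sigma>) * p) / \<tau> powr \<alpha> = C * B * \<tau> powr (\<sigma> - \<alpha>) * p"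
      by (simp add: powr_diff)
    finally show ?thesis by (simp add: S_def V_def p_def)
  qed
  then show ?thesis using C(1) by blast
qed

section \<open>Generalized Vandermonde systems and the starting weights\<close>

text \<open>
  Rolle's theorem between consecutive zeros.
\<close>

lemma rolle_counting:
  fixes f f' :: "real \<Rightarrow> real"
  assumes X: "finite X" "X \<subseteq> {0<..}" "card X = Suc n"
    and der: "\<And>x. x > 0 \<Longrightarrow> (f has_real_derivative f' x) (at x)"
    and zero: "\<And>x. x \<in> X \<Longrightarrow> f x = 0"
  shows "\<exists>Z. finite Z \<and> Z \<subseteq> {0<..} \<and> card Z = n \<and> (\<forall>z\<in>Z. f' z = 0)"
proof -
  define xs where "xs = sorted_list_of_set X"
  have xs: "length xs = Suc n" "set xs = X" "sorted_wrt (<) xs"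
    using X by (auto simp: xs_def)
  have less: "xs ! i < xs ! j" if "i < j" "j \<le> n" for i j
    by (rule sorted_wrt_nth_less[OF xs(3) that(1)]) (use that xs(1) in simp)
  have "\<exists>z. xs ! i < z \<and> z < xs ! Suc i \<and> f' z = 0" if i: "i < n" for i
  proof -
    have mem: "xs ! i \<in> X" "xs ! Suc i \<in> X" using xs(1,2) i nth_mem[of i xs] nth_mem[of "Suc i" xs] by auto
    then have "xs ! i > 0" using X by auto
    have "\<exists>z>xs ! i. z < xs ! Suc i \<and> f (xs ! Suc i) - f (xs ! i) = (xs ! Suc i - xs ! i) * f' z"
      using less[of i "Suc i"] i \<open>xs ! i > 0\<close> der by (intro MVT2) auto
    then obtain z where "xs ! i < z" "z < xs ! Suc i" "f (xs ! Suc i) - f (xs ! i) = (xs ! Suc i - xs ! i) * f' z"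
      by blast
    moreover have "xs ! Suc i - xs ! i \<noteq> 0" using less[of i "Suc i"] i by simp
    ultimately show ?thesis using zero[OF mem(1)] zero[OF mem(2)] by auto
  qed
  then obtain z where z: "\<And>i. i < n \<Longrightarrow> xs ! i < z i" "\<And>i. i < n \<Longrightarrow> z i < xs ! Suc i" "\<And>i. i < n \<Longrightarrow> f' (z i) = 0"
    by metis
  have zless: "z i < z j" if "i < j" "j < n" for i j
  proof -
    have "z i < xs ! Suc i" using z that by auto
    also have "xs ! Suc i \<le> xs ! j" using less[of "Suc i" j] that by (cases "Suc i = j") auto
    also have "xs ! j < z j" using z that by auto
    finally show ?thesis .
  qed
  have "inj_on z {..<n}"
  proof (rule inj_onI)
    fix i j assume "i \<in> {..<n}" "j \<in> {..<n}" "z i = z j"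
    then show "i = j" using zless[of i j] zless[of j i] by (cases i j rule: linorder_cases) auto
  qed
  moreover have "z i > 0" if "i < n" for i
  proof -
    have "xs ! i \<in> X" using xs(1,2) that nth_mem[of i xs] by auto
    then have "xs ! i > 0" using X by auto
    then show ?thesis using z(1)[OF that] by linarith
  qed
  ultimately show ?thesis using z(3)
    by (intro exI[of _ "z ` {..<n}"]) (auto simp: card_image)
qed

text \<open>
  Induction as in Descartes' rule: dividing by one of the powers and differentiating removes one term
  and, by Rolle's theorem, at most one zero.
\<close>

lemma generalized_polynomial_zeros:
  fixes a e :: "'a \<Rightarrow> real"
  assumes "finite R" "inj_on e R" "finite X" "X \<subseteq> {0<..}" "card X = card R"
    and "\<And>x. x \<in> X \<Longrightarrow> (\<Sum>r\<in>R. a r * x powr e r) = 0"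
  shows "\<forall>r\<in>R. a r = 0"
  using assms
proof (induction R arbitrary: a e X rule: finite_induct)
  case (insert r0 R)
  define f where "f x = a r0 + (\<Sum>r\<in>R. a r * x powr (e r - e r0))" for x
  define f' where "f' x = (\<Sum>r\<in>R. (a r * (e r - e r0)) * x powr (e r - e r0 - 1))" for x
  have der: "(f has_real_derivative f' x) (at x)" if "x > 0" for x
    unfolding f_def[abs_def] f'_def using that
    by (auto intro!: derivative_eq_intros simp: mult_ac)
  have fz: "f x = 0" if "x \<in> X" for x
  proof -
    have x: "x > 0" using that insert by auto
    have "(\<Sum>r\<in>insert r0 R. a r * x powr e r) = x powr e r0 * f x"
    proof -
      have "a r * x powr e r = x powr e r0 * (a r * x powr (e r - e r0))" for r
        by (simp add: powr_add[symmetric] mult.left_commute)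
      then have "(\<Sum>r\<in>R. a r * x powr e r) = x powr e r0 * (\<Sum>r\<in>R. a r * x powr (e r - e r0))"
        by (simp only: sum_distrib_left)
      then show ?thesis using insert.hyps
        by (simp add: f_def distrib_left mult.commute)
    qed
    then show ?thesis using insert.prems(5)[OF that] x by simp
  qed
  have "card X = Suc (card R)" using insert by simp
  then obtain Z where Z: "finite Z" "Z \<subseteq> {0<..}" "card Z = card R" "\<forall>z\<in>Z. f' z = 0"
    using rolle_counting[OF insert.prems(2,3) _ der fz] by blast
  have "inj_on (\<lambda>r. e r - e r0 - 1) R" using insert.prems(1) by (auto simp: inj_on_def)
  from insert.IH[OF this Z(1,2,3), of "\<lambda>r. a r * (e r - e r0)"]
  have z: "\<forall>r\<in>R. a r * (e r - e r0) = 0" using Z(4) by (simp add: f'_def)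
  have a0: "a r = 0" if "r \<in> R" for r
  proof -
    have "e r \<noteq> e r0" using insert.prems(1) that insert.hyps by (auto simp: inj_on_def)
    then show ?thesis using z that by auto
  qed
  have "X \<noteq> {}" using \<open>card X = Suc (card R)\<close> by auto
  then obtain x where "x \<in> X" by blast
  then have "f x = 0" by (rule fz)
  then have "a r0 = 0" using a0 by (simp add: f_def)
  then show ?case using a0 by auto
qed simp

text \<open>
  Generalized Vandermonde matrices are invertible. In the induction step, a generalized polynomial
  that vanishes at all points but \<open>x0\<close> cannot vanish there too, so a multiple of it corrects the value at \<open>x0\<close>.
\<close>

lemma generalized_polynomial_interpolation:
  fixes e :: "'a \<Rightarrow> real" and y :: "real \<Rightarrow> real"
  assumes "finite R" "inj_on e R" "finite X" "X \<subseteq> {0<..}" "card X = card R"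
  shows "\<exists>a. \<forall>x\<in>X. (\<Sum>r\<in>R. a r * x powr e r) = y x"
  using assms
proof (induction R arbitrary: X y rule: finite_induct)
  case empty
  then show ?case by auto
next
  case (insert r0 R)
  have "card X = Suc (card R)" using insert by simp
  then obtain x0 X' where X: "X = insert x0 X'" "x0 \<notin> X'" "card X' = card R"
    using card_eq_SucD[of X "card R"] by auto
  have X': "finite X'" "X' \<subseteq> {0<..}" and injR: "inj_on e R" using insert X by auto
  obtain b where b: "\<forall>x\<in>X'. (\<Sum>r\<in>R. b r * x powr e r) = - (x powr e r0)"
    using insert.IH[OF injR X' X(3), of "\<lambda>x. - (x powr e r0)"] by blast
  obtain a where a: "\<forall>x\<in>X'. (\<Sum>r\<in>R. a r * x powr e r) = y x"
    using insert.IH[OF injR X' X(3), of y] by blast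
  define p where "p x = x powr e r0 + (\<Sum>r\<in>R. b r * x powr e r)" for x
  have p: "p x = 0" if "x \<in> X'" for x using b that by (simp add: p_def)
  have ins: "(\<Sum>r\<in>insert r0 R. (c(r0 := c0)) r * x powr e r) = c0 * x powr e r0 + (\<Sum>r\<in>R. c r * x powr e r)" for c c0 x
  proof -
    have "(\<Sum>r\<in>R. (c(r0 := c0)) r * x powr e r) = (\<Sum>r\<in>R. c r * x powr e r)"
      using insert.hyps by (intro sum.cong) auto
    then show ?thesis using insert.hyps by simp
  qed
  have "p x0 \<noteq> 0"
  proof
    assume "p x0 = 0"
    then have "(\<Sum>r\<in>insert r0 R. (b(r0 := 1)) r * x powr e r) = 0" if "x \<in> X" for x
      using that X p unfolding ins by (auto simp: p_def)
    then have "\<forall>r\<in>insert r0 R. (b(r0 := 1)) r = 0"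
      using insert by (intro generalized_polynomial_zeros[of "insert r0 R" e X]) auto
    then show False by auto
  qed
  \<comment> \<open>\<open>p\<close> vanishes on \<open>X'\<close>, so adding \<open>l * p\<close> only changes the value at \<open>x0\<close>.\<close>
  define l where "l = (y x0 - (\<Sum>r\<in>R. a r * x0 powr e r)) / p x0"
  have "(\<Sum>r\<in>insert r0 R. ((\<lambda>r. a r + l * b r)(r0 := l)) r * x powr e r) = y x" if "x \<in> X" for x
  proof -
    have "(\<Sum>r\<in>insert r0 R. ((\<lambda>r. a r + l * b r)(r0 := l)) r * x powr e r) = (\<Sum>r\<in>R. a r * x powr e r) + l * p x"
      unfolding ins by (simp add: p_def algebra_simps sum.distrib sum_distrib_left)
    also have "\<dots> = y x"
    proof (cases "x = x0")
      case True
      then show ?thesis using \<open>p x0 \<noteq> 0\<close> by (simp add: l_def)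
    next
      case False
      then have "x \<in> X'" using that X by auto
      then show ?thesis using a p by simp
    qed
    finally show ?thesis .
  qed
  then show ?case by blast
qed

text \<open>
  If \<open>b\<close> are the coefficients of the generalized polynomial that is \<open>1\<close> at \<open>k\<close> and \<open>0\<close> at the other points of
  \<open>{1..m}\<close>, then \<open>w n k\<close> is the combination with coefficients \<open>b\<close> of the right-hand sides that
  define the weights. These are the truncation errors of the powers on the unit grid.
\<close>

lemma starting_weights_bound:
  assumes \<alpha>: "0 < \<alpha>" "\<alpha> \<le> 1" and w: "starting_weights \<alpha> \<sigma> m w"
    and \<sigma>: "\<And>r. r \<in> {1..m} \<Longrightarrow> \<sigma> r > 0" and inj: "inj_on \<sigma> {1..m}"
  shows "\<exists>\<delta>>0. \<exists>C>0. \<forall>n\<ge>1. \<forall>k\<in>{1..m}. \<bar>w n k\<bar>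
     \<le> C * (real n powr (- 1 - \<delta>) + (\<Sum>r\<in>{r\<in>{1..m}. \<sigma> r \<noteq> 1 + \<alpha>}. real n powr (\<sigma> r - \<alpha> - 2)))"
proof -
  obtain \<delta> where d: "\<delta> > 0" and tr: "\<And>s. s > 0 \<Longrightarrow> \<exists>C>0. \<forall>n\<ge>1.
     \<bar>(\<Sum>k=0..n. g_coeff \<alpha> (n - k) * real k powr s) - Gamma (s + 1) / Gamma (s + 1 - \<alpha>) * real n powr (s - \<alpha>)\<bar>
      \<le> C * (real n powr (- 1 - \<delta>) + (if s = 1 + \<alpha> then 0 else real n powr (s - \<alpha> - 2)))"
    using power_truncation[OF \<alpha>] by blast
  define R where "R r n = Gamma (\<sigma> r + 1) / Gamma (\<sigma> r + 1 - \<alpha>) * real n powr (\<sigma> r - \<alpha>)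
          - (\<Sum>k=0..n. g_coeff \<alpha> (n - k) * real k powr \<sigma> r)" for r n
  define P where "P n = real n powr (- 1 - \<delta>) + (\<Sum>r\<in>{r\<in>{1..m}. \<sigma> r \<noteq> 1 + \<alpha>}. real n powr (\<sigma> r - \<alpha> - 2))" for n
  have P0: "P n \<ge> 0" for n by (auto simp: P_def intro!: add_nonneg_nonneg sum_nonneg)
  have "\<exists>C>0. \<forall>n\<ge>1. \<bar>R r n\<bar> \<le> C * P n" if r: "r \<in> {1..m}" for r
  proof -
    obtain C where C: "C > 0" "\<And>n. n \<ge> 1 \<Longrightarrow>
     \<bar>(\<Sum>k=0..n. g_coeff \<alpha> (n - k) * real k powr \<sigma> r) - Gamma (\<sigma> r + 1) / Gamma (\<sigma> r + 1 - \<alpha>) * real n powr (\<sigma> r - \<alpha>)\<bar>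
      \<le> C * (real n powr (- 1 - \<delta>) + (if \<sigma> r = 1 + \<alpha> then 0 else real n powr (\<sigma> r - \<alpha> - 2)))"
      using tr[OF \<sigma>[OF r]] by blast
    have "\<bar>R r n\<bar> \<le> C * P n" if "n \<ge> 1" for n
    proof -
      have "(if \<sigma> r = 1 + \<alpha> then 0 else real n powr (\<sigma> r - \<alpha> - 2)) \<le> (\<Sum>r\<in>{r\<in>{1..m}. \<sigma> r \<noteq> 1 + \<alpha>}. real n powr (\<sigma> r - \<alpha> - 2))"
      proof (cases "\<sigma> r = 1 + \<alpha>")
        case False
        then have "real n powr (\<sigma> r - \<alpha> - 2) \<le> (\<Sum>r\<in>{r\<in>{1..m}. \<sigma> r \<noteq> 1 + \<alpha>}. real n powr (\<sigma> r - \<alpha> - 2))"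
          by (intro member_le_sum) (use r in auto)
        then show ?thesis using False by simp
      qed (auto intro!: sum_nonneg)
      then have "C * (real n powr (- 1 - \<delta>) + (if \<sigma> r = 1 + \<alpha> then 0 else real n powr (\<sigma> r - \<alpha> - 2))) \<le> C * P n"
        unfolding P_def using C(1) by (intro mult_left_mono add_left_mono) auto
      then show ?thesis using C(2)[OF that] unfolding R_def by (simp add: abs_minus_commute)
    qed
    then show ?thesis using C(1) by blast
  qed
  then obtain C where C: "\<And>r. r \<in> {1..m} \<Longrightarrow> C r > 0" "\<And>r n. r \<in> {1..m} \<Longrightarrow> n \<ge> 1 \<Longrightarrow> \<bar>R r n\<bar> \<le> C r * P n"
    by metis
  define X where "X = real ` {1..m}"
  have X: "finite X" "X \<subseteq> {0<..}" "card X = card {1..m}" by (auto simp: X_def card_image)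
  have "\<exists>b. \<forall>x\<in>X. (\<Sum>r\<in>{1..m}. b r * x powr \<sigma> r) = (if x = real k then 1 else 0)" for k
    by (rule generalized_polynomial_interpolation[OF _ inj X]) auto
  then obtain b where b: "\<And>k. \<forall>x\<in>X. (\<Sum>r\<in>{1..m}. b k r * x powr \<sigma> r) = (if x = real k then 1 else 0)"
    by metis
  have wk: "w n k = (\<Sum>r=1..m. b k r * R r n)" if k: "k \<in> {1..m}" and n: "n \<ge> 1" for n k
  proof -
    have "(\<Sum>r=1..m. b k r * R r n) = (\<Sum>r=1..m. b k r * (\<Sum>l=1..m. w n l * real l powr \<sigma> r))"
      using w n unfolding starting_weights_def R_def by (intro sum.cong) auto
    also have "\<dots> = (\<Sum>r=1..m. \<Sum>l=1..m. w n l * (b k r * real l powr \<sigma> r))"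
      by (simp add: sum_distrib_left mult_ac)
    also have "\<dots> = (\<Sum>l=1..m. \<Sum>r=1..m. w n l * (b k r * real l powr \<sigma> r))"
      by (rule sum.swap)
    also have "\<dots> = (\<Sum>l=1..m. w n l * (if l = k then 1 else 0))"
    proof (rule sum.cong)
      fix l assume "l \<in> {1..m}"
      then have "(\<Sum>r=1..m. b k r * real l powr \<sigma> r) = (if real l = real k then 1 else 0)"
        using b[of k] by (auto simp: X_def)
      then show "(\<Sum>r=1..m. w n l * (b k r * real l powr \<sigma> r)) = w n l * (if l = k then 1 else 0)"
        by (simp add: sum_distrib_left[symmetric])
    qed simp
    also have "\<dots> = w n k" using k by (simp add: if_distrib[of "\<lambda>z. _ * z"] cong: if_cong)
    finally show ?thesis by simp
  qed
  define K where "K = (\<Sum>k=1..m. \<Sum>r=1..m. \<bar>b k r\<bar> * C r) + 1"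
  have "\<bar>w n k\<bar> \<le> K * P n" if k: "k \<in> {1..m}" and n: "n \<ge> 1" for n k
  proof -
    have "\<bar>w n k\<bar> \<le> (\<Sum>r=1..m. \<bar>b k r * R r n\<bar>)" unfolding wk[OF k n] by (rule sum_abs)
    also have "\<dots> \<le> (\<Sum>r=1..m. \<bar>b k r\<bar> * (C r * P n))"
      unfolding abs_mult by (intro sum_mono mult_left_mono C n) auto
    also have "\<dots> = (\<Sum>r=1..m. \<bar>b k r\<bar> * C r) * P n" by (simp add: sum_distrib_right mult.assoc)
    also have "(\<Sum>r=1..m. \<bar>b k r\<bar> * C r) \<le> (\<Sum>k=1..m. \<Sum>r=1..m. \<bar>b k r\<bar> * C r)"
    proof (rule member_le_sum[OF k, of "\<lambda>k. \<Sum>r=1..m. \<bar>b k r\<bar> * C r"])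
      fix x show "0 \<le> (\<Sum>r=1..m. \<bar>b x r\<bar> * C r)" using C(1) by (intro sum_nonneg mult_nonneg_nonneg) (auto intro: less_imp_le)
    qed simp
    then have "(\<Sum>r=1..m. \<bar>b k r\<bar> * C r) * P n \<le> K * P n" using P0[of n] by (intro mult_right_mono) (auto simp: K_def)
    finally show ?thesis .
  qed
  moreover have "(\<Sum>k=1..m. \<Sum>r=1..m. \<bar>b k r\<bar> * C r) \<ge> 0"
    using C(1) by (intro sum_nonneg mult_nonneg_nonneg) (auto intro: less_imp_le)
  then have "K > 0" by (simp add: K_def)
  ultimately show ?thesis using d unfolding P_def by (intro exI[of _ \<delta>] conjI exI[of _ K]) auto
qed

text \<open>
  Summation by parts. Convergence of the expansion of \<open>Y\<close> need not be absolute, so all estimates of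
  its tails rest on this inequality.
\<close>

section \<open>Series of increasing real powers\<close>

lemma abel_inequality:
  fixes b v :: "nat \<Rightarrow> real"
  assumes b: "\<And>q. q \<le> n \<Longrightarrow> \<bar>\<Sum>k<q. b k\<bar> \<le> M" and v: "\<And>k. v (Suc k) \<le> v k" "\<And>k. v k \<ge> 0"
  shows "\<bar>\<Sum>k<n. b k * v k\<bar> \<le> M * v 0"
proof -
  define B where "B q = (\<Sum>k<q. b k)" for q
  have parts: "(\<Sum>k<n. b k * v k) = B n * v n + (\<Sum>k<n. B (Suc k) * (v k - v (Suc k)))" for n
    by (induction n) (auto simp: B_def algebra_simps)
  have "\<bar>\<Sum>k<n. b k * v k\<bar> \<le> M * v n + (\<Sum>k<n. M * (v k - v (Suc k)))"
    unfolding parts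
  proof (rule abs_add_mono)
    show "\<bar>B n * v n\<bar> \<le> M * v n" using b[of n] v(2)[of n] by (simp add: B_def abs_mult mult_right_mono)
    have "\<bar>\<Sum>k<n. B (Suc k) * (v k - v (Suc k))\<bar> \<le> (\<Sum>k<n. \<bar>B (Suc k) * (v k - v (Suc k))\<bar>)" by (rule sum_abs)
    also have "\<dots> \<le> (\<Sum>k<n. M * (v k - v (Suc k)))"
    proof (rule sum_mono)
      fix k assume "k \<in> {..<n}"
      then have "\<bar>B (Suc k)\<bar> \<le> M" using b[of "Suc k"] by (simp add: B_def)
      then show "\<bar>B (Suc k) * (v k - v (Suc k))\<bar> \<le> M * (v k - v (Suc k))"
        unfolding abs_mult using v(1)[of k] by (simp add: mult_right_mono)
    qed
    finally show "\<bar>\<Sum>k<n. B (Suc k) * (v k - v (Suc k))\<bar> \<le> (\<Sum>k<n. M * (v k - v (Suc k)))" .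
  qed
  also have "\<dots> = M * v 0"
    by (simp only: sum_distrib_left[symmetric] sum_lessThan_telescope') (simp add: algebra_simps)
  finally show ?thesis .
qed

lemma abel_inequality_shift:
  fixes b v :: "nat \<Rightarrow> real"
  assumes b: "\<And>q. \<bar>\<Sum>k=p..<q. b k\<bar> \<le> M" and v: "\<And>k. v (Suc k) \<le> v k" "\<And>k. v k \<ge> 0"
  shows "\<bar>\<Sum>k=p..<q. b k * v k\<bar> \<le> M * v p"
proof (cases "p \<le> q")
  case True
  have shift: "(\<Sum>k=p..<p + n. f k) = (\<Sum>k<n. f (p + k))" for f :: "nat \<Rightarrow> real" and n
    by (rule sum.reindex_bij_witness[of _ "\<lambda>k. p + k" "\<lambda>k. k - p"]) auto
  have "\<bar>\<Sum>k<q - p. b (p + k) * v (p + k)\<bar> \<le> M * v (p + 0)"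
  proof (rule abel_inequality)
    fix r show "\<bar>\<Sum>k<r. b (p + k)\<bar> \<le> M" using b[of "p + r"] by (simp add: shift)
  qed (use v in auto)
  then show ?thesis using shift[of "\<lambda>k. b k * v k" "q - p"] True by simp
next
  case False
  have "M \<ge> 0" using b[of p] by simp
  then show ?thesis using False v by simp
qed

lemma abel_test:
  fixes b v :: "nat \<Rightarrow> real"
  assumes b: "summable b" and v: "\<And>k. v (Suc k) \<le> v k" "\<And>k. v k \<ge> 0"
  shows "summable (\<lambda>k. b k * v k)"
  unfolding summable_Cauchy
proof (intro allI impI)
  fix e :: real assume e: "e > 0"
  define e' where "e' = e / (2 * (v 0 + 1))"
  have v0: "v 0 \<ge> 0" by (rule v)
  have e': "e' > 0" using e v0 by (simp add: e'_def)
  obtain N where N: "\<And>m n. m \<ge> N \<Longrightarrow> norm (sum b {m..<n}) < e'"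
    using b e' unfolding summable_Cauchy by blast
  have vle: "v m \<le> v 0" for m by (induction m) (use v(1) order_trans in auto)
  have "norm (\<Sum>k=m..<n. b k * v k) < e" if "m \<ge> N" for m n
  proof -
    have "\<bar>\<Sum>k=m..<n. b k * v k\<bar> \<le> e' * v m"
      by (rule abel_inequality_shift) (use N[OF that] v in \<open>auto intro: less_imp_le\<close>)
    also have "\<dots> \<le> e' * (v 0 + 1)" using vle[of m] e' by (intro mult_left_mono) auto
    also have "\<dots> = e / 2" using v0 by (simp add: e'_def divide_simps)
    also have "\<dots> < e" using e by simp
    finally show ?thesis by simp
  qed
  then show "\<exists>N. \<forall>m\<ge>N. \<forall>n. norm (\<Sum>k=m..<n. b k * v k) < e" by blast
qed

text \<open>
  The factor \<open>s * \<rho> powr s\<close> is not monotone in \<open>s\<close>. It is the difference of \<open>g s\<close> and \<open>h s\<close>, where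
  \<open>h s = C * \<rho> powr (s / 2)\<close> decreases so fast that \<open>g\<close> decreases as well; Abel's test applies to both.
\<close>

lemma summable_times_exponent:
  fixes d s :: "nat \<Rightarrow> real"
  assumes d: "summable d" and s: "\<And>k. s k \<le> s (Suc k)" and \<rho>: "0 < \<rho>" "\<rho> < 1"
  shows "summable (\<lambda>k. d k * (s k * \<rho> powr s k))"
proof -
  define L where "L = - ln \<rho>"
  have L: "L > 0" using \<rho> by (simp add: L_def)
  define C where "C = (2 / L + 2 * \<bar>s 0\<bar>) * \<rho> powr (s 0 / 2)"
  have C: "C \<ge> 0" using L by (simp add: C_def)
  define h where "h x = C * \<rho> powr (x / 2)" for x
  define g where "g x = x * \<rho> powr x + h x" for x
  have s0: "s k \<ge> s 0" for k by (induction k) (use s order_trans in auto)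
  have half: "\<rho> powr x \<le> \<rho> powr (s 0 / 2) * \<rho> powr (x / 2)" if "x \<ge> s 0" for x
  proof -
    have "\<rho> powr x = \<rho> powr (x / 2) * \<rho> powr (x / 2)" by (simp add: powr_add[symmetric])
    moreover have "\<rho> powr (x / 2) \<le> \<rho> powr (s 0 / 2)" using \<rho> that by (intro powr_mono') auto
    ultimately show ?thesis by (simp add: mult_right_mono)
  qed
  have hdec: "h y \<le> h x" if "x \<le> y" for x y
    unfolding h_def using that \<rho> C by (intro mult_left_mono powr_mono') auto
  have gdec: "g y \<le> g x" if "s 0 \<le> x" "x \<le> y" for x y
  proof (rule DERIV_nonpos_imp_nonincreasing[OF that(2)])
    fix z assume z: "x \<le> z" "z \<le> y"
    have "(g has_real_derivative (\<rho> powr z + z * (\<rho> powr z * ln \<rho>)) + C * (\<rho> powr (z / 2) * ln \<rho> / 2)) (at z)"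
      unfolding g_def[abs_def] h_def using \<rho> by (auto intro!: derivative_eq_intros)
    moreover have "(\<rho> powr z + z * (\<rho> powr z * ln \<rho>)) + C * (\<rho> powr (z / 2) * ln \<rho> / 2) \<le> 0"
    proof -
      have "1 - z * L \<le> 1 + \<bar>s 0\<bar> * L"
      proof -
        have "- z \<le> \<bar>s 0\<bar>" using z that by linarith
        then have "- z * L \<le> \<bar>s 0\<bar> * L" using L by (intro mult_right_mono) auto
        then show ?thesis by simp
      qed
      then have "\<rho> powr z * (1 - z * L) \<le> \<rho> powr z * (1 + \<bar>s 0\<bar> * L)" by (intro mult_left_mono) auto
      also have "\<dots> \<le> (\<rho> powr (s 0 / 2) * \<rho> powr (z / 2)) * (1 + \<bar>s 0\<bar> * L)"
        using half[of z] z that L by (intro mult_right_mono) auto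
      also have "\<dots> = C * (\<rho> powr (z / 2) * L / 2)" using L by (simp add: C_def field_simps)
      finally show ?thesis by (simp add: L_def algebra_simps)
    qed
    ultimately show "\<exists>y. (g has_real_derivative y) (at z) \<and> y \<le> 0" by blast
  qed
  have gpos: "g x \<ge> 0" if "x \<ge> s 0" for x
  proof (cases "x \<ge> 0")
    case True
    then show ?thesis using C by (simp add: g_def h_def)
  next
    case False
    then have "\<bar>s 0\<bar> \<ge> - x" using that by linarith
    then have "- x * \<rho> powr x \<le> \<bar>s 0\<bar> * (\<rho> powr (s 0 / 2) * \<rho> powr (x / 2))"
      using half[OF that] False by (intro mult_mono) auto
    also have "\<dots> \<le> (2 / L + 2 * \<bar>s 0\<bar>) * (\<rho> powr (s 0 / 2) * \<rho> powr (x / 2))"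
      using L by (intro mult_right_mono) auto
    also have "\<dots> = h x" by (simp add: h_def C_def)
    finally show ?thesis by (simp add: g_def)
  qed
  have "summable (\<lambda>k. d k * g (s k))"
    by (rule abel_test[OF d]) (use gdec s s0 gpos in auto)
  moreover have "summable (\<lambda>k. d k * h (s k))"
    by (rule abel_test[OF d]) (use hdec s C in \<open>auto simp: h_def\<close>)
  ultimately have "summable (\<lambda>k. d k * g (s k) - d k * h (s k))" by (rule summable_diff)
  then show ?thesis by (simp add: g_def algebra_simps)
qed

lemma power_ratio_decreasing:
  fixes s :: "nat \<Rightarrow> real"
  assumes "\<And>k. s k \<le> s (Suc k)" "0 < \<rho>" "\<rho> \<le> 1"
  shows "\<rho> powr s (Suc k) \<le> \<rho> powr s k"
  using assms by (intro powr_mono') auto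

lemma power_series_summable:
  fixes c s :: "nat \<Rightarrow> real"
  assumes sum: "summable (\<lambda>k. c k * T powr s k)" and s: "\<And>k. s k \<le> s (Suc k)" and t: "0 < t" "t \<le> T"
  shows "summable (\<lambda>k. c k * t powr s k)"
proof -
  have "summable (\<lambda>k. (c k * T powr s k) * (t / T) powr s k)"
    by (rule abel_test[OF sum]) (use power_ratio_decreasing[of s "t/T"] s t in auto)
  then show ?thesis using t by (simp add: powr_divide)
qed

lemma power_series_bound:
  fixes c s :: "nat \<Rightarrow> real"
  assumes sum: "summable (\<lambda>k. c k * T powr s k)" and s: "\<And>k. s k \<le> s (Suc k)" and T: "T > 0"
  shows "\<exists>M\<ge>0. \<forall>t. 0 < t \<longrightarrow> t \<le> T \<longrightarrow> \<bar>\<Sum>k. c k * t powr s k\<bar> \<le> M * t powr s 0"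
proof -
  have "(\<lambda>n. \<Sum>k<n. c k * T powr s k) \<longlonglongrightarrow> (\<Sum>k. c k * T powr s k)" using summable_LIMSEQ[OF sum] .
  then obtain M where M: "M > 0" "\<And>n. \<bar>\<Sum>k<n. c k * T powr s k\<bar> \<le> M" using bounded_seq_from_limit by blast
  have "\<bar>\<Sum>k. c k * t powr s k\<bar> \<le> (M / T powr s 0) * t powr s 0" if t: "0 < t" "t \<le> T" for t
  proof -
    have eq: "c k * t powr s k = (c k * T powr s k) * (t / T) powr s k" for k using t by (simp add: powr_divide)
    have "\<bar>\<Sum>k<n. c k * t powr s k\<bar> \<le> M * (t / T) powr s 0" for n
      unfolding eq by (rule abel_inequality) (use M power_ratio_decreasing[of s "t/T"] s t in auto)
    moreover have "(\<lambda>n. \<bar>\<Sum>k<n. c k * t powr s k\<bar>) \<longlonglongrightarrow> \<bar>\<Sum>k. c k * t powr s k\<bar>"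
      by (intro tendsto_rabs summable_LIMSEQ power_series_summable[OF sum s t])
    ultimately have "\<bar>\<Sum>k. c k * t powr s k\<bar> \<le> M * (t / T) powr s 0"
      by (intro LIMSEQ_le_const2) auto
    then show ?thesis using t by (simp add: powr_divide)
  qed
  then show ?thesis using M(1) by (intro exI[of _ "M / T powr s 0"]) auto
qed

lemma power_series_derivative_summable:
  fixes c s :: "nat \<Rightarrow> real"
  assumes sum: "summable (\<lambda>k. c k * T powr s k)" and s: "\<And>k. s k \<le> s (Suc k)" and t: "0 < t" "t < T"
  shows "summable (\<lambda>k. c k * s k * t powr (s k - 1))"
proof -
  have "summable (\<lambda>k. (c k * T powr s k) * (s k * (t / T) powr s k))"
    by (rule summable_times_exponent[where s = s and d = "\<lambda>k. c k * T powr s k", OF sum s]) (use t in auto)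
  then have "summable (\<lambda>k. ((c k * T powr s k) * (s k * (t / T) powr s k)) / t)" by (rule summable_divide)
  moreover have "((c k * T powr s k) * (s k * (t / T) powr s k)) / t = c k * s k * t powr (s k - 1)" for k
    using t by (simp add: powr_divide powr_diff)
  ultimately show ?thesis by simp
qed

text \<open>
  The differentiated series converges at a point \<open>b\<close> beyond \<open>t\<close>. Relative to it the terms carry the
  decreasing factors \<open>(x / b) powr (s k - 1)\<close>, so Abel's inequality gives uniform convergence near \<open>t\<close>.
\<close>

lemma power_series_derivative:
  fixes c s :: "nat \<Rightarrow> real"
  assumes sum: "summable (\<lambda>k. c k * T powr s k)" and s: "\<And>k. s k \<le> s (Suc k)" and t: "0 < t" "t < T"
  shows "((\<lambda>t. \<Sum>k. c k * t powr s k) has_real_derivative (\<Sum>k. c k * s k * t powr (s k - 1))) (at t)"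
proof -
  define a where "a = t / 2"
  define b where "b = (t + T) / 2"
  have ab: "0 < a" "a < t" "t < b" "b < T" using t by (auto simp: a_def b_def)
  define S where "S = {a<..<b}"
  have sb: "summable (\<lambda>k. c k * s k * b powr (s k - 1))"
    by (rule power_series_derivative_summable[OF sum s]) (use ab in auto)
  have s0: "s k \<ge> s 0" for k by (induction k) (use s order_trans in auto)
  define Q where "Q = max 1 ((a / b) powr (s 0 - 1))"
  have Q: "Q > 0" by (simp add: Q_def)
  have "uniformly_convergent_on S (\<lambda>n x. \<Sum>i<n. c i * s i * x powr (s i - 1))"
  proof (rule Cauchy_uniformly_convergent, rule uniformly_Cauchy_onI')
    fix e :: real assume e: "e > 0"
    obtain N where N: "\<And>m n. m \<ge> N \<Longrightarrow> norm (sum (\<lambda>k. c k * s k * b powr (s k - 1)) {m..<n}) < e / (2 * Q)"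
      using sb[unfolded summable_Cauchy, rule_format, of "e / (2 * Q)"] e Q by auto
    have "dist (\<Sum>i<m. c i * s i * x powr (s i - 1)) (\<Sum>i<n. c i * s i * x powr (s i - 1)) < e"
      if x: "x \<in> S" and m: "m \<ge> N" "m < n" for x m n
    proof -
      have x': "0 < x" "x < b" "a < x" using x ab by (auto simp: S_def)
      have eq: "c k * s k * x powr (s k - 1) = (c k * s k * b powr (s k - 1)) * (x / b) powr (s k - 1)" for k
        using x' by (simp add: powr_divide)
      have xb: "0 < x / b" "x / b \<le> 1" using x' by auto
      have un: "{..<n} = {..<m} \<union> {m..<n}" "{..<m} \<inter> {m..<n} = {}" using m by auto
      have split: "(\<Sum>i<n. f i) = (\<Sum>i<m. f i) + (\<Sum>i=m..<n. f i)" for f :: "nat \<Rightarrow> real"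
        unfolding un(1) by (rule sum.union_disjoint) (use un in auto)
      have "dist (\<Sum>i<m. c i * s i * x powr (s i - 1)) (\<Sum>i<n. c i * s i * x powr (s i - 1)) = \<bar>\<Sum>i=m..<n. c i * s i * x powr (s i - 1)\<bar>"
        unfolding split by (simp add: dist_real_def)
      also have "\<dots> \<le> e / (2 * Q) * (x / b) powr (s m - 1)"
        unfolding eq
      proof (rule abel_inequality_shift)
        fix q show "\<bar>\<Sum>k=m..<q. c k * s k * b powr (s k - 1)\<bar> \<le> e / (2 * Q)" using N[OF m(1), of q] by simp
      qed (use power_ratio_decreasing[of "\<lambda>k. s k - 1" "x / b"] s xb in auto)
      also have "(x / b) powr (s m - 1) \<le> Q"
      proof -
        have "(x / b) powr (s m - 1) \<le> (x / b) powr (s 0 - 1)" using s0[of m] xb by (intro powr_mono') auto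
        also have "\<dots> \<le> Q"
        proof (cases "s 0 - 1 \<ge> 0")
          case True
          then have "(x / b) powr (s 0 - 1) \<le> 1" using xb by (intro powr_le1) auto
          then show ?thesis by (simp add: Q_def)
        next
          case False
          then have "(x / b) powr (s 0 - 1) \<le> (a / b) powr (s 0 - 1)"
            using x' ab by (intro powr_mono2') (auto intro: divide_right_mono)
          then show ?thesis by (simp add: Q_def)
        qed
        finally show ?thesis .
      qed
      then have "e / (2 * Q) * (x / b) powr (s m - 1) \<le> e / (2 * Q) * Q" using e Q by (intro mult_left_mono) auto
      also have "\<dots> < e" using e Q by simp
      finally show ?thesis .
    qed
    then show "\<exists>M. \<forall>x\<in>S. \<forall>m\<ge>M. \<forall>n>m. dist (\<Sum>i<m. c i * s i * x powr (s i - 1)) (\<Sum>i<n. c i * s i * x powr (s i - 1)) < e"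
      by blast
  qed
  then show ?thesis
  proof (rule has_field_derivative_series'(2)[rotated 2])
    show "convex S" "t \<in> S" "t \<in> interior S" using ab by (auto simp: S_def)
    show "summable (\<lambda>k. c k * t powr s k)" by (rule power_series_summable[OF sum s]) (use t in auto)
    fix k x assume "x \<in> S"
    then show "((\<lambda>x. c k * x powr s k) has_real_derivative c k * s k * x powr (s k - 1)) (at x within S)"
      using ab by (auto intro!: derivative_eq_intros simp: S_def)
  qed
qed

section \<open>The remainder of the expansion\<close>

lemma power_like_mono_interval:
  assumes "power_like \<sigma> B T D" "t \<le> T"
  shows "power_like \<sigma> B t D"
proof -
  have "{0..t} \<subseteq> {0..T}" "{0<..t} \<subseteq> {0<..T}" using assms by auto
  then show ?thesis using assms unfolding power_like_def by (auto elim: continuous_on_subset)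
qed

text \<open>
  On \<open>{0<..T/2}\<close> the tail of the expansion can be differentiated term by term, and Abel's inequality
  shows that its size is that of the first omitted power. Near \<open>T\<close> the differentiated series may
  diverge; there the bound comes from the continuity of the derivatives of \<open>Y\<close> on a compact interval.
\<close>

lemma expansion_remainder_power_like:
  fixes Y :: "real \<Rightarrow> real" and c \<sigma> :: "nat \<Rightarrow> real" and E :: "nat \<Rightarrow> real \<Rightarrow> real"
  assumes T: "T > 0"
    and \<sigma>: "\<And>k. k \<ge> 1 \<Longrightarrow> 0 < \<sigma> k \<and> \<sigma> k < \<sigma> (Suc k)"
    and ser: "\<And>t. t \<in> {0..T} \<Longrightarrow> (\<lambda>k. c (Suc k) * t powr \<sigma> (Suc k)) sums E 0 t"
    and der: "\<And>i t. i < 3 \<Longrightarrow> t \<in> {0<..T} \<Longrightarrow> (E i has_real_derivative E (Suc i) t) (at t within {0<..T})"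
    and cont: "\<And>i. i \<le> 3 \<Longrightarrow> continuous_on {0<..T} (E i)"
  shows "\<exists>B\<ge>0. power_like (\<sigma> (Suc K)) B T (\<lambda>i t. E i t - (\<Sum>k=1..K. c k * power_deriv (\<sigma> k) i t))"
proof -
  define L where "L i t = E i t - (\<Sum>k=1..K. c k * power_deriv (\<sigma> k) i t)" for i t
  define s where "s k = \<sigma> (Suc (k + K))" for k
  define p where "p i k = c (Suc (k + K)) * (\<Prod>l<i. s k - real l)" for i k
  define F where "F i t = (\<Sum>k. p i k * t powr (s k - real i))" for i t
  have smono: "s k - x \<le> s (Suc k) - x" for k x using \<sigma>[of "Suc (k + K)"] by (simp add: s_def)
  have p_Suc: "p (Suc i) k * t powr (s k - real (Suc i)) = p i k * (s k - real i) * t powr (s k - real i - 1)" for i k t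
    by (simp add: p_def diff_diff_eq add.commute)
  have base: "(\<lambda>k. p 0 k * t powr (s k - real 0)) sums L 0 t" if t: "t \<in> {0..T}" for t
  proof -
    have "(\<lambda>k. c (Suc (k + K)) * t powr \<sigma> (Suc (k + K))) sums (E 0 t - (\<Sum>k<K. c (Suc k) * t powr \<sigma> (Suc k)))"
      using sums_iff_shift[of "\<lambda>k. c (Suc k) * t powr \<sigma> (Suc k)" K "E 0 t - (\<Sum>k<K. c (Suc k) * t powr \<sigma> (Suc k))"] ser[OF t] by simp
    moreover have "(\<Sum>k<K. c (Suc k) * t powr \<sigma> (Suc k)) = (\<Sum>k=1..K. c k * power_deriv (\<sigma> k) 0 t)"
      by (simp add: sum.atLeast1_atMost_eq power_deriv_0)
    ultimately show ?thesis by (simp add: p_def s_def L_def)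
  qed
  have summ: "summable (\<lambda>k. p i k * t powr (s k - real i))" if "0 < t" "t < T" for i t
    using that
  proof (induction i arbitrary: t)
    case 0
    then show ?case using base[of t] by (auto dest: sums_summable)
  next
    case (Suc i)
    define b where "b = (t + T) / 2"
    have b: "0 < b" "b < T" "t < b" using Suc.prems by (auto simp: b_def)
    have "summable (\<lambda>k. p i k * (s k - real i) * t powr (s k - real i - 1))"
      by (rule power_series_derivative_summable[OF Suc.IH[OF b(1,2)]]) (use smono Suc.prems b in auto)
    then show ?case by (simp only: p_Suc)
  qed
  have Fder: "(F i has_real_derivative F (Suc i) t) (at t)" if t: "0 < t" "t < T" for i t
  proof -
    define b where "b = (t + T) / 2"
    have b: "0 < b" "b < T" "t < b" using t by (auto simp: b_def)
    show ?thesis unfolding F_def[abs_def] p_Suc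
      by (rule power_series_derivative[OF summ[OF b(1,2)]]) (use smono t b in auto)
  qed
  have Lder: "(L i has_real_derivative L (Suc i) t) (at t)" if "i < 3" "0 < t" "t < T" for i t
  proof -
    have "(E i has_real_derivative E (Suc i) t) (at t within {0<..<T})"
      by (rule has_field_derivative_subset[OF der]) (use that in auto)
    then have "(E i has_real_derivative E (Suc i) t) (at t)"
      using that by (simp add: at_within_open[of t "{0<..<T}"])
    then show ?thesis unfolding L_def[abs_def] using that
      by (intro DERIV_diff DERIV_sum DERIV_cmult power_deriv_derivative) auto
  qed
  have LF: "L i t = F i t" if "i \<le> 3" "0 < t" "t < T" for i t
    using that
  proof (induction i arbitrary: t)
    case 0
    then show ?case using base[of t] by (simp add: F_def sums_iff)
  next
    case (Suc i)
    have "(L i has_real_derivative L (Suc i) t) (at t)" using Suc.prems by (intro Lder) auto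
    moreover have "(L i has_real_derivative F (Suc i) t) (at t)"
      by (rule has_field_derivative_transform_within_open[OF Fder[OF Suc.prems(2,3)], of "{0<..<T}"])
        (use Suc in auto)
    ultimately show ?case by (rule DERIV_unique)
  qed
  have Lcont: "continuous_on {0<..T} (L i)" if "i \<le> 3" for i
  proof -
    have "continuous_on {0<..T} (power_deriv x i)" for x
      by (intro continuous_at_imp_continuous_on ballI DERIV_isCont[OF power_deriv_derivative]) auto
    then show ?thesis unfolding L_def[abs_def] using cont[OF that] by (intro continuous_intros)
  qed
  have "\<exists>B\<ge>0. \<forall>t\<in>{0<..T}. \<bar>L i t\<bar> \<le> B * t powr (\<sigma> (Suc K) - real i)" if i: "i \<le> 3" for i
  proof -
    define e where "e = \<sigma> (Suc K) - real i"
    have "\<exists>M\<ge>0. \<forall>t. 0 < t \<longrightarrow> t \<le> T/2 \<longrightarrow> \<bar>\<Sum>k. p i k * t powr (s k - real i)\<bar> \<le> M * t powr (s 0 - real i)"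
      by (rule power_series_bound) (use summ smono T in auto)
    then obtain M where M: "M \<ge> 0" "\<And>t. 0 < t \<Longrightarrow> t \<le> T/2 \<Longrightarrow> \<bar>F i t\<bar> \<le> M * t powr e"
      by (auto simp: F_def e_def s_def)
    have "compact (L i ` {T/2..T})"
      by (intro compact_continuous_image continuous_on_subset[OF Lcont[OF i]]) (use T in auto)
    then have "bounded (L i ` {T/2..T})" by (rule compact_imp_bounded)
    then obtain N where "\<forall>y\<in>L i ` {T/2..T}. norm y \<le> N" unfolding bounded_iff by blast
    then have N: "\<And>t. t \<in> {T/2..T} \<Longrightarrow> \<bar>L i t\<bar> \<le> N" by auto
    have N0: "N \<ge> 0" using N[of T] T by simp
    define B where "B = M + N * (2 powr \<bar>- e\<bar> * T powr (- e))"
    have "\<bar>L i t\<bar> \<le> B * t powr e" if t: "t \<in> {0<..T}" for t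
    proof (cases "t \<le> T / 2")
      case True
      then have "\<bar>L i t\<bar> \<le> M * t powr e" using LF[of i t] M(2)[of t] t i T by simp
      also have "\<dots> \<le> B * t powr e" unfolding B_def using N0 by (intro mult_right_mono) auto
      finally show ?thesis .
    next
      case False
      then have "t powr (- e) \<le> 2 powr \<bar>- e\<bar> * T powr (- e)" using t T by (intro powr_half_range) auto
      then have "t powr (- e) * t powr e \<le> (2 powr \<bar>- e\<bar> * T powr (- e)) * t powr e" by (intro mult_right_mono) auto
      then have "1 \<le> (2 powr \<bar>- e\<bar> * T powr (- e)) * t powr e" using t by (simp add: powr_add[symmetric])
      then have "N * 1 \<le> N * ((2 powr \<bar>- e\<bar> * T powr (- e)) * t powr e)" using N0 by (intro mult_left_mono)
      moreover have "\<bar>L i t\<bar> \<le> N" using N[of t] t False by auto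
      moreover have "0 \<le> M * t powr e" using M by simp
      ultimately show ?thesis by (simp add: B_def algebra_simps)
    qed
    moreover have "B \<ge> 0" unfolding B_def using M N0 by simp
    ultimately show ?thesis unfolding e_def by blast
  qed
  then obtain Bf where Bf: "\<And>i. i \<le> 3 \<Longrightarrow> Bf i \<ge> 0" "\<And>i t. i \<le> 3 \<Longrightarrow> t \<in> {0<..T} \<Longrightarrow> \<bar>L i t\<bar> \<le> Bf i * t powr (\<sigma> (Suc K) - real i)"
    by metis
  define B where "B = (\<Sum>i\<le>3::nat. Bf i)"
  have BfB: "Bf i \<le> B" if "i \<le> 3" for i unfolding B_def by (rule member_le_sum) (use that Bf(1) in auto)
  have bound: "\<bar>L i t\<bar> \<le> B * t powr (\<sigma> (Suc K) - real i)" if "i \<le> 3" "t \<in> {0<..T}" for i t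
    using Bf(2)[OF that] mult_right_mono[OF BfB[OF that(1)], of "t powr (\<sigma> (Suc K) - real i)"] by simp
  have L00: "L 0 0 = 0"
  proof -
    have "(\<lambda>k. p 0 k * 0 powr (s k - real 0)) sums L 0 0" using base[of 0] T by simp
    then show ?thesis by (simp add: sums_iff)
  qed
  have "continuous_on {0..T} (L 0)"
    unfolding continuous_on_eq_continuous_within
  proof
    fix x assume x: "x \<in> {0..T}"
    show "continuous (at x within {0..T}) (L 0)"
    proof (cases "x = 0")
      case False
      then have x0: "x \<in> {0<..T}" using x by auto
      have "at x within {0..T} = at x within {0<..T}"
        by (rule at_within_nhd[of x "{0<..}"]) (use x0 in auto)
      then show ?thesis using Lcont[of 0] x0 by (simp add: continuous_on_eq_continuous_within)
    next
      case True
      have s0: "\<sigma> (Suc K) > 0" using \<sigma>[of "Suc K"] by simp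
      have "((\<lambda>t. B * t powr \<sigma> (Suc K)) \<longlongrightarrow> B * 0 powr \<sigma> (Suc K)) (at 0 within {0..T})"
      proof (rule tendsto_mult[OF tendsto_const])
        have "continuous_on {0..T} (\<lambda>t. t powr \<sigma> (Suc K))"
          by (intro continuous_on_powr' continuous_intros) (use s0 in auto)
        then show "((\<lambda>t. t powr \<sigma> (Suc K)) \<longlongrightarrow> 0 powr \<sigma> (Suc K)) (at 0 within {0..T})"
          unfolding continuous_on_def by (rule bspec) (use T in auto)
      qed
      then have lim: "((\<lambda>t. B * t powr \<sigma> (Suc K)) \<longlongrightarrow> 0) (at 0 within {0..T})" by simp
      have "(L 0 \<longlongrightarrow> 0) (at 0 within {0..T})"
      proof (rule Lim_null_comparison[OF _ lim])
        show "\<forall>\<^sub>F t in at 0 within {0..T}. norm (L 0 t) \<le> B * t powr \<sigma> (Suc K)"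
          using bound[of 0] by (auto simp: eventually_at_filter)
      qed
      then show ?thesis using True L00 by (simp add: continuous_within)
    qed
  qed
  then have "power_like (\<sigma> (Suc K)) B T L"
    unfolding power_like_def using L00 Lcont bound Lder by auto
  moreover have "B \<ge> 0" unfolding B_def using Bf(1) by (intro sum_nonneg) auto
  ultimately show ?thesis unfolding L_def[abs_def] by blast
qed

lemma caputo_eq_caputo_value:
  assumes t: "t \<in> {0<..T}"
    and der: "\<And>s. s \<in> {0<..T} \<Longrightarrow> (Y has_real_derivative Y1 s) (at s within {0<..T})"
  shows "caputo \<alpha> Y t = caputo_value \<alpha> Y1 t"
proof -
  have vd: "vector_derivative Y (at s within {0..t}) = Y1 s" if s: "s \<in> {0<..t}" for s
  proof -
    have "(Y has_real_derivative Y1 s) (at s within {0<..t})"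
      by (rule has_field_derivative_subset[OF der]) (use s t in auto)
    moreover have "at s within {0..t} = at s within {0<..t}"
      by (rule at_within_nhd[of s "{0<..}"]) (use s in auto)
    ultimately have "(Y has_vector_derivative Y1 s) (at s within cbox 0 t)"
      by (simp add: has_real_derivative_iff_has_vector_derivative)
    then have "vector_derivative Y (at s within cbox 0 t) = Y1 s"
      by (rule vector_derivative_within_cbox[rotated 2]) (use s t in auto)
    then show ?thesis by simp
  qed
  have "integral {0..t} (\<lambda>s. (t - s) powr (- \<alpha>) * vector_derivative Y (at s within {0..t}))
      = integral {0..t} (\<lambda>s. (t - s) powr (- \<alpha>) * Y1 s)"
    by (rule integral_spike[of "{0}"]) (auto simp: vd)
  then show ?thesis
    using t vd[of t] by (auto simp: caputo_def caputo_value_def rGamma_inverse_Gamma divide_inverse)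
qed

text \<open>
  Linearity of the Caputo derivative; the integrals of all summands exist separately.
\<close>

lemma caputo_value_expansion:
  fixes K :: nat
  assumes \<alpha>: "0 < \<alpha>" "\<alpha> \<le> 1" and t: "t > 0"
    and \<sigma>: "\<And>k. k \<in> {1..K} \<Longrightarrow> \<sigma> k > 0" and s: "s > 0"
    and L: "power_like s B t (\<lambda>i t. E i t - (\<Sum>k=1..K. c k * power_deriv (\<sigma> k) i t))"
  shows "caputo_value \<alpha> (E 1) t =
      (\<Sum>k=1..K. c k * (Gamma (\<sigma> k + 1) / Gamma (\<sigma> k + 1 - \<alpha>) * t powr (\<sigma> k - \<alpha>)))
      + caputo_value \<alpha> (\<lambda>t. E 1 t - (\<Sum>k=1..K. c k * power_deriv (\<sigma> k) 1 t)) t"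
proof (cases "\<alpha> = 1")
  case True
  have "c k * power_deriv (\<sigma> k) 1 t = c k * (Gamma (\<sigma> k + 1) / Gamma (\<sigma> k + 1 - \<alpha>) * t powr (\<sigma> k - \<alpha>))" if "k \<in> {1..K}" for k
    using caputo_value_power[OF \<alpha> \<sigma>[OF that] t] True by (simp add: caputo_value_def)
  then have "(\<Sum>k=1..K. c k * power_deriv (\<sigma> k) 1 t) = (\<Sum>k=1..K. c k * (Gamma (\<sigma> k + 1) / Gamma (\<sigma> k + 1 - \<alpha>) * t powr (\<sigma> k - \<alpha>)))"
    by (rule sum.cong[OF refl])
  then show ?thesis using True by (simp add: caputo_value_def)
next
  case False
  then have a1: "\<alpha> < 1" using \<alpha> by simp
  define L1 where "L1 t = E 1 t - (\<Sum>k=1..K. c k * power_deriv (\<sigma> k) 1 t)" for t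
  define w where "w s = (t - s) powr (- \<alpha>)" for s
  have iL: "(\<lambda>s. w s * L1 s) integrable_on {0..t}"
    using caputo_integrable[OF \<alpha>(1) a1 t L] unfolding L1_def w_def .
  have ip: "(\<lambda>s. w s * power_deriv (\<sigma> k) 1 s) integrable_on {0..t}" if "k \<in> {1..K}" for k
    unfolding w_def by (rule caputo_integrable[OF \<alpha>(1) a1 t power_like_powr[OF \<sigma>[OF that]]])
  have "((\<lambda>s. (\<Sum>k=1..K. c k * (w s * power_deriv (\<sigma> k) 1 s)) + w s * L1 s) has_integral
      (\<Sum>k=1..K. c k * integral {0..t} (\<lambda>s. w s * power_deriv (\<sigma> k) 1 s)) + integral {0..t} (\<lambda>s. w s * L1 s)) {0..t}"
    by (intro has_integral_add has_integral_sum has_integral_mult_right integrable_integral ip iL) auto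
  moreover have "(\<Sum>k=1..K. c k * (w s * power_deriv (\<sigma> k) 1 s)) + w s * L1 s = w s * E 1 s" for s
    by (simp add: L1_def right_diff_distrib sum_distrib_left mult.left_commute)
  ultimately have I: "integral {0..t} (\<lambda>s. w s * E 1 s) = (\<Sum>k=1..K. c k * integral {0..t} (\<lambda>s. w s * power_deriv (\<sigma> k) 1 s)) + integral {0..t} (\<lambda>s. w s * L1 s)"
    by (simp add: integral_unique)
  have "caputo_value \<alpha> (E 1) t = (\<Sum>k=1..K. c k * caputo_value \<alpha> (power_deriv (\<sigma> k) 1) t) + caputo_value \<alpha> L1 t"
    using False unfolding caputo_value_def w_def[symmetric] I
    by (simp add: distrib_left sum_distrib_left mult.left_commute)
  also have "(\<Sum>k=1..K. c k * caputo_value \<alpha> (power_deriv (\<sigma> k) 1) t) = (\<Sum>k=1..K. c k * (Gamma (\<sigma> k + 1) / Gamma (\<sigma> k + 1 - \<alpha>) * t powr (\<sigma> k - \<alpha>)))"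
    by (intro sum.cong refl) (use caputo_value_power[OF \<alpha> \<sigma> t] in auto)
  finally show ?thesis by (simp only: L1_def[abs_def])
qed

section \<open>A weakly singular discrete Gronwall inequality\<close>

lemma geometric_weight_sum:
  fixes \<tau> l :: real
  assumes "\<tau> > 0" "l > 0"
  shows "\<tau> * (\<Sum>i=1..n. exp (- l * (real i - 1) * \<tau>)) \<le> 1 / l + \<tau>"
proof -
  define r where "r = exp (- l * \<tau>)"
  have x: "l * \<tau> > 0" using assms by simp
  have r: "0 < r" "r < 1" using x by (auto simp: r_def)
  have "(\<Sum>i=1..n. exp (- l * (real i - 1) * \<tau>)) = (\<Sum>i<n. r ^ i)"
    unfolding One_nat_def sum.atLeast1_atMost_eq
    by (intro sum.cong) (auto simp: r_def exp_of_nat_mult[symmetric] algebra_simps)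
  also have "\<dots> \<le> (\<Sum>i. r ^ i)" by (rule sum_le_suminf) (use r in auto)
  also have "\<dots> = 1 / (1 - r)" using r by (simp add: suminf_geometric)
  also have "\<dots> \<le> 1 + 1 / (l * \<tau>)"
  proof -
    have "1 + l * \<tau> \<le> exp (l * \<tau>)" by (rule exp_ge_add_one_self)
    then have "r \<le> 1 / (1 + l * \<tau>)" using x by (simp add: r_def exp_minus field_simps)
    then have "1 - r \<ge> (l * \<tau>) / (1 + l * \<tau>)" using x by (simp add: field_simps)
    then have "1 / (1 - r) \<le> 1 / ((l * \<tau>) / (1 + l * \<tau>))" using x by (intro divide_left_mono) (use r in auto)
    also have "\<dots> = 1 + 1 / (l * \<tau>)" using assms by (simp add: add_divide_distrib)
    finally show ?thesis .
  qed
  finally have "\<tau> * (\<Sum>i=1..n. exp (- l * (real i - 1) * \<tau>)) \<le> \<tau> * (1 + 1 / (l * \<tau>))"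
    using assms by (intro mult_left_mono) auto
  also have "\<dots> = 1 / l + \<tau>" using assms by (simp add: field_simps)
  finally show ?thesis .
qed

text \<open>
  Split at \<open>i * \<tau> = \<delta>\<close>. The near part is small with \<open>\<delta>\<close>, and in the far part the exponential
  weight gives a factor \<open>1 / l + \<tau>\<close>.
\<close>

lemma weighted_kernel_sum:
  fixes \<beta> \<tau> l \<delta> :: real
  assumes \<beta>: "0 < \<beta>" "\<beta> \<le> 1" and pos: "\<tau> > 0" "l > 0" "\<delta> > 0"
  shows "\<tau> powr \<beta> * (\<Sum>i=1..n. real i powr (\<beta> - 1) * exp (- l * (real i - 1) * \<tau>))
    \<le> \<delta> powr \<beta> / \<beta> + \<delta> powr (\<beta> - 1) * (1 / l + \<tau>)"
proof -
  define m where "m = nat \<lfloor>\<delta> / \<tau>\<rfloor>"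
  have m: "real m \<le> \<delta> / \<tau>" using pos by (simp add: m_def)
  have mi: "i \<le> m" if "real i * \<tau> \<le> \<delta>" for i
    using that pos by (simp add: m_def le_nat_floor field_simps)
  have "\<tau> powr \<beta> * (\<Sum>i=1..n. real i powr (\<beta> - 1) * exp (- l * (real i - 1) * \<tau>))
     = (\<Sum>i=1..n. \<tau> powr \<beta> * (real i powr (\<beta> - 1) * exp (- l * (real i - 1) * \<tau>)))"
    by (simp add: sum_distrib_left)
  also have "\<dots> \<le> (\<Sum>i=1..n. (if i \<le> m then \<tau> powr \<beta> * real i powr (\<beta> - 1) else 0) + \<delta> powr (\<beta> - 1) * (\<tau> * exp (- l * (real i - 1) * \<tau>)))"
  proof (rule sum_mono)
    fix i assume i: "i \<in> {1..n}"
    show "\<tau> powr \<beta> * (real i powr (\<beta> - 1) * exp (- l * (real i - 1) * \<tau>))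
       \<le> (if i \<le> m then \<tau> powr \<beta> * real i powr (\<beta> - 1) else 0) + \<delta> powr (\<beta> - 1) * (\<tau> * exp (- l * (real i - 1) * \<tau>))"
    proof (cases "i \<le> m")
      case True
      have "exp (- l * (real i - 1) * \<tau>) \<le> 1" using i pos by simp
      then have "\<tau> powr \<beta> * (real i powr (\<beta> - 1) * exp (- l * (real i - 1) * \<tau>)) \<le> \<tau> powr \<beta> * (real i powr (\<beta> - 1) * 1)"
        by (intro mult_left_mono) auto
      moreover have "0 \<le> \<delta> powr (\<beta> - 1) * (\<tau> * exp (- l * (real i - 1) * \<tau>))" using pos by simp
      ultimately show ?thesis using True by simp
    next
      case False
      then have d: "\<delta> \<le> real i * \<tau>" using mi[of i] by linarith
      have "\<tau> powr \<beta> * real i powr (\<beta> - 1) = \<tau> * (real i * \<tau>) powr (\<beta> - 1)"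
        using pos i by (simp add: powr_mult powr_diff field_simps)
      also have "\<dots> \<le> \<tau> * \<delta> powr (\<beta> - 1)" using d pos \<beta> by (intro mult_left_mono powr_mono2') auto
      finally have "\<tau> powr \<beta> * real i powr (\<beta> - 1) * exp (- l * (real i - 1) * \<tau>) \<le> \<tau> * \<delta> powr (\<beta> - 1) * exp (- l * (real i - 1) * \<tau>)"
        by (intro mult_right_mono) auto
      then show ?thesis using False by (simp add: mult_ac)
    qed
  qed
  also have "\<dots> = (\<Sum>i=1..n. if i \<le> m then \<tau> powr \<beta> * real i powr (\<beta> - 1) else 0) + \<delta> powr (\<beta> - 1) * (\<tau> * (\<Sum>i=1..n. exp (- l * (real i - 1) * \<tau>)))"
    by (simp add: sum.distrib sum_distrib_left)
  also have "\<dots> \<le> \<delta> powr \<beta> / \<beta> + \<delta> powr (\<beta> - 1) * (1 / l + \<tau>)"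
  proof (rule add_mono)
    have "(\<Sum>i=1..n. if i \<le> m then \<tau> powr \<beta> * real i powr (\<beta> - 1) else 0) = (\<Sum>i\<in>{i\<in>{1..n}. i \<le> m}. \<tau> powr \<beta> * real i powr (\<beta> - 1))"
      by (subst sum.inter_filter) auto
    also have "\<dots> \<le> (\<Sum>i=1..m. \<tau> powr \<beta> * real i powr (\<beta> - 1))"
      by (intro sum_mono2) auto
    also have "\<dots> = \<tau> powr \<beta> * (\<Sum>i=1..m. real i powr (\<beta> - 1))" by (simp add: sum_distrib_left)
    also have "\<dots> \<le> \<tau> powr \<beta> * (real m powr \<beta> / \<beta>)"
      using sum_powr_le_integral[of "\<beta> - 1" m] \<beta> by (intro mult_left_mono) auto
    also have "\<dots> \<le> \<tau> powr \<beta> * ((\<delta> / \<tau>) powr \<beta> / \<beta>)"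
      using m \<beta> by (intro mult_left_mono divide_right_mono powr_mono2) auto
    also have "\<dots> = \<delta> powr \<beta> / \<beta>" using pos by (simp add: powr_divide)
    finally show "(\<Sum>i=1..n. if i \<le> m then \<tau> powr \<beta> * real i powr (\<beta> - 1) else 0) \<le> \<delta> powr \<beta> / \<beta>" .
  qed (intro mult_left_mono geometric_weight_sum pos, simp)
  finally show ?thesis .
qed

text \<open>
  In the maximum norm with weight \<open>exp (- l t)\<close> the weakly singular sum is a contraction with factor
  \<open>1/2\<close>, provided that \<open>l\<close> is large and \<open>\<tau>\<close> small enough. The sum may include the implicit term
  \<open>k = n\<close>.
\<close>

lemma weakly_singular_gronwall:
  fixes \<beta> K T :: real
  assumes \<beta>: "0 < \<beta>" "\<beta> \<le> 1" and K: "K > 0"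
  shows "\<exists>C>0. \<exists>\<tau>0>0. \<forall>N \<tau> b x. 0 < \<tau> \<longrightarrow> \<tau> \<le> \<tau>0 \<longrightarrow> real N * \<tau> \<le> T \<longrightarrow>
     (\<forall>n\<in>{1..N}. 0 \<le> x n \<and> x n \<le> b + K * \<tau> powr \<beta> * (\<Sum>k=1..n. (real n + 1 - real k) powr (\<beta> - 1) * x k)) \<longrightarrow>
     (\<forall>n\<in>{1..N}. x n \<le> C * b)"
proof -
  define \<delta> where "\<delta> = (\<beta> / (4 * K)) powr (1 / \<beta>)"
  have \<delta>: "\<delta> > 0" "K * (\<delta> powr \<beta> / \<beta>) = 1/4" using \<beta> K by (auto simp: \<delta>_def powr_powr)
  define l where "l = 8 * K * \<delta> powr (\<beta> - 1)"
  define \<tau>0 where "\<tau>0 = 1 / l"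
  have l: "l > 0" using K \<delta> by (simp add: l_def)
  define C where "C = 2 * exp (l * T)"
  have "x n \<le> C * b" if t: "0 < \<tau>" "\<tau> \<le> \<tau>0" and NT: "real N * \<tau> \<le> T"
    and x: "\<And>n. n \<in> {1..N} \<Longrightarrow> 0 \<le> x n" "\<And>n. n \<in> {1..N} \<Longrightarrow> x n \<le> b + K * \<tau> powr \<beta> * (\<Sum>k=1..n. (real n + 1 - real k) powr (\<beta> - 1) * x k)"
    and n: "n \<in> {1..N}" for N \<tau> b x n
  proof -
    define y where "y n = x n * exp (- l * real n * \<tau>)" for n
    define M where "M = Max (y ` {1..N})"
    have fin: "finite (y ` {1..N})" "y ` {1..N} \<noteq> {}" using n by auto
    have yM: "y k \<le> M" if "k \<in> {1..N}" for k unfolding M_def using that by (intro Max_ge) auto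
    have M0: "M \<ge> 0" using yM[OF n] x(1)[OF n] by (auto simp: y_def intro: order_trans[OF _ yM[OF n]])
    obtain p where p: "p \<in> {1..N}" "M = y p" using Max_in[OF fin] by (auto simp: M_def)
    have "x p \<ge> 0" by (rule x(1)[OF p(1)])
    have kern: "K * (\<tau> powr \<beta> * (\<Sum>i=1..p. real i powr (\<beta> - 1) * exp (- l * (real i - 1) * \<tau>))) \<le> 1/2"
    proof -
      have "K * (\<tau> powr \<beta> * (\<Sum>i=1..p. real i powr (\<beta> - 1) * exp (- l * (real i - 1) * \<tau>)))
         \<le> K * (\<delta> powr \<beta> / \<beta> + \<delta> powr (\<beta> - 1) * (1 / l + \<tau>))"
        using K by (intro mult_left_mono weighted_kernel_sum \<beta> t l \<delta>(1)) auto
      also have "\<dots> \<le> K * (\<delta> powr \<beta> / \<beta> + \<delta> powr (\<beta> - 1) * (1 / l + 1 / l))"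
        using K t by (intro mult_left_mono add_left_mono) (auto simp: \<tau>0_def)
      also have "\<dots> = K * (\<delta> powr \<beta> / \<beta>) + (K * \<delta> powr (\<beta> - 1)) * 2 / l" by (simp add: algebra_simps)
      also have "\<dots> = 1/4 + 1/4" unfolding \<delta>(2) using K \<delta>(1) by (simp add: l_def)
      finally show ?thesis by simp
    qed
    have b0: "M \<le> b * exp (- l * real p * \<tau>) + M * (1/2)"
    proof -
      have "M \<le> (b + K * \<tau> powr \<beta> * (\<Sum>k=1..p. (real p + 1 - real k) powr (\<beta> - 1) * x k)) * exp (- l * real p * \<tau>)"
        unfolding p(2) y_def using x(2)[OF p(1)] by (intro mult_right_mono) auto
      also have "\<dots> = b * exp (- l * real p * \<tau>) + K * (\<tau> powr \<beta> * (\<Sum>k=1..p. (real p + 1 - real k) powr (\<beta> - 1) * (exp (- l * (real p - real k) * \<tau>) * y k)))"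
      proof -
        have eq: "exp (- l * real p * \<tau>) * x k = exp (- l * (real p - real k) * \<tau>) * y k" for k
          by (simp add: y_def exp_add[symmetric] algebra_simps)
        have "(\<Sum>k=1..p. (real p + 1 - real k) powr (\<beta> - 1) * (exp (- l * (real p - real k) * \<tau>) * y k))
          = (\<Sum>k=1..p. (real p + 1 - real k) powr (\<beta> - 1) * x k) * exp (- l * real p * \<tau>)"
          unfolding sum_distrib_right eq[symmetric] by (intro sum.cong) (auto simp: mult_ac)
        then show ?thesis by (simp add: algebra_simps)
      qed
      also have "\<dots> \<le> b * exp (- l * real p * \<tau>) + K * (\<tau> powr \<beta> * (\<Sum>k=1..p. (real p + 1 - real k) powr (\<beta> - 1) * (exp (- l * (real p - real k) * \<tau>) * M)))"
        using K p(1) yM by (intro add_left_mono mult_left_mono sum_mono) auto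
      also have "(\<Sum>k=1..p. (real p + 1 - real k) powr (\<beta> - 1) * (exp (- l * (real p - real k) * \<tau>) * M))
         = (\<Sum>i=1..p. real i powr (\<beta> - 1) * exp (- l * (real i - 1) * \<tau>)) * M"
        unfolding sum_distrib_right
        by (rule sum.reindex_bij_witness[of _ "\<lambda>k. p + 1 - k" "\<lambda>k. p + 1 - k"]) (auto simp: of_nat_diff add.commute)
      also have "K * (\<tau> powr \<beta> * ((\<Sum>i=1..p. real i powr (\<beta> - 1) * exp (- l * (real i - 1) * \<tau>)) * M))
         = M * (K * (\<tau> powr \<beta> * (\<Sum>i=1..p. real i powr (\<beta> - 1) * exp (- l * (real i - 1) * \<tau>))))" by (simp add: mult_ac)
      also have "\<dots> \<le> M * (1/2)" using M0 kern by (intro mult_left_mono)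
      finally show ?thesis by simp
    qed
    then have "0 \<le> b * exp (- l * real p * \<tau>)" using M0 by linarith
    then have bpos: "b \<ge> 0" by (simp add: zero_le_mult_iff)
    have "exp (- l * real p * \<tau>) \<le> 1" using l t by simp
    then have "b * exp (- l * real p * \<tau>) \<le> b * 1" using bpos by (intro mult_left_mono)
    with b0 have Mb: "M \<le> 2 * b" by linarith
    have "x n = y n * exp (l * (real n * \<tau>))" by (simp add: y_def exp_add[symmetric])
    also have "\<dots> \<le> (2 * b) * exp (l * T)"
    proof (rule mult_mono)
      show "y n \<le> 2 * b" using yM[OF n] Mb by linarith
      have "real n * \<tau> \<le> real N * \<tau>" using n t by (intro mult_right_mono) auto
      then show "exp (l * (real n * \<tau>)) \<le> exp (l * T)" using NT l by simp
    qed (use bpos in auto)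
    finally show ?thesis by (simp add: C_def mult_ac)
  qed
  moreover have "C > 0" by (simp add: C_def)
  moreover have "\<tau>0 > 0" using l by (simp add: \<tau>0_def)
  ultimately show ?thesis by (intro exI[of _ C] conjI exI[of _ \<tau>0]) auto
qed

text \<open>
  The inverse of \<open>1 + (a/2) (1 - z)\<close>: a geometric series of ratio \<open>a / (2 + a) \<le> 1/3\<close>.
\<close>

section \<open>Inversion of the operator of highest order\<close>

definition smoother :: "real \<Rightarrow> real fps" where
  "smoother a = Abs_fps (\<lambda>n. 2 / (2 + a) * (a / (2 + a)) ^ n)"

lemma smoother_inverse:
  assumes "a > 0"
  shows "(1 + fps_const (a / 2) * omega_fps 1) * smoother a = 1"
proof (rule fps_ext)
  fix n
  have V: "1 + fps_const (a / 2) * omega_fps 1 = fps_const (1 + a / 2) - fps_const (a / 2) * fps_X"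
    by (simp add: omega_fps_1 right_diff_distrib flip: fps_const_add)
  have Suc: "(1 + a / 2) * fps_nth (smoother a) (Suc k) = a / 2 * fps_nth (smoother a) k" for k
  proof -
    have "fps_nth (smoother a) (Suc k) = a / (2 + a) * fps_nth (smoother a) k"
      by (simp add: smoother_def)
    moreover have "(1 + a / 2) * (a / (2 + a)) = a / 2" using assms by (simp add: field_simps)
    ultimately show ?thesis by (metis mult.assoc)
  qed
  have "(1 + a / 2) * fps_nth (smoother a) 0 = 1" using assms by (simp add: smoother_def field_simps)
  then show "fps_nth ((1 + fps_const (a / 2) * omega_fps 1) * smoother a) n = fps_nth 1 n"
    unfolding V left_diff_distrib mult.assoc using Suc by (cases n) auto
qed

lemma smoother_bound:
  assumes "0 < a" "a \<le> 1"
  shows "\<bar>fps_nth (smoother a) n\<bar> \<le> 2 * (real n + 1) powr (- 2)"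
proof -
  have sq: "(real n + 1)^2 \<le> 2 * 3 ^ n" for n
  proof (induction n)
    case (Suc n)
    show ?case
    proof (cases "n = 0")
      case False
      have "(real (Suc n) + 1)^2 \<le> 3 * (real n + 1)^2" 
      proof -
        have "3 * (real n + 1)^2 - (real (Suc n) + 1)^2 = 2 * (real n)^2 + 2 * real n - 1"
          by (simp add: power2_eq_square algebra_simps)
        moreover have "(real n)^2 \<ge> 0" "real n \<ge> 1" using False by auto
        ultimately show ?thesis by linarith
      qed
      then show ?thesis using Suc by simp
    qed simp
  qed simp
  have "(a / (2 + a)) ^ n \<le> (1 / 3) ^ n" using assms by (intro power_mono) (auto simp: field_simps)
  moreover have "2 / (2 + a) \<le> 1" using assms by (simp add: field_simps)
  ultimately have "2 / (2 + a) * (a / (2 + a)) ^ n \<le> 1 * (1 / 3) ^ n" using assms by (intro mult_mono) auto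
  also have "\<dots> \<le> 2 / (real n + 1)^2" using sq[of n] by (simp add: power_divide field_simps)
  also have "\<dots> = 2 * (real n + 1) powr (- 2)" by (simp add: powr_minus_divide powr_numeral)
  finally show ?thesis using assms by (simp add: smoother_def)
qed

text \<open>
  Convolution with a geometrically decaying sequence does not change the size of the weights
  \<open>(n + 1) powr (\<beta> - 1)\<close> of a discrete fractional integral.
\<close>

lemma smoothed_integral_kernel_bound:
  assumes a: "0 < a" "a \<le> 1" and \<beta>: "0 < \<beta>"
  shows "\<exists>C>0. \<forall>n. \<bar>fps_nth (omega_fps (- \<beta>) * smoother a) n\<bar> \<le> C * (real n + 1) powr (\<beta> - 1)"
proof -
  obtain C1 where C1: "C1 > 0" "\<And>n. \<bar>omega_coeff (- \<beta>) n\<bar> \<le> C1 * (real n + 1) powr (- (- \<beta>) - 1)"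
    using omega_coeff_bound[of "- \<beta>"] by blast
  obtain C2 where C2: "C2 > 0" "\<And>n. n \<ge> 1 \<Longrightarrow> (\<Sum>k=1..n. (real n + 1 - real k) powr (-2) * real k powr (\<beta> - 1))
     \<le> C2 * (real n powr (-2) * max 1 (real n powr (\<beta> - 1 + 1)) + real n powr (\<beta> - 1) * max 1 (real n powr (- 2 + 1)))"
    using convolution_power_bound[of "-2" "\<beta> - 1"] \<beta> by auto
  have "\<bar>fps_nth (omega_fps (- \<beta>) * smoother a) n\<bar> \<le> (4 * C1 * C2) * (real n + 1) powr (\<beta> - 1)" for n
  proof -
    define x where "x = real n + 1"
    have x: "x \<ge> 1" by (simp add: x_def)
    have "\<bar>fps_nth (omega_fps (- \<beta>) * smoother a) n\<bar> \<le> (\<Sum>k=0..n. \<bar>omega_coeff (- \<beta>) k * fps_nth (smoother a) (n - k)\<bar>)"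
      unfolding fps_mult_nth omega_fps_nth by (rule sum_abs)
    also have "\<dots> \<le> (\<Sum>k=0..n. (2 * C1) * ((real (Suc n) + 1 - real (Suc k)) powr (-2) * real (Suc k) powr (\<beta> - 1)))"
    proof (rule sum_mono)
      fix k assume k: "k \<in> {0..n}"
      have "\<bar>omega_coeff (- \<beta>) k\<bar> \<le> C1 * real (Suc k) powr (\<beta> - 1)" using C1(2)[of k] by (simp add: add.commute)
      moreover have "\<bar>fps_nth (smoother a) (n - k)\<bar> \<le> 2 * (real (Suc n) + 1 - real (Suc k)) powr (-2)"
        using smoother_bound[OF a, of "n - k"] k by (simp add: of_nat_diff algebra_simps)
      ultimately have "\<bar>omega_coeff (- \<beta>) k * fps_nth (smoother a) (n - k)\<bar> \<le> (C1 * real (Suc k) powr (\<beta> - 1)) * (2 * (real (Suc n) + 1 - real (Suc k)) powr (-2))"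
        unfolding abs_mult using C1(1) by (intro mult_mono) auto
      then show "\<bar>omega_coeff (- \<beta>) k * fps_nth (smoother a) (n - k)\<bar> \<le> (2 * C1) * ((real (Suc n) + 1 - real (Suc k)) powr (-2) * real (Suc k) powr (\<beta> - 1))"
        by (simp only: mult_ac)
    qed
    also have "\<dots> = (2 * C1) * (\<Sum>k=0..n. (real (Suc n) + 1 - real (Suc k)) powr (-2) * real (Suc k) powr (\<beta> - 1))"
      by (simp only: sum_distrib_left)
    also have "(\<Sum>k=0..n. (real (Suc n) + 1 - real (Suc k)) powr (-2) * real (Suc k) powr (\<beta> - 1))
        = (\<Sum>k=1..Suc n. (real (Suc n) + 1 - real k) powr (-2) * real k powr (\<beta> - 1))"
      using sum.shift_bounds_cl_Suc_ivl[of "\<lambda>k. (real (Suc n) + 1 - real k) powr (-2) * real k powr (\<beta> - 1)" 0 n] by (simp only: One_nat_def)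
    also have "\<dots> \<le> C2 * (real (Suc n) powr (-2) * max 1 (real (Suc n) powr (\<beta> - 1 + 1)) + real (Suc n) powr (\<beta> - 1) * max 1 (real (Suc n) powr (- 2 + 1)))"
      by (rule C2(2)) simp
    also have "real (Suc n) = x" by (simp add: x_def)
    also have "C2 * (x powr (-2) * max 1 (x powr (\<beta> - 1 + 1)) + x powr (\<beta> - 1) * max 1 (x powr (- 2 + 1))) \<le> C2 * (x powr (\<beta> - 1) + x powr (\<beta> - 1) * 1)"
    proof (intro mult_left_mono add_mono)
      have "x powr (-2) * 1 \<le> x powr (\<beta> - 1)" using x \<beta> by (simp add: powr_mono)
      moreover have "x powr (-2) * x powr \<beta> \<le> x powr (\<beta> - 1)" using x by (simp add: powr_add[symmetric] powr_mono)
      ultimately show "x powr (-2) * max 1 (x powr (\<beta> - 1 + 1)) \<le> x powr (\<beta> - 1)" by (simp add: max_def)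
      have "x powr (- 1) \<le> x powr 0" using x by (intro powr_mono) auto
      then show "max 1 (x powr (- 2 + 1)) \<le> 1" using x by simp
    qed (use C2 in auto)
    finally show ?thesis using C1(1) by (simp add: x_def mult_ac)
  qed
  then show ?thesis using C1 C2 by (intro exI[of _ "4 * C1 * C2"]) auto
qed

lemma g_fps_factor: "g_fps \<alpha> = omega_fps \<alpha> * (1 + fps_const (\<alpha> / 2) * omega_fps 1)"
  by (simp add: g_fps_eq distrib_left omega_fps_mult mult.left_commute)

text \<open>
  The factor \<open>1 + (\<alpha>/2) (1 - z)\<close> is a combination of \<open>1 + (a/2) (1 - z)\<close> and \<open>1\<close>. The quotient of the
  two operators is therefore \<open>(1 - z) powr (\<alpha> - a)\<close>, a discrete fractional integral, times a constant
  plus a multiple of the smoother.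
\<close>

lemma inverted_kernel_bound:
  assumes a: "0 < a" "a \<le> 1" and \<alpha>: "0 < \<alpha>" "\<alpha> < a"
  shows "\<exists>C>0. \<forall>n. \<bar>fps_nth (omega_fps (- a) * smoother a * g_fps \<alpha>) n\<bar> \<le> C * (real n + 1) powr (a - \<alpha> - 1)"
proof -
  obtain C1 where C1: "C1 > 0" "\<And>n. \<bar>omega_coeff (- (a - \<alpha>)) n\<bar> \<le> C1 * (real n + 1) powr (- (- (a - \<alpha>)) - 1)"
    using omega_coeff_bound[of "- (a - \<alpha>)"] by blast
  obtain C2 where C2: "C2 > 0" "\<And>n. \<bar>fps_nth (omega_fps (- (a - \<alpha>)) * smoother a) n\<bar> \<le> C2 * (real n + 1) powr ((a - \<alpha>) - 1)"
    using smoothed_integral_kernel_bound[OF a, of "a - \<alpha>"] \<alpha> by auto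
  define c where "c = \<alpha> / a"
  have c: "1 + fps_const (\<alpha> / 2) * omega_fps 1 = fps_const c * (1 + fps_const (a / 2) * omega_fps 1) + fps_const (1 - c)"
  proof -
    have 1: "fps_const c + fps_const (1 - c) = 1" by (simp flip: fps_const_1_eq_1)
    have "c * (a / 2) = \<alpha> / 2" using a by (simp add: c_def)
    then have 2: "fps_const c * fps_const (a / 2) = fps_const (\<alpha> / 2)" by simp
    have "fps_const c * (1 + fps_const (a / 2) * omega_fps 1) + fps_const (1 - c)
       = (fps_const c + fps_const (1 - c)) + (fps_const c * fps_const (a / 2)) * omega_fps 1"
      by (simp only: distrib_left mult_1_right mult.assoc add_ac)
    then show ?thesis unfolding 1 2 by simp
  qed
  have "omega_fps (- a) * smoother a * g_fps \<alpha> = omega_fps (- a) * omega_fps \<alpha> * (smoother a * (1 + fps_const (\<alpha> / 2) * omega_fps 1))"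
    by (simp only: g_fps_factor mult_ac)
  also have "smoother a * (1 + fps_const (\<alpha> / 2) * omega_fps 1) = fps_const c * ((1 + fps_const (a / 2) * omega_fps 1) * smoother a) + fps_const (1 - c) * smoother a"
    unfolding c by (simp only: distrib_left distrib_right mult_ac)
  also have "\<dots> = fps_const c + fps_const (1 - c) * smoother a" using smoother_inverse[OF a(1)] by simp
  also have "omega_fps (- a) * omega_fps \<alpha> = omega_fps (- (a - \<alpha>))" by (simp add: omega_fps_mult)
  also have "omega_fps (- (a - \<alpha>)) * (fps_const c + fps_const (1 - c) * smoother a)
     = fps_const c * omega_fps (- (a - \<alpha>)) + fps_const (1 - c) * (omega_fps (- (a - \<alpha>)) * smoother a)"
    by (simp only: distrib_left mult_ac)
  finally have eq: "omega_fps (- a) * smoother a * g_fps \<alpha> = fps_const c * omega_fps (- (a - \<alpha>)) + fps_const (1 - c) * (omega_fps (- (a - \<alpha>)) * smoother a)" .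
  have "\<bar>fps_nth (omega_fps (- a) * smoother a * g_fps \<alpha>) n\<bar> \<le> (\<bar>c\<bar> * C1 + \<bar>1 - c\<bar> * C2) * (real n + 1) powr (a - \<alpha> - 1)" for n
  proof -
    have 1: "\<bar>omega_coeff (- (a - \<alpha>)) n\<bar> \<le> C1 * (real n + 1) powr (a - \<alpha> - 1)" using C1(2)[of n] by simp
    have "\<bar>fps_nth (omega_fps (- a) * smoother a * g_fps \<alpha>) n\<bar> \<le> \<bar>c\<bar> * (C1 * (real n + 1) powr (a - \<alpha> - 1)) + \<bar>1 - c\<bar> * (C2 * (real n + 1) powr (a - \<alpha> - 1))"
      unfolding eq fps_add_nth fps_mult_left_const_nth omega_fps_nth
      by (intro abs_add_mono abs_mult_mono C2 1)
    then show ?thesis by (simp only: distrib_right mult.assoc)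
  qed
  moreover have "\<bar>c\<bar> * C1 + \<bar>1 - c\<bar> * C2 > 0" using C1 C2 a \<alpha> by (intro add_pos_nonneg mult_pos_pos) (auto simp: c_def)
  ultimately show ?thesis by blast
qed

text \<open>
  Multiplication by the inverse of the operator of highest order \<open>a\<close>. All terms of this order
  together become \<open>(\<Sum>j. \<nu> j) * e n\<close>, and one can divide by the sum of their coefficients.
\<close>

lemma multi_term_inversion:
  fixes \<alpha> \<nu> :: "'j \<Rightarrow> real"
  assumes J: "finite J" and a: "0 < a" "a \<le> 1" and \<alpha>: "\<And>j. j \<in> J \<Longrightarrow> 0 < \<alpha> j \<and> \<alpha> j \<le> a"
    and \<nu>: "(\<Sum>j\<in>{j\<in>J. \<alpha> j = a}. \<nu> j) > 0"
  shows "\<exists>C>0. \<forall>\<tau> e n. \<tau> > 0 \<longrightarrow> \<bar>e n\<bar> \<le>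
     C * (\<tau> powr a * (\<Sum>k=0..n. (real n + 1 - real k) powr (a - 1) *
             \<bar>\<Sum>j\<in>J. \<nu> j * (1 / \<tau> powr \<alpha> j * (\<Sum>i=0..k. g_coeff (\<alpha> j) (k - i) * e i))\<bar>)
        + (\<Sum>j\<in>{j\<in>J. \<alpha> j < a}. \<tau> powr (a - \<alpha> j) * (\<Sum>k=0..n. (real n + 1 - real k) powr (a - \<alpha> j - 1) * \<bar>e k\<bar>)))"
proof -
  define W where "W = omega_fps (- a) * smoother a"
  define \<kappa> where "\<kappa> j = W * g_fps (\<alpha> j)" for j
  define \<nu>s where "\<nu>s = (\<Sum>j\<in>{j\<in>J. \<alpha> j = a}. \<nu> j)"
  have ns: "\<nu>s > 0" using \<nu> by (simp add: \<nu>s_def)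
  obtain C0 where C0: "C0 > 0" "\<And>n. \<bar>fps_nth W n\<bar> \<le> C0 * (real n + 1) powr (a - 1)"
    using smoothed_integral_kernel_bound[OF a a(1)] unfolding W_def by blast
  have "\<exists>C>0. \<forall>n. \<bar>fps_nth (\<kappa> j) n\<bar> \<le> C * (real n + 1) powr (a - \<alpha> j - 1)" if "j \<in> {j\<in>J. \<alpha> j < a}" for j
    unfolding \<kappa>_def W_def using inverted_kernel_bound[OF a] \<alpha> that by auto
  then obtain C1 where C1: "\<And>j. j \<in> {j\<in>J. \<alpha> j < a} \<Longrightarrow> C1 j > 0" "\<And>j n. j \<in> {j\<in>J. \<alpha> j < a} \<Longrightarrow> \<bar>fps_nth (\<kappa> j) n\<bar> \<le> C1 j * (real n + 1) powr (a - \<alpha> j - 1)"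
    by metis
  define D where "D = (\<Sum>j\<in>{j\<in>J. \<alpha> j < a}. \<bar>\<nu> j\<bar> * C1 j)"
  have D0: "D \<ge> 0" unfolding D_def using C1(1) by (intro sum_nonneg mult_nonneg_nonneg) (auto intro: less_imp_le)
  have \<kappa>1: "\<kappa> j = 1" if "\<alpha> j = a" for j
  proof -
    have "\<kappa> j = omega_fps (- a) * omega_fps a * ((1 + fps_const (a / 2) * omega_fps 1) * smoother a)"
      unfolding \<kappa>_def W_def that g_fps_factor by (simp only: mult_ac)
    then show ?thesis using smoother_inverse[OF a(1)] by (simp add: omega_fps_mult omega_fps_0)
  qed
  have Jsplit: "J = {j\<in>J. \<alpha> j = a} \<union> {j\<in>J. \<alpha> j < a}" "{j\<in>J. \<alpha> j = a} \<inter> {j\<in>J. \<alpha> j < a} = {}" using \<alpha> by force+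
  define C where "C = (C0 + D) / \<nu>s"
  have "\<bar>e n\<bar> \<le> C * (\<tau> powr a * (\<Sum>k=0..n. (real n + 1 - real k) powr (a - 1) * \<bar>\<Sum>j\<in>J. \<nu> j * (1 / \<tau> powr \<alpha> j * (\<Sum>i=0..k. g_coeff (\<alpha> j) (k - i) * e i))\<bar>)
        + (\<Sum>j\<in>{j\<in>J. \<alpha> j < a}. \<tau> powr (a - \<alpha> j) * (\<Sum>k=0..n. (real n + 1 - real k) powr (a - \<alpha> j - 1) * \<bar>e k\<bar>)))"
    if \<tau>: "\<tau> > 0" for \<tau> n and e :: "nat \<Rightarrow> real"
  proof -
    define H where "H k = (\<Sum>j\<in>J. \<nu> j * (1 / \<tau> powr \<alpha> j * (\<Sum>i=0..k. g_coeff (\<alpha> j) (k - i) * e i)))" for k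
    define E where "E = Abs_fps e"
    define A where "A = (\<Sum>k=0..n. (real n + 1 - real k) powr (a - 1) * \<bar>H k\<bar>)"
    define B where "B j = (\<Sum>k=0..n. (real n + 1 - real k) powr (a - \<alpha> j - 1) * \<bar>e k\<bar>)" for j
    have Hf: "Abs_fps H = (\<Sum>j\<in>J. fps_const (\<nu> j / \<tau> powr \<alpha> j) * (E * g_fps (\<alpha> j)))"
      by (rule fps_ext) (simp add: H_def E_def fps_sum_nth fps_mult_nth[of "Abs_fps e"] mult.commute)
    have "W * Abs_fps H = (\<Sum>j\<in>J. fps_const (\<nu> j / \<tau> powr \<alpha> j) * (E * \<kappa> j))"
      unfolding Hf sum_distrib_left \<kappa>_def by (intro sum.cong refl) (simp only: mult_ac)
    also have "\<dots> = (\<Sum>j\<in>{j\<in>J. \<alpha> j = a}. fps_const (\<nu> j / \<tau> powr \<alpha> j) * (E * \<kappa> j)) + (\<Sum>j\<in>{j\<in>J. \<alpha> j < a}. fps_const (\<nu> j / \<tau> powr \<alpha> j) * (E * \<kappa> j))"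
      by (subst (1) Jsplit(1), rule sum.union_disjoint[OF _ _ Jsplit(2)]) (use J in auto)
    finally have "fps_nth (W * Abs_fps H) n = fps_nth (\<Sum>j\<in>{j\<in>J. \<alpha> j = a}. fps_const (\<nu> j / \<tau> powr \<alpha> j) * (E * \<kappa> j)) n
        + fps_nth (\<Sum>j\<in>{j\<in>J. \<alpha> j < a}. fps_const (\<nu> j / \<tau> powr \<alpha> j) * (E * \<kappa> j)) n" by simp
    moreover have "fps_nth (\<Sum>j\<in>{j\<in>J. \<alpha> j = a}. fps_const (\<nu> j / \<tau> powr \<alpha> j) * (E * \<kappa> j)) n = \<nu>s / \<tau> powr a * e n"
      unfolding \<nu>s_def fps_sum_nth sum_divide_distrib sum_distrib_right
      by (intro sum.cong refl) (auto simp: \<kappa>1 E_def)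
    ultimately have eq: "\<nu>s / \<tau> powr a * e n = fps_nth (W * Abs_fps H) n - fps_nth (\<Sum>j\<in>{j\<in>J. \<alpha> j < a}. fps_const (\<nu> j / \<tau> powr \<alpha> j) * (E * \<kappa> j)) n"
      by simp
    have 1: "\<bar>fps_nth (W * Abs_fps H) n\<bar> \<le> C0 * A"
    proof -
      have "fps_nth (W * Abs_fps H) n = (\<Sum>k=0..n. H k * fps_nth W (n - k))"
        unfolding mult.commute[of W] fps_mult_nth by simp
      also have "\<bar>\<dots>\<bar> \<le> (\<Sum>k=0..n. C0 * ((real n + 1 - real k) powr (a - 1) * \<bar>H k\<bar>))"
      proof (rule order_trans[OF sum_abs sum_mono])
        fix k assume k: "k \<in> {0..n}"
        then have "\<bar>fps_nth W (n - k)\<bar> \<le> C0 * (real n + 1 - real k) powr (a - 1)"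
          using C0(2)[of "n - k"] by (simp add: of_nat_diff algebra_simps)
        then have "\<bar>H k\<bar> * \<bar>fps_nth W (n - k)\<bar> \<le> \<bar>H k\<bar> * (C0 * (real n + 1 - real k) powr (a - 1))"
          by (intro mult_left_mono) auto
        then show "\<bar>H k * fps_nth W (n - k)\<bar> \<le> C0 * ((real n + 1 - real k) powr (a - 1) * \<bar>H k\<bar>)"
          by (simp only: abs_mult mult_ac)
      qed
      finally show ?thesis by (simp add: A_def sum_distrib_left)
    qed
    have 2: "\<bar>fps_nth (\<Sum>j\<in>{j\<in>J. \<alpha> j < a}. fps_const (\<nu> j / \<tau> powr \<alpha> j) * (E * \<kappa> j)) n\<bar>
        \<le> (\<Sum>j\<in>{j\<in>J. \<alpha> j < a}. (\<bar>\<nu> j\<bar> / \<tau> powr \<alpha> j) * (C1 j * B j))"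
      unfolding fps_sum_nth
    proof (rule order_trans[OF sum_abs sum_mono])
      fix j assume j: "j \<in> {j\<in>J. \<alpha> j < a}"
      have "\<bar>fps_nth (E * \<kappa> j) n\<bar> \<le> (\<Sum>k=0..n. C1 j * ((real n + 1 - real k) powr (a - \<alpha> j - 1) * \<bar>e k\<bar>))"
        unfolding fps_mult_nth
      proof (rule order_trans[OF sum_abs sum_mono])
        fix k assume k: "k \<in> {0..n}"
        then have "\<bar>fps_nth (\<kappa> j) (n - k)\<bar> \<le> C1 j * (real n + 1 - real k) powr (a - \<alpha> j - 1)"
          using C1(2)[OF j, of "n - k"] by (simp add: of_nat_diff algebra_simps)
        then have "\<bar>e k\<bar> * \<bar>fps_nth (\<kappa> j) (n - k)\<bar> \<le> \<bar>e k\<bar> * (C1 j * (real n + 1 - real k) powr (a - \<alpha> j - 1))"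
          by (intro mult_left_mono) auto
        then show "\<bar>fps_nth E k * fps_nth (\<kappa> j) (n - k)\<bar> \<le> C1 j * ((real n + 1 - real k) powr (a - \<alpha> j - 1) * \<bar>e k\<bar>)"
          by (simp add: E_def abs_mult mult_ac)
      qed
      then have "\<bar>fps_nth (E * \<kappa> j) n\<bar> \<le> C1 j * B j" by (simp add: B_def sum_distrib_left)
      then show "\<bar>fps_nth (fps_const (\<nu> j / \<tau> powr \<alpha> j) * (E * \<kappa> j)) n\<bar> \<le> (\<bar>\<nu> j\<bar> / \<tau> powr \<alpha> j) * (C1 j * B j)"
        by (simp add: abs_mult mult_left_mono divide_right_mono)
    qed
    have A0: "A \<ge> 0" unfolding A_def by (intro sum_nonneg) auto
    have B0: "B j \<ge> 0" for j unfolding B_def by (intro sum_nonneg) auto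
    have "(\<nu>s / \<tau> powr a) * \<bar>e n\<bar> = \<bar>\<nu>s / \<tau> powr a * e n\<bar>" using ns by (simp add: abs_mult)
    also have "\<dots> \<le> C0 * A + (\<Sum>j\<in>{j\<in>J. \<alpha> j < a}. (\<bar>\<nu> j\<bar> / \<tau> powr \<alpha> j) * (C1 j * B j))"
      unfolding eq by (rule abs_diff_mono[OF 1 2])
    finally have "\<tau> powr a / \<nu>s * ((\<nu>s / \<tau> powr a) * \<bar>e n\<bar>) \<le> \<tau> powr a / \<nu>s * (C0 * A + (\<Sum>j\<in>{j\<in>J. \<alpha> j < a}. (\<bar>\<nu> j\<bar> / \<tau> powr \<alpha> j) * (C1 j * B j)))"
      using ns by (intro mult_left_mono) auto
    then have "\<bar>e n\<bar> \<le> \<tau> powr a / \<nu>s * (C0 * A + (\<Sum>j\<in>{j\<in>J. \<alpha> j < a}. (\<bar>\<nu> j\<bar> / \<tau> powr \<alpha> j) * (C1 j * B j)))"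
      using ns \<tau> by simp
    also have "\<dots> = 1 / \<nu>s * (C0 * (\<tau> powr a * A) + (\<Sum>j\<in>{j\<in>J. \<alpha> j < a}. (\<bar>\<nu> j\<bar> * C1 j) * (\<tau> powr (a - \<alpha> j) * B j)))"
      by (simp add: distrib_left sum_distrib_left powr_diff mult_ac)
    also have "\<dots> \<le> 1 / \<nu>s * ((C0 + D) * (\<tau> powr a * A) + (\<Sum>j\<in>{j\<in>J. \<alpha> j < a}. (C0 + D) * (\<tau> powr (a - \<alpha> j) * B j)))"
    proof (intro mult_left_mono add_mono sum_mono mult_right_mono)
      fix j assume j: "j \<in> {j\<in>J. \<alpha> j < a}"
      have "\<bar>\<nu> j\<bar> * C1 j \<le> D" unfolding D_def
        by (rule member_le_sum[OF j]) (use C1(1) J in \<open>auto intro!: mult_nonneg_nonneg intro: less_imp_le\<close>)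
      then show "\<bar>\<nu> j\<bar> * C1 j \<le> C0 + D" using C0 by simp
    qed (use D0 A0 B0 ns in auto)
    also have "\<dots> = C * (\<tau> powr a * A + (\<Sum>j\<in>{j\<in>J. \<alpha> j < a}. \<tau> powr (a - \<alpha> j) * B j))"
      by (simp add: C_def sum_distrib_left[symmetric] distrib_left[symmetric])
    finally show ?thesis by (simp add: A_def B_def H_def)
  qed
  moreover have "C > 0" unfolding C_def using C0 D0 ns by (intro divide_pos_pos add_pos_nonneg) auto
  ultimately show ?thesis by blast
qed

text \<open>
  Local errors of size \<open>\<tau> powr (x - a) * \<phi> k\<close>, passed through the discrete fractional integral of order \<open>a\<close>
  (with weights \<open>\<tau> powr a * (n + 1 - k) powr (a - 1)\<close>), add up to \<open>O(\<tau> powr \<rho>)\<close> on \<open>{0..T}\<close>.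
\<close>

section \<open>Accumulation of local errors\<close>

definition accumulates :: "real \<Rightarrow> real \<Rightarrow> real \<Rightarrow> real \<Rightarrow> (nat \<Rightarrow> real) \<Rightarrow> bool" where
  "accumulates a T x \<rho> \<phi> \<longleftrightarrow> (\<exists>C>0. \<forall>\<tau> n. 0 < \<tau> \<longrightarrow> \<tau> \<le> T \<longrightarrow> n \<ge> 1 \<longrightarrow> real n * \<tau> \<le> T \<longrightarrow>
     \<tau> powr x * (\<Sum>k=1..n. (real n + 1 - real k) powr (a - 1) * \<phi> k) \<le> C * \<tau> powr \<rho>)"

lemma accumulates_add:
  assumes "accumulates a T x \<rho> \<phi>" "accumulates a T x \<rho> \<psi>"
  shows "accumulates a T x \<rho> (\<lambda>k. \<phi> k + \<psi> k)"
proof -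
  obtain C1 where C1: "C1 > 0" "\<And>\<tau> n. 0 < \<tau> \<Longrightarrow> \<tau> \<le> T \<Longrightarrow> n \<ge> 1 \<Longrightarrow> real n * \<tau> \<le> T \<Longrightarrow>
     \<tau> powr x * (\<Sum>k=1..n. (real n + 1 - real k) powr (a - 1) * \<phi> k) \<le> C1 * \<tau> powr \<rho>"
    using assms(1) unfolding accumulates_def by blast
  obtain C2 where C2: "C2 > 0" "\<And>\<tau> n. 0 < \<tau> \<Longrightarrow> \<tau> \<le> T \<Longrightarrow> n \<ge> 1 \<Longrightarrow> real n * \<tau> \<le> T \<Longrightarrow>
     \<tau> powr x * (\<Sum>k=1..n. (real n + 1 - real k) powr (a - 1) * \<psi> k) \<le> C2 * \<tau> powr \<rho>"
    using assms(2) unfolding accumulates_def by blast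
  show ?thesis unfolding accumulates_def
  proof (rule exI[of _ "C1 + C2"], intro conjI allI impI)
    fix \<tau> n assume t: "0 < \<tau>" "\<tau> \<le> T" "n \<ge> (1::nat)" "real n * \<tau> \<le> T"
    show "\<tau> powr x * (\<Sum>k=1..n. (real n + 1 - real k) powr (a - 1) * (\<phi> k + \<psi> k)) \<le> (C1 + C2) * \<tau> powr \<rho>"
      using add_mono[OF C1(2)[OF t] C2(2)[OF t]] by (simp add: distrib_left distrib_right sum.distrib)
  qed (use C1 C2 in auto)
qed

lemma accumulates_mono:
  assumes "accumulates a T x \<rho> \<psi>" "K \<ge> 0" "\<And>k. k \<ge> 1 \<Longrightarrow> \<phi> k \<le> K * \<psi> k"
  shows "accumulates a T x \<rho> \<phi>"
proof -
  obtain C where C: "C > 0" "\<And>\<tau> n. 0 < \<tau> \<Longrightarrow> \<tau> \<le> T \<Longrightarrow> n \<ge> 1 \<Longrightarrow> real n * \<tau> \<le> T \<Longrightarrow>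
     \<tau> powr x * (\<Sum>k=1..n. (real n + 1 - real k) powr (a - 1) * \<psi> k) \<le> C * \<tau> powr \<rho>"
    using assms(1) unfolding accumulates_def by blast
  show ?thesis unfolding accumulates_def
  proof (rule exI[of _ "(K + 1) * C"], intro conjI allI impI)
    fix \<tau> n assume t: "0 < \<tau>" "\<tau> \<le> T" "n \<ge> (1::nat)" "real n * \<tau> \<le> T"
    have "\<tau> powr x * (\<Sum>k=1..n. (real n + 1 - real k) powr (a - 1) * \<phi> k) \<le> \<tau> powr x * (\<Sum>k=1..n. (real n + 1 - real k) powr (a - 1) * (K * \<psi> k))"
      by (intro mult_left_mono sum_mono assms(3)) auto
    also have "\<dots> = K * (\<tau> powr x * (\<Sum>k=1..n. (real n + 1 - real k) powr (a - 1) * \<psi> k))"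
      by (simp add: sum_distrib_left mult_ac)
    also have "\<dots> \<le> K * (C * \<tau> powr \<rho>)" using C(2)[OF t] assms(2) by (rule mult_left_mono)
    also have "\<dots> \<le> (K + 1) * C * \<tau> powr \<rho>" using C(1) by (simp add: algebra_simps)
    finally show "\<tau> powr x * (\<Sum>k=1..n. (real n + 1 - real k) powr (a - 1) * \<phi> k) \<le> (K + 1) * C * \<tau> powr \<rho>" .
  qed (use C assms in auto)
qed

lemma powr_le_powr_scaled:
  fixes \<tau> T x y :: real
  assumes "0 < \<tau>" "\<tau> \<le> T" "y \<le> x"
  shows "\<tau> powr x \<le> T powr (x - y) * \<tau> powr y"
proof -
  have "\<tau> powr x = \<tau> powr (x - y) * \<tau> powr y" by (simp add: powr_add[symmetric])
  also have "\<dots> \<le> T powr (x - y) * \<tau> powr y" using assms by (intro mult_right_mono powr_mono2) auto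
  finally show ?thesis .
qed

text \<open>
  For \<open>p < -1\<close> the sum is bounded, for \<open>p > -1\<close> it has size \<open>n powr (a + p)\<close>, which trades powers of \<open>\<tau>\<close>
  for powers of \<open>n * \<tau> \<le> T\<close>. The exponent \<open>-1\<close> would bring in a logarithm.
\<close>

lemma accumulates_power:
  assumes a: "0 < a" "a \<le> 1" and T: "T > 0" and p: "p \<noteq> -1" "\<rho> \<le> x" "\<rho> + (a + p) \<le> x"
  shows "accumulates a T x \<rho> (\<lambda>k. real k powr p)"
proof -
  obtain C where C: "C > 0" "\<And>n. n \<ge> 1 \<Longrightarrow> (\<Sum>k=1..n. (real n + 1 - real k) powr (a - 1) * real k powr p)
     \<le> C * (real n powr (a - 1) * max 1 (real n powr (p + 1)) + real n powr p * max 1 (real n powr (a - 1 + 1)))"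
    using convolution_power_bound[of "a - 1" p] a p by auto
  have sum: "(\<Sum>k=1..n. (real n + 1 - real k) powr (a - 1) * real k powr p) \<le> C * (2 * (1 + real n powr (a + p)))" if n: "n \<ge> 1" for n
  proof -
    have n1: "real n \<ge> 1" using n by simp
    have "real n powr (a - 1) * 1 \<le> 1 + real n powr (a + p)"
      using powr_mono[of "a - 1" 0 "real n"] a n1 by (simp add: add_increasing2)
    moreover have "real n powr (a - 1) * real n powr (p + 1) \<le> 1 + real n powr (a + p)"
      by (simp add: powr_add[symmetric])
    ultimately have 1: "real n powr (a - 1) * max 1 (real n powr (p + 1)) \<le> 1 + real n powr (a + p)" by (simp add: max_def)
    have "max 1 (real n powr (a - 1 + 1)) = real n powr a" using a n1 by (simp add: max_def ge_one_powr_ge_zero)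
    then have 2: "real n powr p * max 1 (real n powr (a - 1 + 1)) \<le> 1 + real n powr (a + p)"
      by (simp add: powr_add[symmetric] add.commute)
    show ?thesis using order_trans[OF C(2)[OF n] mult_left_mono[OF add_mono[OF 1 2]]] C(1) by simp
  qed
  define K where "K = 2 * C * (T powr (x - \<rho>) + T powr (x - (\<rho> + (a + p))) * T powr (a + p) + T powr (x - \<rho>))"
  have "\<tau> powr x * (\<Sum>k=1..n. (real n + 1 - real k) powr (a - 1) * real k powr p) \<le> K * \<tau> powr \<rho>"
    if t: "0 < \<tau>" "\<tau> \<le> T" "n \<ge> 1" "real n * \<tau> \<le> T" for \<tau> n
  proof -
    have t1: "\<tau> powr x \<le> T powr (x - \<rho>) * \<tau> powr \<rho>" by (rule powr_le_powr_scaled) (use t p in auto)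
    have t2: "\<tau> powr x * real n powr (a + p) \<le> (T powr (x - (\<rho> + (a + p))) * T powr (a + p) + T powr (x - \<rho>)) * \<tau> powr \<rho>"
    proof (cases "a + p \<ge> 0")
      case True
      have "\<tau> powr x * real n powr (a + p) \<le> T powr (x - (\<rho> + (a + p))) * \<tau> powr (\<rho> + (a + p)) * real n powr (a + p)"
        by (intro mult_right_mono powr_le_powr_scaled) (use t p in auto)
      also have "\<dots> = T powr (x - (\<rho> + (a + p))) * (real n * \<tau>) powr (a + p) * \<tau> powr \<rho>"
        using t by (simp add: powr_add powr_mult)
      also have "\<dots> \<le> T powr (x - (\<rho> + (a + p))) * T powr (a + p) * \<tau> powr \<rho>"
        using t True by (intro mult_right_mono mult_left_mono powr_mono2) auto
      also have "\<dots> \<le> (T powr (x - (\<rho> + (a + p))) * T powr (a + p) + T powr (x - \<rho>)) * \<tau> powr \<rho>"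
        by (intro mult_right_mono) auto
      finally show ?thesis .
    next
      case False
      then have "real n powr (a + p) \<le> 1" using powr_mono[of "a + p" 0 "real n"] t by simp
      then have "\<tau> powr x * real n powr (a + p) \<le> \<tau> powr x * 1" by (intro mult_left_mono) auto
      also have "\<dots> \<le> T powr (x - \<rho>) * \<tau> powr \<rho>" using t1 by simp
      also have "\<dots> \<le> (T powr (x - (\<rho> + (a + p))) * T powr (a + p) + T powr (x - \<rho>)) * \<tau> powr \<rho>"
        by (intro mult_right_mono) auto
      finally show ?thesis .
    qed
    have "\<tau> powr x * (\<Sum>k=1..n. (real n + 1 - real k) powr (a - 1) * real k powr p) \<le> \<tau> powr x * (C * (2 * (1 + real n powr (a + p))))"
      by (intro mult_left_mono sum t) auto
    also have "\<dots> = 2 * C * (\<tau> powr x + \<tau> powr x * real n powr (a + p))" by (simp add: algebra_simps)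
    also have "\<dots> \<le> 2 * C * (T powr (x - \<rho>) * \<tau> powr \<rho> + (T powr (x - (\<rho> + (a + p))) * T powr (a + p) + T powr (x - \<rho>)) * \<tau> powr \<rho>)"
      using C(1) by (intro mult_left_mono add_mono t1 t2) auto
    also have "\<dots> = K * \<tau> powr \<rho>" by (simp add: K_def algebra_simps)
    finally show ?thesis .
  qed
  moreover have "K > 0" unfolding K_def using C T by (intro mult_pos_pos add_nonneg_pos) auto
  ultimately show ?thesis unfolding accumulates_def by blast
qed

lemma accumulates_zero:
  "accumulates a T x \<rho> (\<lambda>k. 0)"
  unfolding accumulates_def by (intro exI[of _ 1]) auto

lemma accumulates_sum:
  assumes "finite R" "\<And>r. r \<in> R \<Longrightarrow> accumulates a T x \<rho> (\<phi> r)"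
  shows "accumulates a T x \<rho> (\<lambda>k. \<Sum>r\<in>R. \<phi> r k)"
  using assms by (induction R rule: finite_induct) (auto intro: accumulates_add accumulates_zero)

lemma grid_point_le:
  fixes \<tau> T :: real
  assumes "k \<le> n" "0 < \<tau>" "real n * \<tau> \<le> T"
  shows "real k * \<tau> \<le> T"
proof -
  have "real k * \<tau> \<le> real n * \<tau>" using assms by (intro mult_right_mono) auto
  then show ?thesis using assms(3) by (rule order_trans)
qed

text \<open>
  The weights are those of a discrete fractional integral of order \<open>a\<close>, evaluated at the grid
  point \<open>n\<close>.
\<close>

definition history_norm :: "real \<Rightarrow> nat \<Rightarrow> (nat \<Rightarrow> real) \<Rightarrow> real" where
  "history_norm a n r = (\<Sum>k=1..n. (real n + 1 - real k) powr (a - 1) * \<bar>r k\<bar>)"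

lemma history_norm_mono:
  assumes "\<And>k. k \<in> {1..n} \<Longrightarrow> \<bar>r k\<bar> \<le> \<bar>q k\<bar>"
  shows "history_norm a n r \<le> history_norm a n q"
  unfolding history_norm_def by (intro sum_mono mult_left_mono assms) auto

lemma history_norm_add_le: "history_norm a n (\<lambda>k. r k + q k) \<le> history_norm a n r + history_norm a n q"
  unfolding history_norm_def sum.distrib[symmetric] distrib_left[symmetric]
  by (intro sum_mono mult_left_mono abs_triangle_ineq) auto

lemma history_norm_cmult: "history_norm a n (\<lambda>k. c * r k) = \<bar>c\<bar> * history_norm a n r"
  unfolding history_norm_def sum_distrib_left by (intro sum.cong) (auto simp: abs_mult)

lemma history_norm_sum_le:
  assumes "finite J"
  shows "history_norm a n (\<lambda>k. \<Sum>j\<in>J. r j k) \<le> (\<Sum>j\<in>J. history_norm a n (r j))"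
  using assms
proof (induction J rule: finite_induct)
  case empty
  then show ?case by (simp add: history_norm_def)
next
  case (insert j J)
  then show ?case using history_norm_add_le[of a n "r j" "\<lambda>k. \<Sum>j\<in>J. r j k"] by simp
qed

lemma accumulates_history_norm:
  assumes "accumulates a T x \<rho> \<phi>" "x = a + y"
  shows "\<exists>C>0. \<forall>\<tau> n r D. 0 < \<tau> \<longrightarrow> \<tau> \<le> T \<longrightarrow> n \<ge> 1 \<longrightarrow> real n * \<tau> \<le> T \<longrightarrow> D \<ge> 0 \<longrightarrow>
     (\<forall>k\<in>{1..n}. \<bar>r k\<bar> \<le> D * \<tau> powr y * \<phi> k) \<longrightarrow> \<tau> powr a * history_norm a n r \<le> C * D * \<tau> powr \<rho>"
proof -
  obtain C where C: "C > 0" "\<And>\<tau> n. 0 < \<tau> \<Longrightarrow> \<tau> \<le> T \<Longrightarrow> n \<ge> 1 \<Longrightarrow> real n * \<tau> \<le> T \<Longrightarrow>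
     \<tau> powr x * (\<Sum>k=1..n. (real n + 1 - real k) powr (a - 1) * \<phi> k) \<le> C * \<tau> powr \<rho>"
    using assms(1) unfolding accumulates_def by blast
  have "\<tau> powr a * history_norm a n r \<le> C * D * \<tau> powr \<rho>"
    if t: "0 < \<tau>" "\<tau> \<le> T" "n \<ge> 1" "real n * \<tau> \<le> T" and D: "D \<ge> 0"
      and r: "\<And>k. k \<in> {1..n} \<Longrightarrow> \<bar>r k\<bar> \<le> D * \<tau> powr y * \<phi> k" for \<tau> n r D
  proof -
    have "\<tau> powr a * history_norm a n r \<le> \<tau> powr a * (\<Sum>k=1..n. (real n + 1 - real k) powr (a - 1) * (D * \<tau> powr y * \<phi> k))"
      unfolding history_norm_def by (intro mult_left_mono sum_mono r) auto
    also have "\<dots> = D * ((\<tau> powr a * \<tau> powr y) * (\<Sum>k=1..n. (real n + 1 - real k) powr (a - 1) * \<phi> k))"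
      by (simp add: sum_distrib_left mult_ac)
    also have "\<tau> powr a * \<tau> powr y = \<tau> powr x" by (simp add: assms(2) powr_add)
    also have "D * (\<tau> powr x * (\<Sum>k=1..n. (real n + 1 - real k) powr (a - 1) * \<phi> k)) \<le> D * (C * \<tau> powr \<rho>)"
      by (intro mult_left_mono C(2) t D)
    finally show ?thesis by (simp add: mult_ac)
  qed
  then show ?thesis using C(1) by blast
qed

text \<open>
  The second assumption on \<open>\<rho>\<close> and \<open>x\<close> is the condition of \<open>accumulates_power\<close> for the exponents
  \<open>\<sigma> r - \<alpha> - 2\<close>. It will be met in two ways: with \<open>\<rho> = 0\<close> because of \<open>\<sigma> r \<le> 2\<close>, and with
  \<open>\<rho> = min 2 x\<close> because of \<open>\<sigma> r < s\<close>.
\<close>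

lemma starting_weights_accumulate:
  assumes \<alpha>: "0 < \<alpha>" "\<alpha> \<le> 1" and a: "0 < a" "a \<le> 1" and T: "T > 0" and w: "starting_weights \<alpha> \<sigma> m w"
    and \<sigma>: "\<And>r. r \<in> {1..m} \<Longrightarrow> \<sigma> r > 0" and inj: "inj_on \<sigma> {1..m}"
    and x: "\<rho> \<le> x" "\<And>r. r \<in> {1..m} \<Longrightarrow> \<rho> + (a + (\<sigma> r - \<alpha> - 2)) \<le> x"
  shows "accumulates a T x \<rho> (\<lambda>k. \<Sum>i=1..m. \<bar>w k i\<bar>)"
proof -
  obtain \<delta> C where d: "\<delta> > 0" and C: "C > 0" "\<And>n k. n \<ge> 1 \<Longrightarrow> k \<in> {1..m} \<Longrightarrow> \<bar>w n k\<bar>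
     \<le> C * (real n powr (- 1 - \<delta>) + (\<Sum>r\<in>{r\<in>{1..m}. \<sigma> r \<noteq> 1 + \<alpha>}. real n powr (\<sigma> r - \<alpha> - 2)))"
    using starting_weights_bound[OF \<alpha> w \<sigma> inj] by blast
  have "accumulates a T x \<rho> (\<lambda>k. real k powr (- 1 - \<delta>) + (\<Sum>r\<in>{r\<in>{1..m}. \<sigma> r \<noteq> 1 + \<alpha>}. real k powr (\<sigma> r - \<alpha> - 2)))"
    by (intro accumulates_add accumulates_sum accumulates_power a T) (use d x a in auto)
  then show ?thesis
  proof (rule accumulates_mono)
    fix n :: nat assume n: "n \<ge> 1"
    have "(\<Sum>i=1..m. \<bar>w n i\<bar>) \<le> (\<Sum>i=1..m. C * (real n powr (- 1 - \<delta>) + (\<Sum>r\<in>{r\<in>{1..m}. \<sigma> r \<noteq> 1 + \<alpha>}. real n powr (\<sigma> r - \<alpha> - 2))))"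
      by (intro sum_mono C(2) n) auto
    then show "(\<Sum>i=1..m. \<bar>w n i\<bar>) \<le> (real m * C) * (real n powr (- 1 - \<delta>) + (\<Sum>r\<in>{r\<in>{1..m}. \<sigma> r \<noteq> 1 + \<alpha>}. real n powr (\<sigma> r - \<alpha> - 2)))"
      by simp
  qed (use C in auto)
qed

section \<open>Consistency of the corrected operators\<close>

lemma A_op_power_exact:
  assumes w: "starting_weights \<alpha> \<sigma> m w" and "r \<in> {1..m}" "k \<ge> 1" "\<tau> > 0"
  shows "A_op \<tau> \<alpha> w k m (\<lambda>i. (real i * \<tau>) powr \<sigma> r) = Gamma (\<sigma> r + 1) / Gamma (\<sigma> r + 1 - \<alpha>) * (real k * \<tau>) powr (\<sigma> r - \<alpha>)"
proof -
  have p: "(real i * \<tau>) powr \<sigma> r = \<tau> powr \<sigma> r * real i powr \<sigma> r" for i using assms by (simp add: powr_mult)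
  have "A_op \<tau> \<alpha> w k m (\<lambda>i. (real i * \<tau>) powr \<sigma> r)
     = 1 / \<tau> powr \<alpha> * (\<tau> powr \<sigma> r * ((\<Sum>i=0..k. g_coeff \<alpha> (k - i) * real i powr \<sigma> r) + (\<Sum>i=1..m. w k i * real i powr \<sigma> r)))"
    unfolding A_op_def p by (simp add: distrib_left sum_distrib_left mult.left_commute)
  also have "(\<Sum>i=0..k. g_coeff \<alpha> (k - i) * real i powr \<sigma> r) + (\<Sum>i=1..m. w k i * real i powr \<sigma> r)
     = Gamma (\<sigma> r + 1) / Gamma (\<sigma> r + 1 - \<alpha>) * real k powr (\<sigma> r - \<alpha>)"
    using w assms unfolding starting_weights_def by auto
  also have "1 / \<tau> powr \<alpha> * (\<tau> powr \<sigma> r * (Gamma (\<sigma> r + 1) / Gamma (\<sigma> r + 1 - \<alpha>) * real k powr (\<sigma> r - \<alpha>)))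
     = Gamma (\<sigma> r + 1) / Gamma (\<sigma> r + 1 - \<alpha>) * (real k powr (\<sigma> r - \<alpha>) * (\<tau> powr \<sigma> r / \<tau> powr \<alpha>))"
    by (simp add: mult_ac)
  also have "real k powr (\<sigma> r - \<alpha>) * (\<tau> powr \<sigma> r / \<tau> powr \<alpha>) = (real k * \<tau>) powr (\<sigma> r - \<alpha>)"
    using assms by (simp add: powr_mult powr_diff)
  finally show ?thesis .
qed

lemma A_op_add: "A_op \<tau> \<alpha> w n m (\<lambda>k. U k + V k) = A_op \<tau> \<alpha> w n m U + A_op \<tau> \<alpha> w n m V"
  by (simp add: A_op_def distrib_left sum.distrib)

lemma A_op_cmult: "A_op \<tau> \<alpha> w n m (\<lambda>k. c * U k) = c * A_op \<tau> \<alpha> w n m U"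
  by (simp add: A_op_def distrib_left sum_distrib_left mult.left_commute)

lemma A_op_diff: "A_op \<tau> \<alpha> w n m (\<lambda>k. U k - V k) = A_op \<tau> \<alpha> w n m U - A_op \<tau> \<alpha> w n m V"
  using A_op_add[of \<tau> \<alpha> w n m U "\<lambda>k. (-1) * V k"] A_op_cmult[of \<tau> \<alpha> w n m "-1" V] by simp

lemma A_op_sum:
  assumes "finite R"
  shows "A_op \<tau> \<alpha> w n m (\<lambda>k. \<Sum>r\<in>R. U r k) = (\<Sum>r\<in>R. A_op \<tau> \<alpha> w n m (U r))"
  using assms
proof (induction R rule: finite_induct)
  case empty
  then show ?case by (simp add: A_op_def)
qed (simp add: A_op_add)

text \<open>
  The exponent \<open>s = 1 + \<alpha>\<close> is excluded because the truncation error bound would then contain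
  \<open>1 / k\<close>.
\<close>

lemma uncorrected_truncation_accumulates:
  assumes \<alpha>: "0 < \<alpha>" "\<alpha> \<le> 1" and a: "0 < a" "a \<le> 1" and T: "T > 0" and s: "s > 0"
    and res: "s \<noteq> 1 + \<alpha>" and x: "\<rho> \<le> min 2 (s + a - \<alpha>)" and L: "power_like s B T L" and B: "B \<ge> 0"
  shows "\<exists>C>0. \<forall>\<tau> n. 0 < \<tau> \<longrightarrow> \<tau> \<le> T \<longrightarrow> n \<ge> 1 \<longrightarrow> real n * \<tau> \<le> T \<longrightarrow>
     \<tau> powr a * history_norm a n (\<lambda>k. 1 / \<tau> powr \<alpha> * (\<Sum>i=0..k. g_coeff \<alpha> (k - i) * L 0 (real i * \<tau>)) - caputo_value \<alpha> (L 1) (real k * \<tau>))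
       \<le> C * \<tau> powr \<rho>"
proof -
  obtain C1 where C1: "C1 > 0" "\<And>n \<tau> B D. n \<ge> 1 \<Longrightarrow> \<tau> > 0 \<Longrightarrow> power_like s B (\<tau> * real n) D \<Longrightarrow>
      \<bar>1 / \<tau> powr \<alpha> * (\<Sum>k=0..n. g_coeff \<alpha> (n - k) * D 0 (\<tau> * real k)) - caputo_value \<alpha> (D 1) (\<tau> * real n)\<bar>
        \<le> C1 * B * \<tau> powr (s - \<alpha>) * (real n powr (- 1 - \<alpha> / 2) + real n powr (s - \<alpha> - 2))"
    using truncation_error_scaled[OF \<alpha> s] by blast
  have ex: "s + a - \<alpha> = a + (s - \<alpha>)" by simp
  have "accumulates a T (s + a - \<alpha>) \<rho> (\<lambda>k. real k powr (- 1 - \<alpha> / 2) + real k powr (s - \<alpha> - 2))"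
    by (intro accumulates_add accumulates_power a T) (use \<alpha> a x res in auto)
  then obtain C2 where C2: "C2 > 0" "\<And>\<tau> n r D. 0 < \<tau> \<Longrightarrow> \<tau> \<le> T \<Longrightarrow> n \<ge> 1 \<Longrightarrow> real n * \<tau> \<le> T \<Longrightarrow> D \<ge> 0 \<Longrightarrow>
     (\<forall>k\<in>{1..n}. \<bar>r k\<bar> \<le> D * \<tau> powr (s - \<alpha>) * (real k powr (- 1 - \<alpha> / 2) + real k powr (s - \<alpha> - 2))) \<Longrightarrow> \<tau> powr a * history_norm a n r \<le> C2 * D * \<tau> powr \<rho>"
    using accumulates_history_norm[of a T "s + a - \<alpha>" \<rho> "\<lambda>k. real k powr (- 1 - \<alpha> / 2) + real k powr (s - \<alpha> - 2)" "s - \<alpha>", OF _ ex]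
    by blast
  have main: "\<tau> powr a * history_norm a n (\<lambda>k. 1 / \<tau> powr \<alpha> * (\<Sum>i=0..k. g_coeff \<alpha> (k - i) * L 0 (real i * \<tau>)) - caputo_value \<alpha> (L 1) (real k * \<tau>))
       \<le> C2 * (C1 * B) * \<tau> powr \<rho>"
    if t: "0 < \<tau>" "\<tau> \<le> T" "n \<ge> 1" "real n * \<tau> \<le> T" for \<tau> n
  proof (rule C2(2)[OF t], use C1 B in simp, intro ballI)
    fix k assume k: "k \<in> {1..n}"
    have "\<tau> * real k \<le> T" using grid_point_le[of k n \<tau> T] k t by (simp add: mult.commute)
    then have "power_like s B (\<tau> * real k) L" by (rule power_like_mono_interval[OF L])
    from C1(2)[OF _ t(1) this] k
    show "\<bar>1 / \<tau> powr \<alpha> * (\<Sum>i=0..k. g_coeff \<alpha> (k - i) * L 0 (real i * \<tau>)) - caputo_value \<alpha> (L 1) (real k * \<tau>)\<bar>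
      \<le> C1 * B * \<tau> powr (s - \<alpha>) * (real k powr (- 1 - \<alpha> / 2) + real k powr (s - \<alpha> - 2))"
      by (simp add: mult.commute[of \<tau>])
  qed
  have le: "C2 * (C1 * B) * \<tau> powr \<rho> \<le> (C2 * (C1 * B) + 1) * \<tau> powr \<rho>" for \<tau> by (intro mult_right_mono) auto
  have "C2 * (C1 * B) + 1 > 0" using C1 C2 B by (intro add_nonneg_pos) auto
  then show ?thesis
    by (intro exI[of _ "C2 * (C1 * B) + 1"] conjI allI impI order_trans[OF main le])
qed

lemma resonant_truncation_accumulates:
  assumes \<alpha>: "0 < \<alpha>" "\<alpha> \<le> 1" and a: "0 < a" "a \<le> 1" and T: "T > 0"
    and x: "\<rho> \<le> 1 + a"
  shows "\<exists>C>0. \<forall>\<tau> n. 0 < \<tau> \<longrightarrow> \<tau> \<le> T \<longrightarrow> n \<ge> 1 \<longrightarrow> real n * \<tau> \<le> T \<longrightarrow>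
     \<tau> powr a * history_norm a n (\<lambda>k. 1 / \<tau> powr \<alpha> * (\<Sum>i=0..k. g_coeff \<alpha> (k - i) * (real i * \<tau>) powr (1 + \<alpha>))
        - Gamma (2 + \<alpha>) * (real k * \<tau>)) \<le> C * \<tau> powr \<rho>"
proof -
  obtain \<delta> C1 where d: "\<delta> > 0" and C1: "C1 > 0" "\<And>n. n \<ge> 1 \<Longrightarrow> \<bar>(\<Sum>k=0..n. g_coeff \<alpha> (n - k) * real k powr (1 + \<alpha>)) - Gamma (2 + \<alpha>) * real n\<bar>
     \<le> C1 * real n powr (- 1 - \<delta>)"
    using resonant_power_truncation[OF \<alpha>] by blast
  have "accumulates a T (1 + a) \<rho> (\<lambda>k. real k powr (- 1 - \<delta>))"
    by (intro accumulates_power a T) (use a x d in auto)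
  then obtain C2 where C2: "C2 > 0" "\<And>\<tau> n r D. 0 < \<tau> \<Longrightarrow> \<tau> \<le> T \<Longrightarrow> n \<ge> 1 \<Longrightarrow> real n * \<tau> \<le> T \<Longrightarrow> D \<ge> 0 \<Longrightarrow>
     (\<forall>k\<in>{1..n}. \<bar>r k\<bar> \<le> D * \<tau> powr 1 * real k powr (- 1 - \<delta>)) \<Longrightarrow> \<tau> powr a * history_norm a n r \<le> C2 * D * \<tau> powr \<rho>"
    using accumulates_history_norm[of a T "1 + a" \<rho> "\<lambda>k. real k powr (- 1 - \<delta>)" 1, OF _ add.commute] by blast
  have "\<tau> powr a * history_norm a n (\<lambda>k. 1 / \<tau> powr \<alpha> * (\<Sum>i=0..k. g_coeff \<alpha> (k - i) * (real i * \<tau>) powr (1 + \<alpha>)) - Gamma (2 + \<alpha>) * (real k * \<tau>))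
      \<le> C2 * C1 * \<tau> powr \<rho>"
    if t: "0 < \<tau>" "\<tau> \<le> T" "n \<ge> 1" "real n * \<tau> \<le> T" for \<tau> n
  proof (rule C2(2)[OF t], use C1 in simp, intro ballI)
    fix k assume k: "k \<in> {1..n}"
    have e1: "(\<Sum>i=0..k. g_coeff \<alpha> (k - i) * (real i * \<tau>) powr (1 + \<alpha>)) = \<tau> powr (1 + \<alpha>) * (\<Sum>i=0..k. g_coeff \<alpha> (k - i) * real i powr (1 + \<alpha>))"
      using t by (simp add: powr_mult sum_distrib_left mult_ac)
    have e2: "1 / \<tau> powr \<alpha> * (\<tau> powr (1 + \<alpha>) * z) = \<tau> * z" for z using t by (simp add: powr_add)
    have "1 / \<tau> powr \<alpha> * (\<Sum>i=0..k. g_coeff \<alpha> (k - i) * (real i * \<tau>) powr (1 + \<alpha>)) - Gamma (2 + \<alpha>) * (real k * \<tau>)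
       = \<tau> * ((\<Sum>i=0..k. g_coeff \<alpha> (k - i) * real i powr (1 + \<alpha>)) - Gamma (2 + \<alpha>) * real k)"
      unfolding e1 e2 by (simp add: right_diff_distrib mult.left_commute mult.commute)
    also have "\<bar>\<dots>\<bar> \<le> \<bar>\<tau>\<bar> * (C1 * real k powr (- 1 - \<delta>))" using k by (intro abs_mult_mono C1) auto
    finally show "\<bar>1 / \<tau> powr \<alpha> * (\<Sum>i=0..k. g_coeff \<alpha> (k - i) * (real i * \<tau>) powr (1 + \<alpha>)) - Gamma (2 + \<alpha>) * (real k * \<tau>)\<bar>
       \<le> C1 * \<tau> powr 1 * real k powr (- 1 - \<delta>)" using t by (simp add: mult_ac)
  qed
  then show ?thesis using C1 C2 by (intro exI[of _ "C2 * C1"]) auto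
qed

lemma increasing_exponents:
  fixes \<sigma> :: "nat \<Rightarrow> real"
  assumes "\<And>k. k \<ge> 1 \<Longrightarrow> \<sigma> k < \<sigma> (Suc k)" "1 \<le> i" "i < j"
  shows "\<sigma> i < \<sigma> j"
  using assms(3)
proof (induction j)
  case (Suc j)
  show ?case
  proof (cases "i = j")
    case True
    then show ?thesis using assms(1)[of i] assms(2) by simp
  next
    case False
    then have "\<sigma> i < \<sigma> j" "j \<ge> 1" using Suc assms(2) by auto
    then show ?thesis using assms(1)[of j] by simp
  qed
qed simp

text \<open>
  Subtracting the \<open>m\<close> corrected powers from \<open>E 0\<close> does not change the truncation error. What remains are the truncation error of the remainder and the correction weights applied to
  the first \<open>m\<close> values of the remainder, which are \<open>O(\<tau> powr s)\<close> with \<open>s = \<sigma> (m + 1)\<close>. If \<open>s\<close> is the critical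
  exponent, its power is split off as well and the remainder has the next exponent.
\<close>

lemma corrected_consistency:
  fixes c \<sigma> :: "nat \<Rightarrow> real" and E :: "nat \<Rightarrow> real \<Rightarrow> real"
  assumes \<alpha>: "0 < \<alpha>" "\<alpha> \<le> a" and a: "a \<le> 1" and T: "T > 0"
    and \<sigma>: "\<And>k. k \<ge> 1 \<Longrightarrow> 0 < \<sigma> k \<and> \<sigma> k < \<sigma> (Suc k)"
    and ser: "\<And>t. t \<in> {0..T} \<Longrightarrow> (\<lambda>k. c (Suc k) * t powr \<sigma> (Suc k)) sums E 0 t"
    and der: "\<And>i t. i < 3 \<Longrightarrow> t \<in> {0<..T} \<Longrightarrow> (E i has_real_derivative E (Suc i) t) (at t within {0<..T})"
    and cont: "\<And>i. i \<le> 3 \<Longrightarrow> continuous_on {0<..T} (E i)"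
    and w: "starting_weights \<alpha> \<sigma> m w"
  shows "\<exists>C>0. \<forall>\<tau> n. 0 < \<tau> \<longrightarrow> \<tau> \<le> T \<longrightarrow> n \<ge> 1 \<longrightarrow> real n * \<tau> \<le> T \<longrightarrow> real m * \<tau> \<le> T \<longrightarrow>
     \<tau> powr a * history_norm a n (\<lambda>k. A_op \<tau> \<alpha> w k m (\<lambda>i. E 0 (real i * \<tau>)) - caputo_value \<alpha> (E 1) (real k * \<tau>))
       \<le> C * \<tau> powr (min 2 (\<sigma> (m + 1) + a - \<alpha>))"
proof -
  have a0: "0 < a" and \<alpha>1: "\<alpha> \<le> 1" using \<alpha> a by auto
  note \<alpha>' = \<alpha>(1) \<alpha>1 and a' = a0 a
  define s where "s = \<sigma> (Suc m)"
  define x where "x = s + a - \<alpha>"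
  define \<rho> where "\<rho> = min 2 x"
  have s0: "s > 0" using \<sigma>[of "Suc m"] by (simp add: s_def)
  have \<sigma>less: "\<sigma> i < \<sigma> j" if "1 \<le> i" "i < j" for i j
    by (rule increasing_exponents[OF _ that]) (use \<sigma> in auto)
  have inj: "inj_on \<sigma> {1..m}"
  proof (rule inj_onI)
    fix i j assume "i \<in> {1..m}" "j \<in> {1..m}" "\<sigma> i = \<sigma> j"
    then show "i = j" using \<sigma>less[of i j] \<sigma>less[of j i] by (cases i j rule: linorder_cases) auto
  qed
  define L where "L K i t = E i t - (\<Sum>k=1..K. c k * power_deriv (\<sigma> k) i t)" for K i t
  have pl: "\<exists>B\<ge>0. power_like (\<sigma> (Suc K)) B T (L K)" for K
    unfolding L_def[abs_def] by (rule expansion_remainder_power_like[OF T \<sigma> ser der cont])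
  obtain B where B: "B \<ge> 0" "power_like s B T (L m)" using pl[of m] by (auto simp: s_def)
  have cap: "caputo_value \<alpha> (E 1) t = (\<Sum>k=1..K. c k * (Gamma (\<sigma> k + 1) / Gamma (\<sigma> k + 1 - \<alpha>) * t powr (\<sigma> k - \<alpha>))) + caputo_value \<alpha> (L K 1) t"
    if t: "0 < t" "t \<le> T" for K t
  proof -
    obtain B' where "power_like (\<sigma> (Suc K)) B' T (L K)" using pl by blast
    then have "power_like (\<sigma> (Suc K)) B' t (L K)" by (rule power_like_mono_interval) (rule t)
    then show ?thesis unfolding L_def[abs_def]
      by (intro caputo_value_expansion[OF \<alpha>' t(1)]) (use \<sigma> in auto)
  qed
  \<comment> \<open>The truncation error of the remainder without the correction terms.\<close>
  have "\<exists>C>0. \<forall>\<tau> n. 0 < \<tau> \<longrightarrow> \<tau> \<le> T \<longrightarrow> n \<ge> 1 \<longrightarrow> real n * \<tau> \<le> T \<longrightarrow>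
     \<tau> powr a * history_norm a n (\<lambda>k. 1 / \<tau> powr \<alpha> * (\<Sum>i=0..k. g_coeff \<alpha> (k - i) * L m 0 (real i * \<tau>)) - caputo_value \<alpha> (L m 1) (real k * \<tau>))
       \<le> C * \<tau> powr \<rho>"
  proof (cases "s = 1 + \<alpha>")
    case False
    then show ?thesis
      by (intro uncorrected_truncation_accumulates[OF \<alpha>' a' T s0 _ _ B(2,1)]) (simp_all add: \<rho>_def x_def)
  next
    case True
    define s' where "s' = \<sigma> (Suc (Suc m))"
    have s': "s < s'" using \<sigma>[of "Suc m"] by (simp add: s_def s'_def)
    obtain B' where B': "B' \<ge> 0" "power_like s' B' T (L (Suc m))" using pl[of "Suc m"] by (auto simp: s'_def)
    have "\<exists>C>0. \<forall>\<tau> n. 0 < \<tau> \<longrightarrow> \<tau> \<le> T \<longrightarrow> n \<ge> 1 \<longrightarrow> real n * \<tau> \<le> T \<longrightarrow>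
     \<tau> powr a * history_norm a n (\<lambda>k. 1 / \<tau> powr \<alpha> * (\<Sum>i=0..k. g_coeff \<alpha> (k - i) * L (Suc m) 0 (real i * \<tau>)) - caputo_value \<alpha> (L (Suc m) 1) (real k * \<tau>))
       \<le> C * \<tau> powr \<rho>"
      by (rule uncorrected_truncation_accumulates[OF \<alpha>' a' T _ _ _ B'(2,1)]) (use s' s0 True in \<open>auto simp: \<rho>_def x_def\<close>)
    then obtain C1 where C1: "C1 > 0" "\<And>\<tau> n. 0 < \<tau> \<Longrightarrow> \<tau> \<le> T \<Longrightarrow> n \<ge> 1 \<Longrightarrow> real n * \<tau> \<le> T \<Longrightarrow>
     \<tau> powr a * history_norm a n (\<lambda>k. 1 / \<tau> powr \<alpha> * (\<Sum>i=0..k. g_coeff \<alpha> (k - i) * L (Suc m) 0 (real i * \<tau>)) - caputo_value \<alpha> (L (Suc m) 1) (real k * \<tau>))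
       \<le> C1 * \<tau> powr \<rho>" by blast
    have "\<rho> \<le> 1 + a" by (simp add: \<rho>_def x_def True)
    then obtain C2 where C2: "C2 > 0" "\<And>\<tau> n. 0 < \<tau> \<Longrightarrow> \<tau> \<le> T \<Longrightarrow> n \<ge> 1 \<Longrightarrow> real n * \<tau> \<le> T \<Longrightarrow>
     \<tau> powr a * history_norm a n (\<lambda>k. 1 / \<tau> powr \<alpha> * (\<Sum>i=0..k. g_coeff \<alpha> (k - i) * (real i * \<tau>) powr (1 + \<alpha>)) - Gamma (2 + \<alpha>) * (real k * \<tau>)) \<le> C2 * \<tau> powr \<rho>"
      using resonant_truncation_accumulates[OF \<alpha>' a' T] by blast
    have "\<tau> powr a * history_norm a n (\<lambda>k. 1 / \<tau> powr \<alpha> * (\<Sum>i=0..k. g_coeff \<alpha> (k - i) * L m 0 (real i * \<tau>)) - caputo_value \<alpha> (L m 1) (real k * \<tau>))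
       \<le> (C1 + \<bar>c (Suc m)\<bar> * C2) * \<tau> powr \<rho>"
      if t: "0 < \<tau>" "\<tau> \<le> T" "n \<ge> 1" "real n * \<tau> \<le> T" for \<tau> n
    proof -
      define r1 where "r1 k = 1 / \<tau> powr \<alpha> * (\<Sum>i=0..k. g_coeff \<alpha> (k - i) * L (Suc m) 0 (real i * \<tau>)) - caputo_value \<alpha> (L (Suc m) 1) (real k * \<tau>)" for k
      define r2 where "r2 k = 1 / \<tau> powr \<alpha> * (\<Sum>i=0..k. g_coeff \<alpha> (k - i) * (real i * \<tau>) powr (1 + \<alpha>)) - Gamma (2 + \<alpha>) * (real k * \<tau>)" for k
      have "history_norm a n (\<lambda>k. 1 / \<tau> powr \<alpha> * (\<Sum>i=0..k. g_coeff \<alpha> (k - i) * L m 0 (real i * \<tau>)) - caputo_value \<alpha> (L m 1) (real k * \<tau>))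
         \<le> history_norm a n (\<lambda>k. r1 k + c (Suc m) * r2 k)"
      proof (rule history_norm_mono, rule eq_refl, rule arg_cong[of _ _ abs])
        fix k assume k: "k \<in> {1..n}"
        have kt: "0 < real k * \<tau>" "real k * \<tau> \<le> T"
          using k t grid_point_le[of k n \<tau> T] by auto
        have g: "Gamma (s + 1) / Gamma (s + 1 - \<alpha>) * z powr (s - \<alpha>) = Gamma (2 + \<alpha>) * z" if "z > 0" for z
          using True that Gamma_numeral[of "num.Bit0 num.One", where ?'a = real] by (simp add: add_ac)
        have "caputo_value \<alpha> (L m 1) (real k * \<tau>) = c (Suc m) * (Gamma (s + 1) / Gamma (s + 1 - \<alpha>) * (real k * \<tau>) powr (s - \<alpha>)) + caputo_value \<alpha> (L (Suc m) 1) (real k * \<tau>)"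
          using cap[OF kt, of m] cap[OF kt, of "Suc m"] by (simp add: s_def)
        then have c1: "caputo_value \<alpha> (L m 1) (real k * \<tau>) = c (Suc m) * (Gamma (2 + \<alpha>) * (real k * \<tau>)) + caputo_value \<alpha> (L (Suc m) 1) (real k * \<tau>)"
          unfolding g[OF kt(1)] .
        have "L m 0 z = L (Suc m) 0 z + c (Suc m) * z powr (1 + \<alpha>)" for z
          using True by (simp add: L_def power_deriv_0 s_def)
        then have "(\<Sum>i=0..k. g_coeff \<alpha> (k - i) * L m 0 (real i * \<tau>)) = (\<Sum>i=0..k. g_coeff \<alpha> (k - i) * L (Suc m) 0 (real i * \<tau>)) + c (Suc m) * (\<Sum>i=0..k. g_coeff \<alpha> (k - i) * (real i * \<tau>) powr (1 + \<alpha>))"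
          by (simp add: distrib_left sum.distrib sum_distrib_left mult.left_commute)
        then show "1 / \<tau> powr \<alpha> * (\<Sum>i=0..k. g_coeff \<alpha> (k - i) * L m 0 (real i * \<tau>)) - caputo_value \<alpha> (L m 1) (real k * \<tau>) = r1 k + c (Suc m) * r2 k"
          unfolding c1 r1_def r2_def by (simp add: algebra_simps add_divide_distrib)
      qed
      also have "\<dots> \<le> history_norm a n r1 + \<bar>c (Suc m)\<bar> * history_norm a n r2"
        using history_norm_add_le[of a n r1 "\<lambda>k. c (Suc m) * r2 k"] by (simp only: history_norm_cmult)
      finally have "\<tau> powr a * history_norm a n (\<lambda>k. 1 / \<tau> powr \<alpha> * (\<Sum>i=0..k. g_coeff \<alpha> (k - i) * L m 0 (real i * \<tau>)) - caputo_value \<alpha> (L m 1) (real k * \<tau>))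
         \<le> \<tau> powr a * (history_norm a n r1 + \<bar>c (Suc m)\<bar> * history_norm a n r2)" by (intro mult_left_mono) auto
      also have "\<dots> = \<tau> powr a * history_norm a n r1 + \<bar>c (Suc m)\<bar> * (\<tau> powr a * history_norm a n r2)" by (simp add: algebra_simps)
      also have "\<dots> \<le> C1 * \<tau> powr \<rho> + \<bar>c (Suc m)\<bar> * (C2 * \<tau> powr \<rho>)"
        unfolding r1_def r2_def by (intro add_mono mult_left_mono C1(2) C2(2) t) auto
      finally show ?thesis by (simp add: algebra_simps)
    qed
    moreover have "C1 + \<bar>c (Suc m)\<bar> * C2 > 0" using C1 C2 by (intro add_pos_nonneg) auto
    ultimately show ?thesis by blast
  qed
  then obtain C1 where C1: "C1 > 0" "\<And>\<tau> n. 0 < \<tau> \<Longrightarrow> \<tau> \<le> T \<Longrightarrow> n \<ge> 1 \<Longrightarrow> real n * \<tau> \<le> T \<Longrightarrow>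
     \<tau> powr a * history_norm a n (\<lambda>k. 1 / \<tau> powr \<alpha> * (\<Sum>i=0..k. g_coeff \<alpha> (k - i) * L m 0 (real i * \<tau>)) - caputo_value \<alpha> (L m 1) (real k * \<tau>))
       \<le> C1 * \<tau> powr \<rho>" by blast
  \<comment> \<open>The correction terms, applied to the remainder.\<close>
  have "accumulates a T x \<rho> (\<lambda>k. \<Sum>i=1..m. \<bar>w k i\<bar>)"
  proof (rule starting_weights_accumulate[OF \<alpha>' a' T w _ inj])
    fix r assume r: "r \<in> {1..m}"
    then have "\<sigma> r < s" using \<sigma>less[of r "Suc m"] by (simp add: s_def)
    then show "\<rho> + (a + (\<sigma> r - \<alpha> - 2)) \<le> x" by (simp add: \<rho>_def x_def)
    show "\<sigma> r > 0" using \<sigma> r by auto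
  qed (simp add: \<rho>_def)
  moreover have "x = a + (s - \<alpha>)" by (simp add: x_def)
  ultimately obtain C2 where C2: "C2 > 0" "\<And>\<tau> n r D. 0 < \<tau> \<Longrightarrow> \<tau> \<le> T \<Longrightarrow> n \<ge> 1 \<Longrightarrow> real n * \<tau> \<le> T \<Longrightarrow> D \<ge> 0 \<Longrightarrow>
     (\<forall>k\<in>{1..n}. \<bar>r k\<bar> \<le> D * \<tau> powr (s - \<alpha>) * (\<Sum>i=1..m. \<bar>w k i\<bar>)) \<Longrightarrow> \<tau> powr a * history_norm a n r \<le> C2 * D * \<tau> powr \<rho>"
    using accumulates_history_norm[of a T x \<rho> "\<lambda>k. \<Sum>i=1..m. \<bar>w k i\<bar>" "s - \<alpha>"] by blast
  define D where "D = B * real m powr s"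
  have D0: "D \<ge> 0" using B by (simp add: D_def)
  have "\<tau> powr a * history_norm a n (\<lambda>k. A_op \<tau> \<alpha> w k m (\<lambda>i. E 0 (real i * \<tau>)) - caputo_value \<alpha> (E 1) (real k * \<tau>))
       \<le> (C1 + C2 * D) * \<tau> powr \<rho>"
    if t: "0 < \<tau>" "\<tau> \<le> T" "n \<ge> 1" "real n * \<tau> \<le> T" and mt: "real m * \<tau> \<le> T" for \<tau> n
  proof -
    define r1 where "r1 k = 1 / \<tau> powr \<alpha> * (\<Sum>i=0..k. g_coeff \<alpha> (k - i) * L m 0 (real i * \<tau>)) - caputo_value \<alpha> (L m 1) (real k * \<tau>)" for k
    define r2 where "r2 k = 1 / \<tau> powr \<alpha> * (\<Sum>i=1..m. w k i * L m 0 (real i * \<tau>))" for k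
    have "history_norm a n (\<lambda>k. A_op \<tau> \<alpha> w k m (\<lambda>i. E 0 (real i * \<tau>)) - caputo_value \<alpha> (E 1) (real k * \<tau>))
       \<le> history_norm a n (\<lambda>k. r1 k + r2 k)"
    proof (rule history_norm_mono, rule eq_refl, rule arg_cong[of _ _ abs])
      fix k assume k: "k \<in> {1..n}"
      have kt: "0 < real k * \<tau>" "real k * \<tau> \<le> T"
        using k t grid_point_le[of k n \<tau> T] by auto
      have "E 0 z = L m 0 z + (\<Sum>r=1..m. c r * z powr \<sigma> r)" for z by (simp add: L_def power_deriv_0)
      then have "A_op \<tau> \<alpha> w k m (\<lambda>i. E 0 (real i * \<tau>))
        = A_op \<tau> \<alpha> w k m (\<lambda>i. L m 0 (real i * \<tau>)) + (\<Sum>r=1..m. c r * A_op \<tau> \<alpha> w k m (\<lambda>i. (real i * \<tau>) powr \<sigma> r))"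
        by (simp add: A_op_add A_op_sum A_op_cmult)
      also have "(\<Sum>r=1..m. c r * A_op \<tau> \<alpha> w k m (\<lambda>i. (real i * \<tau>) powr \<sigma> r))
        = (\<Sum>r=1..m. c r * (Gamma (\<sigma> r + 1) / Gamma (\<sigma> r + 1 - \<alpha>) * (real k * \<tau>) powr (\<sigma> r - \<alpha>)))"
        by (intro sum.cong refl) (use A_op_power_exact[OF w _ _ t(1)] k in auto)
      finally show "A_op \<tau> \<alpha> w k m (\<lambda>i. E 0 (real i * \<tau>)) - caputo_value \<alpha> (E 1) (real k * \<tau>) = r1 k + r2 k"
        unfolding cap[OF kt, of m] r1_def r2_def by (simp add: A_op_def)
    qed
    also have "\<dots> \<le> history_norm a n r1 + history_norm a n r2" by (rule history_norm_add_le)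
    finally have "\<tau> powr a * history_norm a n (\<lambda>k. A_op \<tau> \<alpha> w k m (\<lambda>i. E 0 (real i * \<tau>)) - caputo_value \<alpha> (E 1) (real k * \<tau>))
       \<le> \<tau> powr a * (history_norm a n r1 + history_norm a n r2)" by (intro mult_left_mono) auto
    also have "\<dots> = \<tau> powr a * history_norm a n r1 + \<tau> powr a * history_norm a n r2" by (simp add: distrib_left)
    also have "\<dots> \<le> C1 * \<tau> powr \<rho> + C2 * D * \<tau> powr \<rho>"
    proof (rule add_mono)
      show "\<tau> powr a * history_norm a n r1 \<le> C1 * \<tau> powr \<rho>" unfolding r1_def by (rule C1(2)[OF t])
      show "\<tau> powr a * history_norm a n r2 \<le> C2 * D * \<tau> powr \<rho>"
      proof (rule C2(2)[OF t D0], intro ballI)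
        fix k assume k: "k \<in> {1..n}"
        have "\<bar>\<Sum>i=1..m. w k i * L m 0 (real i * \<tau>)\<bar> \<le> (\<Sum>i=1..m. \<bar>w k i\<bar> * (D * \<tau> powr s))"
        proof (rule order_trans[OF sum_abs sum_mono])
          fix i assume i: "i \<in> {1..m}"
          have "real i * \<tau> \<in> {0<..T}" using i t mt grid_point_le[of i m \<tau> T] by auto
          then have "\<bar>L m 0 (real i * \<tau>)\<bar> \<le> B * (real i * \<tau>) powr (s - real 0)"
            using B(2) unfolding power_like_def by blast
          also have "\<dots> \<le> B * (real m * \<tau>) powr s" using i t s0 B(1) by (auto intro!: mult_left_mono powr_mono2 mult_right_mono)
          also have "\<dots> = D * \<tau> powr s" using t by (simp add: D_def powr_mult)
          finally show "\<bar>w k i * L m 0 (real i * \<tau>)\<bar> \<le> \<bar>w k i\<bar> * (D * \<tau> powr s)" by (rule abs_mult_mono)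
        qed
        then have "\<bar>r2 k\<bar> \<le> 1 / \<tau> powr \<alpha> * (\<Sum>i=1..m. \<bar>w k i\<bar> * (D * \<tau> powr s))"
          unfolding r2_def abs_mult by (simp add: divide_right_mono)
        also have "\<dots> = D * \<tau> powr (s - \<alpha>) * (\<Sum>i=1..m. \<bar>w k i\<bar>)"
          unfolding sum_distrib_right[symmetric] by (simp add: powr_diff mult_ac)
        finally show "\<bar>r2 k\<bar> \<le> D * \<tau> powr (s - \<alpha>) * (\<Sum>i=1..m. \<bar>w k i\<bar>)" .
      qed
    qed
    finally show ?thesis by (simp add: algebra_simps)
  qed
  moreover have "C1 + C2 * D > 0" using C1 C2 D0 by (intro add_pos_nonneg) auto
  moreover have \<rho>: "min 2 (\<sigma> (m + 1) + a - \<alpha>) = \<rho>" by (simp add: \<rho>_def x_def s_def)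
  ultimately show ?thesis unfolding \<rho> by blast
qed

text \<open>
  After the inversion, all terms with \<open>e\<close> on the right carry weakly singular kernels: of order \<open>a\<close> from
  the Lipschitz term and of orders \<open>a - \<alpha> j\<close> from the terms of lower order. On \<open>{0..T}\<close> they are all
  dominated by the kernel of the smallest order \<open>\<beta>\<close>.
\<close>

section \<open>Stability and convergence\<close>

lemma multi_term_stability:
  fixes \<alpha> \<nu> :: "'j \<Rightarrow> real"
  assumes J: "finite J" and a: "0 < a" "a \<le> 1" and \<alpha>: "\<And>j. j \<in> J \<Longrightarrow> 0 < \<alpha> j \<and> \<alpha> j \<le> a"
    and \<nu>: "(\<Sum>j\<in>{j\<in>J. \<alpha> j = a}. \<nu> j) > 0" and T: "T > 0" and \<Lambda>: "\<Lambda> \<ge> 0"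
  shows "\<exists>C>0. \<exists>\<tau>0>0. \<forall>\<tau> N e F b. 0 < \<tau> \<longrightarrow> \<tau> \<le> \<tau>0 \<longrightarrow> \<tau> \<le> T \<longrightarrow> real N * \<tau> \<le> T \<longrightarrow> e 0 = 0 \<longrightarrow>
     (\<forall>k\<in>{1..N}. 0 \<le> F k \<and> \<bar>\<Sum>j\<in>J. \<nu> j * (1 / \<tau> powr \<alpha> j * (\<Sum>i=0..k. g_coeff (\<alpha> j) (k - i) * e i))\<bar> \<le> \<Lambda> * \<bar>e k\<bar> + F k) \<longrightarrow>
     (\<forall>n\<in>{1..N}. \<tau> powr a * history_norm a n F \<le> b) \<longrightarrow> (\<forall>n\<in>{1..N}. \<bar>e n\<bar> \<le> C * b)"
proof -
  define J' where "J' = {j\<in>J. \<alpha> j < a}"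
  have fin: "finite J'" using J by (simp add: J'_def)
  obtain C1 where C1: "C1 > 0" "\<And>\<tau> e n. \<tau> > 0 \<Longrightarrow> \<bar>e n\<bar> \<le>
     C1 * (\<tau> powr a * (\<Sum>k=0..n. (real n + 1 - real k) powr (a - 1) *
             \<bar>\<Sum>j\<in>J. \<nu> j * (1 / \<tau> powr \<alpha> j * (\<Sum>i=0..k. g_coeff (\<alpha> j) (k - i) * e i))\<bar>)
        + (\<Sum>j\<in>J'. \<tau> powr (a - \<alpha> j) * (\<Sum>k=0..n. (real n + 1 - real k) powr (a - \<alpha> j - 1) * \<bar>e k\<bar>)))"
    using multi_term_inversion[OF J a \<alpha> \<nu>] unfolding J'_def by blast
  define G where "G = insert a ((\<lambda>j. a - \<alpha> j) ` J')"
  define \<beta> where "\<beta> = Min G"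
  have G: "finite G" "G \<noteq> {}" using fin by (auto simp: G_def)
  have \<beta>le: "\<beta> \<le> g" if "g \<in> G" for g unfolding \<beta>_def using G that by simp
  have \<beta>: "0 < \<beta>" "\<beta> \<le> 1"
  proof -
    have "\<beta> \<in> G" unfolding \<beta>_def by (rule Min_in[OF G])
    then show "0 < \<beta>" using a by (auto simp: G_def J'_def)
    have "\<beta> \<le> a" by (rule \<beta>le) (simp add: G_def)
    then show "\<beta> \<le> 1" using a by simp
  qed
  define K where "K = C1 * (\<Lambda> * T powr (a - \<beta>) + (\<Sum>j\<in>J'. T powr (a - \<alpha> j - \<beta>))) + 1"
  have Kpos: "K > 0" unfolding K_def using C1 \<Lambda> by (intro add_nonneg_pos mult_nonneg_nonneg add_nonneg_nonneg sum_nonneg) auto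
  obtain C2 \<tau>0 where C2: "C2 > 0" "\<tau>0 > 0" "\<And>N \<tau> b x. 0 < \<tau> \<Longrightarrow> \<tau> \<le> \<tau>0 \<Longrightarrow> real N * \<tau> \<le> T \<Longrightarrow>
     (\<forall>n\<in>{1..N}. 0 \<le> x n \<and> x n \<le> b + K * \<tau> powr \<beta> * (\<Sum>k=1..n. (real n + 1 - real k) powr (\<beta> - 1) * x k)) \<Longrightarrow>
     (\<forall>n\<in>{1..N}. x n \<le> C2 * b)"
    using weakly_singular_gronwall[OF \<beta> Kpos, of T] by blast
  have "\<bar>e n\<bar> \<le> (C2 * C1) * b"
    if t: "0 < \<tau>" "\<tau> \<le> \<tau>0" "\<tau> \<le> T" "real N * \<tau> \<le> T" and e0: "e 0 = 0"
      and F: "\<And>k. k \<in> {1..N} \<Longrightarrow> 0 \<le> F k" "\<And>k. k \<in> {1..N} \<Longrightarrow> \<bar>\<Sum>j\<in>J. \<nu> j * (1 / \<tau> powr \<alpha> j * (\<Sum>i=0..k. g_coeff (\<alpha> j) (k - i) * e i))\<bar> \<le> \<Lambda> * \<bar>e k\<bar> + F k"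
      and b: "\<And>n. n \<in> {1..N} \<Longrightarrow> \<tau> powr a * history_norm a n F \<le> b" and n: "n \<in> {1..N}" for \<tau> N e F b n
  proof -
    define H where "H k = (\<Sum>j\<in>J. \<nu> j * (1 / \<tau> powr \<alpha> j * (\<Sum>i=0..k. g_coeff (\<alpha> j) (k - i) * e i)))" for k
    define R where "R n = (\<Sum>k=1..n. (real n + 1 - real k) powr (\<beta> - 1) * \<bar>e k\<bar>)" for n
    have kernel: "\<tau> powr \<gamma> * (\<Sum>k=1..n. (real n + 1 - real k) powr (\<gamma> - 1) * \<bar>e k\<bar>) \<le> T powr (\<gamma> - \<beta>) * (\<tau> powr \<beta> * R n)"
      if g: "\<gamma> \<in> G" and n: "n \<in> {1..N}" for \<gamma> n
    proof -
      have "\<tau> powr \<gamma> * (\<Sum>k=1..n. (real n + 1 - real k) powr (\<gamma> - 1) * \<bar>e k\<bar>) = (\<Sum>k=1..n. \<tau> powr \<gamma> * (real n + 1 - real k) powr (\<gamma> - 1) * \<bar>e k\<bar>)"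
        by (simp add: sum_distrib_left mult_ac)
      also have "\<dots> \<le> (\<Sum>k=1..n. T powr (\<gamma> - \<beta>) * (\<tau> powr \<beta> * (real n + 1 - real k) powr (\<beta> - 1)) * \<bar>e k\<bar>)"
      proof (intro sum_mono mult_right_mono)
        fix k assume k: "k \<in> {1..n}"
        define i where "i = real n + 1 - real k"
        have i: "i \<ge> 1" "i \<le> real n" using k by (auto simp: i_def)
        have "\<tau> powr \<gamma> = \<tau> powr (\<gamma> - \<beta>) * \<tau> powr \<beta>" "i powr (\<gamma> - 1) = i powr (\<gamma> - \<beta>) * i powr (\<beta> - 1)"
          by (simp_all add: powr_add[symmetric])
        then have "\<tau> powr \<gamma> * i powr (\<gamma> - 1) = (i * \<tau>) powr (\<gamma> - \<beta>) * (\<tau> powr \<beta> * i powr (\<beta> - 1))"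
          using t i by (simp add: powr_mult)
        also have "\<dots> \<le> T powr (\<gamma> - \<beta>) * (\<tau> powr \<beta> * i powr (\<beta> - 1))"
        proof (intro mult_right_mono powr_mono2)
          have "i * \<tau> \<le> real n * \<tau>" using i t by (intro mult_right_mono) auto
          also have "\<dots> \<le> T" using grid_point_le[of n N \<tau> T] n t by auto
          finally show "i * \<tau> \<le> T" .
        qed (use i t \<beta>le[OF g] in auto)
        finally show "\<tau> powr \<gamma> * (real n + 1 - real k) powr (\<gamma> - 1) \<le> T powr (\<gamma> - \<beta>) * (\<tau> powr \<beta> * (real n + 1 - real k) powr (\<beta> - 1))"
          by (simp add: i_def)
      qed auto
      also have "\<dots> = T powr (\<gamma> - \<beta>) * (\<tau> powr \<beta> * R n)" by (simp add: R_def sum_distrib_left mult_ac)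
      finally show ?thesis .
    qed
    have "\<forall>n\<in>{1..N}. 0 \<le> \<bar>e n\<bar> \<and> \<bar>e n\<bar> \<le> C1 * b + K * \<tau> powr \<beta> * R n"
    proof (intro ballI conjI)
      fix n assume n: "n \<in> {1..N}"
      have R0: "R n \<ge> 0" unfolding R_def by (intro sum_nonneg) auto
      have drop0: "(\<Sum>k=0..n. f k) = (\<Sum>k=1..n. f k)" if "f 0 = 0" for f :: "nat \<Rightarrow> real"
        using that by (simp add: sum.atLeast_Suc_atMost[of 0 n])
      have H0: "H 0 = 0" by (simp add: H_def e0)
      have "\<bar>e n\<bar> \<le> C1 * (\<tau> powr a * (\<Sum>k=0..n. (real n + 1 - real k) powr (a - 1) * \<bar>H k\<bar>)
        + (\<Sum>j\<in>J'. \<tau> powr (a - \<alpha> j) * (\<Sum>k=0..n. (real n + 1 - real k) powr (a - \<alpha> j - 1) * \<bar>e k\<bar>)))"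
        using C1(2)[OF t(1), of e n] by (simp add: H_def)
      also have "\<dots> = C1 * (\<tau> powr a * (\<Sum>k=1..n. (real n + 1 - real k) powr (a - 1) * \<bar>H k\<bar>)
        + (\<Sum>j\<in>J'. \<tau> powr (a - \<alpha> j) * (\<Sum>k=1..n. (real n + 1 - real k) powr (a - \<alpha> j - 1) * \<bar>e k\<bar>)))"
        using H0 e0 by (simp add: drop0)
      also have "\<dots> \<le> C1 * ((\<Lambda> * (T powr (a - \<beta>) * (\<tau> powr \<beta> * R n)) + b)
        + (\<Sum>j\<in>J'. T powr (a - \<alpha> j - \<beta>) * (\<tau> powr \<beta> * R n)))"
      proof (intro mult_left_mono add_mono sum_mono)
        have "(\<Sum>k=1..n. (real n + 1 - real k) powr (a - 1) * \<bar>H k\<bar>) \<le> (\<Sum>k=1..n. (real n + 1 - real k) powr (a - 1) * (\<Lambda> * \<bar>e k\<bar> + \<bar>F k\<bar>))"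
        proof (intro sum_mono mult_left_mono)
          fix k assume "k \<in> {1..n}"
          then have "k \<in> {1..N}" using n by auto
          from F(1)[OF this] F(2)[OF this] show "\<bar>H k\<bar> \<le> \<Lambda> * \<bar>e k\<bar> + \<bar>F k\<bar>" by (simp add: H_def)
        qed auto
        also have "\<dots> = \<Lambda> * (\<Sum>k=1..n. (real n + 1 - real k) powr (a - 1) * \<bar>e k\<bar>) + history_norm a n F"
          by (simp add: history_norm_def distrib_left sum.distrib sum_distrib_left mult.left_commute)
        finally have "\<tau> powr a * (\<Sum>k=1..n. (real n + 1 - real k) powr (a - 1) * \<bar>H k\<bar>)
           \<le> \<tau> powr a * (\<Lambda> * (\<Sum>k=1..n. (real n + 1 - real k) powr (a - 1) * \<bar>e k\<bar>) + history_norm a n F)"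
          by (intro mult_left_mono) auto
        also have "\<dots> = \<Lambda> * (\<tau> powr a * (\<Sum>k=1..n. (real n + 1 - real k) powr (a - 1) * \<bar>e k\<bar>)) + \<tau> powr a * history_norm a n F"
          by (simp add: algebra_simps)
        also have "\<dots> \<le> \<Lambda> * (T powr (a - \<beta>) * (\<tau> powr \<beta> * R n)) + b"
          by (intro add_mono mult_left_mono kernel n b \<Lambda>) (simp add: G_def)
        finally show "\<tau> powr a * (\<Sum>k=1..n. (real n + 1 - real k) powr (a - 1) * \<bar>H k\<bar>) \<le> \<Lambda> * (T powr (a - \<beta>) * (\<tau> powr \<beta> * R n)) + b" .
        fix j assume "j \<in> J'"
        then show "\<tau> powr (a - \<alpha> j) * (\<Sum>k=1..n. (real n + 1 - real k) powr (a - \<alpha> j - 1) * \<bar>e k\<bar>) \<le> T powr (a - \<alpha> j - \<beta>) * (\<tau> powr \<beta> * R n)"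
          by (intro kernel n) (simp add: G_def)
      qed (use C1 in simp)
      also have "\<dots> = C1 * b + (K - 1) * \<tau> powr \<beta> * R n"
        unfolding sum_distrib_right[symmetric] by (simp add: K_def algebra_simps)
      also have "\<dots> \<le> C1 * b + K * \<tau> powr \<beta> * R n"
        using R0 by (intro add_left_mono mult_right_mono) auto
      finally show "\<bar>e n\<bar> \<le> C1 * b + K * \<tau> powr \<beta> * R n" .
    qed simp
    then have "\<forall>n\<in>{1..N}. \<bar>e n\<bar> \<le> C2 * (C1 * b)" unfolding R_def by (rule C2(3)[OF t(1,2,4)])
    then show ?thesis using n by (simp add: mult.assoc)
  qed
  note bound = this
  show ?thesis
  proof (rule exI[of _ "C2 * C1"], intro conjI exI[of _ \<tau>0] C2(2) allI impI ballI)
    show "C2 * C1 > 0" using C1 C2 by simp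
    fix \<tau> N e F b n
    assume "0 < \<tau>" "\<tau> \<le> \<tau>0" "\<tau> \<le> T" "real N * \<tau> \<le> T" "e 0 = 0"
      "\<forall>k\<in>{1..N}. 0 \<le> F k \<and> \<bar>\<Sum>j\<in>J. \<nu> j * (1 / \<tau> powr \<alpha> j * (\<Sum>i=0..k. g_coeff (\<alpha> j) (k - i) * e i))\<bar> \<le> \<Lambda> * \<bar>e k\<bar> + F k"
      "\<forall>n\<in>{1..N}. \<tau> powr a * history_norm a n F \<le> b" "n \<in> {1..N}"
    then show "\<bar>e n\<bar> \<le> C2 * C1 * b" by (intro bound[of \<tau> N e F b n]) auto
  qed
qed

theorem theorem3p2:
  fixes T Y0 L :: real
    and Q :: nat
    and \<nu> \<alpha> c \<sigma> :: "nat \<Rightarrow> real"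
    and f :: "real \<Rightarrow> real \<Rightarrow> real"
    and Y :: "real \<Rightarrow> real"
    and m :: "nat \<Rightarrow> nat"
    and w :: "nat \<Rightarrow> nat \<Rightarrow> nat \<Rightarrow> real"
    and y :: "nat \<Rightarrow> nat \<Rightarrow> real"
  assumes "T > 0" and "Q \<ge> 1"
    and "\<nu> 1 > 0" and "\<And>j. j \<in> {2..Q} \<Longrightarrow> \<nu> j \<ge> 0"
    and "\<And>j. j \<in> {1..Q} \<Longrightarrow> 0 < \<alpha> j \<and> \<alpha> j \<le> 1"
    and "\<And>j. j \<in> {1..<Q} \<Longrightarrow> \<alpha> (Suc j) \<le> \<alpha> j"
    and "\<And>t. t \<in> {0<..T} \<Longrightarrow> (\<Sum>j=1..Q. \<nu> j * caputo (\<alpha> j) Y t) = f t (Y t)"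
    and "Y 0 = Y0"
    and "\<And>k. k \<ge> 1 \<Longrightarrow> 0 < \<sigma> k \<and> \<sigma> k < \<sigma> (Suc k)"
    and "\<And>t. t \<in> {0..T} \<Longrightarrow> (\<lambda>k. c (Suc k) * t powr \<sigma> (Suc k)) sums (Y t - Y 0)"
    and "Ck_on 3 {0<..T} Y"
    and "\<And>t. t \<in> {0<..T} \<Longrightarrow> L-lipschitz_on UNIV (f t)"
    and "\<And>j. j \<in> {1..Q} \<Longrightarrow> m j \<ge> 1 \<and> \<sigma> (m j) \<le> 2"
    and "\<And>j. j \<in> {1..Q} \<Longrightarrow> starting_weights (\<alpha> j) \<sigma> (m j) (w j)"
  shows "\<exists>C>0. \<forall>N\<ge>(MAX j\<in>{1..Q}. m j).
           scheme_solution Q \<nu> \<alpha> m w f Y0 T N (y N) \<longrightarrow>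
           (\<forall>n\<le>N.
              \<bar>Y (real n * (T / real N)) - y N n\<bar>
                \<le> C * ((\<Sum>k=0..(MAX j\<in>{1..Q}. m j). \<bar>Y (real k * (T / real N)) - y N k\<bar>)
                       + (T / real N) powr
                           min 2 (MIN j\<in>{1..Q}. \<sigma> (m j + 1) + \<alpha> 1 - \<alpha> j)))"
proof -
  define J where "J = {1..Q}"
  define a where "a = \<alpha> 1"
  define M where "M = (MAX j\<in>{1..Q}. m j)"
  define \<rho> where "\<rho> = min 2 (MIN j\<in>{1..Q}. \<sigma> (m j + 1) + \<alpha> 1 - \<alpha> j)"
  note T = assms(1)
  have one: "1 \<in> J" and finJ: "finite J" using assms(2) by (auto simp: J_def)
  have a: "0 < a" "a \<le> 1" using assms(5)[of 1] assms(2) by (auto simp: a_def)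
  have \<alpha>le: "\<alpha> j \<le> a" if "j \<in> J" for j
  proof -
    have "1 \<le> j" "j \<le> Q" using that by (auto simp: J_def)
    then show ?thesis
    proof (induction j rule: dec_induct)
      case (step j)
      then show ?case using assms(6)[of j] by simp
    qed (simp add: a_def)
  qed
  have \<alpha>: "0 < \<alpha> j \<and> \<alpha> j \<le> a" if "j \<in> J" for j using assms(5)[of j] \<alpha>le that by (auto simp: J_def)
  have \<nu>0: "\<nu> j \<ge> 0" if "j \<in> J" for j
    using assms(3) assms(4)[of j] that by (cases "j = 1") (auto simp: J_def)
  have \<nu>s: "(\<Sum>j\<in>{j\<in>J. \<alpha> j = a}. \<nu> j) > 0"
  proof -
    have "\<nu> 1 \<le> (\<Sum>j\<in>{j\<in>J. \<alpha> j = a}. \<nu> j)"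
      by (rule member_le_sum) (use one finJ \<nu>0 in \<open>auto simp: a_def\<close>)
    then show ?thesis using assms(3) by simp
  qed
  have mM: "m j \<le> M" if "j \<in> J" for j using that unfolding M_def J_def by (intro Max_ge) auto
  have \<rho>le: "\<rho> \<le> min 2 (\<sigma> (m j + 1) + a - \<alpha> j)" if "j \<in> J" for j
  proof -
    have "(MIN j\<in>{1..Q}. \<sigma> (m j + 1) + \<alpha> 1 - \<alpha> j) \<le> \<sigma> (m j + 1) + \<alpha> 1 - \<alpha> j"
      using that unfolding J_def by (intro Min_le) auto
    then show ?thesis unfolding \<rho>_def a_def by auto
  qed
  \<comment> \<open>\<open>E 0 = Y - Y 0\<close> has the given expansion, and \<open>E i\<close> is its derivative of order \<open>i\<close>.\<close>
  obtain D where D: "\<forall>t\<in>{0<..T}. D 0 t = Y t" "\<forall>i<3. \<forall>t\<in>{0<..T}. (D i has_real_derivative D (Suc i) t) (at t within {0<..T})"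
    "\<forall>i\<le>3. continuous_on {0<..T} (D i)"
    using assms(11) unfolding Ck_on_def by blast
  define E where "E i t = (if i = 0 then Y t - Y 0 else D i t)" for i :: nat and t
  have Yder: "(Y has_real_derivative D 1 t) (at t within {0<..T})" if "t \<in> {0<..T}" for t
  proof (rule has_field_derivative_transform_within[of "D 0", OF _ zero_less_one that])
    show "(D 0 has_real_derivative D 1 t) (at t within {0<..T})" using D(2) that by auto
  qed (use D(1) in auto)
  have Eder: "(E i has_real_derivative E (Suc i) t) (at t within {0<..T})" if "i < 3" "t \<in> {0<..T}" for i t
  proof (cases "i = 0")
    case True
    have "((\<lambda>t. Y t - Y 0) has_real_derivative D 1 t - 0) (at t within {0<..T})"
      by (intro DERIV_diff Yder that DERIV_const)
    then show ?thesis using True by (simp add: E_def[abs_def])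
  next
    case False
    then show ?thesis using D(2) that by (simp add: E_def[abs_def])
  qed
  have Econt: "continuous_on {0<..T} (E i)" if "i \<le> 3" for i
  proof (cases "i = 0")
    case True
    have "continuous_on {0<..T} Y" using D(3)[rule_format, of 0] by (rule continuous_on_eq) (use D(1) in auto)
    then show ?thesis using True by (auto simp: E_def[abs_def] intro!: continuous_intros)
  next
    case False
    then show ?thesis using D(3) that by (simp add: E_def[abs_def])
  qed
  have E0: "E 0 = (\<lambda>t. Y t - Y 0)" and E1: "E 1 = D 1" by (auto simp: E_def)
  have ser: "(\<lambda>k. c (Suc k) * t powr \<sigma> (Suc k)) sums E 0 t" if "t \<in> {0..T}" for t
    using assms(10)[OF that] by (simp add: E0)
  have cap: "caputo (\<alpha> j) Y t = caputo_value (\<alpha> j) (E 1) t" if "t \<in> {0<..T}" for j t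
    unfolding E1 by (rule caputo_eq_caputo_value[OF that Yder])
  \<comment> \<open>Constants for the consistency errors (\<open>C1\<close>), for the propagation of the starting errors through the
      correction weights (\<open>C2\<close>), and for stability (\<open>C3\<close>).\<close>
  define cons where "cons j K \<longleftrightarrow> (\<forall>\<tau> n. 0 < \<tau> \<longrightarrow> \<tau> \<le> T \<longrightarrow> n \<ge> 1 \<longrightarrow> real n * \<tau> \<le> T \<longrightarrow> real (m j) * \<tau> \<le> T \<longrightarrow>
     \<tau> powr a * history_norm a n (\<lambda>k. A_op \<tau> (\<alpha> j) (w j) k (m j) (\<lambda>i. E 0 (real i * \<tau>)) - caputo_value (\<alpha> j) (E 1) (real k * \<tau>))
       \<le> K * \<tau> powr (min 2 (\<sigma> (m j + 1) + a - \<alpha> j)))" for j K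
  have "\<exists>C>0. \<forall>\<tau> n. 0 < \<tau> \<longrightarrow> \<tau> \<le> T \<longrightarrow> n \<ge> 1 \<longrightarrow> real n * \<tau> \<le> T \<longrightarrow> real (m j) * \<tau> \<le> T \<longrightarrow>
     \<tau> powr a * history_norm a n (\<lambda>k. A_op \<tau> (\<alpha> j) (w j) k (m j) (\<lambda>i. E 0 (real i * \<tau>)) - caputo_value (\<alpha> j) (E 1) (real k * \<tau>))
       \<le> C * \<tau> powr (min 2 (\<sigma> (m j + 1) + a - \<alpha> j))" if "j \<in> J" for j
    using \<alpha>[OF that] assms(14)[of j] that
    by (intro corrected_consistency[OF _ _ a(2) T assms(9) ser Eder Econt]) (auto simp: J_def)
  then have "\<forall>j\<in>J. \<exists>K. 0 < K \<and> cons j K" by (simp add: cons_def)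
  then obtain C1 where C1': "\<forall>j\<in>J. 0 < C1 j \<and> cons j (C1 j)" by metis
  have C1: "C1 j > 0" if "j \<in> J" for j using C1' that by simp
  have C1b: "\<tau> powr a * history_norm a n (\<lambda>k. A_op \<tau> (\<alpha> j) (w j) k (m j) (\<lambda>i. E 0 (real i * \<tau>)) - caputo_value (\<alpha> j) (E 1) (real k * \<tau>))
       \<le> C1 j * \<tau> powr (min 2 (\<sigma> (m j + 1) + a - \<alpha> j))"
    if "j \<in> J" "0 < \<tau>" "\<tau> \<le> T" "n \<ge> 1" "real n * \<tau> \<le> T" "real (m j) * \<tau> \<le> T" for j \<tau> n
    using C1' that unfolding cons_def by blast
  define corr where "corr j K \<longleftrightarrow> (\<forall>\<tau> n r D. 0 < \<tau> \<longrightarrow> \<tau> \<le> T \<longrightarrow> n \<ge> 1 \<longrightarrow> real n * \<tau> \<le> T \<longrightarrow> D \<ge> 0 \<longrightarrow>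
     (\<forall>k\<in>{1..n}. \<bar>r k\<bar> \<le> D * \<tau> powr (- \<alpha> j) * (\<Sum>i=1..m j. \<bar>w j k i\<bar>)) \<longrightarrow> \<tau> powr a * history_norm a n r \<le> K * D * \<tau> powr 0)" for j K
  have "\<exists>C>0. \<forall>\<tau> n r D. 0 < \<tau> \<longrightarrow> \<tau> \<le> T \<longrightarrow> n \<ge> 1 \<longrightarrow> real n * \<tau> \<le> T \<longrightarrow> D \<ge> 0 \<longrightarrow>
     (\<forall>k\<in>{1..n}. \<bar>r k\<bar> \<le> D * \<tau> powr (- \<alpha> j) * (\<Sum>i=1..m j. \<bar>w j k i\<bar>)) \<longrightarrow> \<tau> powr a * history_norm a n r \<le> C * D * \<tau> powr 0"
    if j: "j \<in> J" for j
  proof (rule accumulates_history_norm[where x = "a - \<alpha> j"])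
    have less: "\<sigma> i < \<sigma> l" if "1 \<le> i" "i < l" for i l
      by (rule increasing_exponents[OF _ that]) (use assms(9) in auto)
    show "accumulates a T (a - \<alpha> j) 0 (\<lambda>k. \<Sum>i=1..m j. \<bar>w j k i\<bar>)"
    proof (rule starting_weights_accumulate[where \<sigma> = \<sigma>])
      show "starting_weights (\<alpha> j) \<sigma> (m j) (w j)" using assms(14) j by (auto simp: J_def)
      show "inj_on \<sigma> {1..m j}"
      proof (rule inj_onI)
        fix i l assume "i \<in> {1..m j}" "l \<in> {1..m j}" "\<sigma> i = \<sigma> l"
        then show "i = l" using less[of i l] less[of l i] by (cases i l rule: linorder_cases) auto
      qed
      fix r assume r: "r \<in> {1..m j}"
      show "\<sigma> r > 0" using assms(9) r by auto
      have "\<sigma> r \<le> \<sigma> (m j)" using less[of r "m j"] r by (cases "r = m j") auto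
      also have "\<sigma> (m j) \<le> 2" using assms(13) j by (auto simp: J_def)
      finally show "0 + (a + (\<sigma> r - \<alpha> j - 2)) \<le> a - \<alpha> j" by simp
    qed (use \<alpha>[OF j] a T in auto)
  qed simp
  then have "\<forall>j\<in>J. \<exists>K. 0 < K \<and> corr j K" by (simp add: corr_def)
  then obtain C2 where C2': "\<forall>j\<in>J. 0 < C2 j \<and> corr j (C2 j)" by metis
  have C2: "C2 j > 0" if "j \<in> J" for j using C2' that by simp
  have C2b: "\<tau> powr a * history_norm a n r \<le> C2 j * D * \<tau> powr 0"
    if "j \<in> J" "0 < \<tau>" "\<tau> \<le> T" "n \<ge> 1" "real n * \<tau> \<le> T" "D \<ge> 0"
      "\<forall>k\<in>{1..n}. \<bar>r k\<bar> \<le> D * \<tau> powr (- \<alpha> j) * (\<Sum>i=1..m j. \<bar>w j k i\<bar>)" for j \<tau> n r D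
    using C2' that unfolding corr_def by blast
  have L0: "L \<ge> 0" using assms(12)[of T] T by (auto simp: lipschitz_on_def)
  obtain C3 \<tau>0 where C3: "C3 > 0" "\<tau>0 > 0" "\<And>\<tau> N e F b. 0 < \<tau> \<Longrightarrow> \<tau> \<le> \<tau>0 \<Longrightarrow> \<tau> \<le> T \<Longrightarrow> real N * \<tau> \<le> T \<Longrightarrow> e 0 = 0 \<Longrightarrow>
     (\<forall>k\<in>{1..N}. 0 \<le> F k \<and> \<bar>\<Sum>j\<in>J. \<nu> j * (1 / \<tau> powr \<alpha> j * (\<Sum>i=0..k. g_coeff (\<alpha> j) (k - i) * e i))\<bar> \<le> L * \<bar>e k\<bar> + F k) \<Longrightarrow>
     (\<forall>n\<in>{1..N}. \<tau> powr a * history_norm a n F \<le> b) \<Longrightarrow> (\<forall>n\<in>{1..N}. \<bar>e n\<bar> \<le> C3 * b)"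
    using multi_term_stability[OF finJ a \<alpha> \<nu>s T L0] by blast
  define K where "K = (\<Sum>j\<in>J. \<nu> j * (C1 j * T powr (min 2 (\<sigma> (m j + 1) + a - \<alpha> j) - \<rho>) + C2 j))"
  have K0: "K \<ge> 0" unfolding K_def using \<nu>0 C1 C2
    by (intro sum_nonneg mult_nonneg_nonneg add_nonneg_nonneg) (auto intro: less_imp_le)
  define S where "S N = (\<Sum>k=0..M. \<bar>Y (real k * (T / real N)) - y N k\<bar>)" for N
  have S0: "S N \<ge> 0" for N unfolding S_def by (intro sum_nonneg) auto
  \<comment> \<open>On fine grids, the error equation has the Lipschitz difference of \<open>f\<close>, the consistency errors \<open>r j\<close> and the
      correction terms \<open>p j\<close> on its right-hand side; the latter are bounded by \<open>q j\<close>.\<close>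
  have fine: "\<bar>Y (real n * (T / real N)) - y N n\<bar> \<le> C3 * K * (S N + (T / real N) powr \<rho>)"
    if N: "N \<ge> M" "N \<ge> 1" and sol: "scheme_solution Q \<nu> \<alpha> m w f Y0 T N (y N)" and small: "T / real N \<le> \<tau>0" and n: "n \<in> {1..N}" for N n
  proof -
    define \<tau> where "\<tau> = T / real N"
    have \<tau>: "0 < \<tau>" "\<tau> \<le> \<tau>0" "\<tau> \<le> T" "real N * \<tau> \<le> T"
      using N T small by (auto simp: \<tau>_def field_simps)
    define e where "e k = Y (real k * \<tau>) - y N k" for k
    have y0: "y N 0 = Y 0" using sol assms(8) by (simp add: scheme_solution_def)
    have e0: "e 0 = 0" by (simp add: e_def y0)
    have e_eq: "e = (\<lambda>i. E 0 (real i * \<tau>) - (y N i - y N 0))" by (auto simp: e_def E0 y0)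
    define r where "r j k = A_op \<tau> (\<alpha> j) (w j) k (m j) (\<lambda>i. E 0 (real i * \<tau>)) - caputo_value (\<alpha> j) (E 1) (real k * \<tau>)" for j k
    define q where "q j k = S N * (\<tau> powr (- \<alpha> j) * (\<Sum>i=1..m j. \<bar>w j k i\<bar>))" for j k
    define F where "F k = (\<Sum>j\<in>J. \<nu> j * (\<bar>r j k\<bar> + q j k))" for k
    have q0: "q j k \<ge> 0" for j k unfolding q_def using S0 by (intro mult_nonneg_nonneg sum_nonneg) auto
    have eS: "\<bar>e i\<bar> \<le> S N" if "i \<le> M" for i
      unfolding S_def e_def \<tau>_def by (rule member_le_sum) (use that in auto)
    have H: "\<forall>k\<in>{1..N}. 0 \<le> F k \<and> \<bar>\<Sum>j\<in>J. \<nu> j * (1 / \<tau> powr \<alpha> j * (\<Sum>i=0..k. g_coeff (\<alpha> j) (k - i) * e i))\<bar> \<le> L * \<bar>e k\<bar> + F k"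
    proof (intro ballI conjI)
      fix k assume k: "k \<in> {1..N}"
      show "0 \<le> F k" unfolding F_def using \<nu>0 q0 by (intro sum_nonneg mult_nonneg_nonneg add_nonneg_nonneg) auto
      have kt: "real k * \<tau> \<in> {0<..T}" using k \<tau> grid_point_le[of k N \<tau> T] by auto
      define p where "p j = 1 / \<tau> powr \<alpha> j * (\<Sum>i=1..m j. w j k i * e i)" for j
      have p: "\<bar>p j\<bar> \<le> q j k" if j: "j \<in> J" for j
      proof -
        have "\<bar>\<Sum>i=1..m j. w j k i * e i\<bar> \<le> (\<Sum>i=1..m j. \<bar>w j k i\<bar> * S N)"
        proof (rule order_trans[OF sum_abs sum_mono])
          fix i assume "i \<in> {1..m j}"
          then have "i \<le> M" using mM[OF j] by auto
          then show "\<bar>w j k i * e i\<bar> \<le> \<bar>w j k i\<bar> * S N" by (intro abs_mult_mono eS)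
        qed
        then have "\<bar>p j\<bar> \<le> 1 / \<tau> powr \<alpha> j * (\<Sum>i=1..m j. \<bar>w j k i\<bar> * S N)"
          unfolding p_def abs_mult by (simp add: divide_right_mono)
        also have "\<dots> = q j k"
          unfolding q_def sum_distrib_right[symmetric] by (simp add: powr_minus_divide)
        finally show ?thesis .
      qed
      have termj: "(1 / \<tau> powr \<alpha> j * (\<Sum>i=0..k. g_coeff (\<alpha> j) (k - i) * e i))
         = (r j k + caputo_value (\<alpha> j) (E 1) (real k * \<tau>)) - A_op \<tau> (\<alpha> j) (w j) k (m j) (\<lambda>i. y N i - y N 0) - p j" for j
      proof -
        have "A_op \<tau> (\<alpha> j) (w j) k (m j) e = A_op \<tau> (\<alpha> j) (w j) k (m j) (\<lambda>i. E 0 (real i * \<tau>)) - A_op \<tau> (\<alpha> j) (w j) k (m j) (\<lambda>i. y N i - y N 0)"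
          unfolding e_eq by (rule A_op_diff)
        moreover have "1 / \<tau> powr \<alpha> j * (\<Sum>i=0..k. g_coeff (\<alpha> j) (k - i) * e i) = A_op \<tau> (\<alpha> j) (w j) k (m j) e - p j"
          by (simp add: A_op_def p_def)
        ultimately show ?thesis by (simp add: r_def)
      qed
      have "(\<Sum>j\<in>J. \<nu> j * (1 / \<tau> powr \<alpha> j * (\<Sum>i=0..k. g_coeff (\<alpha> j) (k - i) * e i)))
         = (\<Sum>j\<in>J. \<nu> j * caputo_value (\<alpha> j) (E 1) (real k * \<tau>)) - (\<Sum>j\<in>J. \<nu> j * A_op \<tau> (\<alpha> j) (w j) k (m j) (\<lambda>i. y N i - y N 0))
           + (\<Sum>j\<in>J. \<nu> j * (r j k - p j))"
        unfolding termj sum.distrib[symmetric] sum_subtractf[symmetric]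
        by (intro sum.cong) (auto simp: algebra_simps)
      also have "(\<Sum>j\<in>J. \<nu> j * caputo_value (\<alpha> j) (E 1) (real k * \<tau>)) = f (real k * \<tau>) (Y (real k * \<tau>))"
        using assms(7)[OF kt] cap[OF kt] by (simp add: J_def)
      also have "(\<Sum>j\<in>J. \<nu> j * A_op \<tau> (\<alpha> j) (w j) k (m j) (\<lambda>i. y N i - y N 0)) = f (real k * \<tau>) (y N k)"
        using sol k unfolding scheme_solution_def J_def \<tau>_def by auto
      finally have eq: "(\<Sum>j\<in>J. \<nu> j * (1 / \<tau> powr \<alpha> j * (\<Sum>i=0..k. g_coeff (\<alpha> j) (k - i) * e i)))
         = (f (real k * \<tau>) (Y (real k * \<tau>)) - f (real k * \<tau>) (y N k)) + (\<Sum>j\<in>J. \<nu> j * (r j k - p j))" .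
      show "\<bar>\<Sum>j\<in>J. \<nu> j * (1 / \<tau> powr \<alpha> j * (\<Sum>i=0..k. g_coeff (\<alpha> j) (k - i) * e i))\<bar> \<le> L * \<bar>e k\<bar> + F k"
        unfolding eq
      proof (rule abs_add_mono)
        show "\<bar>f (real k * \<tau>) (Y (real k * \<tau>)) - f (real k * \<tau>) (y N k)\<bar> \<le> L * \<bar>e k\<bar>"
          using lipschitz_onD[OF assms(12)[OF kt], of "Y (real k * \<tau>)" "y N k"] by (simp add: dist_real_def e_def)
        show "\<bar>\<Sum>j\<in>J. \<nu> j * (r j k - p j)\<bar> \<le> F k"
          unfolding F_def
        proof (rule order_trans[OF sum_abs sum_mono])
          fix j assume j: "j \<in> J"
          have "\<bar>\<nu> j * (r j k - p j)\<bar> \<le> \<bar>\<nu> j\<bar> * (\<bar>r j k\<bar> + q j k)"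
            by (intro abs_mult_mono abs_diff_mono p j order_refl)
          then show "\<bar>\<nu> j * (r j k - p j)\<bar> \<le> \<nu> j * (\<bar>r j k\<bar> + q j k)" using \<nu>0[OF j] by simp
        qed
      qed
    qed
    have "\<forall>n\<in>{1..N}. \<tau> powr a * history_norm a n F \<le> K * (S N + \<tau> powr \<rho>)"
    proof
      fix n assume n: "n \<in> {1..N}"
      have nt: "n \<ge> 1" "real n * \<tau> \<le> T" using n \<tau> grid_point_le[of n N \<tau> T] by auto
      have "history_norm a n F \<le> (\<Sum>j\<in>J. history_norm a n (\<lambda>k. \<nu> j * (\<bar>r j k\<bar> + q j k)))"
        unfolding F_def by (rule history_norm_sum_le[OF finJ])
      also have "\<dots> \<le> (\<Sum>j\<in>J. \<nu> j * (history_norm a n (r j) + history_norm a n (q j)))"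
      proof (rule sum_mono)
        fix j assume j: "j \<in> J"
        have "history_norm a n (\<lambda>k. \<bar>r j k\<bar> + q j k) \<le> history_norm a n (\<lambda>k. \<bar>r j k\<bar>) + history_norm a n (q j)"
          by (rule history_norm_add_le)
        also have "history_norm a n (\<lambda>k. \<bar>r j k\<bar>) = history_norm a n (r j)" by (simp add: history_norm_def)
        finally show "history_norm a n (\<lambda>k. \<nu> j * (\<bar>r j k\<bar> + q j k)) \<le> \<nu> j * (history_norm a n (r j) + history_norm a n (q j))"
          unfolding history_norm_cmult using \<nu>0[OF j] by (simp add: mult_left_mono)
      qed
      finally have "\<tau> powr a * history_norm a n F \<le> \<tau> powr a * (\<Sum>j\<in>J. \<nu> j * (history_norm a n (r j) + history_norm a n (q j)))"
        by (intro mult_left_mono) auto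
      also have "\<dots> = (\<Sum>j\<in>J. \<nu> j * (\<tau> powr a * history_norm a n (r j) + \<tau> powr a * history_norm a n (q j)))"
        by (simp add: sum_distrib_left algebra_simps)
      also have "\<dots> \<le> (\<Sum>j\<in>J. \<nu> j * (C1 j * T powr (min 2 (\<sigma> (m j + 1) + a - \<alpha> j) - \<rho>) + C2 j) * (S N + \<tau> powr \<rho>))"
      proof (rule sum_mono)
        fix j assume j: "j \<in> J"
        define x where "x = min 2 (\<sigma> (m j + 1) + a - \<alpha> j)"
        have "m j \<le> N" using mM[OF j] N by simp
        then have mt: "real (m j) * \<tau> \<le> T" using grid_point_le[of "m j" N \<tau> T] \<tau> by auto
        have "\<tau> powr a * history_norm a n (r j) \<le> C1 j * \<tau> powr x"
          unfolding r_def x_def by (rule C1b[OF j \<tau>(1,3) nt mt])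
        also have "\<dots> \<le> C1 j * (T powr (x - \<rho>) * \<tau> powr \<rho>)"
          using C1[OF j] \<rho>le[OF j] \<tau> by (intro mult_left_mono powr_le_powr_scaled) (auto simp: x_def)
        also have "\<dots> \<le> C1 j * T powr (x - \<rho>) * (S N + \<tau> powr \<rho>)"
          using C1[OF j] S0[of N] by (simp add: algebra_simps)
        finally have 1: "\<tau> powr a * history_norm a n (r j) \<le> C1 j * T powr (x - \<rho>) * (S N + \<tau> powr \<rho>)" .
        have "\<tau> powr a * history_norm a n (q j) \<le> C2 j * S N * \<tau> powr 0"
        proof (rule C2b[OF j \<tau>(1,3) nt S0], intro ballI)
          fix k show "\<bar>q j k\<bar> \<le> S N * \<tau> powr - \<alpha> j * (\<Sum>i=1..m j. \<bar>w j k i\<bar>)"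
            using q0[of j k] by (simp add: q_def mult.assoc)
        qed
        also have "\<dots> \<le> C2 j * (S N + \<tau> powr \<rho>)" using C2[OF j] \<tau> by simp
        finally have "\<tau> powr a * history_norm a n (r j) + \<tau> powr a * history_norm a n (q j) \<le> (C1 j * T powr (x - \<rho>) + C2 j) * (S N + \<tau> powr \<rho>)"
          using 1 by (simp add: distrib_right)
        then show "\<nu> j * (\<tau> powr a * history_norm a n (r j) + \<tau> powr a * history_norm a n (q j))
           \<le> \<nu> j * (C1 j * T powr (min 2 (\<sigma> (m j + 1) + a - \<alpha> j) - \<rho>) + C2 j) * (S N + \<tau> powr \<rho>)"
          using \<nu>0[OF j] unfolding x_def mult.assoc by (intro mult_left_mono)
      qed
      also have "\<dots> = K * (S N + \<tau> powr \<rho>)" by (simp add: K_def sum_distrib_right)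
      finally show "\<tau> powr a * history_norm a n F \<le> K * (S N + \<tau> powr \<rho>)" .
    qed
    from C3(3)[where e = e, OF \<tau> e0 H this] n
    have "\<bar>e n\<bar> \<le> C3 * (K * (S N + \<tau> powr \<rho>))" by blast
    then show ?thesis by (simp add: e_def \<tau>_def mult.assoc)
  qed
  \<comment> \<open>The finitely many coarse grids only enlarge the constant.\<close>
  define N1 where "N1 = nat \<lceil>T / \<tau>0\<rceil>"
  define B where "B = (\<Sum>N=1..N1. \<Sum>n=0..N. \<bar>Y (real n * (T / real N)) - y N n\<bar> / (T / real N) powr \<rho>)"
  have B0: "B \<ge> 0" unfolding B_def by (intro sum_nonneg) auto
  have coarse: "\<bar>Y (real n * (T / real N)) - y N n\<bar> \<le> B * (T / real N) powr \<rho>"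
    if N: "N \<ge> 1" "\<not> T / real N \<le> \<tau>0" and n: "n \<le> N" for N n
  proof -
    have "real N < T / \<tau>0" using N C3(2) by (simp add: field_simps)
    then have N1: "N \<in> {1..N1}" using N unfolding N1_def by (simp; linarith)
    have "\<bar>Y (real n * (T / real N)) - y N n\<bar> / (T / real N) powr \<rho> \<le> (\<Sum>n=0..N. \<bar>Y (real n * (T / real N)) - y N n\<bar> / (T / real N) powr \<rho>)"
      by (rule member_le_sum) (use n in auto)
    also have "\<dots> \<le> B" unfolding B_def
      by (rule member_le_sum[OF N1, of "\<lambda>N. \<Sum>n=0..N. \<bar>Y (real n * (T / real N)) - y N n\<bar> / (T / real N) powr \<rho>"])
        (auto intro!: sum_nonneg)
    finally show ?thesis using N T by (simp add: divide_le_eq)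
  qed
  define C where "C = C3 * K + B + 1"
  have "\<bar>Y (real n * (T / real N)) - y N n\<bar> \<le> C * (S N + (T / real N) powr \<rho>)"
    if N: "N \<ge> M" and sol: "scheme_solution Q \<nu> \<alpha> m w f Y0 T N (y N)" and n: "n \<le> N" for N n
  proof -
    have "m 1 \<ge> 1" using assms(13)[of 1] assms(2) by auto
    then have N1: "N \<ge> 1" using mM[OF one] N by simp
    define Z where "Z = S N + (T / real N) powr \<rho>"
    have Z0: "Z \<ge> 0" unfolding Z_def using S0 by (intro add_nonneg_nonneg) auto
    have CK: "C3 * K \<ge> 0" using C3 K0 by simp
    consider "n = 0" | "n \<ge> 1" "T / real N \<le> \<tau>0" | "\<not> T / real N \<le> \<tau>0" by linarith
    then show ?thesis
    proof cases
      case 1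
      have "y N 0 = Y 0" using sol assms(8) by (simp add: scheme_solution_def)
      then show ?thesis using 1 Z0 CK B0 by (simp add: Z_def[symmetric] C_def)
    next
      case 2
      then have "\<bar>Y (real n * (T / real N)) - y N n\<bar> \<le> C3 * K * Z"
        unfolding Z_def using N N1 sol n by (intro fine) auto
      also have "\<dots> \<le> C * Z" using Z0 B0 by (intro mult_right_mono) (auto simp: C_def)
      finally show ?thesis by (simp add: Z_def)
    next
      case 3
      have "\<bar>Y (real n * (T / real N)) - y N n\<bar> \<le> B * (T / real N) powr \<rho>" by (rule coarse[OF N1 3 n])
      also have "\<dots> \<le> B * Z" using B0 S0 by (intro mult_left_mono) (auto simp: Z_def)
      also have "\<dots> \<le> C * Z" using Z0 CK by (intro mult_right_mono) (auto simp: C_def)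
      finally show ?thesis by (simp add: Z_def)
    qed
  qed
  moreover have "C > 0" unfolding C_def using C3(1) K0 B0 by (intro add_nonneg_pos) auto
  ultimately show ?thesis unfolding S_def M_def \<rho>_def by blast
qed

end
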